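(* Let $(\mathcal{U},\mathcal{V})$ and $(\mathcal{X},\mathcal{Y})$ be two cotorsion pairs in $R\text{-Mod}$ with $\mathcal{U}\subseteq\mathcal{X}$. If both $(\mathcal{U},\mathcal{V})$ and $(\mathcal{X},\mathcal{Y})$ are cogenerated by sets, then the cotorsion pair $(\widetilde{\mathcal{U}}_{\mathcal{X}},(\widetilde{\mathcal{U}}_{\mathcal{X}})^{\perp})$ in $\mathrm{Ch}(R)$ is also cogenerated by a set, and so it is complete.
   Context: $R$ is an associative ring with $1$, $R\text{-Mod}$ is the category of left $R$-modules, and $\mathrm{Ch}(R)$ is the category of ($\mathbb{Z}$-indexed, unbounded) chain complexes $\cdots\to C_{n+1}\xrightarrow{\delta_{n+1}}C_n\xrightarrow{\delta_n}C_{n-1}\to\cdots$ of left $R$-modules. The $n$th cycle module of $C$ is $Z_nC=\mathrm{Ker}(\delta_n)$. A complex is exact if all its homology modules vanish. For a class $\mathcal{A}$ of objects in an abelian category $\mathcal{C}$, put $\mathcal{A}^{\perp}=\{X : \mathrm{Ext}^1_{\mathcal{C}}(A,X)=0 \text{ for all } A\in\mathcal{A}\}$ and ${}^{\perp}\mathcal{A}=\{X : \mathrm{Ext}^1_{\mathcal{C}}(X,A)=0\text{ for all }A\in\mathcal{A}\}$. A pair $(\mathcal{A},\mathcal{B})$ of classes of objects of $\mathcal{C}$ is a cotorsion pair if $\mathcal{A}={}^{\perp}\mathcal{B}$ and $\mathcal{B}=\mathcal{A}^{\perp}$. It is cogenerated by a set if there is a set $\mathcal{S}\subseteq\mathcal{A}$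 with $\mathcal{S}^{\perp}=\mathcal{B}$. It is complete if for every object $X$ of $\mathcal{C}$ there are short exact sequences $0\to B\to A\to X\to 0$ and $0\to X\to B'\to A'\to 0$ with $A,A'\in\mathcal{A}$ and $B,B'\in\mathcal{B}$. For classes $\mathcal{U}\subseteq\mathcal{X}$ of $R$-modules, $\widetilde{\mathcal{U}}_{\mathcal{X}}$ denotes the class of all exact chain complexes $U$ in $\mathrm{Ch}(R)$ with $U_n\in\mathcal{U}$ and $Z_nU\in\mathcal{X}$ for every $n\in\mathbb{Z}$. For any two cotorsion pairs with $\mathcal{U}\subseteq\mathcal{X}$, the pair $(\widetilde{\mathcal{U}}_{\mathcal{X}},(\widetilde{\mathcal{U}}_{\mathcal{X}})^{\perp})$ is a cotorsion pair in $\mathrm{Ch}(R)$. *)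

theory Defs
  imports "HOL-Algebra.AbelCoset" "HOL-Algebra.Module" "HOL-Algebra.Elementary_Groups" "HOL-Library.Equipollence"
begin

section \<open>Size\<close>

text \<open>
  HOL has no proper classes, so \<open>all modules\<close>, \<open>class\<close> and \<open>set\<close> are read relative to a
  Grothendieck universe, given by a type \<open>'u\<close> of uncountable strongly inaccessible cardinality.
  A set (over any type) is \<open>small\<close> if it has fewer elements than \<open>'u\<close>. Modules live on small
  subsets of \<open>'u\<close>; a class of modules is an arbitrary HOL set of them, while the word \<open>set\<close> in
  \<open>cogenerated by a set\<close> means a small one.
\<close>

definition small :: "'u itself \<Rightarrow> 'a set \<Rightarrow> bool" where
  "small _ A \<longleftrightarrow> A \<prec> (UNIV :: 'u set)"

definition universe :: "'u itself \<Rightarrow> bool" where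
  "universe u \<longleftrightarrow>
     small u (UNIV :: nat set) \<and>
     (\<forall>A :: 'u set. small u A \<longrightarrow> small u (Pow A)) \<and>
     (\<forall>(I :: 'u set) (F :: 'u \<Rightarrow> 'u set).
        small u I \<and> (\<forall>i\<in>I. small u (F i)) \<longrightarrow> small u (\<Union>i\<in>I. F i))"


section \<open>Ext and cotorsion pairs\<close>

text \<open>
  Just the data of an abelian category that is needed for the Yoneda description of Ext. The
  first argument of \<open>cat_comp\<close> is the source of the composite \<open>g \<circ> f\<close>. The predicate
  \<open>cat_ses \<C> X i E p A\<close> says that \<open>0 \<rightarrow> X \<rightarrow> E \<rightarrow> A \<rightarrow> 0\<close> with maps \<open>i\<close> and \<open>p\<close> is short exact.
\<close>

record ('o, 'm) cat =
  cat_ob :: "'o set"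
  cat_hom :: "'o \<Rightarrow> 'o \<Rightarrow> 'm set"
  cat_id :: "'o \<Rightarrow> 'm"
  cat_comp :: "'o \<Rightarrow> 'm \<Rightarrow> 'm \<Rightarrow> 'm"
  cat_ses :: "'o \<Rightarrow> 'm \<Rightarrow> 'o \<Rightarrow> 'm \<Rightarrow> 'o \<Rightarrow> bool"

definition extensions :: "('o, 'm) cat \<Rightarrow> 'o \<Rightarrow> 'o \<Rightarrow> ('m \<times> 'o \<times> 'm) set" where
  "extensions \<C> A X = {(i, E, p). E \<in> cat_ob \<C> \<and> cat_ses \<C> X i E p A}"

definition extension_equiv ::
    "('o, 'm) cat \<Rightarrow> 'o \<Rightarrow> 'o \<Rightarrow> (('m \<times> 'o \<times> 'm) \<times> ('m \<times> 'o \<times> 'm)) set" where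
  "extension_equiv \<C> A X =
     {((i, E, p), (i', E', p')).
        (i, E, p) \<in> extensions \<C> A X \<and> (i', E', p') \<in> extensions \<C> A X \<and>
        (\<exists>\<phi>\<in>cat_hom \<C> E E'. cat_comp \<C> X \<phi> i = i' \<and> cat_comp \<C> E p' \<phi> = p)}"

definition Ext1 :: "('o, 'm) cat \<Rightarrow> 'o \<Rightarrow> 'o \<Rightarrow> ('m \<times> 'o \<times> 'm) set set" where
  "Ext1 \<C> A X = extensions \<C> A X // extension_equiv \<C> A X"

text \<open>The zero element of \<open>Ext1 \<C> A X\<close> is the class of the split extensions.\<close>

definition Ext1_zero :: "('o, 'm) cat \<Rightarrow> 'o \<Rightarrow> 'o \<Rightarrow> ('m \<times> 'o \<times> 'm) set" where
  "Ext1_zero \<C> A X =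
     {(i, E, p) \<in> extensions \<C> A X. \<exists>s\<in>cat_hom \<C> A E. cat_comp \<C> A p s = cat_id \<C> A}"

definition Ext1_vanishes :: "('o, 'm) cat \<Rightarrow> 'o \<Rightarrow> 'o \<Rightarrow> bool" where
  "Ext1_vanishes \<C> A X \<longleftrightarrow> Ext1 \<C> A X = {Ext1_zero \<C> A X}"

definition right_perp :: "('o, 'm) cat \<Rightarrow> 'o set \<Rightarrow> 'o set" where
  "right_perp \<C> \<A> = {X \<in> cat_ob \<C>. \<forall>A\<in>\<A>. Ext1_vanishes \<C> A X}"

definition left_perp :: "('o, 'm) cat \<Rightarrow> 'o set \<Rightarrow> 'o set" where
  "left_perp \<C> \<A> = {X \<in> cat_ob \<C>. \<forall>A\<in>\<A>. Ext1_vanishes \<C> X A}"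

definition cotorsion_pair :: "('o, 'm) cat \<Rightarrow> 'o set \<Rightarrow> 'o set \<Rightarrow> bool" where
  "cotorsion_pair \<C> \<A> \<B> \<longleftrightarrow> \<A> = left_perp \<C> \<B> \<and> \<B> = right_perp \<C> \<A>"

definition cogenerated_by_set :: "'u itself \<Rightarrow> ('o, 'm) cat \<Rightarrow> 'o set \<Rightarrow> 'o set \<Rightarrow> bool" where
  "cogenerated_by_set u \<C> \<A> \<B> \<longleftrightarrow> (\<exists>S\<subseteq>\<A>. small u S \<and> right_perp \<C> S = \<B>)"

definition complete_pair :: "('o, 'm) cat \<Rightarrow> 'o set \<Rightarrow> 'o set \<Rightarrow> bool" where
  "complete_pair \<C> \<A> \<B> \<longleftrightarrow>
     (\<forall>X\<in>cat_ob \<C>.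
        (\<exists>A\<in>\<A>. \<exists>B\<in>\<B>. \<exists>i p. cat_ses \<C> B i A p X) \<and>
        (\<exists>A'\<in>\<A>. \<exists>B'\<in>\<B>. \<exists>i p. cat_ses \<C> X i B' p A'))"


section \<open>Left modules\<close>

text \<open>
  The locale \<open>module\<close> of HOL-Algebra requires a commutative ring; its record type is reused here
  for left modules over an arbitrary ring with 1. The ring multiplication and unit contained in
  that record are ignored.
\<close>

locale left_module = R?: ring R + M?: abelian_group M
  for R (structure) and M (structure) +
  assumes lsmult_closed:
      "\<lbrakk>a \<in> carrier R; x \<in> carrier M\<rbrakk> \<Longrightarrow> a \<odot>\<^bsub>M\<^esub> x \<in> carrier M"
    and lsmult_l_distr:
      "\<lbrakk>a \<in> carrier R; b \<in> carrier R; x \<in> carrier M\<rbrakk> \<Longrightarrow>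
       (a \<oplus>\<^bsub>R\<^esub> b) \<odot>\<^bsub>M\<^esub> x = a \<odot>\<^bsub>M\<^esub> x \<oplus>\<^bsub>M\<^esub> b \<odot>\<^bsub>M\<^esub> x"
    and lsmult_r_distr:
      "\<lbrakk>a \<in> carrier R; x \<in> carrier M; y \<in> carrier M\<rbrakk> \<Longrightarrow>
       a \<odot>\<^bsub>M\<^esub> (x \<oplus>\<^bsub>M\<^esub> y) = a \<odot>\<^bsub>M\<^esub> x \<oplus>\<^bsub>M\<^esub> a \<odot>\<^bsub>M\<^esub> y"
    and lsmult_assoc:
      "\<lbrakk>a \<in> carrier R; b \<in> carrier R; x \<in> carrier M\<rbrakk> \<Longrightarrow>
       (a \<otimes>\<^bsub>R\<^esub> b) \<odot>\<^bsub>M\<^esub> x = a \<odot>\<^bsub>M\<^esub> (b \<odot>\<^bsub>M\<^esub> x)"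
    and lsmult_one:
      "x \<in> carrier M \<Longrightarrow> \<one>\<^bsub>R\<^esub> \<odot>\<^bsub>M\<^esub> x = x"

definition modules :: "('r, 'k) ring_scheme \<Rightarrow> ('r, 'u) module set" where
  "modules R = {M. left_module R M \<and> small TYPE('u) (carrier M)}"

text \<open>Homomorphisms are extensional functions, so that equality of functions is equality of maps.\<close>

definition mod_hom ::
    "('r, 'k) ring_scheme \<Rightarrow> ('r, 'u) module \<Rightarrow> ('r, 'u) module \<Rightarrow> ('u \<Rightarrow> 'u) set" where
  "mod_hom R M N =
     {f \<in> carrier M \<rightarrow>\<^sub>E carrier N.
        (\<forall>x\<in>carrier M. \<forall>y\<in>carrier M. f (x \<oplus>\<^bsub>M\<^esub> y) = f x \<oplus>\<^bsub>N\<^esub> f y) \<and>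
        (\<forall>a\<in>carrier R. \<forall>x\<in>carrier M. f (a \<odot>\<^bsub>M\<^esub> x) = a \<odot>\<^bsub>N\<^esub> f x)}"

definition mod_ses ::
    "('r, 'k) ring_scheme \<Rightarrow> ('r, 'u) module \<Rightarrow> ('u \<Rightarrow> 'u) \<Rightarrow> ('r, 'u) module \<Rightarrow>
     ('u \<Rightarrow> 'u) \<Rightarrow> ('r, 'u) module \<Rightarrow> bool" where
  "mod_ses R L i M p N \<longleftrightarrow>
     i \<in> mod_hom R L M \<and> p \<in> mod_hom R M N \<and>
     inj_on i (carrier L) \<and> i ` carrier L = a_kernel M N p \<and> p ` carrier M = carrier N"

definition RMod :: "('r, 'k) ring_scheme \<Rightarrow> (('r, 'u) module, 'u \<Rightarrow> 'u) cat" where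
  "RMod R =
     \<lparr>cat_ob = modules R,
      cat_hom = mod_hom R,
      cat_id = (\<lambda>M. \<lambda>x\<in>carrier M. x),
      cat_comp = (\<lambda>M g f. compose (carrier M) g f),
      cat_ses = mod_ses R\<rparr>"


section \<open>Chain complexes\<close>

record ('r, 'u) chain_complex =
  ch_mod :: "int \<Rightarrow> ('r, 'u) module"
  ch_diff :: "int \<Rightarrow> 'u \<Rightarrow> 'u"

definition complexes :: "('r, 'k) ring_scheme \<Rightarrow> ('r, 'u) chain_complex set" where
  "complexes R =
     {C. \<forall>n. ch_mod C n \<in> modules R \<and>
             ch_diff C n \<in> mod_hom R (ch_mod C n) (ch_mod C (n - 1)) \<and>
             (\<forall>x\<in>carrier (ch_mod C n).
                ch_diff C (n - 1) (ch_diff C n x) = \<zero>\<^bsub>ch_mod C (n - 2)\<^esub>)}"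

definition ch_hom ::
    "('r, 'k) ring_scheme \<Rightarrow> ('r, 'u) chain_complex \<Rightarrow> ('r, 'u) chain_complex \<Rightarrow> (int \<Rightarrow> 'u \<Rightarrow> 'u) set" where
  "ch_hom R C D =
     {f. \<forall>n. f n \<in> mod_hom R (ch_mod C n) (ch_mod D n) \<and>
             (\<forall>x\<in>carrier (ch_mod C n). ch_diff D n (f n x) = f (n - 1) (ch_diff C n x))}"

definition ch_ses ::
    "('r, 'k) ring_scheme \<Rightarrow> ('r, 'u) chain_complex \<Rightarrow> (int \<Rightarrow> 'u \<Rightarrow> 'u) \<Rightarrow> ('r, 'u) chain_complex \<Rightarrow>
     (int \<Rightarrow> 'u \<Rightarrow> 'u) \<Rightarrow> ('r, 'u) chain_complex \<Rightarrow> bool" where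
  "ch_ses R B i C p D \<longleftrightarrow>
     i \<in> ch_hom R B C \<and> p \<in> ch_hom R C D \<and>
     (\<forall>n. mod_ses R (ch_mod B n) (i n) (ch_mod C n) (p n) (ch_mod D n))"

definition ChR :: "('r, 'k) ring_scheme \<Rightarrow> (('r, 'u) chain_complex, int \<Rightarrow> 'u \<Rightarrow> 'u) cat" where
  "ChR R =
     \<lparr>cat_ob = complexes R,
      cat_hom = ch_hom R,
      cat_id = (\<lambda>C n. \<lambda>x\<in>carrier (ch_mod C n). x),
      cat_comp = (\<lambda>C g f n. compose (carrier (ch_mod C n)) (g n) (f n)),
      cat_ses = ch_ses R\<rparr>"

definition cycles :: "('r, 'u) chain_complex \<Rightarrow> int \<Rightarrow> ('r, 'u) module" where
  "cycles C n =
     (ch_mod C n)\<lparr>carrier := a_kernel (ch_mod C n) (ch_mod C (n - 1)) (ch_diff C n)\<rparr>"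

text \<open>Only the additive group of the homology module, which suffices to say that it vanishes.\<close>

definition homology :: "('r, 'u) chain_complex \<Rightarrow> int \<Rightarrow> 'u set monoid" where
  "homology C n = cycles C n A_Mod (ch_diff C (n + 1) ` carrier (ch_mod C (n + 1)))"

definition exact_complex :: "('r, 'u) chain_complex \<Rightarrow> bool" where
  "exact_complex C \<longleftrightarrow> (\<forall>n. trivial_group (homology C n))"

text \<open>The class \<open>\<U>\<close>-tilde-sub-\<open>\<X>\<close>.\<close>

definition tilde ::
    "('r, 'k) ring_scheme \<Rightarrow> ('r, 'u) module set \<Rightarrow> ('r, 'u) module set \<Rightarrow> ('r, 'u) chain_complex set"
  where
  "tilde R \<U> \<X> =
     {C \<in> complexes R. exact_complex C \<and> (\<forall>n. ch_mod C n \<in> \<U> \<and> cycles C n \<in> \<X>)}"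

end

theory Submission imports Defs begin

text \<open>
  Call a complex in the class of the theorem bounded if its size is at most a fixed infinite
  cardinal that dominates \<open>R\<close> and the modules cogenerating the two given pairs. Up to isomorphism
  the bounded complexes form a set, and the point is that every complex \<open>C\<close> of the class is a
  transfinite extension of bounded ones. Eklof's lemma then shows that the bounded complexes
  have the same right orthogonal class as the whole class. The small object argument applied to them gives
  the approximations, and splitting the precover of a complex in the left orthogonal class shows
  that it is a retract of a complex in the class, hence in the class.

  To filter \<open>C\<close>, note that every \<open>C\<^sub>n\<close> is filtered by bounded modules of the first left class and every
  \<open>Z\<^sub>nC\<close> by bounded modules of the second one. For each of these filtrations, Hill's
  lemma provides many submodules that inherit a filtration, as do the quotients between them. A
  countable closing-off argument finds, through any element of \<open>C\<close>, a bounded subcomplex that can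
  be added to a given exact subcomplex of this kind so that all the degrees, all the cycle
  modules and exactness are respected at once. The quotients of the resulting chain are bounded and belong
  to the class.
\<close>

section \<open>Cardinality and transfinite iteration\<close>

unbundle cardinal_syntax

text \<open>Eklof's lemma, the small object argument and Hill's lemma are used for modules and for
  complexes, so they are proved once, for families of modules with a differential. For modules they
  yield the filtrations from which the overview starts: a module of a left class is at first only a
  retract of a filtered one, and closing good submodules under the idempotent of the retract gives
  it a filtration of its own. Two obstacles shape the rest. Objects live on subsets of the fixed
  type \<open>'u\<close>, and transfinite colimits are formed as unions; hence every step must
  contain the previous object literally, and pushouts are quotients whose classes carry prescribed
  names. And taking cycles is not exact: \<open>N + B\<close> may have cycles that are not sums of a
  cycle of \<open>N\<close> and a cycle of \<open>B\<close>, so the closing-off must repair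
  summands, and exactness of \<open>N\<close> is what makes the cycles of a quotient by
  \<open>N\<close> the quotient of the cycles. The bounding cardinal is that of a set
  \<open>A\<close> holding copies of the naturals and of \<open>R\<close> as well as the carriers of
  the generating modules.\<close>

lemma lepoll_iff_card_of: "A \<lesssim> B \<longleftrightarrow> |A| \<le>o |B|"
  unfolding lepoll_def by (rule card_of_ordLeq)

lemma small_iff_card_of: "small TYPE('u) A \<longleftrightarrow> |A| <o |UNIV :: 'u set|"
  unfolding small_def lesspoll_def lepoll_iff_card_of eqpoll_iff_card_of_ordIso
  by (metis not_ordLess_ordIso ordLeq_iff_ordLess_or_ordIso)

lemma small_lepoll: "A \<lesssim> B \<Longrightarrow> small u B \<Longrightarrow> small u A"
  unfolding small_def by (rule lesspoll_trans1)

lemma small_subset: "A \<subseteq> B \<Longrightarrow> small u B \<Longrightarrow> small u A"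
  by (meson small_lepoll subset_imp_lepoll)

lemma small_image: "small u A \<Longrightarrow> small u (f ` A)"
  by (meson small_lepoll image_lepoll)

lemma small_embed: "small TYPE('u) A \<Longrightarrow> \<exists>f :: _ \<Rightarrow> 'u. inj_on f A"
  unfolding small_def lesspoll_def lepoll_def by blast

lemma small_inj_image: "inj_on f A \<Longrightarrow> small u (f ` A) \<longleftrightarrow> small u A"
  unfolding small_def by simp

lemma universe_nat: "universe u \<Longrightarrow> small u (UNIV :: nat set)"
  unfolding universe_def by blast

lemma universe_infinite: "universe TYPE('u) \<Longrightarrow> infinite (UNIV :: 'u set)"
  using lesspoll_imp_lepoll infinite_le_lepoll unfolding universe_def small_def by blast

lemma small_countable: "universe u \<Longrightarrow> countable A \<Longrightarrow> small u A"
  by (meson countable_def lepoll_def small_lepoll subset_UNIV universe_nat)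

lemma small_Pow:
  assumes "universe TYPE('u)" and "small TYPE('u) A"
  shows "small TYPE('u) (Pow A)"
proof -
  obtain f :: "'a \<Rightarrow> 'u" where f: "inj_on f A"
    using small_embed assms(2) by blast
  then have "small TYPE('u) (f ` A)"
    using assms(2) small_image by blast
  then have "small TYPE('u) (Pow (f ` A))"
    using assms(1) unfolding universe_def by blast
  then have "small TYPE('u) (image f ` Pow A)"
    by (simp add: image_Pow_surj)
  then show ?thesis
    using small_inj_image[OF inj_on_image_Pow[OF f]] by blast
qed

text \<open>The closure axioms of \<open>universe\<close> concern only subsets of \<open>'u\<close>
  indexed by subsets of \<open>'u\<close>. Index set and fibres are therefore embedded into
  \<open>'u\<close>, and pairing each value with its index keeps the fibres apart, so that the
  dependent sum embeds into a small union.\<close>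

lemma small_Sigma:
  assumes u: "universe TYPE('u)" and I: "small TYPE('u) I"
    and F: "\<And>i. i \<in> I \<Longrightarrow> small TYPE('u) (F i)"
  shows "small TYPE('u) (Sigma I F)"
proof -
  obtain f :: "_ \<Rightarrow> 'u" where f: "inj_on f I"
    using small_embed I by blast
  have "\<forall>i\<in>I. \<exists>e :: _ \<Rightarrow> 'u. inj_on e (F i)"
    using small_embed F by blast
  then obtain e :: "_ \<Rightarrow> _ \<Rightarrow> 'u" where e: "\<And>i. i \<in> I \<Longrightarrow> inj_on (e i) (F i)"
    using bchoice by metis
  \<comment> \<open>An infinite cardinal equals its square, which supplies an injective pairing on
    \<open>'u\<close>.\<close>
  have "|(UNIV :: 'u set) \<times> (UNIV :: 'u set)| =o |UNIV :: 'u set|"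
    by (rule card_of_Times_same_infinite[OF universe_infinite[OF u]])
  then obtain g :: "'u \<times> 'u \<Rightarrow> 'u" where "bij_betw g (UNIV \<times> UNIV) UNIV"
    using card_of_ordIso[of "UNIV \<times> UNIV :: ('u \<times> 'u) set" "UNIV :: 'u set"] by auto
  then have g: "inj g" by (simp add: bij_betw_def)
  define G where "G = (\<lambda>a. (\<lambda>x. g (a, e (the_inv_into I f a) x)) ` F (the_inv_into I f a))"
  have "small TYPE('u) (\<Union>a\<in>f ` I. G a)"
  proof -
    have "small TYPE('u) (f ` I)" using I small_image by blast
    moreover have "\<forall>a\<in>f ` I. small TYPE('u) (G a)"
      unfolding G_def using F by (simp add: the_inv_into_f_f[OF f] small_image)
    ultimately show ?thesis using u unfolding universe_def by blast
  qed
  moreover have "Sigma I F \<lesssim> (\<Union>a\<in>f ` I. G a)"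
    unfolding lepoll_def
  proof (intro exI conjI)
    show "inj_on (\<lambda>(i, x). g (f i, e i x)) (Sigma I F)"
    proof (rule inj_onI, clarsimp)
      fix i x j y
      assume *: "i \<in> I" "x \<in> F i" "j \<in> I" "y \<in> F j" "g (f i, e i x) = g (f j, e j y)"
      then have "f i = f j" "e i x = e j y" using injD[OF g] by blast+
      with * show "i = j \<and> x = y" using f e by (metis inj_onD)
    qed
    show "(\<lambda>(i, x). g (f i, e i x)) ` Sigma I F \<subseteq> (\<Union>a\<in>f ` I. G a)"
    proof (clarsimp simp: G_def)
      fix i x assume "i \<in> I" "x \<in> F i"
      then show "\<exists>j\<in>I. g (f i, e i x) \<in> (\<lambda>y. g (f j, e (the_inv_into I f (f j)) y)) ` F (the_inv_into I f (f j))"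
        using the_inv_into_f_f[OF f] by (intro bexI[of _ i]) simp_all
    qed
  qed
  ultimately show ?thesis using small_lepoll by blast
qed

lemma small_UN:
  assumes "universe TYPE('u)" and "small TYPE('u) I" and "\<And>i. i \<in> I \<Longrightarrow> small TYPE('u) (F i)"
  shows "small TYPE('u) (\<Union>i\<in>I. F i)"
proof -
  have "small TYPE('u) (snd ` Sigma I F)"
    using small_image small_Sigma assms by blast
  moreover have "snd ` Sigma I F = (\<Union>i\<in>I. F i)" by force
  ultimately show ?thesis by simp
qed

lemma small_Times:
  "universe TYPE('u) \<Longrightarrow> small TYPE('u) A \<Longrightarrow> small TYPE('u) B \<Longrightarrow> small TYPE('u) (A \<times> B)"
  by (rule small_Sigma)

lemma small_Un:
  assumes "universe TYPE('u)" and "small TYPE('u) A" and "small TYPE('u) B"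
  shows "small TYPE('u) (A \<union> B)"
proof -
  have "small TYPE('u) (\<Union>b\<in>UNIV. if b then A else B)"
    using assms by (intro small_UN) (auto intro: small_countable)
  then show ?thesis by (simp add: UNIV_bool Un_commute)
qed

lemma small_insert: "universe TYPE('u) \<Longrightarrow> small TYPE('u) A \<Longrightarrow> small TYPE('u) (insert a A)"
  using small_Un[of "{a}" A] small_countable[of "TYPE('u)" "{a}"] by simp

text \<open>The complement of a small set is not small, hence has the full cardinality of
  \<open>'u\<close> and room for every small set. This provides fresh names when a quotient must
  contain \<open>B\<close> literally.\<close>

lemma embed_avoiding:
  assumes u: "universe TYPE('u)" and A: "small TYPE('u) A" and B: "small TYPE('u) (B :: 'u set)"
  shows "\<exists>g :: _ \<Rightarrow> 'u. inj_on g A \<and> g ` A \<inter> B = {}"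
proof -
  have "\<not> small TYPE('u) (UNIV - B)"
    using small_Un[OF u _ B, of "UNIV - B"] by (auto simp: small_def)
  then have "|UNIV :: 'u set| \<le>o |UNIV - B|"
    using small_iff_card_of not_ordLeq_iff_ordLess card_of_Well_order by blast
  then have "|A| \<le>o |UNIV - B|"
    using A small_iff_card_of ordLess_ordLeq_trans ordLess_imp_ordLeq by blast
  then show ?thesis
    using card_of_ordLeq[of A "UNIV - B"] by blast
qed

text \<open>By Cantor the successor cardinal is at most the power set. It is the length of the
  iteration in the small object argument.\<close>

lemma small_Field_cardSuc:
  assumes "universe TYPE('u)" and "small TYPE('u) (A :: 'u set)"
  shows "small TYPE('u) (Field (cardSuc |A| ))"
proof -
  have "|Field (cardSuc |A| )| =o cardSuc |A|"
    by (simp add: card_of_Field_ordIso cardSuc_Card_order card_of_Card_order)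
  also have "cardSuc |A| \<le>o |Pow A|"
    by (rule iffD1[OF cardSuc_ordLess_ordLeq card_of_Pow]) (simp_all add: card_of_Card_order)
  finally show ?thesis
    using small_Pow[OF assms] small_lepoll lepoll_iff_card_of by blast
qed

section \<open>Sets bounded by a fixed infinite set\<close>

abbreviation bnd :: "'a set \<Rightarrow> 'b set \<Rightarrow> bool" where
  "bnd A X \<equiv> X \<lesssim> A"

lemma bnd_image: "bnd A X \<Longrightarrow> bnd A (f ` X)"
  by (meson image_lepoll lepoll_trans)

lemma bnd_subset: "X \<subseteq> Y \<Longrightarrow> bnd A Y \<Longrightarrow> bnd A X"
  by (meson subset_imp_lepoll lepoll_trans)

lemma bnd_countable: "infinite A \<Longrightarrow> countable X \<Longrightarrow> bnd A X"
  unfolding countable_def infinite_le_lepoll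
  by (meson lepoll_def lepoll_trans subset_UNIV)

lemma bnd_UN: "infinite A \<Longrightarrow> bnd A I \<Longrightarrow> (\<And>i. i \<in> I \<Longrightarrow> bnd A (F i)) \<Longrightarrow> bnd A (\<Union>i\<in>I. F i)"
  unfolding lepoll_iff_card_of using card_of_UNION_ordLeq_infinite by blast

lemma bnd_Sigma: "infinite A \<Longrightarrow> bnd A I \<Longrightarrow> (\<And>i. i \<in> I \<Longrightarrow> bnd A (F i)) \<Longrightarrow> bnd A (Sigma I F)"
  unfolding lepoll_iff_card_of using card_of_Sigma_ordLeq_infinite by blast

lemma bnd_Un:
  assumes "infinite A" and "bnd A X" and "bnd A Y"
  shows "bnd A (X \<union> Y)"
proof -
  have "bnd A (\<Union>b\<in>UNIV. if b then X else Y)"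
    using assms by (intro bnd_UN) (auto intro: bnd_countable)
  then show ?thesis by (simp add: UNIV_bool Un_commute)
qed

lemma bnd_insert: "infinite A \<Longrightarrow> bnd A X \<Longrightarrow> bnd A (insert x X)"
  using bnd_Un[of A "{x}" X] bnd_countable[of A "{x}"] by simp

text \<open>Countably many rounds suffice because the operation is binary: two elements that appear
  in rounds \<open>j\<close> and \<open>k\<close> are both present in round \<open>max j k\<close>,
  and their values appear one round later. Each round, and the countable union, stays
  bounded.\<close>

lemma bnd_closure:
  assumes A: "infinite A" and f: "\<And>x y. x \<in> M \<Longrightarrow> y \<in> M \<Longrightarrow> bnd A (f x y) \<and> f x y \<subseteq> M"
    and B: "B \<subseteq> M" "bnd A B"
  obtains C where "B \<subseteq> C" "C \<subseteq> M" "bnd A C" "\<And>x y. x \<in> C \<Longrightarrow> y \<in> C \<Longrightarrow> f x y \<subseteq> C"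
proof -
  define s where "s D = D \<union> (\<Union>x\<in>D. \<Union>y\<in>D. f x y)" for D
  define D where "D k = (s ^^ k) B" for k
  have D: "D k \<subseteq> M \<and> bnd A (D k)" for k
  proof (induction k)
    case (Suc k)
    have "bnd A (\<Union>x\<in>D k. \<Union>y\<in>D k. f x y)"
      using Suc f by (intro bnd_UN A) blast+
    then have "bnd A (s (D k))" unfolding s_def by (intro bnd_Un A) (use Suc in blast)+
    moreover have "s (D k) \<subseteq> M" using Suc f unfolding s_def by blast
    moreover have "D (Suc k) = s (D k)" by (simp add: D_def)
    ultimately show ?case by simp
  qed (use B in \<open>auto simp: D_def\<close>)
  have mono: "D j \<subseteq> D k" if "j \<le> k" for j k
    by (rule lift_Suc_mono_le[OF _ that]) (simp add: D_def, simp add: s_def)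
  have cl: "f x y \<subseteq> \<Union>(range D)" if xy: "x \<in> \<Union>(range D)" "y \<in> \<Union>(range D)" for x y
  proof -
    obtain j k where jk: "x \<in> D j" "y \<in> D k" using xy by blast
    then have "x \<in> D (max j k)" "y \<in> D (max j k)"
      using mono max.cobounded1 max.cobounded2 by blast+
    then have "f x y \<subseteq> s (D (max j k))" unfolding s_def by blast
    then have "f x y \<subseteq> D (Suc (max j k))" by (simp add: D_def)
    then show ?thesis by blast
  qed
  show thesis
  proof
    have "B = D 0" by (simp add: D_def)
    then show "B \<subseteq> \<Union>(range D)" by blast
    show "bnd A (\<Union>(range D))" using D A bnd_countable[OF A, of "UNIV :: nat set"]
      by (intro bnd_UN) auto
    show "\<Union>(range D) \<subseteq> M" using D by blast
  qed (rule cl)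
qed

section \<open>Well-orders and transfinite towers\<close>

lemma wf_Well_order: "Well_order r \<Longrightarrow> wf (r - Id)"
  by (simp add: well_order_on_def)

lemma underS_trans:
  assumes "Well_order r" and "i \<in> underS r j" and "j \<in> underS r k"
  shows "i \<in> underS r k"
proof -
  have "trans r" "antisym r"
    using assms(1) by (auto simp: order_on_defs)
  then show ?thesis
    using assms(2,3) unfolding underS_def by (blast dest: transD antisymD)
qed

lemma underS_cases:
  assumes "Well_order r" and "i \<in> Field r" and "j \<in> Field r"
  shows "i = j \<or> i \<in> underS r j \<or> j \<in> underS r i"
proof -
  have "total_on (Field r) r"
    using assms(1) by (auto simp: order_on_defs)
  then show ?thesis
    using assms(2,3) unfolding underS_def total_on_def by blast
qed

lemma Well_order_exists: "\<exists>r. Well_order r \<and> Field r = A"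
  using well_order_on[of A] well_order_on_Well_order by blast

text \<open>Successor and limit steps are not distinguished: stage \<open>i\<close> applies
  \<open>st i\<close> to an upper bound of all earlier stages. The start \<open>s0\<close> is
  inserted everywhere, so that \<open>lub\<close> never meets an empty chain and the first stage
  needs no case of its own. Neither antisymmetry of \<open>le\<close> nor leastness of
  \<open>lub\<close> is assumed, which lets \<open>le\<close> be literal inclusion of
  objects.\<close>

lemma tower:
  fixes r :: "'j rel" and le :: "'s \<Rightarrow> 's \<Rightarrow> bool"
  assumes r: "Well_order r"
    and refl: "\<And>a. a \<in> P \<Longrightarrow> le a a"
    and trans: "\<And>a b c. le a b \<Longrightarrow> le b c \<Longrightarrow> le a c"
    and s0: "s0 \<in> P"
    and step: "\<And>i s. i \<in> Field r \<Longrightarrow> s \<in> P \<Longrightarrow> st i s \<in> P \<and> le s (st i s)"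
    and lub: "\<And>J T. J \<subseteq> Field r \<Longrightarrow> insert s0 (T ` J) \<subseteq> P \<Longrightarrow>
        (\<And>a b. a \<in> insert s0 (T ` J) \<Longrightarrow> b \<in> insert s0 (T ` J) \<Longrightarrow> le a b \<or> le b a) \<Longrightarrow>
        lub (insert s0 (T ` J)) \<in> P \<and> (\<forall>a\<in>insert s0 (T ` J). le a (lub (insert s0 (T ` J))))"
  obtains T where
    "\<And>i. i \<in> Field r \<Longrightarrow> T i = st i (lub (insert s0 (T ` underS r i)))"
    "\<And>i. i \<in> Field r \<Longrightarrow> lub (insert s0 (T ` underS r i)) \<in> P"
    "\<And>i a. i \<in> Field r \<Longrightarrow> a \<in> insert s0 (T ` underS r i) \<Longrightarrow> le a (lub (insert s0 (T ` underS r i)))"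
    "\<And>i. i \<in> Field r \<Longrightarrow> T i \<in> P"
    "\<And>i. i \<in> Field r \<Longrightarrow> le s0 (T i)"
    "\<And>i j. i \<in> Field r \<Longrightarrow> j \<in> underS r i \<Longrightarrow> le (T j) (T i)"
    "\<And>a b. a \<in> insert s0 (T ` Field r) \<Longrightarrow> b \<in> insert s0 (T ` Field r) \<Longrightarrow> le a b \<or> le b a"
    "lub (insert s0 (T ` Field r)) \<in> P"
    "\<And>a. a \<in> insert s0 (T ` Field r) \<Longrightarrow> le a (lub (insert s0 (T ` Field r)))"
proof -
  \<comment> \<open>The recursion is defined without conditions; that its stages stay in
    \<open>P\<close> and increase is proved afterwards by induction.\<close>
  define T where "T = wfrec (r - Id) (\<lambda>f i. st i (lub (insert s0 (f ` underS r i))))"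
  have wf: "wf (r - Id)" using r by (rule wf_Well_order)
  have Teq: "T i = st i (lub (insert s0 (T ` underS r i)))" for i
  proof -
    have "cut T (r - Id) i ` underS r i = T ` underS r i"
      by (rule image_cong) (auto simp: cut_def underS_def)
    then show ?thesis unfolding T_def by (subst wfrec[OF wf]) simp
  qed
  let ?L = "\<lambda>i. lub (insert s0 (T ` underS r i))"
  \<comment> \<open>Two stages compare as their indices do. Stated for any set of indices whose
    stages are already under control, it serves both inside the induction and for the whole
    tower.\<close>
  have chain: "le a b \<or> le b a"
    if J: "J \<subseteq> Field r"
      and Q: "\<And>i. i \<in> J \<Longrightarrow> T i \<in> P \<and> le s0 (T i) \<and> (\<forall>j\<in>underS r i. le (T j) (T i))"
      and ab: "a \<in> insert s0 (T ` J)" "b \<in> insert s0 (T ` J)" for J a b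
    using ab
  proof (elim insertE imageE)
    fix i j assume ij: "a = T i" "b = T j" "i \<in> J" "j \<in> J"
    then show ?thesis
      using underS_cases[OF r, of i j] J Q refl by blast
  next
    fix j assume "a = s0" "b = T j" "j \<in> J"
    then show ?thesis using Q by blast
  next
    fix i assume "a = T i" "b = s0" "i \<in> J"
    then show ?thesis using Q by blast
  next
    assume "a = s0" "b = s0"
    then show ?thesis using refl[OF s0] by simp
  qed
  have main: "i \<in> Field r \<longrightarrow> T i \<in> P \<and> ?L i \<in> P \<and> (\<forall>a\<in>insert s0 (T ` underS r i). le a (?L i)) \<and>
     le s0 (T i) \<and> (\<forall>j\<in>underS r i. le (T j) (T i))" for i
    using wf
  proof (induction i rule: wf_induct_rule)
    case (less i)
    show ?case
    proof
      assume i: "i \<in> Field r"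
      have sub: "underS r i \<subseteq> Field r" by (rule Order_Relation.underS_Field)
      have Q: "T j \<in> P \<and> le s0 (T j) \<and> (\<forall>k\<in>underS r j. le (T k) (T j))" if "j \<in> underS r i" for j
        using less[of j] that sub by (auto simp: underS_def)
      have L: "?L i \<in> P \<and> (\<forall>a\<in>insert s0 (T ` underS r i). le a (?L i))"
      proof (rule lub[OF sub])
        show "insert s0 (T ` underS r i) \<subseteq> P" using Q s0 by blast
        show "le a b \<or> le b a"
          if "a \<in> insert s0 (T ` underS r i)" "b \<in> insert s0 (T ` underS r i)" for a b
          using chain[OF sub Q that] .
      qed
      then have "T i \<in> P \<and> le (?L i) (T i)"
        using step[OF i] Teq[of i] by metis
      with L show "T i \<in> P \<and> ?L i \<in> P \<and> (\<forall>a\<in>insert s0 (T ` underS r i). le a (?L i)) \<and>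
         le s0 (T i) \<and> (\<forall>j\<in>underS r i. le (T j) (T i))"
        using trans by blast
    qed
  qed
  have main': "T i \<in> P \<and> le s0 (T i) \<and> (\<forall>j\<in>underS r i. le (T j) (T i))" if "i \<in> Field r" for i
    using main[of i] that by simp
  have all_chain: "le a b \<or> le b a"
    if "a \<in> insert s0 (T ` Field r)" "b \<in> insert s0 (T ` Field r)" for a b
    using chain[OF order_refl main' that] .
  have all: "lub (insert s0 (T ` Field r)) \<in> P \<and>
      (\<forall>a\<in>insert s0 (T ` Field r). le a (lub (insert s0 (T ` Field r))))"
  proof (rule lub[OF order_refl])
    show "insert s0 (T ` Field r) \<subseteq> P" using main' s0 by blast
  qed (rule all_chain)
  show thesis
  proof (rule that[of T])
    show "T i = st i (?L i)" for i by (rule Teq)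
    show "le a b \<or> le b a" if "a \<in> insert s0 (T ` Field r)" "b \<in> insert s0 (T ` Field r)" for a b
      using all_chain[OF that] .
    show "lub (insert s0 (T ` Field r)) \<in> P" using all by (rule conjunct1)
    show "le a (lub (insert s0 (T ` Field r)))" if "a \<in> insert s0 (T ` Field r)" for a
      using all that by (metis (no_types))
    fix i assume "i \<in> Field r"
    then have i: "T i \<in> P" "?L i \<in> P" "\<forall>a\<in>insert s0 (T ` underS r i). le a (?L i)"
      "le s0 (T i)" "\<forall>j\<in>underS r i. le (T j) (T i)"
      using main[of i] by simp_all
    show "T i \<in> P" "?L i \<in> P" "le s0 (T i)" using i by simp_all
    show "le a (?L i)" if "a \<in> insert s0 (T ` underS r i)" for a using i(3) that by blast
    show "le (T j) (T i)" if "j \<in> underS r i" for j using i(5) that by blast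
  qed
qed

section \<open>Many-sorted modules\<close>

text \<open>The fields are total functions, and the axioms will constrain them only on the carriers.
  Equality of records is therefore too fine, and objects are compared by inclusion instead.\<close>

record ('i, 'r, 'a) gob =
  car :: "'i \<Rightarrow> 'a set"
  ad :: "'i \<Rightarrow> 'a \<Rightarrow> 'a \<Rightarrow> 'a"
  ze :: "'i \<Rightarrow> 'a"
  sm :: "'i \<Rightarrow> 'r \<Rightarrow> 'a \<Rightarrow> 'a"
  df :: "'i \<Rightarrow> 'a \<Rightarrow> 'a"

text \<open>Negation is recovered by choice from the existence axiom; in an object the inverse is
  unique.\<close>

definition ng :: "('i, 'r, 'a) gob \<Rightarrow> 'i \<Rightarrow> 'a \<Rightarrow> 'a" where
  "ng C i x = (SOME y. y \<in> car C i \<and> ad C i x y = ze C i)"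

definition mi :: "('i, 'r, 'a) gob \<Rightarrow> 'i \<Rightarrow> 'a \<Rightarrow> 'a \<Rightarrow> 'a" where
  "mi C i x y = ad C i x (ng C i y)"

definition res :: "('i, 'r, 'a) gob \<Rightarrow> ('i \<Rightarrow> 'a set) \<Rightarrow> ('i, 'r, 'a) gob" where
  "res C N = C\<lparr>car := N\<rparr>"

lemma res_simps [simp]:
  "car (res C N) = N" "ad (res C N) = ad C" "ze (res C N) = ze C" "sm (res C N) = sm C"
  "df (res C N) = df C" "res (res C N) N' = res C N'" "res C (car C) = C"
  by (simp_all add: res_def)

definition prd :: "('i, 'r, 'a) gob \<Rightarrow> ('i, 'r, 'b) gob \<Rightarrow> ('i, 'r, 'a \<times> 'b) gob" where
  "prd C D =
     \<lparr>car = \<lambda>i. car C i \<times> car D i,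
      ad = \<lambda>i x y. (ad C i (fst x) (fst y), ad D i (snd x) (snd y)),
      ze = \<lambda>i. (ze C i, ze D i),
      sm = \<lambda>i a x. (sm C i a (fst x), sm D i a (snd x)),
      df = \<lambda>i x. (df C i (fst x), df D i (snd x))\<rparr>"

lemma prd_simps [simp]:
  "car (prd C D) i = car C i \<times> car D i"
  "ad (prd C D) i x y = (ad C i (fst x) (fst y), ad D i (snd x) (snd y))"
  "ze (prd C D) i = (ze C i, ze D i)"
  "sm (prd C D) i a x = (sm C i a (fst x), sm D i a (snd x))"
  "df (prd C D) i x = (df C i (fst x), df D i (snd x))"
  by (simp_all add: prd_def)

text \<open>The union of a chain: an operation is evaluated in any member that contains the
  arguments, and in a chain of literal inclusions the choice does not affect the value.\<close>

definition lubo :: "('i, 'r, 'a) gob set \<Rightarrow> ('i, 'r, 'a) gob" where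
  "lubo \<C> =
     \<lparr>car = \<lambda>i. \<Union>C\<in>\<C>. car C i,
      ad = \<lambda>i x y. ad (SOME C. C \<in> \<C> \<and> x \<in> car C i \<and> y \<in> car C i) i x y,
      ze = \<lambda>i. ze (SOME C. C \<in> \<C>) i,
      sm = \<lambda>i a x. sm (SOME C. C \<in> \<C> \<and> x \<in> car C i) i a x,
      df = \<lambda>i x. df (SOME C. C \<in> \<C> \<and> x \<in> car C i) i x\<rparr>"

text \<open>
  A common setting for modules (one sort, \<open>W\<close> empty) and chain complexes (sorts \<open>int\<close>, shift
  \<open>n \<mapsto> n - 1\<close>, \<open>W\<close> everything): families of modules with a differential \<open>df C i\<close> from sort
  \<open>i\<close> to sort \<open>sh i\<close> for \<open>i \<in> W\<close>.
\<close>

locale gcat = R: ring R for R :: "('r, 'k) ring_scheme" (structure) +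
  fixes sh :: "'i \<Rightarrow> 'i" and W :: "'i set"
begin

definition ob :: "('i, 'r, 'a) gob \<Rightarrow> bool" where
  "ob C \<longleftrightarrow>
     (\<forall>i. ze C i \<in> car C i) \<and>
     (\<forall>i. \<forall>x\<in>car C i. \<forall>y\<in>car C i. ad C i x y \<in> car C i \<and> ad C i x y = ad C i y x \<and>
        (\<forall>z\<in>car C i. ad C i (ad C i x y) z = ad C i x (ad C i y z))) \<and>
     (\<forall>i. \<forall>x\<in>car C i. ad C i (ze C i) x = x \<and> (\<exists>y\<in>car C i. ad C i x y = ze C i)) \<and>
     (\<forall>i. \<forall>a\<in>carrier R. \<forall>x\<in>car C i. sm C i a x \<in> car C i \<and>
        (\<forall>y\<in>car C i. sm C i a (ad C i x y) = ad C i (sm C i a x) (sm C i a y)) \<and>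
        (\<forall>b\<in>carrier R. sm C i (a \<oplus> b) x = ad C i (sm C i a x) (sm C i b x) \<and>
           sm C i (a \<otimes> b) x = sm C i a (sm C i b x))) \<and>
     (\<forall>i. \<forall>x\<in>car C i. sm C i \<one> x = x) \<and>
     (\<forall>i\<in>W. \<forall>x\<in>car C i. df C i x \<in> car C (sh i) \<and>
        (\<forall>y\<in>car C i. df C i (ad C i x y) = ad C (sh i) (df C i x) (df C i y)) \<and>
        (\<forall>a\<in>carrier R. df C i (sm C i a x) = sm C (sh i) a (df C i x)) \<and>
        (sh i \<in> W \<longrightarrow> df C (sh i) (df C i x) = ze C (sh (sh i))))"

text \<open>Values off the carriers are free, so two maps that agree as homomorphisms may differ as
  functions. Source and target may have elements of different types, which is needed for
  products.\<close>

definition hom :: "('i, 'r, 'a) gob \<Rightarrow> ('i, 'r, 'b) gob \<Rightarrow> ('i \<Rightarrow> 'a \<Rightarrow> 'b) \<Rightarrow> bool" where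
  "hom C D f \<longleftrightarrow>
     (\<forall>i. \<forall>x\<in>car C i. f i x \<in> car D i \<and>
        (\<forall>y\<in>car C i. f i (ad C i x y) = ad D i (f i x) (f i y)) \<and>
        (\<forall>a\<in>carrier R. f i (sm C i a x) = sm D i a (f i x)) \<and>
        (i \<in> W \<longrightarrow> f (sh i) (df C i x) = df D i (f i x)))"

definition sub :: "('i \<Rightarrow> 'a set) \<Rightarrow> ('i, 'r, 'a) gob \<Rightarrow> bool" where
  "sub N C \<longleftrightarrow>
     (\<forall>i. N i \<subseteq> car C i \<and> ze C i \<in> N i \<and>
        (\<forall>x\<in>N i. (\<forall>y\<in>N i. ad C i x y \<in> N i) \<and> (\<forall>a\<in>carrier R. sm C i a x \<in> N i) \<and>
           (i \<in> W \<longrightarrow> df C i x \<in> N (sh i))))"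

text \<open>\<open>le B E\<close>: the object \<open>B\<close> is literally a subobject of \<open>E\<close>.\<close>

definition le :: "('i, 'r, 'a) gob \<Rightarrow> ('i, 'r, 'a) gob \<Rightarrow> bool" where
  "le B E \<longleftrightarrow> hom B E (\<lambda>i x. x)"

text \<open>A quotient is recognised by a surjection with the right kernel instead of being a fixed
  construction, so any isomorphic copy of the quotient of \<open>M\<close> by \<open>N\<close>
  qualifies.\<close>

definition quo :: "('i, 'r, 'a) gob \<Rightarrow> ('i \<Rightarrow> 'a set) \<Rightarrow> ('i, 'r, 'b) gob \<Rightarrow> ('i \<Rightarrow> 'a \<Rightarrow> 'b) \<Rightarrow> bool" where
  "quo M N A p \<longleftrightarrow> hom M A p \<and> (\<forall>i. p i ` car M i = car A i) \<and>
     (\<forall>i. \<forall>x\<in>car M i. p i x = ze A i \<longleftrightarrow> x \<in> N i)"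

section \<open>Elementary algebra of many-sorted modules\<close>

lemma
  assumes "ob C"
  shows ze_car [simp]: "ze C i \<in> car C i"
    and ad_car [simp]: "x \<in> car C i \<Longrightarrow> y \<in> car C i \<Longrightarrow> ad C i x y \<in> car C i"
    and ad_comm: "x \<in> car C i \<Longrightarrow> y \<in> car C i \<Longrightarrow> ad C i x y = ad C i y x"
    and ad_assoc: "x \<in> car C i \<Longrightarrow> y \<in> car C i \<Longrightarrow> z \<in> car C i \<Longrightarrow>
      ad C i (ad C i x y) z = ad C i x (ad C i y z)"
    and ze_ad [simp]: "x \<in> car C i \<Longrightarrow> ad C i (ze C i) x = x"
    and sm_car [simp]: "a \<in> carrier R \<Longrightarrow> x \<in> car C i \<Longrightarrow> sm C i a x \<in> car C i"
    and sm_ad: "a \<in> carrier R \<Longrightarrow> x \<in> car C i \<Longrightarrow> y \<in> car C i \<Longrightarrow>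
      sm C i a (ad C i x y) = ad C i (sm C i a x) (sm C i a y)"
    and sm_add: "a \<in> carrier R \<Longrightarrow> b \<in> carrier R \<Longrightarrow> x \<in> car C i \<Longrightarrow>
      sm C i (a \<oplus> b) x = ad C i (sm C i a x) (sm C i b x)"
    and sm_mult: "a \<in> carrier R \<Longrightarrow> b \<in> carrier R \<Longrightarrow> x \<in> car C i \<Longrightarrow>
      sm C i (a \<otimes> b) x = sm C i a (sm C i b x)"
    and sm_one [simp]: "x \<in> car C i \<Longrightarrow> sm C i \<one> x = x"
    and df_car [simp]: "i \<in> W \<Longrightarrow> x \<in> car C i \<Longrightarrow> df C i x \<in> car C (sh i)"
    and df_ad: "i \<in> W \<Longrightarrow> x \<in> car C i \<Longrightarrow> y \<in> car C i \<Longrightarrow>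
      df C i (ad C i x y) = ad C (sh i) (df C i x) (df C i y)"
    and df_sm: "i \<in> W \<Longrightarrow> x \<in> car C i \<Longrightarrow> a \<in> carrier R \<Longrightarrow>
      df C i (sm C i a x) = sm C (sh i) a (df C i x)"
    and df_df: "i \<in> W \<Longrightarrow> sh i \<in> W \<Longrightarrow> x \<in> car C i \<Longrightarrow> df C (sh i) (df C i x) = ze C (sh (sh i))"
    and ng_ex: "x \<in> car C i \<Longrightarrow> \<exists>y. y \<in> car C i \<and> ad C i x y = ze C i"
  using assms unfolding ob_def by blast+

lemma obI:
  assumes "\<And>i. ze C i \<in> car C i"
    and "\<And>i x y. x \<in> car C i \<Longrightarrow> y \<in> car C i \<Longrightarrow> ad C i x y \<in> car C i"
    and "\<And>i x y. x \<in> car C i \<Longrightarrow> y \<in> car C i \<Longrightarrow> ad C i x y = ad C i y x"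
    and "\<And>i x y z. x \<in> car C i \<Longrightarrow> y \<in> car C i \<Longrightarrow> z \<in> car C i \<Longrightarrow>
      ad C i (ad C i x y) z = ad C i x (ad C i y z)"
    and "\<And>i x. x \<in> car C i \<Longrightarrow> ad C i (ze C i) x = x"
    and "\<And>i x. x \<in> car C i \<Longrightarrow> \<exists>y\<in>car C i. ad C i x y = ze C i"
    and "\<And>i a x. a \<in> carrier R \<Longrightarrow> x \<in> car C i \<Longrightarrow> sm C i a x \<in> car C i"
    and "\<And>i a x y. a \<in> carrier R \<Longrightarrow> x \<in> car C i \<Longrightarrow> y \<in> car C i \<Longrightarrow>
      sm C i a (ad C i x y) = ad C i (sm C i a x) (sm C i a y)"
    and "\<And>i a b x. a \<in> carrier R \<Longrightarrow> b \<in> carrier R \<Longrightarrow> x \<in> car C i \<Longrightarrow>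
      sm C i (a \<oplus> b) x = ad C i (sm C i a x) (sm C i b x)"
    and "\<And>i a b x. a \<in> carrier R \<Longrightarrow> b \<in> carrier R \<Longrightarrow> x \<in> car C i \<Longrightarrow>
      sm C i (a \<otimes> b) x = sm C i a (sm C i b x)"
    and "\<And>i x. x \<in> car C i \<Longrightarrow> sm C i \<one> x = x"
    and "\<And>i x. i \<in> W \<Longrightarrow> x \<in> car C i \<Longrightarrow> df C i x \<in> car C (sh i)"
    and "\<And>i x y. i \<in> W \<Longrightarrow> x \<in> car C i \<Longrightarrow> y \<in> car C i \<Longrightarrow>
      df C i (ad C i x y) = ad C (sh i) (df C i x) (df C i y)"
    and "\<And>i x a. i \<in> W \<Longrightarrow> x \<in> car C i \<Longrightarrow> a \<in> carrier R \<Longrightarrow>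
      df C i (sm C i a x) = sm C (sh i) a (df C i x)"
    and "\<And>i x. i \<in> W \<Longrightarrow> sh i \<in> W \<Longrightarrow> x \<in> car C i \<Longrightarrow> df C (sh i) (df C i x) = ze C (sh (sh i))"
  shows "ob C"
  unfolding ob_def using assms by simp

lemma ad_ze [simp]: "ob C \<Longrightarrow> x \<in> car C i \<Longrightarrow> ad C i x (ze C i) = x"
  by (subst ad_comm) simp_all

lemma ad_lcomm:
  "ob C \<Longrightarrow> x \<in> car C i \<Longrightarrow> y \<in> car C i \<Longrightarrow> z \<in> car C i \<Longrightarrow>
   ad C i x (ad C i y z) = ad C i y (ad C i x z)"
  by (metis ad_assoc ad_comm)

lemmas ad_ac = ad_assoc ad_comm ad_lcomm

lemma
  assumes "ob C" "x \<in> car C i"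
  shows ng_car [simp]: "ng C i x \<in> car C i"
    and ad_ng [simp]: "ad C i x (ng C i x) = ze C i"
  using someI_ex[OF ng_ex[OF assms]] unfolding ng_def by simp_all

lemma ng_ad [simp]: "ob C \<Longrightarrow> x \<in> car C i \<Longrightarrow> ad C i (ng C i x) x = ze C i"
  by (metis ad_comm ad_ng ng_car)

lemma ad_cancel:
  assumes "ob C" "x \<in> car C i" "y \<in> car C i" "z \<in> car C i" "ad C i x y = ad C i x z"
  shows "y = z"
proof -
  have "ad C i (ng C i x) (ad C i x y) = ad C i (ng C i x) (ad C i x z)" using assms by simp
  then show ?thesis using assms(1-4) by (simp flip: ad_assoc)
qed

lemma ng_unique: "ob C \<Longrightarrow> x \<in> car C i \<Longrightarrow> y \<in> car C i \<Longrightarrow> ad C i x y = ze C i \<Longrightarrow> y = ng C i x"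
  by (rule ad_cancel[of C x i]) simp_all

lemma ng_ng [simp]: "ob C \<Longrightarrow> x \<in> car C i \<Longrightarrow> ng C i (ng C i x) = x"
  using ng_unique[of C "ng C i x" i x] by simp

lemma ng_ze [simp]: "ob C \<Longrightarrow> ng C i (ze C i) = ze C i"
  using ng_unique[of C "ze C i" i "ze C i"] by simp

lemma ad4:
  "ob C \<Longrightarrow> a \<in> car C i \<Longrightarrow> b \<in> car C i \<Longrightarrow> c \<in> car C i \<Longrightarrow> d \<in> car C i \<Longrightarrow>
   ad C i (ad C i a b) (ad C i c d) = ad C i (ad C i a c) (ad C i b d)"
  by (simp add: ad_assoc ad_lcomm)

lemma ng_dist:
  assumes "ob C" "x \<in> car C i" "y \<in> car C i"
  shows "ng C i (ad C i x y) = ad C i (ng C i x) (ng C i y)"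
proof -
  have "ad C i (ad C i x y) (ad C i (ng C i x) (ng C i y)) = ze C i"
    using assms by (subst ad4) simp_all
  then show ?thesis using assms by (intro ng_unique[symmetric]) simp_all
qed

lemma mi_car [simp]: "ob C \<Longrightarrow> x \<in> car C i \<Longrightarrow> y \<in> car C i \<Longrightarrow> mi C i x y \<in> car C i"
  by (simp add: mi_def)

lemma mi_self [simp]: "ob C \<Longrightarrow> x \<in> car C i \<Longrightarrow> mi C i x x = ze C i"
  by (simp add: mi_def)

lemma mi_ze [simp]: "ob C \<Longrightarrow> x \<in> car C i \<Longrightarrow> mi C i x (ze C i) = x"
  by (simp add: mi_def)

lemma ze_mi [simp]: "ob C \<Longrightarrow> x \<in> car C i \<Longrightarrow> mi C i (ze C i) x = ng C i x"
  by (simp add: mi_def)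

lemma mi_ad [simp]: "ob C \<Longrightarrow> x \<in> car C i \<Longrightarrow> y \<in> car C i \<Longrightarrow> ad C i (mi C i x y) y = x"
  by (simp add: mi_def ad_assoc)

lemma ad_mi_cancel [simp]: "ob C \<Longrightarrow> x \<in> car C i \<Longrightarrow> y \<in> car C i \<Longrightarrow> mi C i (ad C i x y) y = x"
  by (simp add: mi_def ad_assoc)

lemma ad_mi_cancel' [simp]: "ob C \<Longrightarrow> x \<in> car C i \<Longrightarrow> y \<in> car C i \<Longrightarrow> mi C i (ad C i x y) x = y"
  by (subst ad_comm) simp_all

lemma mi_eq_ze: "ob C \<Longrightarrow> x \<in> car C i \<Longrightarrow> y \<in> car C i \<Longrightarrow> mi C i x y = ze C i \<longleftrightarrow> x = y"
  by (metis mi_ad mi_self ze_ad)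

lemma mi_dist:
  "ob C \<Longrightarrow> a \<in> car C i \<Longrightarrow> b \<in> car C i \<Longrightarrow> c \<in> car C i \<Longrightarrow> d \<in> car C i \<Longrightarrow>
   mi C i (ad C i a b) (ad C i c d) = ad C i (mi C i a c) (mi C i b d)"
  unfolding mi_def by (simp add: ng_dist ad4)

lemma mi_trans:
  "ob C \<Longrightarrow> x \<in> car C i \<Longrightarrow> y \<in> car C i \<Longrightarrow> z \<in> car C i \<Longrightarrow>
   ad C i (mi C i x y) (mi C i y z) = mi C i x z"
  by (metis ad_assoc mi_ad mi_def ng_car mi_car)

lemma ng_mi: "ob C \<Longrightarrow> x \<in> car C i \<Longrightarrow> y \<in> car C i \<Longrightarrow> ng C i (mi C i x y) = mi C i y x"
  by (simp add: mi_def ng_dist ad_comm)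

lemma zero_sm: "ob C \<Longrightarrow> x \<in> car C i \<Longrightarrow> sm C i \<zero> x = ze C i"
  using ad_cancel[of C "sm C i \<zero> x" i "sm C i \<zero> x" "ze C i"] sm_add[of C \<zero> \<zero> x i] by simp

lemma ng_sm: "ob C \<Longrightarrow> x \<in> car C i \<Longrightarrow> ng C i x = sm C i (\<ominus> \<one>) x"
  using ng_unique[of C x i "sm C i (\<ominus> \<one>) x"] sm_add[of C \<one> "\<ominus> \<one>" x i] zero_sm[of C x i]
  by (simp add: R.r_neg)

lemma sm_ng: "ob C \<Longrightarrow> a \<in> carrier R \<Longrightarrow> x \<in> car C i \<Longrightarrow> sm C i a (ng C i x) = ng C i (sm C i a x)"
  by (simp add: ng_sm R.l_minus R.r_minus flip: sm_mult)

lemma sm_mi: "ob C \<Longrightarrow> a \<in> carrier R \<Longrightarrow> x \<in> car C i \<Longrightarrow> y \<in> car C i \<Longrightarrow>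
  sm C i a (mi C i x y) = mi C i (sm C i a x) (sm C i a y)"
  by (simp add: mi_def sm_ad sm_ng)

lemma sm_ze: "ob C \<Longrightarrow> a \<in> carrier R \<Longrightarrow> sm C i a (ze C i) = ze C i"
  using sm_mi[of C a "ze C i" i "ze C i"] by simp

lemma
  assumes "hom C D f"
  shows hom_car: "x \<in> car C i \<Longrightarrow> f i x \<in> car D i"
    and hom_ad: "x \<in> car C i \<Longrightarrow> y \<in> car C i \<Longrightarrow> f i (ad C i x y) = ad D i (f i x) (f i y)"
    and hom_sm: "x \<in> car C i \<Longrightarrow> a \<in> carrier R \<Longrightarrow> f i (sm C i a x) = sm D i a (f i x)"
    and hom_df: "x \<in> car C i \<Longrightarrow> i \<in> W \<Longrightarrow> f (sh i) (df C i x) = df D i (f i x)"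
  using assms unfolding hom_def by blast+

lemma hom_ze:
  assumes "ob C" "ob D" and f: "hom C D f" shows "f i (ze C i) = ze D i"
proof (rule ad_cancel[of D "f i (ze C i)" i])
  show "ad D i (f i (ze C i)) (f i (ze C i)) = ad D i (f i (ze C i)) (ze D i)"
    using assms(1,2) hom_ad[OF f, of "ze C i" i "ze C i"] hom_car[OF f] by simp
qed (use assms(1,2) hom_car[OF f] in simp_all)

lemma hom_ng:
  assumes "ob C" "ob D" and f: "hom C D f" and "x \<in> car C i" shows "f i (ng C i x) = ng D i (f i x)"
  using assms hom_ad[OF f, of x i "ng C i x"] by (intro ng_unique) (simp_all add: hom_car[OF f] hom_ze)

lemma hom_mi:
  assumes "ob C" "ob D" and f: "hom C D f" and "x \<in> car C i" "y \<in> car C i"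
  shows "f i (mi C i x y) = mi D i (f i x) (f i y)"
  using assms by (simp add: mi_def hom_ad[OF f] hom_ng[OF _ _ f])

lemma df_ze: "ob C \<Longrightarrow> i \<in> W \<Longrightarrow> df C i (ze C i) = ze C (sh i)"
  by (metis ad_cancel df_ad df_car ad_ze ze_car)

lemma df_mi: "ob C \<Longrightarrow> i \<in> W \<Longrightarrow> x \<in> car C i \<Longrightarrow> y \<in> car C i \<Longrightarrow>
  df C i (mi C i x y) = mi C (sh i) (df C i x) (df C i y)"
  by (simp add: mi_def df_ad ng_sm df_sm)

lemma hom_comp: "hom C D f \<Longrightarrow> hom D E g \<Longrightarrow> hom C E (\<lambda>i x. g i (f i x))"
  unfolding hom_def by simp

lemma hom_cong: "hom C D f \<Longrightarrow> ob C \<Longrightarrow> (\<And>i x. x \<in> car C i \<Longrightarrow> g i x = f i x) \<Longrightarrow> hom C D g"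
  unfolding hom_def by simp

lemma hom_id: "hom C C (\<lambda>i x. x)"
  if "ob C"
  using that by (simp add: hom_def)

lemma hom_zero: "ob C \<Longrightarrow> ob D \<Longrightarrow> hom C D (\<lambda>i x. ze D i)"
  by (simp add: hom_def sm_ze df_ze)

lemma
  assumes "sub N C"
  shows sub_car: "x \<in> N i \<Longrightarrow> x \<in> car C i"
    and sub_subset: "N i \<subseteq> car C i"
    and sub_ze: "ze C i \<in> N i"
    and sub_ad: "x \<in> N i \<Longrightarrow> y \<in> N i \<Longrightarrow> ad C i x y \<in> N i"
    and sub_sm: "x \<in> N i \<Longrightarrow> a \<in> carrier R \<Longrightarrow> sm C i a x \<in> N i"
    and sub_df: "x \<in> N i \<Longrightarrow> i \<in> W \<Longrightarrow> df C i x \<in> N (sh i)"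
  using assms unfolding sub_def by blast+

lemma sub_ng: "ob C \<Longrightarrow> sub N C \<Longrightarrow> x \<in> N i \<Longrightarrow> ng C i x \<in> N i"
  using ng_sm[of C x i] sub_car[of N C x i] sub_sm[of N C x i] by simp

lemma sub_mi: "ob C \<Longrightarrow> sub N C \<Longrightarrow> x \<in> N i \<Longrightarrow> y \<in> N i \<Longrightarrow> mi C i x y \<in> N i"
  unfolding mi_def by (rule sub_ad[of N C]) (rule sub_ng[of C N] | assumption)+

lemma ob_res: assumes C: "ob C" and N: "sub N C" shows "ob (res C N)"
proof (rule obI, unfold res_simps)
  note c = sub_car[OF N]
  show "\<exists>y\<in>N i. ad C i x y = ze C i" if "x \<in> N i" for i x
    using sub_ng[OF C N that] ad_ng[OF C c[OF that]] by blast
  show "ad C i x y = ad C i y x" if "x \<in> N i" "y \<in> N i" for i x y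
    using that C c by (simp add: ad_comm)
qed (use C N sub_car[OF N] in \<open>simp_all add: sub_ze[OF N] sub_ad[OF N] sub_sm[OF N] sub_df[OF N] ad_assoc sm_ad sm_add sm_mult df_ad df_sm df_df\<close>)

lemma ng_res:
  assumes C: "ob C" and N: "sub N C" and x: "x \<in> N i" shows "ng (res C N) i x = ng C i x"
proof (rule ng_unique[OF C])
  show "ad C i x (ng (res C N) i x) = ze C i" "ng (res C N) i x \<in> car C i" "x \<in> car C i"
    using ad_ng[OF ob_res[OF C N], of x i] ng_car[OF ob_res[OF C N], of x i] x sub_car[OF N] by simp_all
qed

lemma mi_res: "ob C \<Longrightarrow> sub N C \<Longrightarrow> x \<in> N i \<Longrightarrow> y \<in> N i \<Longrightarrow> mi (res C N) i x y = mi C i x y"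
  unfolding mi_def by (simp only: ng_res res_simps)

lemma sub_top: "ob C \<Longrightarrow> sub (car C) C"
  by (simp add: sub_def)

lemma sub_zero: "ob C \<Longrightarrow> sub (\<lambda>i. {ze C i}) C"
  by (simp add: sub_def sm_ze df_ze)

lemma hom_res: assumes "hom C D f" and N: "sub N C" shows "hom (res C N) D f"
  using assms(1) unfolding hom_def by (simp add: sub_car[OF N])

lemma hom_res2: "hom C D f \<Longrightarrow> (\<And>i x. x \<in> car C i \<Longrightarrow> f i x \<in> N i) \<Longrightarrow> hom C (res D N) f"
  unfolding hom_def by simp

lemma hom_res2D: assumes "hom C (res D N) f" and N: "sub N D" shows "hom C D f"
  using assms(1) unfolding hom_def by (simp add: sub_car[OF N])

lemma sub_res: "sub N' C \<Longrightarrow> sub N (res C N') \<longleftrightarrow> sub N C \<and> N \<le> N'"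
  unfolding sub_def le_fun_def res_simps by blast

lemma sub_Int: "sub N C \<Longrightarrow> sub N' C \<Longrightarrow> sub (\<lambda>i. N i \<inter> N' i) C"
  unfolding sub_def by blast

lemma sub_preimage:
  assumes C: "ob C" and D: "ob D" and f: "hom C D f" and N: "sub N D"
  shows "sub (\<lambda>i. {x \<in> car C i. f i x \<in> N i}) C"
  unfolding sub_def[of _ C] using C
  by (simp add: hom_ze[OF C D f] hom_ad[OF f] hom_sm[OF f] hom_df[OF f]
    sub_ad[OF N] sub_sm[OF N] sub_df[OF N] sub_ze[OF N])

lemma sub_kernel: "ob C \<Longrightarrow> ob D \<Longrightarrow> hom C D f \<Longrightarrow> sub (\<lambda>i. {x \<in> car C i. f i x = ze D i}) C"
  using sub_preimage[OF _ _ _ sub_zero, of C D f] by simp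

lemma sub_image:
  assumes C: "ob C" and D: "ob D" and f: "hom C D f" and N: "sub N C"
  shows "sub (\<lambda>i. f i ` N i) D"
  unfolding sub_def[of _ D]
proof (intro allI conjI ballI impI subsetI)
  fix i
  note c = sub_car[OF N]
  show "x \<in> car D i" if "x \<in> f i ` N i" for x using that hom_car[OF f] c by blast
  show "ze D i \<in> f i ` N i" using hom_ze[OF C D f, of i] sub_ze[OF N, of i] by (metis imageI)
  fix x assume "x \<in> f i ` N i"
  then obtain y where y: "y \<in> N i" "x = f i y" by blast
  show "ad D i x x' \<in> f i ` N i" if "x' \<in> f i ` N i" for x'
  proof -
    obtain y' where y': "y' \<in> N i" "x' = f i y'" using \<open>x' \<in> f i ` N i\<close> by blast
    have "ad D i x x' = f i (ad C i y y')" using y y' by (simp add: hom_ad[OF f] c)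
    then show ?thesis using sub_ad[OF N y(1) y'(1)] by simp
  qed
  show "sm D i a x \<in> f i ` N i" if "a \<in> carrier R" for a
    using y that hom_sm[OF f, of y i a] sub_sm[OF N y(1) that] c by (metis imageI)
  show "df D i x \<in> f (sh i) ` N (sh i)" if "i \<in> W"
    using y that hom_df[OF f, of y i] sub_df[OF N y(1) that] c by (metis imageI)
qed

definition sums :: "('i, 'r, 'a) gob \<Rightarrow> ('i \<Rightarrow> 'a set) \<Rightarrow> ('i \<Rightarrow> 'a set) \<Rightarrow> 'i \<Rightarrow> 'a set" where
  "sums C N B i = {ad C i x y | x y. x \<in> N i \<and> y \<in> B i}"

lemma sumsI: "x \<in> N i \<Longrightarrow> y \<in> B i \<Longrightarrow> ad C i x y \<in> sums C N B i"
  by (auto simp: sums_def)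

lemma sumsE: "z \<in> sums C N B i \<Longrightarrow> (\<And>x y. x \<in> N i \<Longrightarrow> y \<in> B i \<Longrightarrow> z = ad C i x y \<Longrightarrow> thesis) \<Longrightarrow> thesis"
  by (auto simp: sums_def)

lemma sub_sums: assumes C: "ob C" and N: "sub N C" and B: "sub B C" shows "sub (sums C N B) C"
  unfolding sub_def
proof (intro allI conjI ballI impI subsetI)
  fix i
  show "z \<in> car C i" if "z \<in> sums C N B i" for z
    using that C by (auto elim!: sumsE simp: sub_car[OF N] sub_car[OF B])
  have "ad C i (ze C i) (ze C i) \<in> sums C N B i" by (intro sumsI sub_ze[OF N] sub_ze[OF B])
  then show "ze C i \<in> sums C N B i" using C by simp
  fix z assume "z \<in> sums C N B i"
  then obtain x y where xy: "x \<in> N i" "y \<in> B i" "z = ad C i x y" by (rule sumsE)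
  note c = sub_car[OF N] sub_car[OF B]
  show "ad C i z w \<in> sums C N B i" if "w \<in> sums C N B i" for w
  proof -
    from that obtain x' y' where xy': "x' \<in> N i" "y' \<in> B i" "w = ad C i x' y'" by (rule sumsE)
    have "ad C i z w = ad C i (ad C i x x') (ad C i y y')"
      unfolding xy(3) xy'(3) using C xy xy' by (intro ad4) (simp_all add: c)
    then show ?thesis using xy xy' by (simp add: sumsI sub_ad[OF N] sub_ad[OF B])
  qed
  show "sm C i a z \<in> sums C N B i" if "a \<in> carrier R" for a
    unfolding xy(3) using that C xy by (simp add: sm_ad c sumsI sub_sm[OF N] sub_sm[OF B])
  show "df C i z \<in> sums C N B (sh i)" if "i \<in> W"
    unfolding xy(3) using that C xy by (simp add: df_ad c sumsI sub_df[OF N] sub_df[OF B])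
qed

lemma sums_upper1: "ob C \<Longrightarrow> sub N C \<Longrightarrow> sub B C \<Longrightarrow> x \<in> N i \<Longrightarrow> x \<in> sums C N B i"
  using sumsI[of x N i "ze C i" B C] sub_ze[of B C i] sub_car[of N C x i] by simp

lemma sums_upper2: "ob C \<Longrightarrow> sub N C \<Longrightarrow> sub B C \<Longrightarrow> x \<in> B i \<Longrightarrow> x \<in> sums C N B i"
  using sumsI[of "ze C i" N i x B C] sub_ze[of N C i] sub_car[of B C x i] by simp

lemma
  assumes "le B E"
  shows le_car: "x \<in> car B i \<Longrightarrow> x \<in> car E i"
    and le_ad: "x \<in> car B i \<Longrightarrow> y \<in> car B i \<Longrightarrow> ad B i x y = ad E i x y"
    and le_sm: "x \<in> car B i \<Longrightarrow> a \<in> carrier R \<Longrightarrow> sm B i a x = sm E i a x"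
    and le_df: "x \<in> car B i \<Longrightarrow> i \<in> W \<Longrightarrow> df B i x = df E i x"
  using assms unfolding le_def hom_def by simp_all

lemma le_fun: "le B E \<Longrightarrow> car B \<le> car E"
  by (intro le_funI subsetI) (rule le_car)

lemma le_ze: "ob B \<Longrightarrow> ob E \<Longrightarrow> le B E \<Longrightarrow> ze B i = ze E i"
  unfolding le_def by (rule hom_ze[of B E "\<lambda>i x. x"])

lemma le_ng: "ob B \<Longrightarrow> ob E \<Longrightarrow> le B E \<Longrightarrow> x \<in> car B i \<Longrightarrow> ng B i x = ng E i x"
  unfolding le_def by (rule hom_ng[of B E "\<lambda>i x. x"])

lemma le_refl: "ob B \<Longrightarrow> le B B"
  unfolding le_def by (rule hom_id)

lemma le_trans: "le A B \<Longrightarrow> le B C \<Longrightarrow> le A C"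
  unfolding le_def using hom_comp[of A B "\<lambda>i x. x" C "\<lambda>i x. x"] by simp

lemma sub_le: "ob C \<Longrightarrow> sub N C \<Longrightarrow> le (res C N) C"
  unfolding le_def by (rule hom_res[OF hom_id])

lemma le_sub: assumes B: "ob B" and E: "ob E" and le: "le B E" shows "sub (car B) E"
  unfolding sub_def
proof (intro allI conjI ballI impI subsetI)
  fix i
  show "x \<in> car E i" if "x \<in> car B i" for x using le_car[OF le that] .
  show "ze E i \<in> car B i" using le_ze[OF B E le, of i] B by (metis ze_car)
  fix x assume x: "x \<in> car B i"
  show "ad E i x y \<in> car B i" if "y \<in> car B i" for y using le_ad[OF le x that] B x that by (metis ad_car)
  show "sm E i a x \<in> car B i" if "a \<in> carrier R" for a using le_sm[OF le x that] B x that by (metis sm_car)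
  show "df E i x \<in> car B (sh i)" if "i \<in> W" using le_df[OF le x that] B x that by (metis df_car)
qed

lemma le_subsub: assumes B: "ob B" and E: "ob E" and le: "le B E" and N: "sub N B" shows "sub N E"
  unfolding sub_def
proof (intro allI conjI ballI impI subsetI)
  fix i
  note c = sub_car[OF N]
  show "x \<in> car E i" if "x \<in> N i" for x using le_car[OF le c[OF that]] .
  show "ze E i \<in> N i" using le_ze[OF B E le, of i] sub_ze[OF N, of i] by simp
  fix x assume x: "x \<in> N i"
  show "ad E i x y \<in> N i" if "y \<in> N i" for y
    using le_ad[OF le c[OF x] c[OF that]] sub_ad[OF N x that] by simp
  show "sm E i a x \<in> N i" if "a \<in> carrier R" for a
    using le_sm[OF le c[OF x] that] sub_sm[OF N x that] by simp
  show "df E i x \<in> N (sh i)" if "i \<in> W" using le_df[OF le c[OF x] that] sub_df[OF N x that] by simp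
qed

lemma le_hom: "le B E \<Longrightarrow> hom E D f \<Longrightarrow> hom B D f"
  using hom_comp[of B E "\<lambda>i x. x" D f] by (simp add: le_def)

lemma hom_le: "hom C B f \<Longrightarrow> le B E \<Longrightarrow> hom C E f"
  using hom_comp[of C B f E "\<lambda>i x. x"] by (simp add: le_def)

lemma le_le:
  assumes B: "ob B" and le: "le B E" and le': "le B' E" and s: "car B \<le> car B'"
  shows "le B B'"
proof -
  have c: "x \<in> car B' i" if "x \<in> car B i" for x i using that s by (auto simp: le_fun_def)
  show ?thesis
    unfolding le_def hom_def
    using B c le_ad[OF le] le_sm[OF le] le_df[OF le] le_ad[OF le'] le_sm[OF le'] le_df[OF le'] by simp
qed

lemma
  assumes "quo M N A p"
  shows quo_hom: "hom M A p"
    and quo_surj: "p i ` car M i = car A i"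
    and quo_ker: "x \<in> car M i \<Longrightarrow> p i x = ze A i \<longleftrightarrow> x \<in> N i"
  using assms unfolding quo_def by blast+

lemma quo_eq:
  assumes "ob M" "ob A" and p: "quo M N A p" and "x \<in> car M i" "y \<in> car M i"
  shows "p i x = p i y \<longleftrightarrow> mi M i x y \<in> N i"
  using assms(1,2,4,5) hom_mi[OF assms(1,2) quo_hom[OF p], of x i y] quo_ker[OF p, of "mi M i x y" i]
    mi_eq_ze[of A "p i x" i "p i y"] hom_car[OF quo_hom[OF p]] by simp

lemma quo_lift: "quo M N A p \<Longrightarrow> a \<in> car A i \<Longrightarrow> \<exists>x\<in>car M i. p i x = a"
  using quo_surj[of M N A p i] by (force simp: image_iff)

lemma quo_zero: "ob M \<Longrightarrow> quo M (\<lambda>i. {ze M i}) M (\<lambda>i x. x)"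
  by (simp add: quo_def hom_id)

text \<open>The homomorphism theorem. \<open>t\<close> evaluates \<open>u\<close> at a chosen
  preimage under \<open>a\<close>; two preimages differ by an element of the kernel of
  \<open>a\<close>, which \<open>u\<close> kills.\<close>

lemma factor:
  assumes ob: "ob C" "ob E" "ob V" and a: "hom C E a" "\<And>i. a i ` car C i = car E i"
    and u: "hom C V u" and k: "\<And>i x. x \<in> car C i \<Longrightarrow> a i x = ze E i \<Longrightarrow> u i x = ze V i"
  obtains t where "hom E V t" "\<And>i x. x \<in> car C i \<Longrightarrow> t i (a i x) = u i x"
proof -
  define t where "t i y = u i (SOME x. x \<in> car C i \<and> a i x = y)" for i y
  have t: "t i (a i x) = u i x" if x: "x \<in> car C i" for i x
  proof -
    define z where "z = (SOME z. z \<in> car C i \<and> a i z = a i x)"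
    have z: "z \<in> car C i" "a i z = a i x"
      using someI[of "\<lambda>z. z \<in> car C i \<and> a i z = a i x" x] x by (auto simp: z_def)
    then have "a i (mi C i z x) = ze E i" using ob(1,2) x hom_mi[OF ob(1,2) a(1)] hom_car[OF a(1)] by simp
    then have "u i (mi C i z x) = ze V i" using k z x ob by simp
    then have "u i z = u i x" using ob(1,3) z x hom_mi[OF ob(1,3) u] hom_car[OF u] by (simp add: mi_eq_ze)
    then show ?thesis by (simp add: t_def z_def)
  qed
  have "hom E V t"
    unfolding hom_def
  proof (intro allI ballI conjI impI)
    fix i y assume "y \<in> car E i"
    then obtain x where x: "x \<in> car C i" "y = a i x" using a(2) by blast
    show "t i y \<in> car V i" using x t hom_car[OF u] by simp
    show "t i (ad E i y z) = ad V i (t i y) (t i z)" if "z \<in> car E i" for z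
    proof -
      obtain w where w: "w \<in> car C i" "z = a i w" using a(2) \<open>z \<in> car E i\<close> by blast
      show ?thesis using x w t[of "ad C i x w" i] t ob(1) by (simp add: hom_ad[OF a(1)] hom_ad[OF u])
    qed
    show "t i (sm E i b y) = sm V i b (t i y)" if "b \<in> carrier R" for b
      using x t[of "sm C i b x" i] t ob(1) that by (simp add: hom_sm[OF a(1)] hom_sm[OF u])
    show "t (sh i) (df E i y) = df V i (t i y)" if "i \<in> W"
      using x t[of "df C i x" "sh i"] t ob(1) that by (simp add: hom_df[OF a(1)] hom_df[OF u])
  qed
  with t that show thesis by blast
qed

lemma ob_prd: assumes C: "ob C" and D: "ob D" shows "ob (prd C D)"
proof (rule obI)
  show "\<exists>y\<in>car (prd C D) i. ad (prd C D) i x y = ze (prd C D) i" if x: "x \<in> car (prd C D) i" for i x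
    using x C D by (intro bexI[of _ "(ng C i (fst x), ng D i (snd x))"]) auto
qed (use C D in \<open>auto simp: ad_assoc sm_ad sm_add sm_mult df_ad df_sm df_df intro: ad_comm\<close>)

lemma hom_fst: "hom (prd C D) C (\<lambda>i. fst)" and hom_snd: "hom (prd C D) D (\<lambda>i. snd)"
  by (auto simp: hom_def)

lemma hom_inl: "ob C \<Longrightarrow> ob D \<Longrightarrow> hom C (prd C D) (\<lambda>i x. (x, ze D i))"
  and hom_inr: "ob C \<Longrightarrow> ob D \<Longrightarrow> hom D (prd C D) (\<lambda>i x. (ze C i, x))"
  by (auto simp: hom_def sm_ze df_ze)

lemma hom_ad2:
  assumes E: "ob E" and f: "hom C E f" and g: "hom D E g"
  shows "hom (prd C D) E (\<lambda>i x. ad E i (f i (fst x)) (g i (snd x)))"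
  unfolding hom_def[of "prd C D"]
  using E by (auto simp: hom_car[OF f] hom_car[OF g] hom_ad[OF f] hom_ad[OF g] hom_sm[OF f] hom_sm[OF g]
    hom_df[OF f] hom_df[OF g] sm_ad df_ad intro: ad4)

lemma ng_prd: "ob C \<Longrightarrow> ob D \<Longrightarrow> x \<in> car C i \<Longrightarrow> y \<in> car D i \<Longrightarrow>
  ng (prd C D) i (x, y) = (ng C i x, ng D i y)"
  by (rule ng_unique[symmetric]) (auto simp: ob_prd)

lemma mi_prd: "ob C \<Longrightarrow> ob D \<Longrightarrow> x \<in> car C i \<Longrightarrow> x' \<in> car C i \<Longrightarrow> y \<in> car D i \<Longrightarrow> y' \<in> car D i \<Longrightarrow>
  mi (prd C D) i (x, y) (x', y') = (mi C i x x', mi D i y y')"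
  by (simp add: mi_def ng_prd)

text \<open>\<open>E\<close> is the image of the product of \<open>X\<close> and \<open>Y\<close>,
  so this is \<open>factor\<close> for the sum map. The condition on sums that vanish is the
  compatibility of \<open>u\<close> and \<open>w\<close> on the overlap.\<close>

lemma glue:
  assumes ob: "ob X" "ob Y" "ob E" "ob V" and a: "hom X E a" and b: "hom Y E b"
    and surj: "\<And>i e. e \<in> car E i \<Longrightarrow> \<exists>x\<in>car X i. \<exists>y\<in>car Y i. e = ad E i (a i x) (b i y)"
    and u: "hom X V u" and w: "hom Y V w"
    and k: "\<And>i x y. x \<in> car X i \<Longrightarrow> y \<in> car Y i \<Longrightarrow> ad E i (a i x) (b i y) = ze E i \<Longrightarrow>
      ad V i (u i x) (w i y) = ze V i"
  obtains t where "hom E V t" "\<And>i x. x \<in> car X i \<Longrightarrow> t i (a i x) = u i x"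
    "\<And>i y. y \<in> car Y i \<Longrightarrow> t i (b i y) = w i y"
proof -
  have im: "(\<lambda>x. ad E i (a i (fst x)) (b i (snd x))) ` car (prd X Y) i = car E i" for i
    using surj ob hom_car[OF a] hom_car[OF b] by (force simp: image_iff)
  obtain t where t: "hom E V t"
    "\<And>i x. x \<in> car (prd X Y) i \<Longrightarrow> t i (ad E i (a i (fst x)) (b i (snd x))) = ad V i (u i (fst x)) (w i (snd x))"
    by (rule factor[OF ob_prd[OF ob(1,2)] ob(3,4) hom_ad2[OF ob(3) a b] im hom_ad2[OF ob(4) u w]])
      (use k in auto)
  show thesis
  proof
    show "hom E V t" by fact
    show "t i (a i x) = u i x" if "x \<in> car X i" for i x
      using t(2)[of "(x, ze Y i)" i] that ob hom_car[OF a] hom_car[OF u]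
        hom_ze[OF ob(2,3) b] hom_ze[OF ob(2,4) w] by simp
    show "t i (b i y) = w i y" if "y \<in> car Y i" for i y
      using t(2)[of "(ze X i, y)" i] that ob hom_car[OF b] hom_car[OF w]
        hom_ze[OF ob(1,3) a] hom_ze[OF ob(1,4) u] by simp
  qed
qed

end

section \<open>Quotients with chosen names and unions of chains\<close>

definition sml :: "'u itself \<Rightarrow> ('i, 'r, 'a) gob \<Rightarrow> bool" where
  "sml u C \<longleftrightarrow> (\<forall>i. small u (car C i))"

context gcat begin

text \<open>The quotient structure carried over to the values of \<open>q\<close>, computed on
  chosen representatives. Any \<open>q\<close> that separates exactly the cosets will do, so the
  elements of a quotient can be named at will.\<close>

definition imob :: "('i, 'r, 'a) gob \<Rightarrow> ('i \<Rightarrow> 'a \<Rightarrow> 'b) \<Rightarrow> ('i, 'r, 'b) gob" where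
  "imob C q = (let s = (\<lambda>i u. SOME x. x \<in> car C i \<and> q i x = u) in
     \<lparr>car = \<lambda>i. q i ` car C i,
      ad = \<lambda>i u v. q i (ad C i (s i u) (s i v)),
      ze = \<lambda>i. q i (ze C i),
      sm = \<lambda>i a u. q i (sm C i a (s i u)),
      df = \<lambda>i u. q (sh i) (df C i (s i u))\<rparr>)"

text \<open>All axioms are equations or assert an element that can be pushed forward, so they pass
  to surjective images. Requiring \<open>ze E\<close> to be the image of zero is what makes an
  arbitrary record \<open>E\<close> eligible.\<close>

lemma ob_surj:
  assumes C: "ob C" and q: "hom C E q" and surj: "\<And>i. q i ` car C i = car E i"
    and z: "\<And>i. ze E i = q i (ze C i)"
  shows "ob E"
proof -
  have ex: "\<exists>x'\<in>car C i. x = q i x'" if "x \<in> car E i" for i x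
    using that surj[of i] by blast
  note c = hom_car[OF q]
  note f = hom_ad[OF q, symmetric] hom_sm[OF q, symmetric] hom_df[OF q, symmetric]
  show ?thesis
  proof (rule obI)
    fix i
    show "ze E i \<in> car E i" using z C c by simp
    fix x assume "x \<in> car E i"
    then obtain x' where x: "x' \<in> car C i" "x = q i x'" using ex by blast
    show "ad E i (ze E i) x = x" using x C by (simp add: z f)
    show "\<exists>y\<in>car E i. ad E i x y = ze E i"
      using x C by (intro bexI[of _ "q i (ng C i x')"]) (simp_all add: z f c)
    show "sm E i \<one> x = x" using x C by (simp add: f)
    show "df E i x \<in> car E (sh i)" if "i \<in> W" using x C that by (simp add: f c)
    show "df E (sh i) (df E i x) = ze E (sh (sh i))" if "i \<in> W" "sh i \<in> W"
      using x C that by (simp add: f z df_df)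
    show "sm E i a x \<in> car E i" if "a \<in> carrier R" for a using x C that by (simp add: f c)
    show "df E i (sm E i a x) = sm E (sh i) a (df E i x)" if "i \<in> W" "a \<in> carrier R" for a
      using x C that by (simp add: f df_sm)
    show "sm E i (a \<oplus> b) x = ad E i (sm E i a x) (sm E i b x)" "sm E i (a \<otimes> b) x = sm E i a (sm E i b x)"
      if "a \<in> carrier R" "b \<in> carrier R" for a b
      using x C that by (simp_all add: f sm_add sm_mult)
    fix y assume "y \<in> car E i"
    then obtain y' where y: "y' \<in> car C i" "y = q i y'" using ex by blast
    show "ad E i x y \<in> car E i" using x y C by (simp add: f c)
    show "ad E i x y = ad E i y x" using x y C by (simp add: f ad_comm)
    show "sm E i a (ad E i x y) = ad E i (sm E i a x) (sm E i a y)" if "a \<in> carrier R" for a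
      using x y C that by (simp add: f sm_ad)
    show "df E i (ad E i x y) = ad E (sh i) (df E i x) (df E i y)" if "i \<in> W"
      using x y C that by (simp add: f df_ad)
    fix w assume "w \<in> car E i"
    then obtain w' where w: "w' \<in> car C i" "w = q i w'" using ex by blast
    show "ad E i (ad E i x y) w = ad E i x (ad E i y w)" using x y w C by (simp add: f ad_assoc)
  qed
qed

text \<open>The chosen representative of \<open>q i x\<close> differs from \<open>x\<close> by an
  element of \<open>N\<close>, and \<open>N\<close> absorbs this difference under every
  operation.\<close>

lemma quo_imob:
  assumes C: "ob C" and N: "sub N C"
    and q: "\<And>i x y. x \<in> car C i \<Longrightarrow> y \<in> car C i \<Longrightarrow> q i x = q i y \<longleftrightarrow> mi C i x y \<in> N i"
  shows "ob (imob C q)" "quo C N (imob C q) q"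
proof -
  define s where "s i u = (SOME x. x \<in> car C i \<and> q i x = u)" for i u
  have E: "imob C q = \<lparr>car = \<lambda>i. q i ` car C i, ad = \<lambda>i u v. q i (ad C i (s i u) (s i v)),
      ze = \<lambda>i. q i (ze C i), sm = \<lambda>i a u. q i (sm C i a (s i u)),
      df = \<lambda>i u. q (sh i) (df C i (s i u))\<rparr>"
    by (simp add: imob_def s_def Let_def)
  have s: "s i (q i x) \<in> car C i" "mi C i x (s i (q i x)) \<in> N i" if "x \<in> car C i" for i x
  proof -
    have "s i (q i x) \<in> car C i \<and> q i (s i (q i x)) = q i x"
      unfolding s_def by (rule someI[of _ x]) (use that in simp)
    then show "s i (q i x) \<in> car C i" "mi C i x (s i (q i x)) \<in> N i"
      using q[of x i "s i (q i x)"] that by auto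
  qed
  have h: "hom C (imob C q) q"
    unfolding hom_def E gob.simps
  proof (intro allI ballI conjI impI)
    fix i x assume x: "x \<in> car C i"
    show "q i x \<in> q i ` car C i" using x by blast
    show "q i (ad C i x y) = q i (ad C i (s i (q i x)) (s i (q i y)))" if y: "y \<in> car C i" for y
      using x y C s[of x] s[of y] sub_ad[OF N s(2)[OF x] s(2)[OF y]]
      by (subst q) (simp_all add: mi_dist)
    show "q i (sm C i a x) = q i (sm C i a (s i (q i x)))" if "a \<in> carrier R" for a
      using x that C s[of x] sub_sm[OF N s(2)[OF x] that]
      by (subst q) (simp_all add: sm_mi)
    show "q (sh i) (df C i x) = q (sh i) (df C i (s i (q i x)))" if "i \<in> W"
      using x that C s[of x] sub_df[OF N s(2)[OF x] that]
      by (subst q) (simp_all add: df_mi)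
  qed
  show "ob (imob C q)"
    by (rule ob_surj[OF C h]) (simp_all add: E)
  show "quo C N (imob C q) q"
    unfolding quo_def using h C by (simp add: q) (simp add: E q)
qed

text \<open>Only addition involves two elements; linearity puts both into one member.\<close>

lemma sub_Sup_chain:
  assumes ne: "\<G> \<noteq> {}" and sub: "\<And>N. N \<in> \<G> \<Longrightarrow> sub N M"
    and chain: "\<And>N N'. N \<in> \<G> \<Longrightarrow> N' \<in> \<G> \<Longrightarrow> N \<le> N' \<or> N' \<le> N"
  shows "sub (Sup \<G>) M"
  unfolding sub_def
proof (intro allI conjI ballI impI subsetI)
  fix i
  have S: "Sup \<G> i = (\<Union>N\<in>\<G>. N i)" for i by (simp add: Sup_apply)
  show "x \<in> car M i" if "x \<in> Sup \<G> i" for x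
    using that sub_subset[OF sub, of _ i] unfolding S by blast
  show "ze M i \<in> Sup \<G> i" using ne sub_ze[OF sub, of _ i] unfolding S by blast
  fix x assume "x \<in> Sup \<G> i"
  then obtain N where N: "N \<in> \<G>" "x \<in> N i" unfolding S by blast
  show "ad M i x y \<in> Sup \<G> i" if "y \<in> Sup \<G> i" for y
  proof -
    obtain N' where N': "N' \<in> \<G>" "y \<in> N' i" using \<open>y \<in> Sup \<G> i\<close> unfolding S by blast
    obtain K where "K \<in> \<G>" "x \<in> K i" "y \<in> K i"
      using chain[OF N(1) N'(1)] N N' by (auto simp: le_fun_def)
    then have "ad M i x y \<in> K i" using sub_ad[OF sub[of K]] by simp
    then show ?thesis using \<open>K \<in> \<G>\<close> unfolding S by blast
  qed
  show "sm M i a x \<in> Sup \<G> i" if "a \<in> carrier R" for a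
    using N sub_sm[OF sub[OF N(1)] N(2) that] unfolding S by blast
  show "df M i x \<in> Sup \<G> (sh i)" if "i \<in> W"
    using N sub_df[OF sub[OF N(1)] N(2) that] unfolding S by blast
qed

text \<open>Every axiom concerns at most three elements, and in a chain finitely many elements lie
  in one member, where the axiom holds and the operations agree with those of the union.\<close>

lemma
  assumes ne: "\<C> \<noteq> {}" and ob: "\<And>C. C \<in> \<C> \<Longrightarrow> ob C"
    and chain: "\<And>C D. C \<in> \<C> \<Longrightarrow> D \<in> \<C> \<Longrightarrow> le C D \<or> le D C"
  shows ob_lubo: "ob (lubo \<C>)" and lubo_upper: "C \<in> \<C> \<Longrightarrow> le C (lubo \<C>)"
    and lubo_least: "(\<And>C. C \<in> \<C> \<Longrightarrow> le C E) \<Longrightarrow> le (lubo \<C>) E"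
proof -
  have car: "car (lubo \<C>) i = (\<Union>C\<in>\<C>. car C i)" for i by (simp add: lubo_def)
  have ze: "ze (lubo \<C>) i = ze C i" if "C \<in> \<C>" for C i
  proof -
    define D where "D = (SOME C. C \<in> \<C>)"
    have "D \<in> \<C>" using that unfolding D_def by (rule someI)
    then have "ze D i = ze C i" using chain[OF that, of D] le_ze ob that by metis
    then show ?thesis by (simp add: lubo_def D_def)
  qed
  have ad: "ad (lubo \<C>) i x y = ad C i x y" if "C \<in> \<C>" "x \<in> car C i" "y \<in> car C i" for C i x y
  proof -
    define D where "D = (SOME C. C \<in> \<C> \<and> x \<in> car C i \<and> y \<in> car C i)"
    have D: "D \<in> \<C> \<and> x \<in> car D i \<and> y \<in> car D i" unfolding D_def by (rule someI[of _ C]) (use that in simp)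
    then have "ad D i x y = ad C i x y" using chain[OF that(1), of D] le_ad that by metis
    then show ?thesis by (simp add: lubo_def D_def)
  qed
  have sm: "sm (lubo \<C>) i a x = sm C i a x" if "C \<in> \<C>" "x \<in> car C i" "a \<in> carrier R" for C i x a
  proof -
    define D where "D = (SOME C. C \<in> \<C> \<and> x \<in> car C i)"
    have D: "D \<in> \<C> \<and> x \<in> car D i" unfolding D_def by (rule someI[of _ C]) (use that in simp)
    then have "sm D i a x = sm C i a x" using chain[OF that(1), of D] le_sm that by metis
    then show ?thesis by (simp add: lubo_def D_def)
  qed
  have df: "df (lubo \<C>) i x = df C i x" if "C \<in> \<C>" "x \<in> car C i" "i \<in> W" for C i x
  proof -
    define D where "D = (SOME C. C \<in> \<C> \<and> x \<in> car C i)"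
    have D: "D \<in> \<C> \<and> x \<in> car D i" unfolding D_def by (rule someI[of _ C]) (use that in simp)
    then have "df D i x = df C i x" using chain[OF that(1), of D] le_df that by metis
    then show ?thesis by (simp add: lubo_def D_def)
  qed
  have ex1: "\<exists>C\<in>\<C>. x \<in> car C i" if "x \<in> car (lubo \<C>) i" for i x
    using that unfolding car by blast
  have ex2: "\<exists>C\<in>\<C>. x \<in> car C i \<and> y \<in> car C i" if "x \<in> car (lubo \<C>) i" "y \<in> car (lubo \<C>) i" for i x y
  proof -
    obtain C D where *: "C \<in> \<C>" "x \<in> car C i" "D \<in> \<C>" "y \<in> car D i"
      using \<open>x \<in> car (lubo \<C>) i\<close> \<open>y \<in> car (lubo \<C>) i\<close> unfolding car by blast
    from chain[OF *(1,3)] show ?thesis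
    proof
      assume "le C D" then show ?thesis using * le_car[of C D x i] by blast
    next
      assume "le D C" then show ?thesis using * le_car[of D C y i] by blast
    qed
  qed
  have ex3: "\<exists>C\<in>\<C>. x \<in> car C i \<and> y \<in> car C i \<and> z \<in> car C i"
    if "x \<in> car (lubo \<C>) i" "y \<in> car (lubo \<C>) i" "z \<in> car (lubo \<C>) i" for i x y z
  proof -
    obtain C where *: "C \<in> \<C>" "x \<in> car C i" "y \<in> car C i"
      using ex2[OF \<open>x \<in> car (lubo \<C>) i\<close> \<open>y \<in> car (lubo \<C>) i\<close>] by blast
    obtain D where **: "D \<in> \<C>" "z \<in> car D i"
      using ex1[OF \<open>z \<in> car (lubo \<C>) i\<close>] by blast
    from chain[OF *(1) **(1)] show ?thesis
    proof
      assume "le C D" then show ?thesis using * ** le_car[of C D x i] le_car[of C D y i] by blast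
    next
      assume "le D C" then show ?thesis using * ** le_car[of D C z i] by blast
    qed
  qed
  have carI: "x \<in> car C i \<Longrightarrow> C \<in> \<C> \<Longrightarrow> x \<in> car (lubo \<C>) i" for x C i unfolding car by blast
  show up: "le C (lubo \<C>)" if "C \<in> \<C>" for C
    unfolding le_def hom_def using that by (simp add: carI ad sm df)
  show "ob (lubo \<C>)"
  proof (rule obI)
    fix i
    show "ze (lubo \<C>) i \<in> car (lubo \<C>) i"
      using ne ze ob carI by (metis all_not_in_conv ze_car)
    fix x assume x: "x \<in> car (lubo \<C>) i"
    then obtain C where C: "C \<in> \<C>" "x \<in> car C i" using ex1 by blast
    note o = ob[OF C(1)]
    note s = ad[OF C(1)] sm[OF C(1)] df[OF C(1)] ze[OF C(1)] carI[OF _ C(1)]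
    show "ad (lubo \<C>) i (ze (lubo \<C>) i) x = x" using C o by (simp add: s)
    show "\<exists>y\<in>car (lubo \<C>) i. ad (lubo \<C>) i x y = ze (lubo \<C>) i"
      using C o by (intro bexI[of _ "ng C i x"]) (simp_all add: s)
    show "sm (lubo \<C>) i \<one> x = x" using C o by (simp add: s)
    show "df (lubo \<C>) i x \<in> car (lubo \<C>) (sh i)" if "i \<in> W" using C o that by (simp add: s)
    show "df (lubo \<C>) (sh i) (df (lubo \<C>) i x) = ze (lubo \<C>) (sh (sh i))" if "i \<in> W" "sh i \<in> W"
      using C o that by (simp add: s df_df)
    show "sm (lubo \<C>) i a x \<in> car (lubo \<C>) i" if "a \<in> carrier R" for a using C o that by (simp add: s)
    show "df (lubo \<C>) i (sm (lubo \<C>) i a x) = sm (lubo \<C>) (sh i) a (df (lubo \<C>) i x)"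
      if "i \<in> W" "a \<in> carrier R" for a
      using C o that by (simp add: s df_sm)
    show "sm (lubo \<C>) i (a \<oplus> b) x = ad (lubo \<C>) i (sm (lubo \<C>) i a x) (sm (lubo \<C>) i b x)"
      "sm (lubo \<C>) i (a \<otimes> b) x = sm (lubo \<C>) i a (sm (lubo \<C>) i b x)"
      if "a \<in> carrier R" "b \<in> carrier R" for a b
      using C o that by (simp_all add: s sm_add sm_mult)
  next
    fix i x y assume xy: "x \<in> car (lubo \<C>) i" "y \<in> car (lubo \<C>) i"
    then obtain C where C: "C \<in> \<C>" "x \<in> car C i" "y \<in> car C i" using ex2 by blast
    note o = ob[OF C(1)]
    note s = ad[OF C(1)] sm[OF C(1)] df[OF C(1)] ze[OF C(1)] carI[OF _ C(1)]
    show "ad (lubo \<C>) i x y \<in> car (lubo \<C>) i" using C o by (simp add: s)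
    show "ad (lubo \<C>) i x y = ad (lubo \<C>) i y x" using C o by (simp add: s ad_comm)
    show "sm (lubo \<C>) i a (ad (lubo \<C>) i x y) = ad (lubo \<C>) i (sm (lubo \<C>) i a x) (sm (lubo \<C>) i a y)"
      if "a \<in> carrier R" for a using C o that by (simp add: s sm_ad)
    show "df (lubo \<C>) i (ad (lubo \<C>) i x y) = ad (lubo \<C>) (sh i) (df (lubo \<C>) i x) (df (lubo \<C>) i y)"
      if "i \<in> W" using C o that by (simp add: s df_ad)
    fix z assume "z \<in> car (lubo \<C>) i"
    then obtain C where C: "C \<in> \<C>" "x \<in> car C i" "y \<in> car C i" "z \<in> car C i" using ex3 xy by blast
    note o = ob[OF C(1)]
    show "ad (lubo \<C>) i (ad (lubo \<C>) i x y) z = ad (lubo \<C>) i x (ad (lubo \<C>) i y z)"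
      using C o by (simp add: ad[OF C(1)] ad_assoc)
  qed
  show "le (lubo \<C>) E" if le: "\<And>C. C \<in> \<C> \<Longrightarrow> le C E"
    unfolding le_def hom_def
  proof (intro allI ballI conjI impI)
    fix i x assume x: "x \<in> car (lubo \<C>) i"
    then obtain C where C: "C \<in> \<C>" "x \<in> car C i" using ex1 by blast
    show "x \<in> car E i" using le_car[OF le[OF C(1)] C(2)] .
    show "sm (lubo \<C>) i a x = sm E i a x" if "a \<in> carrier R" for a
      using sm[OF C that] le_sm[OF le[OF C(1)] C(2) that] by simp
    show "df (lubo \<C>) i x = df E i x" if "i \<in> W"
      using df[OF C that] le_df[OF le[OF C(1)] C(2) that] by simp
    fix y assume "y \<in> car (lubo \<C>) i"
    then obtain C where C: "C \<in> \<C>" "x \<in> car C i" "y \<in> car C i" using ex2 x by blast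
    show "ad (lubo \<C>) i x y = ad E i x y"
      using ad[OF C] le_ad[OF le[OF C(1)] C(2,3)] by simp
  qed
qed

end

section \<open>Pushouts and extensions of homomorphisms\<close>

context gcat begin

lemma hom_neg: assumes C: "ob C" and D: "ob D" and f: "hom C D f" shows "hom C D (\<lambda>i x. ng D i (f i x))"
  unfolding hom_def using C D hom_car[OF f] hom_ad[OF f] hom_sm[OF f] hom_df[OF f]
  by (simp add: ng_dist sm_ng) (simp add: ng_sm df_sm)

lemma hom_pair: "hom X C f \<Longrightarrow> hom X D g \<Longrightarrow> hom X (prd C D) (\<lambda>i x. (f i x, g i x))"
  unfolding hom_def by simp

end

abbreviation (in gcat) "smob u C \<equiv> ob C \<and> sml u C"

text \<open>\<open>A\<close> bounds the index type, the ring, and later the generating objects.\<close>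

locale gcatu = gcat R sh W for R :: "('r, 'k) ring_scheme" (structure) and sh :: "'i \<Rightarrow> 'i" and W +
  fixes A :: "'u set"
  assumes univ: "universe TYPE('u)" and A_inf: "infinite A" and A_small: "small TYPE('u) A"
    and I_bnd: "bnd A (UNIV :: 'i set)" and R_bnd: "bnd A (carrier R)"
begin

lemma small_I: "small TYPE('u) (UNIV :: 'i set)"
  using I_bnd A_small small_lepoll by blast

lemma small_R: "small TYPE('u) (carrier R)"
  using R_bnd A_small small_lepoll by blast

lemma smlD: "sml TYPE('u) C \<Longrightarrow> small TYPE('u) (car C i)"
  by (simp add: sml_def)

lemma sml_res: "sml TYPE('u) C \<Longrightarrow> sub N C \<Longrightarrow> sml TYPE('u) (res C N)"
  unfolding sml_def res_simps using small_subset sub_subset by metis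

lemma sml_prd: "sml TYPE('u) C \<Longrightarrow> sml TYPE('u) D \<Longrightarrow> sml TYPE('u) (prd C D)"
  by (simp add: sml_def small_Times[OF univ])

lemma smob_res: "smob TYPE('u) C \<Longrightarrow> sub N C \<Longrightarrow> smob TYPE('u) (res C N)"
  using ob_res sml_res by blast

text \<open>A quotient in which the class of \<open>j i b\<close> is called \<open>b\<close>.
  Injectivity of \<open>j\<close> modulo \<open>N\<close> makes this naming consistent. It is the
  device that lets a pushout contain the old object literally.\<close>

lemma quotient_over:
  fixes C :: "('i, 'r, 'b) gob" and j :: "'i \<Rightarrow> 'u \<Rightarrow> 'b"
  assumes C: "ob C" and N: "sub N C" and smC: "sml TYPE('u) C"
    and B: "\<And>i. small TYPE('u) (B i)"
    and j: "\<And>i b. b \<in> B i \<Longrightarrow> j i b \<in> car C i"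
    and inj: "\<And>i b b'. b \<in> B i \<Longrightarrow> b' \<in> B i \<Longrightarrow> mi C i (j i b) (j i b') \<in> N i \<Longrightarrow> b = b'"
  obtains E :: "('i, 'r, 'u) gob" and q where
    "smob TYPE('u) E" "quo C N E q" "\<And>i b. b \<in> B i \<Longrightarrow> q i (j i b) = b"
proof -
  have "\<forall>i. \<exists>g :: 'b \<Rightarrow> 'u. inj_on g (car C i) \<and> g ` car C i \<inter> B i = {}"
    using embed_avoiding[OF univ smlD[OF smC] B] by blast
  then obtain g :: "'i \<Rightarrow> 'b \<Rightarrow> 'u" where g: "\<And>i. inj_on (g i) (car C i)" "\<And>i. g i ` car C i \<inter> B i = {}"
    by metis
  define eq where "eq i x y \<longleftrightarrow> mi C i x y \<in> N i" for i x y
  have eq_refl: "eq i x x" if "x \<in> car C i" for i x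
    using that C sub_ze[OF N] by (simp add: eq_def)
  have eq_sym: "eq i y x" if "eq i x y" "x \<in> car C i" "y \<in> car C i" for i x y
    using that sub_ng[OF C N, of "mi C i x y" i] by (simp add: eq_def ng_mi[OF C])
  have eq_trans: "eq i x z" if "eq i x y" "eq i y z" "x \<in> car C i" "y \<in> car C i" "z \<in> car C i" for i x y z
    using that sub_ad[OF N, of "mi C i x y" i "mi C i y z"] by (simp add: eq_def mi_trans[OF C])
  \<comment> \<open>A representative that depends only on the class: the chosen predicate is the
    same for equivalent elements.\<close>
  define r where "r i x = (SOME y. y \<in> car C i \<and> eq i x y)" for i x
  have r: "r i x \<in> car C i" "eq i x (r i x)" if "x \<in> car C i" for i x
    using someI[of "\<lambda>y. y \<in> car C i \<and> eq i x y" x] that eq_refl by (auto simp: r_def)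
  have r_eq: "r i x = r i y" if "eq i x y" "x \<in> car C i" "y \<in> car C i" for i x y
  proof -
    have "(\<lambda>z. z \<in> car C i \<and> eq i x z) = (\<lambda>z. z \<in> car C i \<and> eq i y z)"
      using that eq_sym eq_trans by blast
    then show ?thesis by (simp add: r_def)
  qed
  \<comment> \<open>Classes that meet the image of \<open>j\<close> keep their prescribed names; the
    others are named by \<open>g\<close>, whose values avoid \<open>B\<close>, so the two kinds of
    names never clash.\<close>
  define q where "q i x = (if \<exists>b\<in>B i. eq i x (j i b) then (SOME b. b \<in> B i \<and> eq i x (j i b)) else g i (r i x))" for i x
  have q1: "q i x = b" if "b \<in> B i" "eq i x (j i b)" "x \<in> car C i" for i x b
  proof -
    define c where "c = (SOME b. b \<in> B i \<and> eq i x (j i b))"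
    have c: "c \<in> B i \<and> eq i x (j i c)" unfolding c_def by (rule someI[of _ b]) (use that in simp)
    then have "eq i (j i c) (j i b)" using that j eq_sym eq_trans by meson
    then have "c = b" using inj[of c i b] c that(1) by (simp add: eq_def)
    moreover have "q i x = c" using that by (auto simp: q_def c_def)
    ultimately show ?thesis by simp
  qed
  have q2: "q i x = g i (r i x)" if "\<not> (\<exists>b\<in>B i. eq i x (j i b))" for i x
    using that by (auto simp: q_def)
  have q: "q i x = q i y \<longleftrightarrow> mi C i x y \<in> N i" if xy: "x \<in> car C i" "y \<in> car C i" for i x y
  proof (cases "\<exists>b\<in>B i. eq i x (j i b)")
    case True
    then obtain b where b: "b \<in> B i" "eq i x (j i b)" by blast
    note qx = q1[OF b xy(1)]
    show ?thesis
    proof (cases "\<exists>b\<in>B i. eq i y (j i b)")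
      case True
      then obtain c where c: "c \<in> B i" "eq i y (j i c)" by blast
      have "b = c \<longleftrightarrow> eq i x y"
      proof
        assume "b = c" then show "eq i x y" using b c xy j[OF b(1)] eq_sym eq_trans by meson
      next
        assume "eq i x y"
        then have "eq i x (j i c)" using eq_trans[OF _ c(2)] xy j[OF c(1)] by blast
        then show "b = c" using q1[OF c(1) _ xy(1)] qx by simp
      qed
      then show ?thesis using qx q1[OF c xy(2)] by (simp add: eq_def)
    next
      case False
      then have "\<not> eq i x y" using b xy j[OF b(1)] eq_sym eq_trans by meson
      moreover have "q i y \<notin> B i" using q2[OF False] r(1)[OF xy(2)] g(2)[of i] by auto
      ultimately show ?thesis using qx b by (auto simp: eq_def)
    qed
  next
    case False
    note qx = q2[OF False]
    show ?thesis
    proof (cases "\<exists>b\<in>B i. eq i y (j i b)")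
      case True
      then obtain c where c: "c \<in> B i" "eq i y (j i c)" by blast
      then have "\<not> eq i x y" using False xy j[OF c(1)] eq_trans by meson
      moreover have "q i x \<notin> B i" using qx r(1)[OF xy(1)] g(2)[of i] by auto
      ultimately show ?thesis using q1[OF c xy(2)] c by (auto simp: eq_def)
    next
      case F: False
      have "r i x = r i y \<longleftrightarrow> eq i x y"
        using r_eq[OF _ xy] r[OF xy(1)] r[OF xy(2)] xy eq_sym eq_trans by metis
      then show ?thesis using qx q2[OF F] inj_onD[OF g(1)[of i]] r(1)[OF xy(1)] r(1)[OF xy(2)]
        by (auto simp: eq_def)
    qed
  qed
  have "sml TYPE('u) (imob C q)"
    using smlD[OF smC] by (simp add: sml_def imob_def Let_def small_image)
  moreover have "q i (j i b) = b" if "b \<in> B i" for i b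
    using q1[OF that eq_refl] j that by blast
  ultimately show thesis
    using that[of "imob C q" q] quo_imob[OF C N q] by blast
qed

lemma quotient_exists:
  fixes C :: "('i, 'r, 'b) gob"
  assumes "ob C" and "sub N C" and "sml TYPE('u) C"
  obtains E :: "('i, 'r, 'u) gob" and q where "smob TYPE('u) E" "quo C N E q"
  by (rule quotient_over[OF assms, of "\<lambda>i. {}" undefined]) (auto intro: small_countable univ)

text \<open>\<open>E\<close> is the pushout of \<open>f\<close> and the inclusion of \<open>N\<close> into \<open>M\<close>, with \<open>V\<close> a literal subobject.\<close>

definition po :: "('i, 'r, 'u) gob \<Rightarrow> ('i \<Rightarrow> 'u set) \<Rightarrow> ('i, 'r, 'u) gob \<Rightarrow> ('i \<Rightarrow> 'u \<Rightarrow> 'u) \<Rightarrow>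
    ('i, 'r, 'u) gob \<Rightarrow> ('i \<Rightarrow> 'u \<Rightarrow> 'u) \<Rightarrow> bool" where
  "po M N V f E h \<longleftrightarrow> le V E \<and> hom M E h \<and> (\<forall>i. \<forall>x\<in>N i. h i x = f i x) \<and>
     (\<forall>i. \<forall>y\<in>car E i. \<exists>v\<in>car V i. \<exists>m\<in>car M i. y = ad E i v (h i m)) \<and>
     (\<forall>i. \<forall>m\<in>car M i. h i m \<in> car V i \<longrightarrow> m \<in> N i)"

text \<open>The usual pushout, the product of \<open>V\<close> and \<open>M\<close> modulo an
  antidiagonal copy of \<open>N\<close>, taken with \<open>quotient_over\<close> so that
  \<open>V\<close> keeps its names.\<close>

lemma po_exists:
  assumes M: "smob TYPE('u) M" and V: "smob TYPE('u) V" and N: "sub N M" and f: "hom (res M N) V f"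
  obtains E h where "smob TYPE('u) E" "po M N V f E h"
proof -
  let ?C = "prd V M"
  have obs: "ob M" "ob V" "ob ?C" "ob (res M N)" using M V N ob_prd ob_res by auto
  \<comment> \<open>These are the pairs that must vanish for the images of \<open>x\<close> and
    \<open>f i x\<close> to agree.\<close>
  define K where "K i = (\<lambda>m. (ng V i (f i m), m)) ` N i" for i
  note c = sub_car[OF N]
  have fc: "f i x \<in> car V i" if "x \<in> N i" for i x using hom_car[OF f] that by simp
  have f0: "f i (ze M i) = ze V i" for i using hom_ze[OF obs(4,2) f, of i] by simp
  have fK: "hom (res M N) ?C (\<lambda>i m. (ng V i (f i m), m))"
    by (rule hom_pair[OF hom_neg[OF obs(4,2) f] hom_res[OF hom_id[OF obs(1)] N]])
  have K: "sub K ?C"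
    using sub_image[OF obs(4,3) fK sub_top[OF obs(4)]] unfolding K_def[abs_def] by simp
  obtain E :: "('i, 'r, 'u) gob" and q where E: "smob TYPE('u) E" "quo ?C K E q"
    and qb: "\<And>i b. b \<in> car V i \<Longrightarrow> q i (b, ze M i) = b"
  proof (rule quotient_over[OF obs(3) K sml_prd, of "car V" "\<lambda>i b. (b, ze M i)"])
    show "small TYPE('u) (car V i)" for i using V by (simp add: smlD)
    show "(b, ze M i) \<in> car ?C i" if "b \<in> car V i" for i b using that obs by simp
    \<comment> \<open>An element of \<open>K\<close> with second component zero comes from zero, so
      its first component vanishes as well: \<open>V\<close> embeds into the quotient.\<close>
    show "b = b'" if "b \<in> car V i" "b' \<in> car V i" "mi ?C i (b, ze M i) (b', ze M i) \<in> K i" for i b b'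
    proof -
      have "(mi V i b b', ze M i) \<in> K i" using that obs by (simp add: mi_prd)
      then have "mi V i b b' = ze V i" using obs by (auto simp: K_def f0)
      then show ?thesis using that obs by (simp add: mi_eq_ze)
    qed
  qed (use M V in auto)
  note q = quo_hom[OF E(2)]
  have obE: "ob E" using E by blast
  have le: "le V E"
    unfolding le_def
    by (rule hom_cong[OF hom_comp[OF hom_inl[OF obs(2,1)] q] obs(2)]) (simp add: qb)
  define h where "h i m = q i (ze V i, m)" for i m
  have h: "hom M E h"
    unfolding h_def by (rule hom_comp[OF hom_inr[OF obs(2,1)] q])
  have "po M N V f E h"
    unfolding po_def
  proof (intro conjI le h allI ballI impI)
    fix i
    show "h i x = f i x" if x: "x \<in> N i" for x
    proof -
      have "mi ?C i (ze V i, x) (f i x, ze M i) = (ng V i (f i x), x)"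
        using x obs fc c by (simp add: mi_prd)
      then have "q i (ze V i, x) = q i (f i x, ze M i)"
        using quo_eq[OF obs(3) obE E(2), of "(ze V i, x)" i "(f i x, ze M i)"] x obs fc c by (auto simp: K_def)
      then show ?thesis using qb fc x by (simp add: h_def)
    qed
    show "\<exists>v\<in>car V i. \<exists>m\<in>car M i. y = ad E i v (h i m)" if y: "y \<in> car E i" for y
    proof -
      obtain v m where vm: "v \<in> car V i" "m \<in> car M i" "q i (v, m) = y"
        using quo_lift[OF E(2) y] by auto
      have "(v, m) = ad ?C i (v, ze M i) (ze V i, m)" using vm obs by simp
      then have "y = ad E i (q i (v, ze M i)) (q i (ze V i, m))"
        using vm obs hom_ad[OF q, of "(v, ze M i)" i "(ze V i, m)"] by simp
      then show ?thesis using vm qb by (auto simp: h_def)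
    qed
    show "m \<in> N i" if m: "m \<in> car M i" "h i m \<in> car V i" for m
    proof -
      have "q i (h i m, ze M i) = q i (ze V i, m)" using qb[OF m(2)] by (simp add: h_def)
      then have "mi ?C i (ze V i, m) (h i m, ze M i) \<in> K i"
        using quo_eq[OF obs(3) obE E(2), of "(ze V i, m)" i "(h i m, ze M i)"] m obs by simp
      then show ?thesis using m obs by (auto simp: mi_prd K_def)
    qed
  qed
  with E that show thesis by blast
qed

text \<open>The universal property of the pushout, as an instance of \<open>glue\<close>.\<close>

lemma po_map:
  assumes po: "po M N V f E h" and obs: "ob M" "ob V" "ob E" "ob Z" and N: "sub N M"
    and f: "hom (res M N) V f"
    and u: "hom V Z u" and w: "hom M Z w" and uw: "\<And>i x. x \<in> N i \<Longrightarrow> u i (f i x) = w i x"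
  obtains t where "hom E Z t" "\<And>i v. v \<in> car V i \<Longrightarrow> t i v = u i v" "\<And>i m. m \<in> car M i \<Longrightarrow> t i (h i m) = w i m"
proof -
  have le: "le V E" and h: "hom M E h" and hf: "\<And>i x. x \<in> N i \<Longrightarrow> h i x = f i x"
    and surj: "\<And>i y. y \<in> car E i \<Longrightarrow> \<exists>v\<in>car V i. \<exists>m\<in>car M i. y = ad E i v (h i m)"
    and inj: "\<And>i m. m \<in> car M i \<Longrightarrow> h i m \<in> car V i \<Longrightarrow> m \<in> N i"
    using po unfolding po_def by blast+
  \<comment> \<open>If \<open>x\<close> and \<open>h i y\<close> cancel, then \<open>h i y\<close>
    lies in \<open>V\<close>, which forces \<open>y\<close> into \<open>N\<close>, where the two
    given maps agree.\<close>
  have k: "ad Z i (u i x) (w i y) = ze Z i"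
    if xy: "x \<in> car V i" "y \<in> car M i" "ad E i x (h i y) = ze E i" for i x y
  proof -
    have "h i y = ng E i x"
      by (rule ng_unique[OF obs(3) _ _ xy(3)]) (use xy le_car[OF le] hom_car[OF h] in auto)
    also have "\<dots> = ng V i x" using le_ng[OF obs(2,3) le xy(1)] by simp
    finally have hy: "h i y = ng V i x" .
    then have "y \<in> N i" using inj[OF xy(2)] xy(1) obs by simp
    then have "w i y = u i (ng V i x)" using uw hf hy by metis
    then show ?thesis using hom_ng[OF obs(2,4) u xy(1)] hom_car[OF u xy(1)] obs by simp
  qed
  show thesis
    by (rule glue[OF obs(2,1,3,4) le[unfolded le_def] h surj u w k]) (use that in blast)+
qed

text \<open>A pushout preserves cokernels: the projection is glued from zero on \<open>V\<close> and
  \<open>p\<close> on \<open>M\<close>.\<close>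

lemma po_quo:
  assumes po: "po M N V f E h" and obs: "ob M" "ob V" "ob E" "ob S" and N: "sub N M"
    and f: "hom (res M N) V f" and p: "quo M N S p"
  obtains p' where "quo E (car V) S p'"
proof -
  have le: "le V E" and h: "hom M E h" and hf: "\<And>i x. x \<in> N i \<Longrightarrow> h i x = f i x"
    and surj: "\<And>i y. y \<in> car E i \<Longrightarrow> \<exists>v\<in>car V i. \<exists>m\<in>car M i. y = ad E i v (h i m)"
    using po unfolding po_def by blast+
  have "ze S i = p i x" if "x \<in> N i" for i x
    using quo_ker[OF p, of x i] sub_car[OF N that] that by simp
  then obtain p' where p': "hom E S p'" "\<And>i v. v \<in> car V i \<Longrightarrow> p' i v = ze S i"
      "\<And>i m. m \<in> car M i \<Longrightarrow> p' i (h i m) = p i m"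
    using po_map[OF po obs N f hom_zero[OF obs(2,4)] quo_hom[OF p]] by blast
  have "quo E (car V) S p'"
    unfolding quo_def
  proof (intro conjI p' allI ballI)
    fix i
    show "p' i ` car E i = car S i"
    proof (intro equalityI subsetI)
      show "x \<in> car S i" if "x \<in> p' i ` car E i" for x using that hom_car[OF p'(1)] by blast
      show "x \<in> p' i ` car E i" if "x \<in> car S i" for x
        using quo_lift[OF p that] p'(3) hom_car[OF h] by (metis imageI)
    qed
    show "p' i x = ze S i \<longleftrightarrow> x \<in> car V i" if x: "x \<in> car E i" for x
    proof
      show "p' i x = ze S i" if "x \<in> car V i" using p'(2) that .
      assume 0: "p' i x = ze S i"
      obtain v m where vm: "v \<in> car V i" "m \<in> car M i" "x = ad E i v (h i m)" using surj[OF x] by blast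
      have "p' i x = p i m"
        using vm hom_ad[OF p'(1), of v i "h i m"] p' le_car[OF le] hom_car[OF h] hom_car[OF quo_hom[OF p]] obs by simp
      then have "m \<in> N i" using 0 quo_ker[OF p vm(2)] by simp
      then have "h i m \<in> car V i" using hf hom_car[OF f] by simp
      then show "x \<in> car V i" using vm le_ad[OF le, of v i "h i m"] obs by (metis ad_car)
    qed
  qed
  with that show thesis by blast
qed

text \<open>
  Vanishing of \<open>Ext\<^sup>1(C, V)\<close>: homomorphisms into \<open>V\<close> extend along every monomorphism with
  cokernel \<open>C\<close>.
\<close>

definition ext0 :: "('i, 'r, 'u) gob \<Rightarrow> ('i, 'r, 'u) gob \<Rightarrow> bool" where
  "ext0 C V \<longleftrightarrow>
     (\<forall>M N p f. smob TYPE('u) (M :: ('i, 'r, 'u) gob) \<and> sub N M \<and> quo M N C p \<and> hom (res M N) V f \<longrightarrow>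
        (\<exists>g. hom M V g \<and> (\<forall>i. \<forall>x\<in>N i. g i x = f i x)))"

lemma ext0D:
  assumes "ext0 C V" "smob TYPE('u) (M :: ('i, 'r, 'u) gob)" "sub N M" "quo M N C p" "hom (res M N) V f"
  obtains g where "hom M V g" "\<And>i x. x \<in> N i \<Longrightarrow> g i x = f i x"
  using assms unfolding ext0_def by blast

text \<open>\<open>ext0\<close> can quantify only over objects with elements in \<open>'u\<close>. A
  small object on another type, such as a product, is first copied into \<open>'u\<close> as its
  quotient by zero, and the extension problem is carried along.\<close>

lemma ext0D_any:
  fixes M :: "('i, 'r, 'b) gob"
  assumes ext: "ext0 C V" and M: "smob TYPE('u) M" and N: "sub N M" and p: "quo M N C p"
    and f: "hom (res M N) V f" and obs: "ob C" "ob V"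
  obtains g where "hom M V g" "\<And>i x. x \<in> N i \<Longrightarrow> g i x = f i x"
proof -
  have oM: "ob M" using M by blast
  obtain E :: "('i, 'r, 'u) gob" and q where E: "smob TYPE('u) E" and q: "quo M (\<lambda>i. {ze M i}) E q"
    using quotient_exists[OF oM sub_zero[OF oM]] M by blast
  have oE: "ob E" using E by blast
  note qh = quo_hom[OF q]
  note q0 = quo_ker[OF q]
  obtain p' where p': "hom E C p'" "\<And>i x. x \<in> car M i \<Longrightarrow> p' i (q i x) = p i x"
    by (rule factor[OF oM oE obs(1) qh quo_surj[OF q] quo_hom[OF p]])
      (use q0 hom_ze[OF oM obs(1) quo_hom[OF p]] in auto)
  define N' where "N' i = q i ` N i" for i
  have N': "sub N' E" unfolding N'_def by (rule sub_image[OF oM oE qh N])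
  have qN: "x \<in> N i" if "x \<in> car M i" "q i x \<in> N' i" for i x
  proof -
    obtain y where y: "y \<in> N i" "q i x = q i y" using \<open>q i x \<in> N' i\<close> by (auto simp: N'_def)
    then have "x = y" using quo_eq[OF oM oE q that(1) sub_car[OF N y(1)]] mi_eq_ze[OF oM that(1) sub_car[OF N y(1)]]
      by simp
    then show ?thesis using y by simp
  qed
  have quo': "quo E N' C p'"
    unfolding quo_def
  proof (intro conjI p' allI ballI)
    fix i
    show "p' i ` car E i = car C i"
      using p'(2) by (simp add: image_image quo_surj[OF p, symmetric] quo_surj[OF q, symmetric])
    show "p' i x = ze C i \<longleftrightarrow> x \<in> N' i" if x: "x \<in> car E i" for x
    proof -
      obtain y where y: "y \<in> car M i" "q i y = x" using quo_lift[OF q x] by blast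
      then have "p' i x = ze C i \<longleftrightarrow> y \<in> N i" using p'(2) quo_ker[OF p] by metis
      also have "\<dots> \<longleftrightarrow> x \<in> N' i" using qN[OF y(1)] y by (auto simp: N'_def)
      finally show ?thesis .
    qed
  qed
  have oN: "ob (res M N)" "ob (res E N')" using ob_res oM oE N N' by auto
  have hN: "hom (res M N) (res E N') q"
    by (rule hom_res2[OF hom_res[OF qh N]]) (auto simp: N'_def)
  have sN: "q i ` car (res M N) i = car (res E N') i" for i by (simp add: N'_def)
  obtain f' where f': "hom (res E N') V f'" "\<And>i x. x \<in> car (res M N) i \<Longrightarrow> f' i (q i x) = f i x"
    by (rule factor[OF oN obs(2) hN sN f])
      (use q0 sub_car[OF N] hom_ze[OF oN(1) obs(2) f] in auto)
  obtain g' where g': "hom E V g'" "\<And>i x. x \<in> N' i \<Longrightarrow> g' i x = f' i x"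
    using ext0D[OF ext E N' quo' f'(1)] by blast
  show thesis
  proof
    show "hom M V (\<lambda>i x. g' i (q i x))" by (rule hom_comp[OF qh g'(1)])
    show "g' i (q i x) = f i x" if "x \<in> N i" for i x
      using that g'(2)[of "q i x" i] f'(2)[of x i] by (simp add: N'_def)
  qed
qed

text \<open>Pull the extension \<open>M\<close> of \<open>C\<close> back along \<open>q\<close>. The
  pullback is an extension of \<open>Q\<close>, where \<open>f\<close> extends; restricting along
  the map into the pullback induced by \<open>s\<close> gives the extension to
  \<open>M\<close>.\<close>

lemma ext0_retract:
  assumes ext: "ext0 Q V" and C: "smob TYPE('u) C" and Q: "smob TYPE('u) Q" and V: "ob V"
    and s: "hom C Q s" and q: "hom Q C q" and qs: "\<And>i x. x \<in> car C i \<Longrightarrow> q i (s i x) = x"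
  shows "ext0 C V"
  unfolding ext0_def
proof (intro allI impI, elim conjE)
  fix M N p f
  assume M: "ob (M :: ('i, 'r, 'u) gob)" "sml TYPE('u) M" and N: "sub N M" and p: "quo M N C p"
    and f: "hom (res M N) V f"
  have oC: "ob C" and oQ: "ob Q" using C Q by auto
  note ph = quo_hom[OF p]
  let ?X = "prd M Q"
  have X: "smob TYPE('u) ?X" using M Q by (simp add: ob_prd sml_prd)
  \<comment> \<open>The pullback of \<open>p\<close> and \<open>q\<close>, written as the kernel of
    their difference.\<close>
  define P where "P i = {x \<in> car ?X i. mi C i (p i (fst x)) (q i (snd x)) = ze C i}" for i
  have oX: "ob ?X" using X by blast
  have "hom ?X C (\<lambda>i x. ad C i (p i (fst x)) (ng C i (q i (snd x))))"
  proof (rule hom_ad2[OF oC ph])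
    show "hom Q C (\<lambda>i x. ng C i (q i x))" by (rule hom_neg[OF oQ oC q])
  qed
  then have P: "sub P ?X"
    unfolding P_def mi_def by (rule sub_kernel[OF oX oC])
  have Peq: "P i = {x \<in> car ?X i. p i (fst x) = q i (snd x)}" for i
    unfolding P_def using mi_eq_ze[OF oC] hom_car[OF ph] hom_car[OF q] by auto
  let ?P = "res ?X P"
  have sP: "smob TYPE('u) ?P" using smob_res[OF X P] .
  have oP: "ob ?P" using sP by blast
  \<comment> \<open>The kernel of the second projection; the first projection takes it into
    \<open>N\<close>.\<close>
  define L where "L i = {x \<in> P i. snd x = ze Q i}" for i
  have L: "sub L ?P"
    using sub_kernel[OF oP oQ hom_res[OF hom_snd P]] unfolding L_def[abs_def] by simp
  have quo: "quo ?P L Q (\<lambda>i. snd)"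
    unfolding quo_def
  proof (intro conjI allI ballI)
    show "hom ?P Q (\<lambda>i. snd)" by (rule hom_res[OF hom_snd P])
    fix i
    show "snd ` car ?P i = car Q i"
    proof (intro equalityI subsetI)
      show "x \<in> car Q i" if "x \<in> snd ` car ?P i" for x using that sub_car[OF P] by auto
      fix x assume x: "x \<in> car Q i"
      obtain y where "y \<in> car M i" "p i y = q i x" using quo_lift[OF p hom_car[OF q x]] by blast
      then have "(y, x) \<in> P i" using x by (simp add: Peq)
      then show "x \<in> snd ` car ?P i" by (force simp: image_iff)
    qed
    show "snd x = ze Q i \<longleftrightarrow> x \<in> L i" if "x \<in> car ?P i" for x using that by (simp add: L_def)
  qed
  have LN: "fst x \<in> N i" if "x \<in> L i" for i x
    using that quo_ker[OF p, of "fst x" i] hom_ze[OF oQ oC q] by (auto simp: L_def Peq)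
  have LX: "sub L ?X" using L sub_res[OF P] by blast
  have fL: "hom (res ?P L) V (\<lambda>i x. f i (fst x))"
    using hom_comp[OF hom_res2[OF hom_res[OF hom_fst LX], of N] f] LN by simp
  obtain g where g: "hom ?P V g" "\<And>i x. x \<in> L i \<Longrightarrow> g i x = f i (fst x)"
    using ext0D_any[OF ext sP L quo fL oQ V] by blast
  \<comment> \<open>\<open>q\<close> undoes \<open>s\<close>, so the pair of \<open>x\<close> and
    \<open>s i (p i x)\<close> satisfies the pullback condition.\<close>
  have e: "hom M ?P (\<lambda>i x. (x, s i (p i x)))"
    unfolding hom_def using M hom_car[OF ph] hom_car[OF s]
    by (auto simp: Peq qs hom_ad[OF ph] hom_ad[OF s] hom_sm[OF ph] hom_sm[OF s] hom_df[OF ph] hom_df[OF s])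
  show "\<exists>g. hom M V g \<and> (\<forall>i. \<forall>x\<in>N i. g i x = f i x)"
  proof (intro exI conjI allI ballI)
    show "hom M V (\<lambda>i x. g i (x, s i (p i x)))" by (rule hom_comp[OF e g(1)])
    fix i x assume x: "x \<in> N i"
    then have "p i x = ze C i" using quo_ker[OF p] sub_car[OF N] by blast
    then have sx: "s i (p i x) = ze Q i" using hom_ze[OF oC oQ s] by simp
    have "(x, ze Q i) \<in> L i"
      using hom_car[OF e sub_car[OF N x]] sx by (simp add: L_def)
    then show "g i (x, s i (p i x)) = f i x" using g(2) sx by fastforce
  qed
qed

end

section \<open>Filtrations\<close>

definition wochain :: "'a::order set \<Rightarrow> bool" where
  "wochain F \<longleftrightarrow> (\<forall>G\<subseteq>F. G \<noteq> {} \<longrightarrow> (\<exists>L\<in>G. \<forall>N\<in>G. L \<le> N))"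

lemma wochain_least: "wochain F \<Longrightarrow> G \<subseteq> F \<Longrightarrow> G \<noteq> {} \<Longrightarrow> \<exists>L\<in>G. \<forall>N\<in>G. L \<le> N"
  by (simp add: wochain_def)

lemma wochain_linear: "wochain F \<Longrightarrow> L \<in> F \<Longrightarrow> N \<in> F \<Longrightarrow> L \<le> N \<or> N \<le> L"
  using wochain_least[of F "{L, N}"] by auto

lemma wochain_Well_order:
  assumes "wochain F"
  obtains r where "Well_order r" "Field r = F" "\<And>N. N \<in> F \<Longrightarrow> underS r N = {L \<in> F. L < N}"
proof -
  define r where "r = {(L, N). L \<in> F \<and> N \<in> F \<and> L \<le> N}"
  have F: "Field r = F" by (auto simp: r_def Field_def)
  have "wf (r - Id)"
  proof (rule wfI_min)
    fix x Q assume "(x :: 'a) \<in> Q"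
    show "\<exists>z\<in>Q. \<forall>y. (y, z) \<in> r - Id \<longrightarrow> y \<notin> Q"
    proof (cases "Q \<inter> F = {}")
      case True
      then show ?thesis using \<open>x \<in> Q\<close> by (auto simp: r_def)
    next
      case False
      then obtain L where "L \<in> Q \<inter> F" "\<forall>N\<in>Q \<inter> F. L \<le> N"
        using wochain_least[OF assms, of "Q \<inter> F"] by blast
      then show ?thesis by (intro bexI[of _ L]) (auto simp: r_def intro: antisym)
    qed
  qed
  moreover have "Linear_order r"
    unfolding order_on_defs F using wochain_linear[OF assms]
    by (auto simp: r_def refl_on_def trans_def antisym_def total_on_def)
  ultimately have "Well_order r" by (simp add: well_order_on_def)
  moreover have "underS r N = {L \<in> F. L < N}" if "N \<in> F" for N
    using that by (auto simp: underS_def r_def)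
  ultimately show thesis using F that by blast
qed

lemma underS_Field1: "j \<in> underS r i \<Longrightarrow> j \<in> Field r"
  using Order_Relation.underS_Field by fast

text \<open>In a filtration the limit stages are not listed; they occur only as values of
  \<open>prev\<close>, as unions of the earlier stages.\<close>

definition prev :: "'a::complete_lattice \<Rightarrow> 'a set \<Rightarrow> 'a \<Rightarrow> 'a" where
  "prev X F N = Sup (insert X {L \<in> F. L < N})"

lemma prev_upper1: "X \<le> prev X F N"
  unfolding prev_def by (rule Sup_upper) simp

lemma prev_upper2: "L \<in> F \<Longrightarrow> L < N \<Longrightarrow> L \<le> prev X F N"
  unfolding prev_def by (rule Sup_upper) simp

lemma prev_le: "X \<le> N \<Longrightarrow> prev X F N \<le> N"
  unfolding prev_def by (rule Sup_least) auto

text \<open>The second component is a homomorphism to a fixed object.\<close>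

type_synonym ('i, 'r, 'u) state = "('i, 'r, 'u) gob \<times> ('i \<Rightarrow> 'u \<Rightarrow> 'u)"

definition lubs :: "('i, 'r, 'u) state set \<Rightarrow> ('i, 'r, 'u) state" where
  "lubs \<S> = (lubo (fst ` \<S>), \<lambda>i x. snd (SOME s. s \<in> \<S> \<and> x \<in> car (fst s) i) i x)"

lemma car_lubs: "car (fst (lubs \<S>)) = Sup ((\<lambda>s. car (fst s)) ` \<S>)"
  by (auto simp: lubs_def lubo_def fun_eq_iff Sup_apply)

context gcat begin

definition les :: "('i, 'r, 'u) state \<Rightarrow> ('i, 'r, 'u) state \<Rightarrow> bool" where
  "les s t \<longleftrightarrow> le (fst s) (fst t) \<and> (\<forall>i. \<forall>x\<in>car (fst s) i. snd t i x = snd s i x)"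

definition over :: "'u itself \<Rightarrow> ('i, 'r, 'a) gob \<Rightarrow> (('i, 'r, 'u) gob \<times> ('i \<Rightarrow> 'u \<Rightarrow> 'a)) set" where
  "over u V = {s. ob (fst s) \<and> sml u (fst s) \<and> hom (fst s) V (snd s)}"

lemma les_refl: "ob (fst s) \<Longrightarrow> les s s"
  by (simp add: les_def le_refl)

lemma les_trans: assumes "les s t" "les t v" shows "les s v"
  unfolding les_def
proof (intro conjI allI ballI)
  have l: "le (fst s) (fst t)" "le (fst t) (fst v)" using assms by (auto simp: les_def)
  show "le (fst s) (fst v)" by (rule le_trans[OF l])
  show "snd v i x = snd s i x" if "x \<in> car (fst s) i" for i x
    using assms that le_car[OF l(1) that] by (simp add: les_def)
qed

lemma
  assumes ne: "\<S> \<noteq> {}" and over: "\<S> \<subseteq> over u V"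
    and chain: "\<And>s t. s \<in> \<S> \<Longrightarrow> t \<in> \<S> \<Longrightarrow> les s t \<or> les t s"
  shows lubs_ob: "ob (fst (lubs \<S>))" and lubs_hom: "hom (fst (lubs \<S>)) V (snd (lubs \<S>))"
    and lubs_upper: "s \<in> \<S> \<Longrightarrow> les s (lubs \<S>)"
    and lubs_least: "(\<And>s. s \<in> \<S> \<Longrightarrow> le (fst s) E) \<Longrightarrow> le (fst (lubs \<S>)) E"
proof -
  have fst: "fst (lubs \<S>) = lubo (fst ` \<S>)" by (simp add: lubs_def)
  have ob: "ob C" if "C \<in> fst ` \<S>" for C using that over by (auto simp: over_def)
  have ch: "le C D \<or> le D C" if "C \<in> fst ` \<S>" "D \<in> fst ` \<S>" for C D
    using that chain unfolding les_def by blast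
  note lub = ob_lubo[OF _ ob ch] lubo_upper[OF _ ob ch] lubo_least[OF _ ob ch]
  have ne': "fst ` \<S> \<noteq> {}" using ne by simp
  show obL: "ob (fst (lubs \<S>))" unfolding fst by (rule lub(1)[OF ne'])
  have leL: "le (fst s) (fst (lubs \<S>))" if "s \<in> \<S>" for s
    unfolding fst by (rule lub(2)[OF ne']) (use that in auto)
  show "le (fst (lubs \<S>)) E" if "\<And>s. s \<in> \<S> \<Longrightarrow> le (fst s) E"
    unfolding fst by (rule lub(3)[OF ne']) (use that in auto)
  have snd: "snd (lubs \<S>) i x = snd s i x" if s: "s \<in> \<S>" "x \<in> car (fst s) i" for s i x
  proof -
    define t where "t = (SOME s. s \<in> \<S> \<and> x \<in> car (fst s) i)"
    have t: "t \<in> \<S> \<and> x \<in> car (fst t) i" unfolding t_def by (rule someI[of _ s]) (use s in simp)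
    have "snd t i x = snd s i x" using chain[OF s(1), of t] t s unfolding les_def by auto
    then show ?thesis by (simp add: lubs_def t_def)
  qed
  show up: "les s (lubs \<S>)" if "s \<in> \<S>" for s
    unfolding les_def using leL[OF that] snd[OF that] by blast
  have car: "x \<in> car (fst (lubs \<S>)) i \<longleftrightarrow> (\<exists>s\<in>\<S>. x \<in> car (fst s) i)" for x i
    by (simp add: car_lubs Sup_apply)
  show "hom (fst (lubs \<S>)) V (snd (lubs \<S>))"
    unfolding hom_def
  proof (intro allI ballI conjI impI)
    fix i x assume "x \<in> car (fst (lubs \<S>)) i"
    then obtain s where s: "s \<in> \<S>" "x \<in> car (fst s) i" using car by blast
    have h: "hom (fst s) V (snd s)" and o: "ob (fst s)" using s over by (auto simp: over_def)
    note l = leL[OF s(1)]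
    show "snd (lubs \<S>) i x \<in> car V i" using snd[OF s] hom_car[OF h s(2)] by simp
    show "snd (lubs \<S>) i (sm (fst (lubs \<S>)) i a x) = sm V i a (snd (lubs \<S>) i x)" if "a \<in> carrier R" for a
      using snd[OF s] snd[OF s(1) sm_car[OF o that s(2)]] hom_sm[OF h s(2) that] le_sm[OF l s(2) that] by simp
    show "snd (lubs \<S>) (sh i) (df (fst (lubs \<S>)) i x) = df V i (snd (lubs \<S>) i x)" if "i \<in> W"
      using snd[OF s] snd[OF s(1) df_car[OF o that s(2)]] hom_df[OF h s(2) that] le_df[OF l s(2) that] by simp
    fix y assume "y \<in> car (fst (lubs \<S>)) i"
    then obtain s' where s': "s' \<in> \<S>" "y \<in> car (fst s') i" using car by blast
    have "\<exists>t\<in>\<S>. x \<in> car (fst t) i \<and> y \<in> car (fst t) i"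
      using chain[OF s(1) s'(1)]
    proof
      assume "les s s'"
      then have "le (fst s) (fst s')" by (simp add: les_def)
      then show ?thesis using le_car[of "fst s" "fst s'" x i] s s' by blast
    next
      assume "les s' s"
      then have "le (fst s') (fst s)" by (simp add: les_def)
      then show ?thesis using le_car[of "fst s'" "fst s" y i] s s' by blast
    qed
    then obtain t where t: "t \<in> \<S>" "x \<in> car (fst t) i" "y \<in> car (fst t) i" by blast
    have h: "hom (fst t) V (snd t)" and o: "ob (fst t)" using t over by (auto simp: over_def)
    show "snd (lubs \<S>) i (ad (fst (lubs \<S>)) i x y) = ad V i (snd (lubs \<S>) i x) (snd (lubs \<S>) i y)"
      using snd[OF t(1,2)] snd[OF t(1,3)] snd[OF t(1) ad_car[OF o t(2,3)]] hom_ad[OF h t(2,3)]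
        le_ad[OF leL[OF t(1)] t(2,3)] by simp
  qed
qed

text \<open>
  A filtration of \<open>M\<close> starting at \<open>X\<close> with quotients in \<open>\<S>\<close>, given by its set of
  successor stages: for \<open>N \<in> F\<close>, \<open>prev X F N\<close> is the stage preceding \<open>N\<close>.
\<close>

definition filtr :: "('i, 'r, 'b) gob set \<Rightarrow> ('i \<Rightarrow> 'a set) \<Rightarrow> ('i, 'r, 'a) gob \<Rightarrow> ('i \<Rightarrow> 'a set) set \<Rightarrow> bool" where
  "filtr \<S> X M F \<longleftrightarrow>
     (\<forall>N\<in>F. sub N M \<and> X \<le> N \<and> prev X F N \<noteq> N \<and> (\<exists>S\<in>\<S>. \<exists>p. quo (res M N) (prev X F N) S p)) \<and>
     wochain F \<and> Sup (insert X F) = car M"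

lemma
  assumes "filtr \<S> X M F"
  shows filtr_sub: "N \<in> F \<Longrightarrow> sub N M" and filtr_ge: "N \<in> F \<Longrightarrow> X \<le> N"
    and filtr_neq: "N \<in> F \<Longrightarrow> prev X F N \<noteq> N"
    and filtr_quo: "N \<in> F \<Longrightarrow> \<exists>S\<in>\<S>. \<exists>p. quo (res M N) (prev X F N) S p"
    and filtr_wo: "wochain F" and filtr_Sup: "Sup (insert X F) = car M"
  using assms unfolding filtr_def by blast+

lemma filtr_mono: "filtr \<S> X M F \<Longrightarrow> \<S> \<subseteq> \<S>' \<Longrightarrow> filtr \<S>' X M F"
  unfolding filtr_def by blast

lemma filtr_prev_sub:
  assumes f: "filtr \<S> X M F" and X: "sub X M" and N: "N \<in> F"
  shows "sub (prev X F N) M"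
  unfolding prev_def
proof (rule sub_Sup_chain)
  show "sub L M" if "L \<in> insert X {L \<in> F. L < N}" for L using that X filtr_sub[OF f] by auto
  show "L \<le> L' \<or> L' \<le> L" if "L \<in> insert X {L \<in> F. L < N}" "L' \<in> insert X {L \<in> F. L < N}" for L L'
    using that filtr_ge[OF f] wochain_linear[OF filtr_wo[OF f], of L L'] by auto
qed simp

lemma filtr_trivial: "sub X M \<Longrightarrow> car M = X \<Longrightarrow> filtr \<S> X M {}"
  by (simp add: filtr_def wochain_def)

text \<open>A listed stage must differ from its predecessor, so a zero quotient has to be
  represented by the empty filtration.\<close>

lemma filtr_single:
  assumes "ob M" "sub X M" "S \<in> \<S>" "quo M X S p"
  shows "\<exists>F. filtr \<S> X M F"
proof (cases "X = car M")
  case True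
  then show ?thesis using filtr_trivial assms(2) by blast
next
  case False
  have "X \<le> car M" using sub_subset[OF assms(2)] by (simp add: le_fun_def)
  moreover have "{L \<in> {car M}. L < car M} = {}" by auto
  then have "prev X {car M} (car M) = X" unfolding prev_def by (simp only: Sup_insert Sup_empty sup_bot_right)
  ultimately have "filtr \<S> X M {car M}"
    unfolding filtr_def using False assms sub_top[OF assms(1)]
    by (auto simp: wochain_def sup_absorb2)
  then show ?thesis by blast
qed

text \<open>Concatenation of filtrations. The stages of block \<open>i\<close> lie strictly above
  \<open>L i\<close> and at most at \<open>T i\<close>, so the blocks follow each other as in
  \<open>r\<close>, and the predecessor of a stage is already determined inside its block.\<close>

lemma filtr_merge:
  assumes r: "Well_order r" and T: "\<And>i. i \<in> Field r \<Longrightarrow> sub (T i) M"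
    and L: "\<And>i. i \<in> Field r \<Longrightarrow> L i = Sup (insert X (T ` underS r i))"
    and F: "\<And>i. i \<in> Field r \<Longrightarrow> filtr \<S> (L i) (res M (T i)) (F i)"
    and M: "Sup (insert X (T ` Field r)) = car M"
  shows "filtr \<S> X M (\<Union>i\<in>Field r. F i)"
proof -
  let ?F = "\<Union>i\<in>Field r. F i"
  have T_eq: "T i = Sup (insert (L i) (F i))" if "i \<in> Field r" for i
    using filtr_Sup[OF F[OF that]] by simp
  have LT: "L i \<le> T i" if "i \<in> Field r" for i
    unfolding T_eq[OF that] by (rule Sup_upper) simp
  have TL: "T j \<le> L i" if "i \<in> Field r" "j \<in> underS r i" for i j
    unfolding L[OF that(1)] using that by (intro Sup_upper) simp
  have XL: "X \<le> L i" if "i \<in> Field r" for i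
    unfolding L[OF that(1)] by (intro Sup_upper) simp
  have FL: "L i < N" "N \<le> T i" if "i \<in> Field r" "N \<in> F i" for i N
  proof -
    show "N \<le> T i" unfolding T_eq[OF that(1)] using that(2) by (intro Sup_upper) simp
    have ge: "L i \<le> N" using filtr_ge[OF F[OF that(1)] that(2)] .
    have "L i \<noteq> N"
    proof
      assume "L i = N"
      then have "prev (L i) (F i) N = N"
        using prev_le[of "L i" N "F i"] prev_upper1[of "L i" "F i" N] by simp
      then show False using filtr_neq[OF F[OF that(1)] that(2)] by simp
    qed
    with ge show "L i < N" by simp
  qed
  \<comment> \<open>\<open>T i\<close> is exhausted by the blocks up to \<open>i\<close>: its own
    block starts at \<open>L i\<close>, which is the union of earlier \<open>T j\<close>, and these
    are exhausted by induction.\<close>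
  have Tgen: "i \<in> Field r \<longrightarrow> T i \<le> Sup (insert X (\<Union>j\<in>insert i (underS r i). F j))" for i
    using wf_Well_order[OF r]
  proof (induction i rule: wf_induct_rule)
    case (less i)
    let ?S = "Sup (insert X (\<Union>j\<in>insert i (underS r i). F j))"
    show ?case
    proof
      assume i: "i \<in> Field r"
      have "T j \<le> ?S" if "j \<in> underS r i" for j
      proof -
        have "j \<in> Field r" "(j, i) \<in> r - Id"
          using that underS_Field1[OF that] by (auto simp: underS_def)
        then have "T j \<le> Sup (insert X (\<Union>k\<in>insert j (underS r j). F k))" using less by blast
        also have "\<dots> \<le> ?S"
        proof (rule Sup_subset_mono)
          have "insert j (underS r j) \<subseteq> insert i (underS r i)"
            using that underS_trans[OF r] by blast
          then show "insert X (\<Union>k\<in>insert j (underS r j). F k) \<subseteq> insert X (\<Union>j\<in>insert i (underS r i). F j)"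
            by blast
        qed
        finally show ?thesis .
      qed
      moreover have "X \<le> ?S" by (rule Sup_upper) simp
      ultimately have "L i \<le> ?S" unfolding L[OF i] by (intro Sup_least) auto
      moreover have "K \<le> ?S" if "K \<in> F i" for K using that by (intro Sup_upper) simp
      ultimately show "T i \<le> ?S" unfolding T_eq[OF i] by (intro Sup_least) auto
    qed
  qed
  \<comment> \<open>Earlier blocks contribute nothing beyond \<open>L i\<close>, and by
    \<open>Tgen\<close> they do reach \<open>L i\<close>.\<close>
  have prev_eq: "prev X ?F N = prev (L i) (F i) N" if i: "i \<in> Field r" "N \<in> F i" for i N
  proof (rule antisym)
    show "prev X ?F N \<le> prev (L i) (F i) N"
      unfolding prev_def[of X]
    proof (rule Sup_least, elim insertE)
      fix K assume "K = X"
      then show "K \<le> prev (L i) (F i) N" using XL[OF i(1)] prev_upper1 order_trans by blast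
    next
      fix K assume "K \<in> {L \<in> ?F. L < N}"
      then obtain j where j: "j \<in> Field r" "K \<in> F j" "K < N" by blast
      consider "j = i" | "j \<in> underS r i" | "i \<in> underS r j" using underS_cases[OF r j(1) i(1)] by blast
      then show "K \<le> prev (L i) (F i) N"
      proof cases
        case 1 then show ?thesis using j prev_upper2 by blast
      next
        case 2 then show ?thesis
          using FL(2)[OF j(1,2)] TL[OF i(1), of j] prev_upper1[of "L i" "F i" N] order_trans by metis
      next
        \<comment> \<open>\<open>N \<le> T i \<le> L j < K\<close> contradicts
          \<open>K < N\<close>.\<close>
        case 3 then show ?thesis
          using FL(2)[OF i] TL[OF j(1) 3] FL(1)[OF j(1,2)] j(3) by (meson leD order_trans order_less_imp_le)
      qed
    qed
    have "L i \<le> prev X ?F N"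
      unfolding L[OF i(1)]
    proof (rule Sup_least, elim insertE imageE)
      show "K \<le> prev X ?F N" if "K = X" for K using that prev_upper1 by metis
      fix K j assume j: "K = T j" "j \<in> underS r i"
      have "T j \<le> Sup (insert X (\<Union>k\<in>insert j (underS r j). F k))" using Tgen underS_Field1[OF j(2)] by blast
      also have "\<dots> \<le> prev X ?F N"
      proof (rule Sup_least)
        fix K assume "K \<in> insert X (\<Union>k\<in>insert j (underS r j). F k)"
        then consider "K = X" | k where "k \<in> insert j (underS r j)" "K \<in> F k" by blast
        then show "K \<le> prev X ?F N"
        proof cases
          case 1 then show ?thesis using prev_upper1 by metis
        next
        case k: (2 k)
        then have k': "k \<in> underS r i" using j underS_trans[OF r] by blast
        then have "k \<in> Field r" using underS_Field1[OF k'] by simp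
        then have "K \<le> T k" "T k \<le> L i" "L i < N" using FL k TL[OF i(1) k'] i by auto
        then have "K < N" by (meson order.strict_trans1)
        then show ?thesis using \<open>k \<in> Field r\<close> k by (intro prev_upper2) auto
        qed
      qed
      finally show "K \<le> prev X ?F N" using j by simp
    qed
    moreover have "K \<le> prev X ?F N" if "K \<in> {L \<in> F i. L < N}" for K
      using that i by (intro prev_upper2) auto
    ultimately show "prev (L i) (F i) N \<le> prev X ?F N"
      unfolding prev_def[of "L i"] by (intro Sup_least) auto
  qed
  show ?thesis
    unfolding filtr_def
  proof (intro conjI ballI)
    fix N assume "N \<in> ?F"
    then obtain i where i: "i \<in> Field r" "N \<in> F i" by blast
    have "sub N (res M (T i))" using filtr_sub[OF F[OF i(1)] i(2)] .
    then show "sub N M" using sub_res[OF T[OF i(1)]] by blast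
    show "X \<le> N" using XL[OF i(1)] FL(1)[OF i] by (meson order.strict_implies_order order_trans)
    show "prev X ?F N \<noteq> N" unfolding prev_eq[OF i] using filtr_neq[OF F[OF i(1)] i(2)] .
    show "\<exists>S\<in>\<S>. \<exists>p. quo (res M N) (prev X ?F N) S p"
      unfolding prev_eq[OF i] using filtr_quo[OF F[OF i(1)] i(2)] by simp
  next
    \<comment> \<open>The least element of a subset lies in the first block that meets it.\<close>
    show "wochain ?F"
      unfolding wochain_def
    proof (intro allI impI)
      fix G assume G: "G \<subseteq> ?F" "G \<noteq> {}"
      let ?I = "{i \<in> Field r. F i \<inter> G \<noteq> {}}"
      have "?I \<noteq> {}" using G by blast
      then obtain k where "k \<in> ?I" by blast
      then obtain i where i: "i \<in> ?I" "\<And>j. (j, i) \<in> r - Id \<Longrightarrow> j \<notin> ?I"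
        by (rule wfE_min[OF wf_Well_order[OF r]]) blast
      have "wochain (F i)" by (rule filtr_wo[OF F]) (use i(1) in simp)
      then obtain K where K: "K \<in> F i \<inter> G" "\<forall>N\<in>F i \<inter> G. K \<le> N"
        using wochain_least[of "F i" "F i \<inter> G"] i(1) by auto
      have "K \<le> N" if N: "N \<in> G" for N
      proof -
        obtain j where j: "j \<in> Field r" "N \<in> F j" using G N by blast
        consider "j = i" | "j \<in> underS r i" | "i \<in> underS r j" using underS_cases[OF r j(1)] i by blast
        then show ?thesis
        proof cases
          case 1 then show ?thesis using K j N by blast
        next
          case 2
          then have "j \<notin> ?I" using i(2) by (simp add: underS_def)
          then show ?thesis using j N by blast
        next
          case 3
          have "K \<le> T i" "T i \<le> L j" "L j < N" using FL i K j TL[OF j(1) 3] by auto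
          then show ?thesis by (meson order.strict_implies_order order_trans)
        qed
      qed
      then show "\<exists>L\<in>G. \<forall>N\<in>G. L \<le> N" using K by blast
    qed
    show "Sup (insert X ?F) = car M"
    proof (rule antisym)
      show "Sup (insert X ?F) \<le> car M"
        unfolding M[symmetric]
      proof (rule Sup_least, elim insertE UN_E)
        show "K \<le> Sup (insert X (T ` Field r))" if "K = X" for K using that by (auto intro: Sup_upper)
        show "K \<le> Sup (insert X (T ` Field r))" if "i \<in> Field r" "K \<in> F i" for K i
          using FL(2)[OF that] Sup_upper[of "T i" "insert X (T ` Field r)"] that(1) by (meson image_eqI insertCI order_trans)
      qed
      show "car M \<le> Sup (insert X ?F)"
        unfolding M[symmetric]
      proof (rule Sup_least, elim insertE imageE)
        show "K \<le> Sup (insert X ?F)" if "K = X" for K using that by (auto intro: Sup_upper)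
        fix K i assume i: "K = T i" "i \<in> Field r"
        have "T i \<le> Sup (insert X (\<Union>j\<in>insert i (underS r i). F j))" using Tgen i by blast
        also have "\<dots> \<le> Sup (insert X ?F)"
          using i(2) underS_Field1 by (intro Sup_subset_mono) fastforce
        finally show "K \<le> Sup (insert X ?F)" using i by simp
      qed
    qed
  qed
qed

text \<open>The form in which towers are turned into filtrations: consecutive stages may coincide,
  and such repetitions contribute an empty block to \<open>filtr_merge\<close>.\<close>

lemma filtr_tower:
  assumes M: "ob M" and r: "Well_order r" and T: "\<And>i. i \<in> Field r \<Longrightarrow> sub (T i) M"
    and L: "\<And>i. i \<in> Field r \<Longrightarrow> L i = Sup (insert X (T ` underS r i))"
    and Lsub: "\<And>i. i \<in> Field r \<Longrightarrow> sub (L i) M"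
    and jump: "\<And>i. i \<in> Field r \<Longrightarrow> L i = T i \<or> (L i \<le> T i \<and> (\<exists>S\<in>\<S>. \<exists>p. quo (res M (T i)) (L i) S p))"
    and top: "Sup (insert X (T ` Field r)) = car M"
  shows "\<exists>F. filtr \<S> X M F"
proof -
  have "\<exists>F. filtr \<S> (L i) (res M (T i)) F" if i: "i \<in> Field r" for i
  proof (cases "L i = T i")
    case True
    then have "filtr \<S> (L i) (res M (T i)) {}"
      using sub_top[OF ob_res[OF M T[OF i]]] by (intro filtr_trivial) simp_all
    then show ?thesis by blast
  next
    case False
    then have le: "L i \<le> T i" and ex: "\<exists>S\<in>\<S>. \<exists>p. quo (res M (T i)) (L i) S p" using jump[OF i] by auto
    then obtain S p where "S \<in> \<S>" "quo (res M (T i)) (L i) S p" by blast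
    moreover have "sub (L i) (res M (T i))" using le sub_res[OF T[OF i]] Lsub[OF i] by blast
    ultimately show ?thesis using filtr_single[OF ob_res[OF M T[OF i]]] by blast
  qed
  then obtain F where "\<And>i. i \<in> Field r \<Longrightarrow> filtr \<S> (L i) (res M (T i)) (F i)" by metis
  from filtr_merge[OF r T L this top] show ?thesis by blast
qed

end

text \<open>Bundles the conclusions of \<open>tower\<close>, so that one fact is carried through
  long proofs and its parts are retrieved by name.\<close>

definition is_tower :: "'j rel \<Rightarrow> 's set \<Rightarrow> ('s \<Rightarrow> 's \<Rightarrow> bool) \<Rightarrow> 's \<Rightarrow> ('j \<Rightarrow> 's \<Rightarrow> 's) \<Rightarrow> ('s set \<Rightarrow> 's) \<Rightarrow> ('j \<Rightarrow> 's) \<Rightarrow> bool"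
  where "is_tower r P lq s0 st lub T \<longleftrightarrow>
    (\<forall>i\<in>Field r. T i = st i (lub (insert s0 (T ` underS r i))) \<and>
      lub (insert s0 (T ` underS r i)) \<in> P \<and>
      (\<forall>a\<in>insert s0 (T ` underS r i). lq a (lub (insert s0 (T ` underS r i)))) \<and>
      T i \<in> P \<and> lq s0 (T i) \<and> (\<forall>j\<in>underS r i. lq (T j) (T i))) \<and>
    (\<forall>a\<in>insert s0 (T ` Field r). \<forall>b\<in>insert s0 (T ` Field r). lq a b \<or> lq b a) \<and>
    lub (insert s0 (T ` Field r)) \<in> P \<and>
    (\<forall>a\<in>insert s0 (T ` Field r). lq a (lub (insert s0 (T ` Field r))))"

lemma
  assumes "is_tower r P lq s0 st lub T"
  shows is_tower_eq: "i \<in> Field r \<Longrightarrow> T i = st i (lub (insert s0 (T ` underS r i)))"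
    and is_tower_lub: "i \<in> Field r \<Longrightarrow> lub (insert s0 (T ` underS r i)) \<in> P"
    and is_tower_le_lub: "i \<in> Field r \<Longrightarrow> a \<in> insert s0 (T ` underS r i) \<Longrightarrow> lq a (lub (insert s0 (T ` underS r i)))"
    and is_tower_in: "i \<in> Field r \<Longrightarrow> T i \<in> P"
    and is_tower_le: "i \<in> Field r \<Longrightarrow> j \<in> underS r i \<Longrightarrow> lq (T j) (T i)"
    and is_tower_chain: "a \<in> insert s0 (T ` Field r) \<Longrightarrow> b \<in> insert s0 (T ` Field r) \<Longrightarrow> lq a b \<or> lq b a"
    and is_tower_top: "lub (insert s0 (T ` Field r)) \<in> P"
    and is_tower_le_top: "a \<in> insert s0 (T ` Field r) \<Longrightarrow> lq a (lub (insert s0 (T ` Field r)))"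
  using assms unfolding is_tower_def by blast+

lemma tower_exists:
  fixes r :: "'j rel" and lq :: "'s \<Rightarrow> 's \<Rightarrow> bool"
  assumes "Well_order r"
    and "\<And>a. a \<in> P \<Longrightarrow> lq a a"
    and "\<And>a b c. lq a b \<Longrightarrow> lq b c \<Longrightarrow> lq a c"
    and "s0 \<in> P"
    and "\<And>i s. i \<in> Field r \<Longrightarrow> s \<in> P \<Longrightarrow> st i s \<in> P \<and> lq s (st i s)"
    and "\<And>J T. J \<subseteq> Field r \<Longrightarrow> insert s0 (T ` J) \<subseteq> P \<Longrightarrow>
        (\<And>a b. a \<in> insert s0 (T ` J) \<Longrightarrow> b \<in> insert s0 (T ` J) \<Longrightarrow> lq a b \<or> lq b a) \<Longrightarrow>
        lub (insert s0 (T ` J)) \<in> P \<and> (\<forall>a\<in>insert s0 (T ` J). lq a (lub (insert s0 (T ` J))))"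
  obtains T where "is_tower r P lq s0 st lub T"
proof (rule tower[OF assms])
  fix T
  assume *: "\<And>i. i \<in> Field r \<Longrightarrow> T i = st i (lub (insert s0 (T ` underS r i)))"
    "\<And>i. i \<in> Field r \<Longrightarrow> lub (insert s0 (T ` underS r i)) \<in> P"
    "\<And>i a. i \<in> Field r \<Longrightarrow> a \<in> insert s0 (T ` underS r i) \<Longrightarrow> lq a (lub (insert s0 (T ` underS r i)))"
    "\<And>i. i \<in> Field r \<Longrightarrow> T i \<in> P"
    "\<And>i. i \<in> Field r \<Longrightarrow> lq s0 (T i)"
    "\<And>i j. i \<in> Field r \<Longrightarrow> j \<in> underS r i \<Longrightarrow> lq (T j) (T i)"
    "\<And>a b. a \<in> insert s0 (T ` Field r) \<Longrightarrow> b \<in> insert s0 (T ` Field r) \<Longrightarrow> lq a b \<or> lq b a"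
    "lub (insert s0 (T ` Field r)) \<in> P"
    "\<And>a. a \<in> insert s0 (T ` Field r) \<Longrightarrow> lq a (lub (insert s0 (T ` Field r)))"
  have "is_tower r P lq s0 st lub T"
    unfolding is_tower_def by (intro conjI ballI) (fact *)+
  then show thesis by (rule that)
qed

context gcat begin

lemma sub_le_car: "sub N C \<Longrightarrow> N \<le> car C"
  by (intro le_funI) (rule sub_subset)

lemma sub_fiber:
  assumes obs: "ob M" "ob E" "ob C" and p: "hom M C p" and p': "hom E C p'" and N: "sub N M"
  shows "sub (\<lambda>i. {z \<in> car (prd M E) i. fst z \<in> N i \<and> p i (fst z) = p' i (snd z)}) (prd M E)"
proof -
  note o = ob_prd[OF obs(1,2)]
  have "hom (prd M E) C (\<lambda>i z. ad C i (p i (fst z)) (ng C i (p' i (snd z))))"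
    by (rule hom_ad2[OF obs(3) p hom_neg[OF obs(2,3) p']])
  then have "sub (\<lambda>i. {z \<in> car (prd M E) i. mi C i (p i (fst z)) (p' i (snd z)) = ze C i}) (prd M E)"
    unfolding mi_def by (rule sub_kernel[OF o obs(3)])
  moreover have "sub (\<lambda>i. {z \<in> car (prd M E) i. fst z \<in> N i}) (prd M E)"
    by (rule sub_preimage[OF o obs(1) hom_fst N])
  ultimately have "sub (\<lambda>i. {z \<in> car (prd M E) i. mi C i (p i (fst z)) (p' i (snd z)) = ze C i} \<inter>
      {z \<in> car (prd M E) i. fst z \<in> N i}) (prd M E)" by (rule sub_Int)
  moreover have "{z \<in> car (prd M E) i. mi C i (p i (fst z)) (p' i (snd z)) = ze C i} \<inter>
      {z \<in> car (prd M E) i. fst z \<in> N i} =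
      {z \<in> car (prd M E) i. fst z \<in> N i \<and> p i (fst z) = p' i (snd z)}" for i
    using mi_eq_ze[OF obs(3)] hom_car[OF p] hom_car[OF p'] by auto
  ultimately show ?thesis by simp
qed

text \<open>Having a filtration above \<open>X\<close> depends only on the quotient: through
  \<open>C\<close>, the subobjects of \<open>M\<close> above \<open>X\<close> correspond to those of
  \<open>E\<close> above \<open>L\<close>, with the same successive quotients.\<close>

lemma filtr_transfer:
  fixes M :: "('i, 'r, 'a) gob" and E :: "('i, 'r, 'b) gob"
  assumes obs: "ob M" "ob E" "ob C" and obS: "\<And>S. S \<in> \<S> \<Longrightarrow> ob S"
    and f: "filtr \<S> X M F" and X: "sub X M" and p: "quo M X C p" and p': "quo E L C p'" and L: "sub L E"
  shows "\<exists>F'. filtr \<S> L E F'"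
proof -
  note ph = quo_hom[OF p] and ph' = quo_hom[OF p']
  \<comment> \<open>The preimage in \<open>E\<close> of the image of \<open>N\<close> in
    \<open>C\<close>.\<close>
  define up where "up N = (\<lambda>i. {y \<in> car E i. p' i y \<in> p i ` N i})" for N :: "'i \<Rightarrow> 'a set"
  have up_sub: "sub (up N) E" if "sub N M" for N
    unfolding up_def by (rule sub_preimage[OF obs(2,3) ph' sub_image[OF obs(1,3) ph that]])
  have up_mono: "up N \<le> up N'" if "N \<le> N'" for N N'
    using that unfolding up_def le_fun_def by blast
  have ex: "\<exists>y\<in>car E i. p' i y = p i x" if "x \<in> car M i" for i x
    using quo_lift[OF p' hom_car[OF ph that]] .
  \<comment> \<open>A subobject that contains the kernel \<open>X\<close> is recovered from its
    image in \<open>C\<close>.\<close>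
  have mem: "x \<in> N i" if "sub N M" "X \<le> N" "x \<in> car M i" "p i x \<in> p i ` N i" for N i x
  proof -
    obtain n where n: "n \<in> N i" "p i x = p i n" using \<open>p i x \<in> p i ` N i\<close> by blast
    note nc = sub_car[OF \<open>sub N M\<close> n(1)]
    have "mi M i x n \<in> X i" using quo_eq[OF obs(1,3) p that(3) nc] n by simp
    then have "mi M i x n \<in> N i" using \<open>X \<le> N\<close> by (auto simp: le_fun_def)
    then have "ad M i (mi M i x n) n \<in> N i" using sub_ad[OF \<open>sub N M\<close> _ n(1)] by blast
    then show ?thesis using obs(1) that(3) nc by simp
  qed
  have up_le: "N \<le> N'" if "up N \<le> up N'" "sub N M" "sub N' M" "X \<le> N'" for N N'
  proof (intro le_funI subsetI)
    fix i x assume x: "x \<in> N i"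
    then have xc: "x \<in> car M i" using sub_car[OF that(2)] by blast
    obtain y where y: "y \<in> car E i" "p' i y = p i x" using ex[OF xc] by blast
    then have "y \<in> up N i" using x by (auto simp: up_def)
    then have "y \<in> up N' i" using that(1) by (auto simp: le_fun_def)
    then show "x \<in> N' i" using mem[OF that(3,4) xc] y by (simp add: up_def)
  qed
  have upX: "up X = L"
  proof (intro ext equalityI subsetI)
    fix i y
    show "y \<in> L i" if "y \<in> up X i"
    proof -
      from that obtain x where x: "y \<in> car E i" "x \<in> X i" "p' i y = p i x" by (auto simp: up_def)
      then show ?thesis using quo_ker[OF p sub_car[OF X x(2)]] quo_ker[OF p' x(1)] by simp
    qed
    show "y \<in> up X i" if y: "y \<in> L i"
    proof -
      have "p' i y = p i (ze M i)"
        using quo_ker[OF p' sub_car[OF L y]] y hom_ze[OF obs(1,3) ph] by simp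
      then show ?thesis using sub_car[OF L y] sub_ze[OF X] by (auto simp: up_def)
    qed
  qed
  have upSup: "up (Sup \<G>) = Sup (up ` \<G>)" for \<G>
    unfolding up_def by (auto simp: fun_eq_iff Sup_apply)
  have upM: "up (car M) = car E"
    using quo_surj[OF p] hom_car[OF ph'] by (auto simp: up_def fun_eq_iff)
  have less: "up K < up N \<longleftrightarrow> K < N" if "K \<in> F" "N \<in> F" for K N
    using up_le[of K N] up_le[of N K] up_mono[of K N] up_mono[of N K] filtr_sub[OF f] filtr_ge[OF f] that
    by (auto simp: less_le_not_le)
  have prev: "prev L (up ` F) (up N) = up (prev X F N)" if "N \<in> F" for N
  proof -
    have "{K \<in> up ` F. K < up N} = up ` {K \<in> F. K < N}" using less[OF _ that] by auto
    moreover have "up (prev X F N) = Sup (insert L (up ` {K \<in> F. K < N}))"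
      unfolding prev_def upSup image_insert upX ..
    ultimately show ?thesis by (simp add: prev_def)
  qed
  have jump: "\<exists>\<pi>'. quo (res E (up N)) (up P) S \<pi>'"
    if N: "sub N M" and P: "sub P M" and "X \<le> P" "P \<le> N" and q: "quo (res M N) P S \<pi>" and S: "ob S" for N P S \<pi>
  proof -
    \<comment> \<open>The projection \<open>\<pi>\<close> is moved from \<open>N\<close> to
      \<open>up N\<close> along this fibre product: \<open>y\<close> receives the value of any
      \<open>x\<close> with the same image in \<open>C\<close>, and two such \<open>x\<close> differ
      by an element of \<open>X\<close>, hence of \<open>P\<close>.\<close>
    define Y where "Y i = {z \<in> car (prd M E) i. fst z \<in> N i \<and> p i (fst z) = p' i (snd z)}" for i
    have Y: "sub Y (prd M E)" unfolding Y_def[abs_def] by (rule sub_fiber[OF obs ph ph' N])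
    note qh = quo_hom[OF q]
    have h1: "hom (res (prd M E) Y) (res E (up N)) (\<lambda>i. snd)"
      by (rule hom_res2[OF hom_res[OF hom_snd Y]]) (auto simp: Y_def up_def intro: image_eqI[OF sym])
    have s1: "snd ` car (res (prd M E) Y) i = car (res E (up N)) i" for i
    proof (intro equalityI subsetI)
      fix y
      show "y \<in> car (res E (up N)) i" if "y \<in> snd ` car (res (prd M E) Y) i"
        using that hom_car[OF h1] by auto
      show "y \<in> snd ` car (res (prd M E) Y) i" if y: "y \<in> car (res E (up N)) i"
      proof -
        obtain x where "x \<in> N i" "p' i y = p i x" "y \<in> car E i" using y by (auto simp: up_def)
        then have "(x, y) \<in> Y i" using sub_car[OF N] by (simp add: Y_def)
        then show ?thesis by (force simp: image_iff)
      qed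
    qed
    have h2: "hom (res (prd M E) Y) S (\<lambda>i z. \<pi> i (fst z))"
      by (rule hom_comp[OF hom_res2[OF hom_res[OF hom_fst Y]] qh]) (auto simp: Y_def)
    obtain \<pi>' where \<pi>': "hom (res E (up N)) S \<pi>'"
      "\<And>i z. z \<in> car (res (prd M E) Y) i \<Longrightarrow> \<pi>' i (snd z) = \<pi> i (fst z)"
    proof (rule factor[OF ob_res[OF ob_prd[OF obs(1,2)] Y] ob_res[OF obs(2) up_sub[OF N]] S h1 s1 h2])
      fix i z assume z: "z \<in> car (res (prd M E) Y) i" "snd z = ze (res E (up N)) i"
      then have "p i (fst z) = ze C i" "fst z \<in> N i" "fst z \<in> car M i"
        using hom_ze[OF obs(2,3) ph'] by (auto simp: Y_def)
      then have "fst z \<in> P i" using quo_ker[OF p] \<open>X \<le> P\<close> by (auto simp: le_fun_def)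
      then show "\<pi> i (fst z) = ze S i" using quo_ker[OF q, of "fst z" i] \<open>fst z \<in> N i\<close> by simp
    qed blast
    have "quo (res E (up N)) (up P) S \<pi>'"
      unfolding quo_def
    proof (intro conjI \<pi>' allI ballI)
      fix i
      have \<pi>'': "\<exists>x\<in>N i. p' i y = p i x \<and> \<pi>' i y = \<pi> i x" if yN: "y \<in> up N i" for y
      proof -
        obtain x where x: "x \<in> N i" "p' i y = p i x" "y \<in> car E i" using yN by (auto simp: up_def)
        then have "(x, y) \<in> Y i" using sub_car[OF N] by (simp add: Y_def)
        then have "\<pi>' i y = \<pi> i x" using \<pi>'(2)[of "(x, y)" i] by simp
        with x show ?thesis by blast
      qed
      show "\<pi>' i ` car (res E (up N)) i = car S i"
      proof (intro equalityI subsetI)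
        show "s \<in> car S i" if "s \<in> \<pi>' i ` car (res E (up N)) i" for s using that hom_car[OF \<pi>'(1)] by blast
        fix s assume "s \<in> car S i"
        then obtain x where x: "x \<in> N i" "\<pi> i x = s" using quo_lift[OF q] by auto
        obtain y where y: "y \<in> car E i" "p' i y = p i x" using ex[OF sub_car[OF N x(1)]] by blast
        then have "(x, y) \<in> Y i" "y \<in> up N i" using x sub_car[OF N] by (auto simp: Y_def up_def)
        then show "s \<in> \<pi>' i ` car (res E (up N)) i" using \<pi>'(2)[of "(x, y)" i] x by force
      qed
      fix y assume y: "y \<in> car (res E (up N)) i"
      then obtain x where x: "x \<in> N i" "p' i y = p i x" "\<pi>' i y = \<pi> i x" using \<pi>'' by auto
      have "\<pi>' i y = ze S i \<longleftrightarrow> x \<in> P i" using x quo_ker[OF q, of x i] by simp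
      also have "\<dots> \<longleftrightarrow> y \<in> up P i"
      proof -
        have "y \<in> car E i" using sub_car[OF up_sub[OF N]] y by simp
        then have "y \<in> up P i \<longleftrightarrow> p i x \<in> p i ` P i" using x(2) by (simp add: up_def)
        then show ?thesis using mem[OF P \<open>X \<le> P\<close> sub_car[OF N x(1)]] by blast
      qed
      finally show "\<pi>' i y = ze S i \<longleftrightarrow> y \<in> up P i" .
    qed
    then show ?thesis by blast
  qed
  have "filtr \<S> L E (up ` F)"
    unfolding filtr_def
  proof (intro conjI ballI)
    fix K assume "K \<in> up ` F"
    then obtain N where N: "N \<in> F" "K = up N" by blast
    note Nsub = filtr_sub[OF f N(1)] and Nge = filtr_ge[OF f N(1)]
    note Psub = filtr_prev_sub[OF f X N(1)]
    note Pge = prev_upper1[of X F N] and Ple = prev_le[OF Nge, of F]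
    show "sub K E" using N(2) up_sub[OF Nsub] by simp
    show "L \<le> K" using N(2) up_mono[OF Nge] upX by simp
    show "prev L (up ` F) K \<noteq> K"
    proof
      assume "prev L (up ` F) K = K"
      then have "up N \<le> up (prev X F N)" using prev[OF N(1)] N(2) by simp
      then have "N \<le> prev X F N" using up_le[OF _ Nsub Psub Pge] by blast
      then show False using Ple filtr_neq[OF f N(1)] by simp
    qed
    obtain S \<pi> where S: "S \<in> \<S>" "quo (res M N) (prev X F N) S \<pi>" using filtr_quo[OF f N(1)] by blast
    then show "\<exists>S\<in>\<S>. \<exists>p. quo (res E K) (prev L (up ` F) K) S p"
      using jump[OF Nsub Psub Pge Ple S(2) obS[OF S(1)]] prev[OF N(1)] N(2) by auto
  next
    show "wochain (up ` F)"
      unfolding wochain_def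
    proof (intro allI impI)
      fix G assume G: "G \<subseteq> up ` F" "G \<noteq> {}"
      then have "{N \<in> F. up N \<in> G} \<noteq> {}" "{N \<in> F. up N \<in> G} \<subseteq> F" by blast+
      then obtain K where K: "K \<in> F" "up K \<in> G" "\<forall>N\<in>{N \<in> F. up N \<in> G}. K \<le> N"
        using wochain_least[OF filtr_wo[OF f]] by blast
      have "up K \<le> N" if NG: "N \<in> G" for N
      proof -
        obtain N' where "N' \<in> F" "N = up N'" using G(1) NG by blast
        then show ?thesis using K(3) NG up_mono[of K N'] by blast
      qed
      then show "\<exists>L\<in>G. \<forall>N\<in>G. L \<le> N" using K(2) by blast
    qed
    show "Sup (insert L (up ` F)) = car E"
      using upSup[of "insert X F"] unfolding filtr_Sup[OF f] upM image_insert upX by simp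
  qed
  then show ?thesis by blast
qed

end

section \<open>Eklof's lemma\<close>

context gcatu begin

text \<open>A family of subsets is encoded as one subset of a small disjoint sum, so a power set
  bounds the number of families.\<close>

lemma small_families:
  fixes F :: "('i \<Rightarrow> 'b set) set" and M :: "('i, 'r, 'b) gob"
  assumes "\<And>N. N \<in> F \<Longrightarrow> N \<le> car M" and "sml TYPE('u) M"
  shows "small TYPE('u) F"
proof -
  have inj: "inj_on (\<lambda>N. Sigma (UNIV :: 'i set) N) F"
  proof (rule inj_onI)
    fix N N' :: "'i \<Rightarrow> 'b set" assume "Sigma UNIV N = Sigma UNIV N'"
    then show "N = N'" by (auto simp: fun_eq_iff set_eq_iff)
  qed
  have "small TYPE('u) (Pow (Sigma (UNIV :: 'i set) (car M)))"
    by (rule small_Pow[OF univ small_Sigma[OF univ small_I smlD[OF assms(2)]]])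
  moreover have "(\<lambda>N. Sigma UNIV N) ` F \<subseteq> Pow (Sigma UNIV (car M))"
    using assms(1) by (auto simp: le_fun_def)
  ultimately have "small TYPE('u) ((\<lambda>N. Sigma (UNIV :: 'i set) N) ` F)" using small_subset by blast
  then show ?thesis using small_inj_image[OF inj] by blast
qed

lemma lubs_over:
  assumes "\<S> \<noteq> {}" and "\<S> \<subseteq> over TYPE('u) V"
    and "\<And>s t. s \<in> \<S> \<Longrightarrow> t \<in> \<S> \<Longrightarrow> les s t \<or> les t s" and "small TYPE('u) \<S>"
  shows "lubs \<S> \<in> over TYPE('u) V"
proof -
  have "car (fst (lubs \<S>)) i = (\<Union>s\<in>\<S>. car (fst s) i)" for i by (simp add: car_lubs Sup_apply)
  moreover have "small TYPE('u) (\<Union>s\<in>\<S>. car (fst s) i)" for i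
    by (rule small_UN[OF univ assms(4)]) (use assms(2) in \<open>auto simp: over_def smlD\<close>)
  ultimately show ?thesis
    using lubs_ob[OF assms(1-3)] lubs_hom[OF assms(1-3)] by (simp add: over_def sml_def)
qed

text \<open>A homomorphism is extended stage by stage: \<open>ext0\<close> of the quotient extends
  it from the predecessor of a stage to the stage, and extensions along a chain are united. A state
  carries the domain together with the map, so that the union of states does both at once.\<close>

lemma eklof:
  fixes M :: "('i, 'r, 'u) gob"
  assumes F: "filtr \<S> X M F" and X: "sub X M" and M: "smob TYPE('u) M" and V: "ob V"
    and ext: "\<And>S. S \<in> \<S> \<Longrightarrow> ext0 S V" and f: "hom (res M X) V f"
  obtains g where "hom M V g" "\<And>i x. x \<in> X i \<Longrightarrow> g i x = f i x"
proof -
  have oM: "ob M" using M by blast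
  obtain r where r: "Well_order r" "Field r = F" "\<And>N. N \<in> F \<Longrightarrow> underS r N = {L \<in> F. L < N}"
    using wochain_Well_order[OF filtr_wo[OF F]] by blast
  define s0 where "s0 = (res M X, f)"
  define good where "good N s g \<longleftrightarrow> hom (res M N) V g \<and> (\<forall>i. \<forall>x\<in>car (fst s) i. g i x = snd s i x)" for N and s :: "('i, 'r, 'u) state" and g
  \<comment> \<open>The second branch is a default that keeps \<open>step\<close> valid for every
    state; \<open>main\<close> shows that the recursion always takes the first branch.\<close>
  define st where "st N s = (if le (fst s) M \<and> car (fst s) = prev X F N
      then (res M N, SOME g. good N s g) else s)" for N and s :: "('i, 'r, 'u) state"
  let ?P = "over TYPE('u) V"
  have step: "st N s \<in> ?P \<and> les s (st N s)" if N: "N \<in> F" and s: "s \<in> ?P" for N s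
  proof (cases "le (fst s) M \<and> car (fst s) = prev X F N")
    case True
    obtain B q where Bq: "s = (B, q)" by (cases s)
    have B: "ob B" "sml TYPE('u) B" "hom B V q" "le B M" "car B = prev X F N"
      using s True Bq by (auto simp: over_def)
    note Ns = filtr_sub[OF F N] and Ps = filtr_prev_sub[OF F X N]
    have PN: "prev X F N \<le> N" by (rule prev_le[OF filtr_ge[OF F N]])
    have PsN: "sub (prev X F N) (res M N)" using Ps PN sub_res[OF Ns] by blast
    have "le (res M (prev X F N)) B"
      by (rule le_le[OF ob_res[OF oM Ps] sub_le[OF oM Ps] B(4)]) (simp add: B(5))
    then have qP: "hom (res (res M N) (prev X F N)) V q" using le_hom[OF _ B(3)] by simp
    obtain S p where S: "S \<in> \<S>" "quo (res M N) (prev X F N) S p" using filtr_quo[OF F N] by blast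
    obtain g where "hom (res M N) V g" "\<And>i x. x \<in> prev X F N i \<Longrightarrow> g i x = q i x"
      using ext0D[OF ext[OF S(1)] smob_res[OF M Ns] PsN S(2) qP] by blast
    then have "good N s g" by (simp add: good_def Bq B(5))
    then have g: "good N s (SOME g. good N s g)" by (rule someI[of "good N s"])
    define g0 where "g0 = (SOME g. good N s g)"
    have st: "st N s = (res M N, g0)" using True by (simp add: st_def g0_def)
    have "le B (res M N)"
      by (rule le_le[OF B(1,4) sub_le[OF oM Ns]]) (simp add: B(5) PN)
    then show ?thesis
      using g[folded g0_def] smob_res[OF M Ns] unfolding st by (simp add: over_def les_def good_def Bq)
  next
    case False
    then have "st N s = s" unfolding st_def by (rule if_not_P)
    moreover have "ob (fst s)" using s by (simp add: over_def)
    ultimately show ?thesis using s les_refl by simp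
  qed
  have s0: "s0 \<in> ?P" using smob_res[OF M X] f by (simp add: over_def s0_def)
  have sF: "small TYPE('u) F"
    by (rule small_families[OF sub_le_car[OF filtr_sub[OF F]]]) (use M in blast)+
  have lub: "lubs (insert s0 (T ` J)) \<in> ?P \<and> (\<forall>a\<in>insert s0 (T ` J). les a (lubs (insert s0 (T ` J))))"
    if J: "J \<subseteq> Field r" and P: "insert s0 (T ` J) \<subseteq> ?P"
      and ch: "\<And>a b. a \<in> insert s0 (T ` J) \<Longrightarrow> b \<in> insert s0 (T ` J) \<Longrightarrow> les a b \<or> les b a" for J T
  proof -
    have sm: "small TYPE('u) (insert s0 (T ` J))"
      using small_insert[OF univ small_image[OF small_subset[OF J]]] sF r(2) by simp
    show ?thesis
      using lubs_over[OF _ P ch sm] lubs_upper[OF _ P ch] by blast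
  qed
  have refl: "les s s" if "s \<in> ?P" for s
    by (rule les_refl) (use that in \<open>simp add: over_def\<close>)
  obtain T where TT: "is_tower r ?P les s0 st lubs T"
    by (rule tower_exists[OF r(1) refl les_trans s0 step[folded r(2)] lub])
  note T = is_tower_eq[OF TT, unfolded r(2)] is_tower_in[OF TT, unfolded r(2)]
    is_tower_chain[OF TT, unfolded r(2)] is_tower_top[OF TT, unfolded r(2)] is_tower_le_top[OF TT, unfolded r(2)]
  have sub': "insert s0 (T ` G) \<subseteq> ?P" if "G \<subseteq> F" for G using that s0 T(2) by blast
  \<comment> \<open>A union of states that sit on their intended stages sits on the union of these
    stages, which for the stages below \<open>N\<close> is the predecessor of
    \<open>N\<close>.\<close>
  have leM: "le (fst (lubs (insert s0 (T ` G)))) M \<and> car (fst (lubs (insert s0 (T ` G)))) = Sup (insert X G)"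
    if G: "G \<subseteq> F" and c: "\<And>N. N \<in> G \<Longrightarrow> le (fst (T N)) M \<and> car (fst (T N)) = N" for G
  proof
    have "le (fst s) M" if "s \<in> insert s0 (T ` G)" for s
      using that c sub_le[OF oM X] by (auto simp: s0_def)
    moreover have "les a b \<or> les b a" if "a \<in> insert s0 (T ` G)" "b \<in> insert s0 (T ` G)" for a b
      using T(3)[of a b] that G by blast
    ultimately show "le (fst (lubs (insert s0 (T ` G)))) M"
      by (intro lubs_least[OF _ sub'[OF G]]) auto
    have "(\<lambda>s. car (fst s)) ` insert s0 (T ` G) = insert X ((\<lambda>N. car (fst (T N))) ` G)"
      by (simp add: s0_def image_image)
    also have "(\<lambda>N. car (fst (T N))) ` G = G" using c by simp
    finally show "car (fst (lubs (insert s0 (T ` G)))) = Sup (insert X G)" by (simp add: car_lubs)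
  qed
  \<comment> \<open>The state at \<open>N\<close> really has carrier \<open>N\<close> and the
    operations of \<open>M\<close>.\<close>
  have main: "N \<in> F \<longrightarrow> le (fst (T N)) M \<and> car (fst (T N)) = N" for N
    using wf_Well_order[OF r(1)]
  proof (induction N rule: wf_induct_rule)
    case (less N)
    show ?case
    proof
      assume N: "N \<in> F"
      have IH: "le (fst (T K)) M \<and> car (fst (T K)) = K" if "K \<in> underS r N" for K
        using less[of K] that r(3)[OF N] by (auto simp: underS_def)
      have "le (fst (lubs (insert s0 (T ` underS r N)))) M \<and>
          car (fst (lubs (insert s0 (T ` underS r N)))) = Sup (insert X (underS r N))"
        by (rule leM) (use IH r(3)[OF N] in auto)
      then have "T N = (res M N, SOME g. good N (lubs (insert s0 (T ` underS r N))) g)"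
        using T(1)[OF N] r(3)[OF N] by (simp add: st_def prev_def)
      then show "le (fst (T N)) M \<and> car (fst (T N)) = N" using sub_le[OF oM filtr_sub[OF F N]] by simp
    qed
  qed
  obtain B q where Bq: "lubs (insert s0 (T ` F)) = (B, q)" by (cases "lubs (insert s0 (T ` F))")
  have B: "le B M" "car B = car M" "hom B V q" "ob B"
    using leM[of F] main T(4) filtr_Sup[OF F] by (auto simp: Bq over_def)
  have "le M B" by (rule le_le[OF oM le_refl[OF oM] B(1)]) (simp add: B(2))
  then have "hom M V q" by (rule le_hom[OF _ B(3)])
  moreover have "q i x = f i x" if "x \<in> X i" for i x
    using T(5)[of s0] that unfolding Bq by (simp add: les_def s0_def)
  ultimately show thesis by (rule that)
qed

text \<open>Any extension with quotient \<open>C\<close> inherits the filtration by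
  \<open>filtr_transfer\<close>, and \<open>eklof\<close> applies to it.\<close>

lemma ext0_filtr:
  fixes M :: "('i, 'r, 'b) gob"
  assumes F: "filtr \<S> X M F" and X: "sub X M" and M: "ob M" and p: "quo M X C p" and C: "ob C" and V: "ob V"
    and S: "\<And>S. S \<in> \<S> \<Longrightarrow> ob S \<and> ext0 S V"
  shows "ext0 C V"
  unfolding ext0_def
proof (intro allI impI, elim conjE)
  fix E L p' f
  assume E: "ob (E :: ('i, 'r, 'u) gob)" "sml TYPE('u) E" "sub L E" "quo E L C p'" "hom (res E L) V f"
  obtain F' where "filtr \<S> L E F'"
    using filtr_transfer[OF M E(1) C _ F X p E(4,3)] S by blast
  from eklof[OF this E(3) _ V _ E(5)] E(1,2) S
  show "\<exists>g. hom E V g \<and> (\<forall>i. \<forall>x\<in>L i. g i x = f i x)" by metis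
qed

end

section \<open>The small object argument\<close>

context gcat begin

lemma quo_le: "le M' M \<Longrightarrow> car M' = car M \<Longrightarrow> quo M N S p \<Longrightarrow> quo M' N S p"
  unfolding quo_def by (metis le_hom)

text \<open>\<open>T\<close> and the restriction of \<open>Q\<close> to its carrier agree on
  elements but may be different records; the filtration has to be moved from one to the
  other.\<close>

lemma filtr_le:
  assumes T: "ob T" and Q: "ob Q" and le: "le T Q" and F: "filtr \<S> X T F"
  shows "filtr \<S> X (res Q (car T)) F"
  unfolding filtr_def
proof (intro conjI ballI)
  note sT = le_sub[OF T Q le]
  fix N assume N: "N \<in> F"
  note NT = filtr_sub[OF F N]
  note NQ = le_subsub[OF T Q le NT]
  show "sub N (res Q (car T))" using NQ sub_res[OF sT] sub_le_car[OF NT] by simp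
  show "X \<le> N" "prev X F N \<noteq> N" using filtr_ge[OF F N] filtr_neq[OF F N] by auto
  obtain S p where S: "S \<in> \<S>" "quo (res T N) (prev X F N) S p" using filtr_quo[OF F N] by blast
  have "le (res Q N) (res T N)"
    by (rule le_le[OF ob_res[OF Q NQ] sub_le[OF Q NQ] le_trans[OF sub_le[OF T NT] le]]) simp
  from quo_le[OF this _ S(2)] S(1)
  show "\<exists>S\<in>\<S>. \<exists>p. quo (res (res Q (car T)) N) (prev X F N) S p" by auto
qed (use filtr_wo[OF F] filtr_Sup[OF F] in simp_all)

text \<open>Renaming along an injection is the quotient by zero with names given by
  \<open>e\<close>.\<close>

lemma iso_copy:
  fixes C :: "('i, 'r, 'a) gob"
  assumes C: "ob C" and e: "\<And>i. inj_on (e i) (car C i)"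
  obtains E d where "ob E" "\<And>i. car E i = e i ` car C i" "hom C E e" "hom E C d"
    "\<And>i x. x \<in> car C i \<Longrightarrow> d i (e i x) = x"
proof -
  have eq: "e i x = e i y \<longleftrightarrow> mi C i x y \<in> {ze C i}" if "x \<in> car C i" "y \<in> car C i" for i x y
    using inj_onD[OF e[of i]] that mi_eq_ze[OF C that] by auto
  note E = quo_imob[OF C sub_zero[OF C] eq]
  note eh = quo_hom[OF E(2)]
  obtain d where "hom (imob C e) C d" "\<And>i x. x \<in> car C i \<Longrightarrow> d i (e i x) = x"
    by (rule factor[OF C E(1) C eh quo_surj[OF E(2)] hom_id[OF C]]) (use quo_ker[OF E(2)] in blast)+
  then show thesis using that[of "imob C e" d] E(1) eh quo_surj[OF E(2)] by metis
qed

text \<open>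
  Lifting problems for \<open>s\<close> over \<open>Z\<close> against inclusions \<open>K \<le> F\<close> with quotient in \<open>\<S>\<close>. They
  are posed inside \<open>A\<close>, so that there is only a small number of them.
\<close>

definition prob ::
    "('i, 'r, 'u) gob set \<Rightarrow> 'u set \<Rightarrow> ('i, 'r, 'u) gob \<Rightarrow> ('i, 'r, 'u) state \<Rightarrow>
     ('i, 'r, 'u) gob \<Rightarrow> ('i \<Rightarrow> 'u set) \<Rightarrow> ('i \<Rightarrow> 'u \<Rightarrow> 'u) \<Rightarrow> ('i \<Rightarrow> 'u \<Rightarrow> 'u) \<Rightarrow> bool" where
  "prob \<S> A Z s F K f g \<longleftrightarrow>
     ob F \<and> (\<forall>i. car F i \<subseteq> A) \<and> sub K F \<and> (\<exists>S\<in>\<S>. \<exists>p. quo F K S p) \<and>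
     hom (res F K) (fst s) f \<and> hom F Z g \<and> (\<forall>i. \<forall>x\<in>K i. snd s i (f i x) = g i x)"

definition sol ::
    "('i, 'r, 'u) state \<Rightarrow> ('i, 'r, 'u) gob \<Rightarrow> ('i \<Rightarrow> 'u set) \<Rightarrow> ('i \<Rightarrow> 'u \<Rightarrow> 'u) \<Rightarrow> ('i \<Rightarrow> 'u \<Rightarrow> 'u) \<Rightarrow> bool" where
  "sol t F K f g \<longleftrightarrow>
     (\<exists>h. hom F (fst t) h \<and> (\<forall>i. \<forall>x\<in>K i. h i x = f i x) \<and> (\<forall>i. \<forall>x\<in>car F i. snd t i (h i x) = g i x))"

lemma sol_les: assumes "sol t F K f g" and les: "les t t'" shows "sol t' F K f g"
proof -
  obtain h where h: "hom F (fst t) h" "\<forall>i. \<forall>x\<in>K i. h i x = f i x" "\<forall>i. \<forall>x\<in>car F i. snd t i (h i x) = g i x"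
    using assms(1) unfolding sol_def by blast
  have "hom F (fst t') h" by (rule hom_le[OF h(1)]) (use les in \<open>simp add: les_def\<close>)
  moreover have "snd t' i (h i x) = g i x" if "x \<in> car F i" for i x
    using les h(3) hom_car[OF h(1) that] that by (simp add: les_def)
  ultimately show ?thesis using h(2) unfolding sol_def by blast
qed

lemma prob_les: assumes p: "prob \<S> A Z s F K f g" and les: "les s s'" shows "prob \<S> A Z s' F K f g"
proof -
  have f: "hom (res F K) (fst s) f" using p by (simp add: prob_def)
  have "hom (res F K) (fst s') f" by (rule hom_le[OF f]) (use les in \<open>simp add: les_def\<close>)
  moreover have "snd s' i (f i x) = g i x" if "x \<in> K i" for i x
    using les hom_car[OF f, of x i] that p by (simp add: les_def prob_def)
  ultimately show ?thesis using p unfolding prob_def by blast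
qed

text \<open>
  The values of the operations outside the carrier are arbitrary, so that there are too many
  objects on a small set, but only few codes.
\<close>

definition obcode :: "('i, 'r, 'u) gob \<Rightarrow> ('i \<times> 'u) set \<times> ('i \<times> 'u \<times> 'u \<times> 'u) set \<times> ('i \<times> 'r \<times> 'u \<times> 'u) set \<times> ('i \<times> 'u \<times> 'u) set"
  where "obcode F =
    (Sigma UNIV (car F), {(i, x, y, z). x \<in> car F i \<and> y \<in> car F i \<and> z = ad F i x y},
     {(i, a, x, z). a \<in> carrier R \<and> x \<in> car F i \<and> z = sm F i a x},
     {(i, x, z). i \<in> W \<and> x \<in> car F i \<and> z = df F i x})"

lemma obcode_car: assumes "obcode F = obcode F'" shows "car F = car F'"
proof -
  have "Sigma UNIV (car F) = Sigma UNIV (car F')" using assms by (simp add: obcode_def)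
  then show ?thesis by (auto simp: fun_eq_iff set_eq_iff)
qed

text \<open>Equal codes mean equal carriers and operations that agree there; homomorphisms out of
  one object are then homomorphisms out of the other.\<close>

lemma obcode_le: assumes F: "ob F" and eq: "obcode F = obcode F'" shows "le F F'"
proof -
  have c: "car F' = car F" using obcode_car[OF eq] by simp
  have 1: "{(i, x, y, z). x \<in> car F i \<and> y \<in> car F i \<and> z = ad F i x y} =
      {(i, x, y, z). x \<in> car F i \<and> y \<in> car F i \<and> z = ad F' i x y}"
    and 2: "{(i, a, x, z). a \<in> carrier R \<and> x \<in> car F i \<and> z = sm F i a x} =
      {(i, a, x, z). a \<in> carrier R \<and> x \<in> car F i \<and> z = sm F' i a x}"
    and 3: "{(i, x, z). i \<in> W \<and> x \<in> car F i \<and> z = df F i x} =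
      {(i, x, z). i \<in> W \<and> x \<in> car F i \<and> z = df F' i x}"
    using eq by (simp_all add: obcode_def c)
  show ?thesis
    unfolding le_def hom_def
  proof (intro allI ballI conjI impI)
    fix i x assume x: "x \<in> car F i"
    show "x \<in> car F' i" using x c by simp
    show "ad F i x y = ad F' i x y" if "y \<in> car F i" for y
      using x that equalityD1[OF 1] by blast
    show "sm F i a x = sm F' i a x" if "a \<in> carrier R" for a
      using x that equalityD1[OF 2] by blast
    show "df F i x = df F' i x" if "i \<in> W"
      using x that equalityD1[OF 3] by blast
  qed
qed

end

context gcatu begin

lemma small_Pow4:
  assumes "small TYPE('u) P1" "small TYPE('u) P2" "small TYPE('u) P3" "small TYPE('u) P4"
  shows "small TYPE('u) (Pow P1 \<times> Pow P2 \<times> Pow P3 \<times> Pow P4)"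
  using assms by (intro small_Times[OF univ] small_Pow[OF univ])

lemma small_obcodes:
  assumes "\<And>F. F \<in> \<F> \<Longrightarrow> ob F \<and> (\<forall>i. car F i \<subseteq> A)"
  shows "small TYPE('u) (obcode ` \<F>)"
proof (rule small_subset)
  let ?I = "UNIV :: 'i set"
  show "obcode ` \<F> \<subseteq> Pow (?I \<times> A) \<times> Pow (?I \<times> A \<times> A \<times> A) \<times> Pow (?I \<times> carrier R \<times> A \<times> A) \<times> Pow (?I \<times> A \<times> A)"
  proof (rule image_subsetI)
    fix F assume "F \<in> \<F>"
    then have F: "ob F" "\<And>i x. x \<in> car F i \<Longrightarrow> x \<in> A" using assms by blast+
    show "obcode F \<in> Pow (?I \<times> A) \<times> Pow (?I \<times> A \<times> A \<times> A) \<times> Pow (?I \<times> carrier R \<times> A \<times> A) \<times> Pow (?I \<times> A \<times> A)"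
      unfolding obcode_def using F(2) F(2)[OF ad_car[OF F(1)]] F(2)[OF sm_car[OF F(1)]] F(2)[OF df_car[OF F(1)]]
      by auto
  qed
  show "small TYPE('u) (Pow (?I \<times> A) \<times> Pow (?I \<times> A \<times> A \<times> A) \<times> Pow (?I \<times> carrier R \<times> A \<times> A) \<times> Pow (?I \<times> A \<times> A))"
    by (intro small_Pow4 small_Times[OF univ] small_I small_R A_small)
qed

lemma sml_A: "(\<And>i. car F i \<subseteq> A) \<Longrightarrow> sml TYPE('u) F"
  unfolding sml_def using small_subset[OF _ A_small] by blast

text \<open>One cell attachment: the pushout of \<open>K \<le> F\<close> along \<open>f\<close>
  solves the problem, and its cokernel over the old object is that of \<open>K\<close> in
  \<open>F\<close>, so it counts as one step of a filtration.\<close>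

lemma attach:
  assumes s: "s \<in> over TYPE('u) Z" and Z: "ob Z" and obS: "\<And>S. S \<in> \<S> \<Longrightarrow> ob S"
    and p: "prob \<S> A Z s F K f g"
  obtains t where "t \<in> over TYPE('u) Z" "les s t" "sol t F K f g"
    "\<exists>S\<in>\<S>. \<exists>p. quo (fst t) (car (fst s)) S p"
proof -
  obtain B q where Bq: "s = (B, q)" by (cases s)
  have B: "smob TYPE('u) B" "hom B Z q" using s by (auto simp: over_def Bq)
  have F: "ob F" "sub K F" "hom (res F K) B f" "hom F Z g" "\<And>i x. x \<in> K i \<Longrightarrow> q i (f i x) = g i x"
    using p by (auto simp: prob_def Bq)
  have sF: "sml TYPE('u) F" by (rule sml_A) (use p in \<open>simp add: prob_def\<close>)
  have oB: "ob B" using B by blast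
  obtain S p0 where S: "S \<in> \<S>" "quo F K S p0" using p unfolding prob_def by blast
  obtain E h where E: "smob TYPE('u) E" "po F K B f E h"
    using po_exists[OF conjI[OF F(1) sF] B(1) F(2,3)] by blast
  have oE: "ob E" using E by blast
  have po: "le B E" "hom F E h" "\<And>i x. x \<in> K i \<Longrightarrow> h i x = f i x"
    using E(2) unfolding po_def by blast+
  obtain t where t: "hom E Z t" "\<And>i v. v \<in> car B i \<Longrightarrow> t i v = q i v" "\<And>i m. m \<in> car F i \<Longrightarrow> t i (h i m) = g i m"
    by (rule po_map[OF E(2) F(1) oB oE Z F(2,3) B(2) F(4,5)]) (assumption | rule that)+
  obtain p' where p': "quo E (car B) S p'"
    by (rule po_quo[OF E(2) F(1) oB oE obS[OF S(1)] F(2,3) S(2)]) (assumption | rule that)+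
  show thesis
  proof (rule that[of "(E, t)"])
    show "(E, t) \<in> over TYPE('u) Z" using E t by (simp add: over_def)
    show "les s (E, t)" using po t by (simp add: les_def Bq)
    show "sol (E, t) F K f g" unfolding sol_def using po t by auto
    show "\<exists>S\<in>\<S>. \<exists>p. quo (fst (E, t)) (car (fst s)) S p" using p' S Bq by auto
  qed
qed

lemma lub_above:
  assumes sJ: "small TYPE('u) J"
    and P: "insert s0 (T ` J) \<subseteq> {s \<in> over TYPE('u) Z. les s0 s}"
    and ch: "\<And>a b. a \<in> insert s0 (T ` J) \<Longrightarrow> b \<in> insert s0 (T ` J) \<Longrightarrow> les a b \<or> les b a"
  shows "lubs (insert s0 (T ` J)) \<in> {s \<in> over TYPE('u) Z. les s0 s} \<and>
    (\<forall>a\<in>insert s0 (T ` J). les a (lubs (insert s0 (T ` J))))"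
proof -
  have sm: "small TYPE('u) (insert s0 (T ` J))"
    using small_insert[OF univ small_image[OF sJ]] .
  have P': "insert s0 (T ` J) \<subseteq> over TYPE('u) Z" using P by blast
  show ?thesis
    using lubs_over[OF _ P' ch sm] lubs_upper[OF _ P' ch] by blast
qed

text \<open>One round: the problems posed at \<open>s\<close> have solutions at \<open>t\<close>.
  New problems posed at \<open>t\<close> are left to later rounds.\<close>

definition solved :: "('i, 'r, 'u) gob set \<Rightarrow> ('i, 'r, 'u) gob \<Rightarrow> ('i, 'r, 'u) state \<Rightarrow> ('i, 'r, 'u) state \<Rightarrow> bool" where
  "solved \<S> Z s t \<longleftrightarrow> t \<in> over TYPE('u) Z \<and> les s t \<and> (\<exists>F. filtr \<S> (car (fst s)) (fst t) F) \<and>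
     (\<forall>F K f g. prob \<S> A Z s F K f g \<longrightarrow> sol t F K f g)"

text \<open>The maps enter through their graphs on \<open>K\<close> and \<open>F\<close> only, so
  that the codes, unlike the problems, form a small set.\<close>

definition pcode where
  "pcode F K f g = (obcode F, {(i :: 'i, x :: 'u, y :: 'u). x \<in> K i \<and> y = f i x},
     {(i :: 'i, x :: 'u, y :: 'u). x \<in> car F i \<and> y = g i x})"

lemma small_pcodes:
  assumes s: "s \<in> over TYPE('u) Z" and Z: "sml TYPE('u) Z"
  shows "small TYPE('u) {pcode F K f g | F K f g. prob \<S> A Z s F K f g}"
proof (rule small_subset)
  let ?I = "UNIV :: 'i set"
  let ?C = "obcode ` {F. ob F \<and> (\<forall>i. car F i \<subseteq> A)}"
  let ?B = "\<Union>i\<in>UNIV. car (fst s) i" and ?Z = "\<Union>i\<in>UNIV. car Z i"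
  show "{pcode F K f g | F K f g. prob \<S> A Z s F K f g} \<subseteq> ?C \<times> Pow (?I \<times> A \<times> ?B) \<times> Pow (?I \<times> A \<times> ?Z)"
  proof (rule subsetI)
    fix c assume "c \<in> {pcode F K f g | F K f g. prob \<S> A Z s F K f g}"
    then obtain F K f g where c: "c = pcode F K f g" and p: "prob \<S> A Z s F K f g" by blast
    from p have F: "ob F" "\<And>i. car F i \<subseteq> A" "sub K F" "hom (res F K) (fst s) f" "hom F Z g"
      by (auto simp: prob_def)
    have 1: "f i x \<in> ?B" "x \<in> A" if "x \<in> K i" for i x
      using hom_car[OF F(4), of x i] that sub_car[OF F(3) that] F(2) by auto
    have 2: "g i x \<in> ?Z" "x \<in> A" if "x \<in> car F i" for i x
      using hom_car[OF F(5) that] F(2) that by auto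
    show "c \<in> ?C \<times> Pow (?I \<times> A \<times> ?B) \<times> Pow (?I \<times> A \<times> ?Z)"
      unfolding c pcode_def
    proof (intro SigmaI)
      show "obcode F \<in> ?C" using F(1,2) by blast
      show "{(i, x, y). x \<in> K i \<and> y = f i x} \<in> Pow (?I \<times> A \<times> ?B)" using 1 by blast
      show "{(i, x, y). x \<in> car F i \<and> y = g i x} \<in> Pow (?I \<times> A \<times> ?Z)" using 2 by blast
    qed
  qed
  have "small TYPE('u) ?B" "small TYPE('u) ?Z"
    using s Z by (auto intro!: small_UN[OF univ small_I] smlD simp: over_def)
  then show "small TYPE('u) (?C \<times> Pow (?I \<times> A \<times> ?B) \<times> Pow (?I \<times> A \<times> ?Z))"
    by (intro small_Times[OF univ] small_Pow[OF univ] small_I A_small small_obcodes) auto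
qed

text \<open>The codes of problems are well-ordered and cells are attached one after another; a
  problem posed at \<open>s\<close> remains a problem at every later stage.\<close>

lemma solve_all:
  assumes s: "s \<in> over TYPE('u) Z" and Z: "smob TYPE('u) Z" and obS: "\<And>S. S \<in> \<S> \<Longrightarrow> ob S"
  shows "\<exists>t. solved \<S> Z s t"
proof -
  define I where "I = {pcode F K f g | F K f g. prob \<S> A Z s F K f g}"
  let ?P = "{s' \<in> over TYPE('u) Z. les s s'}"
  have oZ: "ob Z" using Z by blast
  have sI: "small TYPE('u) I" unfolding I_def using small_pcodes[OF s] Z by simp
  obtain r where r: "Well_order r" "Field r = I" using Well_order_exists[of I] by auto
  \<comment> \<open>A step knows only a code \<open>c\<close>, so it solves some problem with this
    code.\<close>
  define ok where "ok c s' t \<longleftrightarrow> t \<in> over TYPE('u) Z \<and> les s' t \<and>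
      (\<exists>F K f g. prob \<S> A Z s F K f g \<and> pcode F K f g = c \<and> sol t F K f g) \<and>
      (\<exists>S\<in>\<S>. \<exists>p. quo (fst t) (car (fst s')) S p)" for c s' t
  define st where "st c s' = (SOME t. ok c s' t)" for c s'
  have ok: "ok c s' (st c s')" if c: "c \<in> I" and s': "s' \<in> ?P" for c s'
  proof -
    obtain F K f g where p: "prob \<S> A Z s F K f g" "c = pcode F K f g" using c unfolding I_def by blast
    have "prob \<S> A Z s' F K f g" by (rule prob_les[OF p(1)]) (use s' in blast)
    then obtain t where "t \<in> over TYPE('u) Z" "les s' t" "sol t F K f g"
        "\<exists>S\<in>\<S>. \<exists>p. quo (fst t) (car (fst s')) S p"
      using attach[OF _ oZ obS] s' by blast
    then have "ok c s' t" unfolding ok_def using p by blast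
    then show ?thesis unfolding st_def by (rule someI)
  qed
  have refl: "les s s" if "s \<in> ?P" for s
    by (rule les_refl) (use that in \<open>simp add: over_def\<close>)
  have s0: "s \<in> ?P" using s les_refl[of s] by (simp add: over_def)
  have step: "st c s' \<in> ?P \<and> les s' (st c s')" if "c \<in> Field r" "s' \<in> ?P" for c s'
    using ok[of c s'] that les_trans[of s s' "st c s'"] unfolding r(2) ok_def by blast
  have lub: "lubs (insert s (T ` J)) \<in> ?P \<and> (\<forall>a\<in>insert s (T ` J). les a (lubs (insert s (T ` J))))"
    if J: "J \<subseteq> Field r" and P: "insert s (T ` J) \<subseteq> ?P"
      and ch: "\<And>a b. a \<in> insert s (T ` J) \<Longrightarrow> b \<in> insert s (T ` J) \<Longrightarrow> les a b \<or> les b a" for J T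
    by (rule lub_above[OF small_subset[OF J[unfolded r(2)] sI] P ch])
  obtain T where T: "is_tower r ?P les s st lubs T"
    by (rule tower_exists[OF r(1) refl les_trans s0 step lub])
  let ?L = "\<lambda>c. lubs (insert s (T ` underS r c))"
  let ?Q = "lubs (insert s (T ` Field r))"
  have Q: "?Q \<in> over TYPE('u) Z" "les s ?Q" using is_tower_top[OF T] by auto
  have oQ: "ob (fst ?Q)" using Q by (simp add: over_def)
  have Tok: "ok c (?L c) (T c)" if "c \<in> Field r" for c
    using ok[OF that[unfolded r(2)] is_tower_lub[OF T that]] is_tower_eq[OF T that] by simp
  have TQ: "les (T c) ?Q" if "c \<in> Field r" for c using is_tower_le_top[OF T] that by blast
  have lT: "le (fst (T c)) (fst ?Q)" "ob (fst (T c))" if "c \<in> Field r" for c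
    using TQ[OF that] is_tower_in[OF T that] by (auto simp: les_def over_def)
  have lL: "le (fst (?L c)) (fst (T c))" "ob (fst (?L c))" if "c \<in> Field r" for c
    using Tok[OF that] is_tower_lub[OF T that] by (auto simp: les_def over_def ok_def)
  have "\<exists>F. filtr \<S> (car (fst s)) (fst ?Q) F"
  proof (rule filtr_tower[OF oQ r(1), of "\<lambda>c. car (fst (T c))" "\<lambda>c. car (fst (?L c))"])
    fix c assume c: "c \<in> Field r"
    show "sub (car (fst (T c))) (fst ?Q)" by (rule le_sub[OF lT(2) oQ lT(1)]) (rule c)+
    show "car (fst (?L c)) = Sup (insert (car (fst s)) ((\<lambda>c. car (fst (T c))) ` underS r c))"
      by (simp add: car_lubs image_image)
    show "sub (car (fst (?L c))) (fst ?Q)"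
      by (rule le_sub[OF lL(2) oQ le_trans[OF lL(1) lT(1)]]) (rule c)+
    obtain S p where S: "S \<in> \<S>" "quo (fst (T c)) (car (fst (?L c))) S p"
      using Tok[OF c] unfolding ok_def by blast
    have sT: "sub (car (fst (T c))) (fst ?Q)" by (rule le_sub[OF lT(2) oQ lT(1)]) (rule c)+
    have "le (res (fst ?Q) (car (fst (T c)))) (fst (T c))"
      by (rule le_le[OF ob_res[OF oQ sT] sub_le[OF oQ sT] lT(1)[OF c]]) simp
    from quo_le[OF this _ S(2)] S(1)
    have "\<exists>S\<in>\<S>. \<exists>p. quo (res (fst ?Q) (car (fst (T c)))) (car (fst (?L c))) S p" by auto
    then show "car (fst (?L c)) = car (fst (T c)) \<or>
        car (fst (?L c)) \<le> car (fst (T c)) \<and>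
        (\<exists>S\<in>\<S>. \<exists>p. quo (res (fst ?Q) (car (fst (T c)))) (car (fst (?L c))) S p)"
      using le_fun[OF lL(1)[OF c]] by blast
  next
    show "Sup (insert (car (fst s)) ((\<lambda>c. car (fst (T c))) ` Field r)) = car (fst ?Q)"
      by (simp add: car_lubs image_image)
  qed
  \<comment> \<open>Problems with equal codes have the same maps on the same carriers, so a solution
    of the representative solves them all.\<close>
  moreover have "sol ?Q F K f g" if p: "prob \<S> A Z s F K f g" for F K f g
  proof -
    have c: "pcode F K f g \<in> Field r" unfolding r(2) I_def using p by blast
    obtain F' K' f' g' where *: "prob \<S> A Z s F' K' f' g'" "pcode F' K' f' g' = pcode F K f g"
      "sol (T (pcode F K f g)) F' K' f' g'"
      using Tok[OF c] unfolding ok_def by blast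
    have "sol ?Q F' K' f' g'" by (rule sol_les[OF *(3) TQ[OF c]])
    then obtain h where h: "hom F' (fst ?Q) h" "\<And>i x. x \<in> K' i \<Longrightarrow> h i x = f' i x"
      "\<And>i x. x \<in> car F' i \<Longrightarrow> snd ?Q i (h i x) = g' i x"
      unfolding sol_def by blast
    have code: "obcode F = obcode F'" using *(2) by (simp add: pcode_def)
    note cF = obcode_car[OF code]
    have oF: "ob F" using p by (simp add: prob_def)
    have fe: "{(i, x, y). x \<in> K' i \<and> y = f' i x} = {(i, x, y). x \<in> K i \<and> y = f i x}"
      and ge: "{(i, x, y). x \<in> car F' i \<and> y = g' i x} = {(i, x, y). x \<in> car F i \<and> y = g i x}"
      using *(2) by (simp_all add: pcode_def)
    have f: "x \<in> K' i \<and> f' i x = f i x" if "x \<in> K i" for i x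
    proof -
      have "(i, x, f i x) \<in> {(i, x, y). x \<in> K i \<and> y = f i x}" using that by simp
      then have "(i, x, f i x) \<in> {(i, x, y). x \<in> K' i \<and> y = f' i x}" by (simp only: fe)
      then show ?thesis by simp
    qed
    have g: "g' i x = g i x" if "x \<in> car F i" for i x
    proof -
      have "(i, x, g i x) \<in> {(i, x, y). x \<in> car F i \<and> y = g i x}" using that by simp
      then have "(i, x, g i x) \<in> {(i, x, y). x \<in> car F' i \<and> y = g' i x}" by (simp only: ge)
      then show ?thesis by simp
    qed
    have "hom F (fst ?Q) h" by (rule le_hom[OF obcode_le[OF oF code] h(1)])
    moreover have "h i x = f i x" if "x \<in> K i" for i x using f[OF that] h(2) by metis
    moreover have "snd ?Q i (h i x) = g i x" if "x \<in> car F i" for i x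
      using g[OF that] h(3)[of x i] that cF by metis
    ultimately show ?thesis unfolding sol_def by blast
  qed
  ultimately have "solved \<S> Z s ?Q" unfolding solved_def using Q by blast
  then show ?thesis by blast
qed

abbreviation kr :: "('i, 'r, 'a) gob \<Rightarrow> ('i, 'r, 'b) gob \<Rightarrow> ('i \<Rightarrow> 'a \<Rightarrow> 'b) \<Rightarrow> 'i \<Rightarrow> 'a set" where
  "kr Q Z q \<equiv> \<lambda>i. {x \<in> car Q i. q i x = ze Z i}"

text \<open>One round creates new problems, so rounds are iterated long enough that every problem at
  the end was already posed before the end. The filtrations of the rounds are concatenated.\<close>

lemma small_object_argument:
  assumes s: "s \<in> over TYPE('u) Z" and Z: "smob TYPE('u) Z" and obS: "\<And>S. S \<in> \<S> \<Longrightarrow> ob S"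
  obtains t where "t \<in> over TYPE('u) Z" "les s t" "\<exists>F. filtr \<S> (car (fst s)) (fst t) F"
    "\<And>F K f g. prob \<S> A Z t F K f g \<Longrightarrow> sol t F K f g"
proof -
  \<comment> \<open>The successor cardinal is regular, so a problem at the last stage is posed at an earlier one.\<close>
  let ?r = "cardSuc (card_of A)"
  let ?P = "{s' \<in> over TYPE('u) Z. les s s'}"
  have co: "Card_order ?r" by (simp add: cardSuc_Card_order card_of_Card_order)
  then have r: "Well_order ?r" using card_order_on_well_order_on by blast
  have rinf: "infinite (Field ?r)"
    using A_inf cardSuc_finite[OF card_of_Card_order, of A] by (simp only: Field_card_of not_False_eq_True)
  have sI: "small TYPE('u) (Field ?r)" by (rule small_Field_cardSuc[OF univ A_small])
  \<comment> \<open>Every index performs the same round; the well-order only counts the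
    rounds.\<close>
  define st where "st i s' = (SOME t. solved \<S> Z s' t)" for i :: "'u set" and s'
  have st: "solved \<S> Z s' (st i s')" if "s' \<in> ?P" for i s'
  proof -
    have "\<exists>t. solved \<S> Z s' t" by (rule solve_all[OF _ Z obS]) (use that in blast)+
    then show ?thesis unfolding st_def by (rule someI_ex)
  qed
  have refl: "les s' s'" if "s' \<in> ?P" for s'
    by (rule les_refl) (use that in \<open>simp add: over_def\<close>)
  have s0: "s \<in> ?P" using s les_refl[of s] by (simp add: over_def)
  have step: "st c s' \<in> ?P \<and> les s' (st c s')" if "c \<in> Field ?r" "s' \<in> ?P" for c s'
    using st[OF that(2), of c] that les_trans[of s s' "st c s'"] unfolding solved_def by blast
  have lub: "lubs (insert s (T ` J)) \<in> ?P \<and> (\<forall>a\<in>insert s (T ` J). les a (lubs (insert s (T ` J))))"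
    if J: "J \<subseteq> Field ?r" and P: "insert s (T ` J) \<subseteq> ?P"
      and ch: "\<And>a b. a \<in> insert s (T ` J) \<Longrightarrow> b \<in> insert s (T ` J) \<Longrightarrow> les a b \<or> les b a" for J T
    by (rule lub_above[OF small_subset[OF J sI] P ch])
  obtain T where T: "is_tower ?r ?P les s st lubs T"
    by (rule tower_exists[OF r refl les_trans s0 step lub])
  let ?L = "\<lambda>c. lubs (insert s (T ` underS ?r c))"
  let ?Q = "lubs (insert s (T ` Field ?r))"
  have Q: "?Q \<in> over TYPE('u) Z" "les s ?Q" using is_tower_top[OF T] by auto
  have oQ: "ob (fst ?Q)" using Q by (simp add: over_def)
  have Tok: "solved \<S> Z (?L c) (T c)" if "c \<in> Field ?r" for c
    using st[OF is_tower_lub[OF T that], of c] is_tower_eq[OF T that] by simp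
  have TQ: "les (T c) ?Q" if "c \<in> Field ?r" for c using is_tower_le_top[OF T] that by blast
  have lT: "le (fst (T c)) (fst ?Q)" "ob (fst (T c))" if "c \<in> Field ?r" for c
    using TQ[OF that] is_tower_in[OF T that] by (auto simp: les_def over_def)
  have "\<exists>F. filtr \<S> (car (fst (?L c))) (res (fst ?Q) (car (fst (T c)))) F" if c: "c \<in> Field ?r" for c
  proof -
    obtain F where "filtr \<S> (car (fst (?L c))) (fst (T c)) F" using Tok[OF c] unfolding solved_def by blast
    from filtr_le[OF lT(2)[OF c] oQ lT(1)[OF c] this] show ?thesis by blast
  qed
  then obtain F where F: "\<And>c. c \<in> Field ?r \<Longrightarrow> filtr \<S> (car (fst (?L c))) (res (fst ?Q) (car (fst (T c)))) (F c)"
    by metis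
  have cQ: "Sup (insert (car (fst s)) ((\<lambda>c. car (fst (T c))) ` Field ?r)) = car (fst ?Q)"
    by (simp add: car_lubs image_image)
  have "filtr \<S> (car (fst s)) (fst ?Q) (\<Union>c\<in>Field ?r. F c)"
  proof (rule filtr_merge[OF r _ _ F cQ])
    fix c assume c: "c \<in> Field ?r"
    show "sub (car (fst (T c))) (fst ?Q)" by (rule le_sub[OF lT(2) oQ lT(1)]) (rule c)+
    show "car (fst (?L c)) = Sup (insert (car (fst s)) ((\<lambda>c. car (fst (T c))) ` underS ?r c))"
      by (simp add: car_lubs image_image)
  qed
  moreover have "sol ?Q G K f g" if p: "prob \<S> A Z ?Q G K f g" for G K f g
  proof -
    have G: "ob G" "\<And>i. car G i \<subseteq> A" "sub K G" "hom (res G K) (fst ?Q) f" "hom G Z g"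
      "\<And>i x. x \<in> K i \<Longrightarrow> snd ?Q i (f i x) = g i x"
      using p by (auto simp: prob_def)
    \<comment> \<open>All sorts are put into one set, because regularity is applied to a single
      bounded set covered by an increasing chain.\<close>
    define As where "As c = Sigma UNIV (car (fst (T c)))" for c
    let ?B = "(\<lambda>(i, x). (i, f i x)) ` Sigma UNIV K"
    have sT: "les s (T c)" if "c \<in> Field ?r" for c using is_tower_in[OF T that] by blast
    have cov: "?B \<subseteq> (\<Union>c\<in>Field ?r. As c)"
    proof
      fix z assume "z \<in> ?B"
      then obtain i x where z: "z = (i, f i x)" "x \<in> K i" by auto
      then have "f i x \<in> car (fst ?Q) i" using hom_car[OF G(4), of x i] by simp
      then have "f i x \<in> car (fst s) i \<or> (\<exists>c\<in>Field ?r. f i x \<in> car (fst (T c)) i)"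
        by (auto simp: cQ[symmetric] Sup_apply)
      then have "\<exists>c\<in>Field ?r. f i x \<in> car (fst (T c)) i"
      proof
        assume x: "f i x \<in> car (fst s) i"
        have "Field ?r \<noteq> {}" using rinf by (metis finite.emptyI)
        then obtain c where c: "c \<in> Field ?r" by blast
        then have "le (fst s) (fst (T c))" using sT[OF c] by (simp add: les_def)
        from le_car[OF this x] c show ?thesis by blast
      qed
      then show "z \<in> (\<Union>c\<in>Field ?r. As c)" using z by (simp add: As_def)
    qed
    have "bnd A (Sigma UNIV K)"
    proof (rule bnd_Sigma[OF A_inf I_bnd])
      show "bnd A (K i)" for i
        by (rule subset_imp_lepoll[OF order_trans[OF sub_subset[OF G(3)] G(2)]])
    qed
    from bnd_image[OF this] have "card_of ?B \<le>o card_of A" unfolding lepoll_iff_card_of .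
    moreover have "relChain ?r As"
      unfolding relChain_def
    proof (intro allI impI)
      fix c d assume cd: "(c, d) \<in> ?r"
      then have d: "d \<in> Field ?r" by (auto simp: Field_def)
      show "As c \<subseteq> As d"
      proof (cases "c = d")
        case False
        then have "les (T c) (T d)" using is_tower_le[OF T d, of c] cd by (simp add: underS_def)
        then have "le (fst (T c)) (fst (T d))" by (simp add: les_def)
        from le_fun[OF this] show ?thesis by (auto simp: As_def le_fun_def)
      qed simp
    qed
    ultimately obtain c where c: "c \<in> Field ?r" "?B \<subseteq> As c"
      using cardSuc_UNION[of "card_of A" As ?B, OF card_of_Card_order] A_inf cov by (auto simp only: Field_card_of)
    \<comment> \<open>\<open>T d\<close> solves the problems posed at the union of the stages before
      \<open>d\<close>. The problem is posed at \<open>T c\<close>, so any \<open>d\<close> strictly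
      above \<open>c\<close> will do; it exists because an infinite cardinal has no last
      element.\<close>
    obtain d where d: "d \<in> Field ?r" "c \<in> underS ?r d"
      using infinite_Card_order_limit[OF co rinf c(1)] by (auto simp: underS_def)
    have fT: "f i x \<in> car (fst (T c)) i" if "x \<in> K i" for i x
      using c(2) that by (force simp: As_def)
    have oG: "ob (res G K)" by (rule ob_res[OF G(1,3)])
    have sT: "sub (car (fst (T c))) (fst ?Q)" by (rule le_sub[OF lT(2)[OF c(1)] oQ lT(1)[OF c(1)]])
    have "le (res (fst ?Q) (car (fst (T c)))) (fst (T c))"
      by (rule le_le[OF ob_res[OF oQ sT] sub_le[OF oQ sT] lT(1)[OF c(1)]]) simp
    then have fhom: "hom (res G K) (fst (T c)) f"
      using hom_le[OF hom_res2[OF G(4), of "car (fst (T c))"]] fT by simp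
    have qT: "snd ?Q i y = snd (T c) i y" if "y \<in> car (fst (T c)) i" for i y
      using TQ[OF c(1)] that by (simp add: les_def)
    have "prob \<S> A Z (T c) G K f g"
      using p fhom qT fT G(6) unfolding prob_def by metis
    moreover have "les (T c) (?L d)" using is_tower_le_lub[OF T d(1)] d(2) by blast
    ultimately have "prob \<S> A Z (?L d) G K f g" by (rule prob_les)
    then have "sol (T d) G K f g" using Tok[OF d(1)] unfolding solved_def by blast
    then show ?thesis by (rule sol_les[OF _ TQ[OF d(1)]])
  qed
  ultimately show thesis using Q that by blast
qed

text \<open>The bounded subobject generated by \<open>B0\<close> and closed under an extra bounded
  rule \<open>\<Theta>\<close>. The rule is the hook through which later arguments impose their own
  closing-off conditions.\<close>

lemma gensub:
  fixes M :: "('i, 'r, 'a) gob"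
  assumes M: "ob M" and B0: "B0 \<subseteq> Sigma UNIV (car M)" "bnd A B0"
    and \<Theta>: "\<And>z. z \<in> Sigma UNIV (car M) \<Longrightarrow> bnd A (\<Theta> z) \<and> \<Theta> z \<subseteq> Sigma UNIV (car M)"
  obtains B where "sub B M" "bnd A (Sigma UNIV B)" "B0 \<subseteq> Sigma UNIV B"
    "\<And>z. z \<in> Sigma UNIV B \<Longrightarrow> \<Theta> z \<subseteq> Sigma UNIV B"
proof -
  let ?X = "Sigma (UNIV :: 'i set) (car M)"
  \<comment> \<open>All closure conditions are packed into one binary operation, as
    \<open>bnd_closure\<close> expects; sums are formed only within one sort.\<close>
  define h where "h z w = (if fst z = fst w then {(fst z, ad M (fst z) (snd z) (snd w))} else {}) \<union>
      (\<lambda>a. (fst z, sm M (fst z) a (snd z))) ` carrier R \<union>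
      (if fst z \<in> W then {(sh (fst z), df M (fst z) (snd z))} else {}) \<union> \<Theta> z" for z w
  let ?B0 = "B0 \<union> (\<lambda>i. (i, ze M i)) ` UNIV"
  have h: "bnd A (h z w) \<and> h z w \<subseteq> ?X" if zw: "z \<in> ?X" "w \<in> ?X" for z w
  proof
    show "bnd A (h z w)"
      unfolding h_def using \<Theta>[OF zw(1)]
      by (intro bnd_Un[OF A_inf] bnd_image[OF R_bnd]) (auto intro: bnd_countable[OF A_inf])
    show "h z w \<subseteq> ?X" using zw \<Theta>[OF zw(1)] M by (auto simp: h_def split: if_splits)
  qed
  have sB0: "?B0 \<subseteq> ?X" using B0(1) M by auto
  have bB0: "bnd A ?B0" by (intro bnd_Un[OF A_inf] B0(2) bnd_image[OF I_bnd])
  obtain C where C: "?B0 \<subseteq> C" "C \<subseteq> ?X" "bnd A C" "\<And>z w. z \<in> C \<Longrightarrow> w \<in> C \<Longrightarrow> h z w \<subseteq> C"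
    by (rule bnd_closure[OF A_inf h sB0 bB0]) (assumption | rule that)+
  define B where "B i = {x. (i, x) \<in> C}" for i
  have BC: "Sigma UNIV B = C" by (auto simp: B_def)
  have "sub B M"
    unfolding sub_def
  proof (intro allI conjI ballI impI subsetI)
    fix i
    show "x \<in> car M i" if "x \<in> B i" for x using that C(2) by (auto simp: B_def)
    show "ze M i \<in> B i" using C(1) by (auto simp: B_def)
    fix x assume x: "x \<in> B i"
    then have xC: "(i, x) \<in> C" by (simp add: B_def)
    show "ad M i x y \<in> B i" if "y \<in> B i" for y
      using C(4)[OF xC, of "(i, y)"] that by (auto simp: B_def h_def)
    show "sm M i a x \<in> B i" if "a \<in> carrier R" for a
      using C(4)[OF xC xC] that by (auto simp: B_def h_def)
    show "df M i x \<in> B (sh i)" if "i \<in> W"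
      using C(4)[OF xC xC] that by (auto simp: B_def h_def)
  qed
  moreover have "\<Theta> z \<subseteq> Sigma UNIV B" if "z \<in> Sigma UNIV B" for z
    using C(4)[of z z] that unfolding BC by (auto simp: h_def)
  moreover have "B0 \<subseteq> Sigma UNIV B" unfolding BC using C(1) by blast
  ultimately show thesis using that[of B] C(3) BC by simp
qed

text \<open>Moves a bounded object into the one place where lifting problems are posed and codes are
  counted.\<close>

lemma copy_in_A:
  fixes C :: "('i, 'r, 'a) gob"
  assumes C: "ob C" and b: "bnd A (Sigma UNIV (car C))"
  obtains E :: "('i, 'r, 'u) gob" and e d where "ob E" "\<And>i. car E i \<subseteq> A" "\<And>i. car E i = e i ` car C i"
    "hom C E e" "hom E C d" "\<And>i x. x \<in> car C i \<Longrightarrow> d i (e i x) = x" "\<And>i y. y \<in> car E i \<Longrightarrow> e i (d i y) = y"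
proof -
  obtain \<phi> :: "'i \<times> 'a \<Rightarrow> 'u" where \<phi>: "inj_on \<phi> (Sigma UNIV (car C))" "\<phi> ` Sigma UNIV (car C) \<subseteq> A"
    using b unfolding lepoll_def by blast
  define e where "e i x = \<phi> (i, x)" for i x
  have "inj_on (e i) (car C i)" for i
    using inj_onD[OF \<phi>(1)] by (fastforce simp: e_def intro: inj_onI)
  then obtain E d where E: "ob E" "\<And>i. car E i = e i ` car C i" "hom C E e" "hom E C d"
    "\<And>i x. x \<in> car C i \<Longrightarrow> d i (e i x) = x"
    using iso_copy[OF C] by blast
  have cA: "car E i \<subseteq> A" for i using \<phi>(2) by (auto simp: E(2) e_def)
  have ed: "e i (d i y) = y" if "y \<in> car E i" for i y
    using that E(2,5) by auto
  show thesis by (rule that[OF E(1) cA E(2-5) ed])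
qed

lemma quo_iso:
  fixes C :: "('i, 'r, 'a) gob" and E :: "('i, 'r, 'b) gob" and S :: "('i, 'r, 'c) gob"
    and e :: "'i \<Rightarrow> 'a \<Rightarrow> 'b" and d :: "'i \<Rightarrow> 'b \<Rightarrow> 'a" and p :: "'i \<Rightarrow> 'a \<Rightarrow> 'c"
  assumes obs: "ob C" "ob E" "ob S" and N: "sub N C"
    and d: "hom E C d" "\<And>i x. x \<in> car C i \<Longrightarrow> d i (e i x) = x" "\<And>i. car E i = e i ` car C i"
    and p: "quo C N S p"
  shows "quo E (\<lambda>i. e i ` N i) S (\<lambda>i y. p i (d i y))"
  unfolding quo_def
proof (intro conjI allI ballI)
  show "hom E S (\<lambda>i y. p i (d i y))" by (rule hom_comp[OF d(1) quo_hom[OF p]])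
  fix i
  have "(\<lambda>y. p i (d i y)) ` car E i = p i ` car C i" by (simp add: d(3) image_image d(2))
  then show "(\<lambda>y. p i (d i y)) ` car E i = car S i" using quo_surj[OF p] by simp
  fix y assume "y \<in> car E i"
  then have "y \<in> e i ` car C i" by (simp only: d(3))
  then obtain x where x: "x \<in> car C i" "y = e i x" by (elim imageE) simp
  have "x \<in> N i \<longleftrightarrow> y \<in> e i ` N i"
  proof
    assume "y \<in> e i ` N i"
    then show "x \<in> N i"
    proof (rule imageE)
      fix x' assume x': "y = e i x'" "x' \<in> N i"
      have "d i (e i x) = d i (e i x')" using x(2) x'(1) by simp
      then have "x = x'" by (simp only: d(2)[OF x(1)] d(2)[OF sub_car[OF N x'(2)]])
      then show "x \<in> N i" using x' by simp
    qed
  next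
    assume "x \<in> N i"
    then show "y \<in> e i ` N i" unfolding x(2) by (rule imageI)
  qed
  then show "p i (d i y) = ze S i \<longleftrightarrow> y \<in> e i ` N i" using quo_ker[OF p x(1)] x d(2) by simp
qed

text \<open>An extension \<open>M\<close> of \<open>S\<close> may be arbitrarily large, but
  \<open>S\<close> is bounded: lifts of its elements generate a bounded \<open>B\<close> with
  \<open>M = N + B\<close>. The problem of extending from \<open>N \<inter> B\<close> to
  \<open>B\<close> has a copy inside \<open>A\<close>, and its solution is glued with the given map
  on \<open>N\<close>.\<close>

lemma rlp_ext0:
  assumes t: "t \<in> over TYPE('u) Z" and Z: "ob Z" and S: "S \<in> \<S>" "ob S" "bnd A (Sigma UNIV (car S))"
    and rlp: "\<And>F K f g. prob \<S> A Z t F K f g \<Longrightarrow> sol t F K f g"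
  shows "ext0 S (res (fst t) (kr (fst t) Z (snd t)))"
  unfolding ext0_def
proof (intro allI impI, elim conjE)
  fix M N p f
  let ?Q = "fst t" and ?q = "snd t"
  let ?V = "res ?Q (kr ?Q Z ?q)"
  assume M: "ob (M :: ('i, 'r, 'u) gob)" "sml TYPE('u) M" "sub N M" "quo M N S p" "hom (res M N) ?V f"
  have Q: "ob ?Q" "hom ?Q Z ?q" using t by (auto simp: over_def)
  have V: "sub (kr ?Q Z ?q) ?Q" by (rule sub_kernel[OF Q(1) Z Q(2)])
  have oV: "ob ?V" by (rule ob_res[OF Q(1) V])
  have "\<forall>i. \<forall>y\<in>car S i. \<exists>x\<in>car M i. p i x = y" using quo_lift[OF M(4)] by blast
  then obtain l where l: "\<And>i y. y \<in> car S i \<Longrightarrow> l i y \<in> car M i \<and> p i (l i y) = y" by metis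
  \<comment> \<open>One lift for each element of \<open>S\<close>; a subobject containing them maps
    onto \<open>S\<close>.\<close>
  let ?B0 = "(\<lambda>(i, y). (i, l i y)) ` Sigma UNIV (car S)"
  have sB: "?B0 \<subseteq> Sigma UNIV (car M)" using l by auto
  obtain B where B: "sub B M" "bnd A (Sigma UNIV B)" "?B0 \<subseteq> Sigma UNIV B"
    by (rule gensub[OF M(1) sB bnd_image[OF S(3)], where \<Theta> = "\<lambda>_. {}"]) (simp, rule that)
  have lB: "l i y \<in> B i" if "y \<in> car S i" for i y using B(3) that by auto
  let ?C = "res M B"
  let ?N = "\<lambda>i. N i \<inter> B i"
  have oC: "ob ?C" by (rule ob_res[OF M(1) B(1)])
  have N': "sub ?N ?C" using sub_Int[OF M(3) B(1)] sub_res[OF B(1)] by (simp add: le_fun_def)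
  have pC: "quo ?C ?N S p"
    unfolding quo_def
  proof (intro conjI allI ballI)
    show "hom ?C S p" by (rule hom_res[OF quo_hom[OF M(4)] B(1)])
    fix i
    show "p i ` car ?C i = car S i"
      using hom_car[OF quo_hom[OF M(4)]] sub_car[OF B(1)] l lB by force
    show "p i x = ze S i \<longleftrightarrow> x \<in> ?N i" if "x \<in> car ?C i" for x
      using quo_ker[OF M(4), of x i] sub_car[OF B(1)] that by simp
  qed
  obtain E :: "('i, 'r, 'u) gob" and e d where E: "ob E" "\<And>i. car E i \<subseteq> A" "\<And>i. car E i = e i ` car ?C i"
    "hom ?C E e" "hom E ?C d" "\<And>i x. x \<in> car ?C i \<Longrightarrow> d i (e i x) = x" "\<And>i y. y \<in> car E i \<Longrightarrow> e i (d i y) = y"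
    by (rule copy_in_A[OF oC]) (use B(2) in simp, rule that)
  define K where "K i = e i ` ?N i" for i
  have K: "sub K E" unfolding K_def by (rule sub_image[OF oC E(1,4) N'])
  have dK: "d i y \<in> N i" if "y \<in> K i" for i y using that E(6) by (auto simp: K_def)
  have dh: "hom (res E K) (res M N) d"
    using hom_res2[OF hom_res2D[OF hom_res[OF E(5) K] B(1)], of N] dK by simp
  \<comment> \<open>The prescribed map to \<open>Z\<close> is zero, so a solution takes its values
    in the kernel.\<close>
  have "prob \<S> A Z t E K (\<lambda>i y. f i (d i y)) (\<lambda>i y. ze Z i)"
    unfolding prob_def
  proof (intro conjI allI ballI)
    show "ob E" by fact
    show "car E i \<subseteq> A" for i by fact
    show "sub K E" by fact
    show "\<exists>S\<in>\<S>. \<exists>p. quo E K S p"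
      using quo_iso[OF oC E(1) S(2) N' E(5,6,3) pC] S(1) unfolding K_def[abs_def] by blast
    show "hom (res E K) ?Q (\<lambda>i y. f i (d i y))" by (rule hom_res2D[OF hom_comp[OF dh M(5)] V])
    show "hom E Z (\<lambda>i y. ze Z i)" by (rule hom_zero[OF E(1) Z])
    show "?q i (f i (d i y)) = ze Z i" if "y \<in> K i" for i y
      using hom_car[OF M(5), of "d i y" i] dK[OF that] by simp
  qed
  from rlp[OF this] obtain h where h: "hom E ?Q h" "\<And>i y. y \<in> K i \<Longrightarrow> h i y = f i (d i y)"
    "\<And>i y. y \<in> car E i \<Longrightarrow> ?q i (h i y) = ze Z i"
    unfolding sol_def by blast
  have h': "hom E ?V h" by (rule hom_res2[OF h(1)]) (use h(3) hom_car[OF h(1)] in simp)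
  have w: "hom ?C ?V (\<lambda>i x. h i (e i x))" by (rule hom_comp[OF E(4) h'])
  have oN: "ob (res M N)" by (rule ob_res[OF M(1,3)])
  \<comment> \<open>Gluing over \<open>M = N + B\<close>; if a sum vanishes, both summands lie in
    \<open>N \<inter> B\<close>, where the maps agree.\<close>
  obtain g where g: "hom M ?V g" "\<And>i x. x \<in> car (res M N) i \<Longrightarrow> g i x = f i x"
  proof (rule glue[OF oN oC M(1) oV hom_res[OF hom_id[OF M(1)] M(3)] hom_res[OF hom_id[OF M(1)] B(1)] _ M(5) w])
    fix i y assume y: "y \<in> car M i"
    let ?b = "l i (p i y)"
    have b: "?b \<in> B i" "?b \<in> car M i" "p i ?b = p i y"
      using hom_car[OF quo_hom[OF M(4)] y] l lB by auto
    then have "mi M i y ?b \<in> N i" using quo_eq[OF M(1) S(2) M(4) y b(2)] by simp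
    then show "\<exists>x\<in>car (res M N) i. \<exists>b\<in>car ?C i. y = ad M i x b"
      using b M(1) y by (intro bexI[of _ "mi M i y ?b"] bexI[of _ ?b]) simp_all
  next
    fix i x y assume xy: "x \<in> car (res M N) i" "y \<in> car ?C i" "ad M i x y = ze M i"
    have c: "x \<in> car M i" "y \<in> car M i" using xy sub_car[OF M(3)] sub_car[OF B(1)] by auto
    have yx: "y = ng M i x" by (rule ng_unique[OF M(1) c xy(3)])
    then have yN: "y \<in> N i" using sub_ng[OF M(1,3)] xy(1) by simp
    then have "e i y \<in> K i" using xy(2) by (simp add: K_def)
    then have "h i (e i y) = f i y" using h(2) E(6) xy(2) by simp
    also have "\<dots> = ng ?V i (f i x)"
      using hom_ng[OF oN oV M(5) xy(1)] ng_res[OF M(1,3)] xy(1) yx by simp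
    finally show "ad ?V i (f i x) (h i (e i y)) = ze ?V i"
      using ad_ng[OF oV hom_car[OF M(5) xy(1)]] by simp
  qed blast
  then show "\<exists>g. hom M ?V g \<and> (\<forall>i. \<forall>x\<in>N i. g i x = f i x)" by auto
qed

lemma over_zero: fixes Z :: "('i, 'r, 'u) gob" assumes "smob TYPE('u) Z" shows "(res Z (\<lambda>i. {ze Z i}), \<lambda>i x. x) \<in> over TYPE('u) Z"
  using assms smob_res[OF assms sub_zero] hom_res[OF hom_id sub_zero] by (auto simp: over_def)

text \<open>The small object argument is started at zero over \<open>Z\<close>. Problems with zero
  subobject lift every map from \<open>\<S>\<close> to \<open>Z\<close>, so the result is onto;
  problems over the zero map put the kernel into the right orthogonal class.\<close>

lemma special_precover:
  fixes Z :: "('i, 'r, 'u) gob"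
  assumes Z: "smob TYPE('u) Z"
    and S: "\<And>S. S \<in> \<S> \<Longrightarrow> ob S \<and> bnd A (Sigma UNIV (car S))"
    and gen: "\<And>i x. x \<in> car Z i \<Longrightarrow> \<exists>S\<in>\<S>. \<exists>g. hom S Z g \<and> x \<in> g i ` car S i"
  obtains Q q F where "smob TYPE('u) Q" "quo Q (kr Q Z q) Z q" "filtr \<S> (\<lambda>i. {ze Q i}) Q F"
    "\<And>S. S \<in> \<S> \<Longrightarrow> ext0 S (res Q (kr Q Z q))"
proof -
  have oZ: "ob Z" using Z by blast
  have obS: "ob S" if "S \<in> \<S>" for S using S that by blast
  \<comment> \<open>The zero object is taken inside \<open>Z\<close> only to have a concrete object
    to start from.\<close>
  define s0 :: "('i, 'r, 'u) state" where "s0 = (res Z (\<lambda>i. {ze Z i}), \<lambda>i x. x)"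
  have ov: "s0 \<in> over TYPE('u) Z" using over_zero[OF Z] by (simp add: s0_def)
  obtain t where t: "t \<in> over TYPE('u) Z" "les s0 t" "\<exists>F. filtr \<S> (car (fst s0)) (fst t) F"
    "\<And>F K f g. prob \<S> A Z t F K f g \<Longrightarrow> sol t F K f g"
    by (rule small_object_argument[OF ov Z obS]) (assumption | rule that)+
  obtain Q q where tq: "t = (Q, q)" by (cases t)
  have Q: "smob TYPE('u) Q" "hom Q Z q" using t(1) by (auto simp: over_def tq)
  have oQ: "ob Q" using Q by blast
  have "le (res Z (\<lambda>i. {ze Z i})) Q" using t(2) by (simp add: les_def tq s0_def)
  from le_ze[OF ob_res[OF oZ sub_zero[OF oZ]] oQ this]
  have zz: "ze Z i = ze Q i" for i by simp
  obtain F where F: "filtr \<S> (\<lambda>i. {ze Q i}) Q F" using t(3) by (auto simp: tq zz s0_def)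
  have "quo Q (kr Q Z q) Z q"
    unfolding quo_def
  proof (intro conjI Q(2) allI ballI)
    fix i
    show "q i ` car Q i = car Z i"
    proof (intro equalityI subsetI)
      show "z \<in> car Z i" if "z \<in> q i ` car Q i" for z using that hom_car[OF Q(2)] by blast
      fix z assume z: "z \<in> car Z i"
      obtain S g where S': "S \<in> \<S>" "hom S Z g" "z \<in> g i ` car S i" using gen[OF z] by blast
      have oS: "ob S" using obS S'(1) by blast
      obtain E :: "('i, 'r, 'u) gob" and e d where E: "ob E" "\<And>i. car E i \<subseteq> A" "\<And>i. car E i = e i ` car S i"
        "hom S E e" "hom E S d" "\<And>i x. x \<in> car S i \<Longrightarrow> d i (e i x) = x" "\<And>i y. y \<in> car E i \<Longrightarrow> e i (d i y) = y"
        by (rule copy_in_A[OF oS conjunct2[OF S[OF S'(1)]]]) (rule that)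
      have e0: "e i ` {ze S i} = {ze E i}" for i using hom_ze[OF oS E(1,4)] by simp
      have o0: "ob (res E (\<lambda>i. {ze E i}))" by (rule ob_res[OF E(1) sub_zero[OF E(1)]])
      have gd: "hom E Z (\<lambda>i y. g i (d i y))" by (rule hom_comp[OF E(5) S'(2)])
      \<comment> \<open>A solution is a lift of the map \<open>g\<close> through \<open>q\<close>,
        and \<open>g\<close> hits \<open>z\<close>.\<close>
      have "prob \<S> A Z t E (\<lambda>i. {ze E i}) (\<lambda>i y. ze Q i) (\<lambda>i y. g i (d i y))"
        unfolding prob_def
      proof (intro conjI allI ballI)
        show "ob E" by fact
        show "car E i \<subseteq> A" for i by fact
        show "sub (\<lambda>i. {ze E i}) E" by (rule sub_zero[OF E(1)])
        show "\<exists>S\<in>\<S>. \<exists>p. quo E (\<lambda>i. {ze E i}) S p"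
          using quo_iso[OF oS E(1) oS sub_zero[OF oS] E(5,6,3) quo_zero[OF oS]] S'(1) unfolding e0 by blast
        show "hom (res E (\<lambda>i. {ze E i})) (fst t) (\<lambda>i y. ze Q i)" using hom_zero[OF o0 oQ] by (simp add: tq)
        show "hom E Z (\<lambda>i y. g i (d i y))" by (rule gd)
        show "snd t i (ze Q i) = g i (d i y)" if "y \<in> {ze E i}" for i y
          using that hom_ze[OF oQ oZ Q(2)] hom_ze[OF E(1) oZ gd, of i] by (simp add: tq)
      qed
      from t(4)[OF this] obtain h where h: "hom E Q h" "\<And>i y. y \<in> car E i \<Longrightarrow> q i (h i y) = g i (d i y)"
        unfolding sol_def tq by auto
      obtain x where x: "x \<in> car S i" "z = g i x" using S'(3) by blast
      then have "e i x \<in> car E i" using E(3) by simp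
      then have "q i (h i (e i x)) = z" "h i (e i x) \<in> car Q i" using h E(6) x hom_car[OF h(1)] by auto
      then show "z \<in> q i ` car Q i" by blast
    qed
    show "q i x = ze Z i \<longleftrightarrow> x \<in> kr Q Z q i" if "x \<in> car Q i" for x using that by simp
  qed
  moreover have "ext0 S' (res Q (kr Q Z q))" if "S' \<in> \<S>" for S'
    using rlp_ext0[OF t(1) oZ that _ _ t(4)] S[OF that] by (simp add: tq)
  ultimately show thesis using that[of Q q F] Q F by blast
qed

text \<open>The same construction over the zero object, started at \<open>X\<close>: the kernel of
  the structure map is then the whole result.\<close>

lemma special_preenvelope:
  fixes X :: "('i, 'r, 'u) gob"
  assumes X: "smob TYPE('u) X"
    and S: "\<And>S. S \<in> \<S> \<Longrightarrow> ob S \<and> bnd A (Sigma UNIV (car S))"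
  obtains B F where "smob TYPE('u) B" "le X B" "filtr \<S> (car X) B F" "\<And>S. S \<in> \<S> \<Longrightarrow> ext0 S B"
proof -
  have oX: "ob X" using X by blast
  have obS: "ob S" if "S \<in> \<S>" for S using S that by blast
  let ?Z = "res X (\<lambda>i. {ze X i})"
  have Z: "smob TYPE('u) ?Z" by (rule smob_res[OF X sub_zero[OF oX]])
  have oZ: "ob ?Z" using Z by blast
  have h: "hom X ?Z (\<lambda>i x. ze X i)" using hom_zero[OF oX oZ] by simp
  define s0 :: "('i, 'r, 'u) state" where "s0 = (X, \<lambda>i x. ze X i)"
  have ov: "s0 \<in> over TYPE('u) ?Z" using X h by (simp add: over_def s0_def)
  obtain t where t: "t \<in> over TYPE('u) ?Z" "les s0 t" "\<exists>F. filtr \<S> (car (fst s0)) (fst t) F"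
    "\<And>F K f g. prob \<S> A ?Z t F K f g \<Longrightarrow> sol t F K f g"
    by (rule small_object_argument[OF ov Z obS]) (assumption | rule that)+
  obtain B q where tq: "t = (B, q)" by (cases t)
  have B: "smob TYPE('u) B" "hom B ?Z q" using t(1) by (auto simp: over_def tq)
  have le: "le X B" using t(2) by (simp add: les_def tq s0_def)
  have "kr B ?Z q = car B" using hom_car[OF B(2)] by auto
  then have "ext0 S' B" if "S' \<in> \<S>" for S'
    using rlp_ext0[OF t(1) oZ that _ _ t(4)] S[OF that] by (simp add: tq)
  moreover obtain F where "filtr \<S> (car X) B F" using t(3) by (auto simp: tq s0_def)
  ultimately show thesis using that B le by blast
qed

end

section \<open>Hill's lemma\<close>

context gcatu begin

abbreviation zs :: "('i, 'r, 'a) gob \<Rightarrow> 'i \<Rightarrow> 'a set" where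
  "zs Q \<equiv> \<lambda>i. {ze Q i}"

text \<open>
  For each successor stage, \<open>P\<close> either meets it only in the preceding stage or covers it modulo
  the preceding stage; such \<open>P\<close> inherit a filtration, and so do the quotients between them
  (Hill's lemma).
\<close>

definition good :: "('i, 'r, 'a) gob \<Rightarrow> ('i \<Rightarrow> 'a set) set \<Rightarrow> ('i \<Rightarrow> 'a set) \<Rightarrow> bool" where
  "good Q F P \<longleftrightarrow> sub P Q \<and>
     (\<forall>L\<in>F. (\<forall>i. L i \<inter> P i \<subseteq> prev (zs Q) F L i) \<or> (\<forall>i. L i \<subseteq> sums Q (prev (zs Q) F L) P i))"

lemma good_sub: "good Q F P \<Longrightarrow> sub P Q"
  by (simp add: good_def)

lemma goodD:
  assumes "good Q F P" "L \<in> F"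
  obtains "\<And>i x. x \<in> L i \<Longrightarrow> x \<in> P i \<Longrightarrow> x \<in> prev (zs Q) F L i"
  | "\<And>i x. x \<in> L i \<Longrightarrow> x \<in> sums Q (prev (zs Q) F L) P i"
  using assms unfolding good_def by blast

lemma good_zero: assumes Q: "ob Q" and F: "filtr \<S> (zs Q) Q F" shows "good Q F (zs Q)"
  unfolding good_def
proof (intro conjI ballI disjI1 allI)
  show "sub (zs Q) Q" by (rule sub_zero[OF Q])
  fix L i assume "L \<in> F"
  show "L i \<inter> zs Q i \<subseteq> prev (zs Q) F L i"
    using prev_upper1[of "zs Q" F L] by (auto simp: le_fun_def)
qed

lemma sums_mono: "N \<le> N' \<Longrightarrow> B \<le> B' \<Longrightarrow> sums Q N B i \<subseteq> sums Q N' B' i"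
  unfolding sums_def le_fun_def by blast

text \<open>For a fixed stage, if some member covers it then so does the union; otherwise all
  members meet it only in its predecessor, and so does the union.\<close>

lemma good_Sup_chain:
  assumes ne: "\<G> \<noteq> {}" and g: "\<And>P. P \<in> \<G> \<Longrightarrow> good Q F P"
    and chain: "\<And>N N'. N \<in> \<G> \<Longrightarrow> N' \<in> \<G> \<Longrightarrow> N \<le> N' \<or> N' \<le> N"
  shows "good Q F (Sup \<G>)"
  unfolding good_def
proof (intro conjI ballI)
  show "sub (Sup \<G>) Q" by (rule sub_Sup_chain[OF ne good_sub[OF g] chain])
  fix L assume L: "L \<in> F"
  show "(\<forall>i. L i \<inter> Sup \<G> i \<subseteq> prev (zs Q) F L i) \<or> (\<forall>i. L i \<subseteq> sums Q (prev (zs Q) F L) (Sup \<G>) i)"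
  proof (cases "\<exists>P\<in>\<G>. \<forall>i. L i \<subseteq> sums Q (prev (zs Q) F L) P i")
    case True
    then obtain P where P: "P \<in> \<G>" "\<forall>i. L i \<subseteq> sums Q (prev (zs Q) F L) P i" by blast
    have "sums Q (prev (zs Q) F L) P i \<subseteq> sums Q (prev (zs Q) F L) (Sup \<G>) i" for i
      by (rule sums_mono[OF order_refl Sup_upper[OF P(1)]])
    then have "\<forall>i. L i \<subseteq> sums Q (prev (zs Q) F L) (Sup \<G>) i" using P(2) by (meson order_trans)
    then show ?thesis ..
  next
    case False
    have "L i \<inter> P i \<subseteq> prev (zs Q) F L i" if "P \<in> \<G>" for P i
      using g[OF that] L False that unfolding good_def by blast
    then have "\<forall>i. L i \<inter> Sup \<G> i \<subseteq> prev (zs Q) F L i" by (simp add: Sup_apply) blast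
    then show ?thesis ..
  qed
qed

text \<open>The filtration of \<open>P'\<close> over \<open>P\<close> is induced by \<open>L\<close>
  going to \<open>(L \<inter> P') + P\<close>. A stage contributes its full quotient if
  \<open>P'\<close> covers it while \<open>P\<close> avoids it, and nothing in the other
  cases.\<close>

lemma good_quotient:
  assumes Q: "ob Q" and obS: "\<And>S. S \<in> \<S> \<Longrightarrow> ob S" and F: "filtr \<S> (zs Q) Q F"
    and P: "good Q F P" and P': "good Q F P'" and le: "P \<le> P'"
  shows "\<exists>F'. filtr \<S> P (res Q P') F'"
proof -
  note sP = good_sub[OF P] and sP' = good_sub[OF P']
  have PP': "x \<in> P' i" if "x \<in> P i" for x i using that le by (auto simp: le_fun_def)
  let ?M = "res Q P'"
  have oM: "ob ?M" by (rule ob_res[OF Q sP'])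
  obtain r where r: "Well_order r" "Field r = F" "\<And>N. N \<in> F \<Longrightarrow> underS r N = {L \<in> F. L < N}"
    using wochain_Well_order[OF filtr_wo[OF F]] by blast
  define T where "T L = sums Q (\<lambda>i. L i \<inter> P' i) P" for L
  have sub_T: "sub (T L) Q" "sub (T L) ?M" if "sub L Q" for L
  proof -
    show 1: "sub (T L) Q" unfolding T_def by (rule sub_sums[OF Q sub_Int[OF that sP'] sP])
    have "T L \<le> P'" unfolding T_def le_fun_def using PP' by (auto elim!: sumsE intro: sub_ad[OF sP'])
    then show "sub (T L) ?M" using 1 sub_res[OF sP'] by blast
  qed
  have PT: "P \<le> T L" if "sub L Q" for L
    unfolding T_def by (intro le_funI subsetI sums_upper2[OF Q sub_Int[OF that sP'] sP])
  have T_mono: "T K \<le> T L" if "K \<le> L" for K L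
  proof (rule le_funI)
    fix i
    have "(\<lambda>i. K i \<inter> P' i) \<le> (\<lambda>i. L i \<inter> P' i)" using that by (auto simp: le_fun_def)
    then show "T K i \<subseteq> T L i" unfolding T_def by (rule sums_mono) simp
  qed
  note prevS = filtr_prev_sub[OF F sub_zero[OF Q]]
  have Tmem: "x \<in> T L i" if "x \<in> L i" "x \<in> P' i" "sub L Q" for x L i
    unfolding T_def using that sums_upper1[OF Q sub_Int[OF that(3) sP'] sP] by blast
  have TSup: "T (Sup (insert (zs Q) G)) = Sup (insert P (T ` G))" if G: "G \<subseteq> F" for G
  proof (rule antisym)
    show "T (Sup (insert (zs Q) G)) \<le> Sup (insert P (T ` G))"
    proof (intro le_funI subsetI)
      fix i z assume "z \<in> T (Sup (insert (zs Q) G)) i"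
      then obtain x y where xy: "x \<in> Sup (insert (zs Q) G) i" "x \<in> P' i" "y \<in> P i" "z = ad Q i x y"
        unfolding T_def by (auto elim!: sumsE)
      then consider "x = ze Q i" | K where "K \<in> G" "x \<in> K i" by (auto simp: Sup_apply)
      then show "z \<in> Sup (insert P (T ` G)) i"
      proof cases
        case 1
        then have "z = y" using xy Q sub_car[OF sP] by simp
        then show ?thesis using xy by (auto simp: Sup_apply)
      next
        case (2 K)
        then have "z \<in> T K i" unfolding T_def xy(4) using xy by (intro sumsI) auto
        then show ?thesis using 2 by (auto simp: Sup_apply)
      qed
    qed
    show "Sup (insert P (T ` G)) \<le> T (Sup (insert (zs Q) G))"
    proof (rule Sup_least)
      fix K assume "K \<in> insert P (T ` G)"
      then consider "K = P" | L where "L \<in> G" "K = T L" by blast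
      then show "K \<le> T (Sup (insert (zs Q) G))"
      proof cases
        case 1
        have "P \<le> T (zs Q)" by (rule PT[OF sub_zero[OF Q]])
        also have "\<dots> \<le> T (Sup (insert (zs Q) G))" by (rule T_mono) (rule Sup_upper, simp)
        finally show ?thesis using 1 by simp
      next
        case 2
        then show ?thesis using T_mono[of L "Sup (insert (zs Q) G)"] Sup_upper[of L "insert (zs Q) G"] by simp
      qed
    qed
  qed
  show ?thesis
  proof (rule filtr_tower[OF oM r(1), of T "\<lambda>L. T (prev (zs Q) F L)" P])
    fix L assume "L \<in> Field r"
    then have L: "L \<in> F" using r(2) by simp
    note sL = filtr_sub[OF F L] and sp = prevS[OF L]
    have pL: "prev (zs Q) F L \<le> L" by (rule prev_le[OF filtr_ge[OF F L]])
    have pLx: "x \<in> L i" if "x \<in> prev (zs Q) F L i" for x i using pL that by (auto simp: le_fun_def)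
    show "sub (T L) ?M" "sub (T (prev (zs Q) F L)) ?M" by (rule sub_T[OF sL] sub_T[OF sp])+
    show "T (prev (zs Q) F L) = Sup (insert P (T ` underS r L))"
      unfolding prev_def r(3)[OF L] by (rule TSup) blast
    have le1: "T (prev (zs Q) F L) \<le> T L" by (rule T_mono[OF pL])
    show "T (prev (zs Q) F L) = T L \<or> T (prev (zs Q) F L) \<le> T L \<and>
        (\<exists>S\<in>\<S>. \<exists>p. quo (res ?M (T L)) (T (prev (zs Q) F L)) S p)"
    proof (rule goodD[OF P' L])
      assume a: "\<And>i x. x \<in> L i \<Longrightarrow> x \<in> P' i \<Longrightarrow> x \<in> prev (zs Q) F L i"
      have "(\<lambda>i. L i \<inter> P' i) \<le> (\<lambda>i. prev (zs Q) F L i \<inter> P' i)" using a by (auto simp: le_fun_def)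
      then have "T L \<le> T (prev (zs Q) F L)" unfolding T_def by (rule le_funI[OF sums_mono]) simp
      then show ?thesis using le1 by simp
    next
      assume b: "\<And>i x. x \<in> L i \<Longrightarrow> x \<in> sums Q (prev (zs Q) F L) P' i"
      show ?thesis
      proof (rule goodD[OF P L])
        assume c: "\<And>i x. x \<in> L i \<Longrightarrow> x \<in> sums Q (prev (zs Q) F L) P i"
        \<comment> \<open>Modular law: write an element of \<open>L \<inter> P'\<close> as
          \<open>k + n\<close> with \<open>k\<close> in the predecessor and \<open>n\<close> in
          \<open>P\<close>; since \<open>P \<le> P'\<close>, the summand \<open>k\<close> lies in
          \<open>P'\<close> too.\<close>
        have "T L \<le> T (prev (zs Q) F L)"
        proof (intro le_funI subsetI)
          fix i z assume "z \<in> T L i"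
          then obtain x y where xy: "x \<in> L i" "x \<in> P' i" "y \<in> P i" "z = ad Q i x y"
            unfolding T_def by (auto elim!: sumsE)
          obtain k n where kn: "k \<in> prev (zs Q) F L i" "n \<in> P i" "x = ad Q i k n"
            using c[OF xy(1)] by (rule sumsE)
          have cs: "x \<in> car Q i" "y \<in> car Q i" "k \<in> car Q i" "n \<in> car Q i"
            using xy kn sub_car[OF sL] sub_car[OF sP] sub_car[OF sp] by auto
          have "k = mi Q i x n" using kn(3) cs Q by simp
          then have "k \<in> P' i" using sub_mi[OF Q sP' xy(2) PP'[OF kn(2)]] by simp
          moreover have "z = ad Q i k (ad Q i n y)" unfolding xy(4) kn(3) using cs Q by (simp add: ad_assoc)
          ultimately show "z \<in> T (prev (zs Q) F L) i"
            unfolding T_def using kn(1) sub_ad[OF sP kn(2) xy(3)] by (auto intro: sumsI)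
        qed
        then show ?thesis using le1 by simp
      next
        assume c: "\<And>i x. x \<in> L i \<Longrightarrow> x \<in> P i \<Longrightarrow> x \<in> prev (zs Q) F L i"
        obtain S \<pi> where S: "S \<in> \<S>" "quo (res Q L) (prev (zs Q) F L) S \<pi>" using filtr_quo[OF F L] by blast
        have oS: "ob S" by (rule obS[OF S(1)])
        note \<pi>h = quo_hom[OF S(2)]
        have oL: "ob (res Q L)" by (rule ob_res[OF Q sL])
        let ?L' = "\<lambda>i. L i \<inter> P' i"
        have sL': "sub ?L' Q" by (rule sub_Int[OF sL sP'])
        have oL': "ob (res Q ?L')" by (rule ob_res[OF Q sL'])
        have oP: "ob (res Q P)" by (rule ob_res[OF Q sP])
        have oT: "ob (res Q (T L))" by (rule ob_res[OF Q sub_T(1)[OF sL]])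
        have LT: "hom (res Q ?L') (res Q (T L)) (\<lambda>i x. x)"
          by (rule hom_res2[OF hom_res[OF hom_id[OF Q] sL']]) (use Tmem[OF _ _ sL] in auto)
        have PTh: "hom (res Q P) (res Q (T L)) (\<lambda>i x. x)"
          by (rule hom_res2[OF hom_res[OF hom_id[OF Q] sP]]) (use PT[OF sL] in \<open>auto simp: le_fun_def\<close>)
        have L'L: "hom (res Q ?L') S \<pi>"
          using hom_res[OF \<pi>h, of ?L'] sub_res[OF sL, of ?L'] sL' by (simp add: le_fun_def)
        \<comment> \<open>The projection of the stage on \<open>L \<inter> P'\<close> is glued with
          zero on \<open>P\<close>. They agree on the overlap because \<open>P\<close> meets
          \<open>L\<close> only in the predecessor.\<close>
        obtain t where t: "hom (res Q (T L)) S t" "\<And>i x. x \<in> car (res Q ?L') i \<Longrightarrow> t i x = \<pi> i x"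
          "\<And>i y. y \<in> car (res Q P) i \<Longrightarrow> t i y = ze S i"
        proof (rule glue[OF oL' oP oT oS LT PTh _ L'L hom_zero[OF oP oS]])
          show "\<exists>x\<in>car (res Q ?L') i. \<exists>y\<in>car (res Q P) i. e = ad (res Q (T L)) i x y"
            if "e \<in> car (res Q (T L)) i" for i e
            using that by (auto simp: T_def elim!: sumsE)
          fix i x y assume xy: "x \<in> car (res Q ?L') i" "y \<in> car (res Q P) i" "ad (res Q (T L)) i x y = ze (res Q (T L)) i"
          have cs: "x \<in> car Q i" "y \<in> car Q i" using xy sub_car[OF sL] sub_car[OF sP] by auto
          have "ad Q i y x = ze Q i" using xy(3) cs Q by (simp add: ad_comm)
          then have "x = ng Q i y" using ng_unique[OF Q cs(2,1)] by simp
          then have "x \<in> P i" using sub_ng[OF Q sP] xy(2) by simp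
          then have "x \<in> prev (zs Q) F L i" using c xy(1) by simp
          then have "\<pi> i x = ze S i" using quo_ker[OF S(2), of x i] xy(1) by simp
          then show "ad S i (\<pi> i x) (ze S i) = ze S i" using oS by simp
        qed blast
        have "quo (res Q (T L)) (T (prev (zs Q) F L)) S t"
          unfolding quo_def
        proof (intro conjI t(1) allI ballI)
          fix i
          show "t i ` car (res Q (T L)) i = car S i"
          proof (intro equalityI subsetI)
            show "s \<in> car S i" if "s \<in> t i ` car (res Q (T L)) i" for s using that hom_car[OF t(1)] by blast
            fix s assume "s \<in> car S i"
            then obtain l where l: "l \<in> L i" "\<pi> i l = s" using quo_lift[OF S(2)] by auto
            \<comment> \<open>\<open>P'\<close> covers the stage, so each class has a representative
              \<open>n\<close> that lies in \<open>P'\<close>.\<close>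
            obtain k n where kn: "k \<in> prev (zs Q) F L i" "n \<in> P' i" "l = ad Q i k n" using b[OF l(1)] by (rule sumsE)
            have cs: "l \<in> car Q i" "k \<in> car Q i" "n \<in> car Q i"
              using l kn sub_car[OF sL] sub_car[OF sP'] sub_car[OF sp] by auto
            have "n = mi Q i l k" using kn(3) cs Q by simp
            then have nL: "n \<in> L i" using sub_mi[OF Q sL l(1) pLx[OF kn(1)]] by simp
            have "\<pi> i k = ze S i" using quo_ker[OF S(2), of k i] kn(1) pLx by simp
            then have "\<pi> i n = s"
              using hom_ad[OF \<pi>h, of k i n] nL pLx[OF kn(1)] kn(3) l(2) hom_car[OF \<pi>h, of n i] oS by simp
            then have "t i n = s" using t(2)[of n i] nL kn(2) by simp
            then show "s \<in> t i ` car (res Q (T L)) i" using Tmem[OF nL kn(2) sL] by auto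
          qed
          fix z assume "z \<in> car (res Q (T L)) i"
          then obtain x y where xy: "x \<in> L i" "x \<in> P' i" "y \<in> P i" "z = ad Q i x y"
            by (auto simp: T_def elim!: sumsE)
          have tad: "t i (ad Q i x y) = \<pi> i x" if "x \<in> L i" "x \<in> P' i" "y \<in> P i" for x y
          proof -
            have "x \<in> T L i" "y \<in> T L i" using Tmem[OF that(1,2) sL] PT[OF sL] that(3) by (auto simp: le_fun_def)
            then have "t i (ad Q i x y) = ad S i (\<pi> i x) (ze S i)"
              using hom_ad[OF t(1), of x i y] t(2)[of x i] t(3)[of y i] that by simp
            then show ?thesis using oS hom_car[OF \<pi>h, of x i] that(1) by simp
          qed
          show "t i z = ze S i \<longleftrightarrow> z \<in> T (prev (zs Q) F L) i"
          proof
            assume "t i z = ze S i"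
            then have "x \<in> prev (zs Q) F L i" using tad[OF xy(1-3)] xy quo_ker[OF S(2), of x i] by simp
            then show "z \<in> T (prev (zs Q) F L) i" unfolding T_def xy(4) using xy by (intro sumsI) auto
          next
            assume "z \<in> T (prev (zs Q) F L) i"
            then obtain x' y' where xy': "x' \<in> prev (zs Q) F L i" "x' \<in> P' i" "y' \<in> P i" "z = ad Q i x' y'"
              by (auto simp: T_def elim!: sumsE)
            then show "t i z = ze S i" using tad[OF pLx[OF xy'(1)] xy'(2,3)] quo_ker[OF S(2), of x' i] pLx by simp
          qed
        qed
        then show ?thesis using le1 S(1) by auto
      qed
    qed
  next
    have "T (car Q) = Sup (insert P (T ` F))" using TSup[of F] filtr_Sup[OF F] by simp
    moreover have "T (car Q) = P'"
    proof (intro antisym)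
      show "T (car Q) \<le> P'" using sub_le_car[OF sub_T(2)[OF sub_top[OF Q]]] by simp
      show "P' \<le> T (car Q)" using Tmem[OF _ _ sub_top[OF Q]] sub_car[OF sP'] by (auto simp: le_fun_def)
    qed
    ultimately show "Sup (insert P (T ` Field r)) = car ?M" using r(2) by simp
  qed
qed

text \<open>Each stage gets a bounded set of representatives modulo its predecessor. An element
  \<open>z\<close> triggers the representatives of the least stage \<open>L\<close> with
  \<open>z\<close> in \<open>L + N\<close>. If \<open>N + B\<close> reaches a new part of a stage,
  some element of \<open>B\<close> has this very stage as its least one, so \<open>B\<close>
  contains the representatives and covers the stage.\<close>

lemma good_extend:
  fixes Q :: "('i, 'r, 'u) gob"
  assumes Q: "ob Q" and S: "\<And>S. S \<in> \<S> \<Longrightarrow> ob S \<and> bnd A (Sigma UNIV (car S))"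
    and F: "filtr \<S> (zs Q) Q F" and N: "good Q F N"
  obtains \<Theta> where "\<And>z. bnd A (\<Theta> z) \<and> \<Theta> z \<subseteq> Sigma UNIV (car Q)"
    "\<And>B. sub B Q \<Longrightarrow> \<forall>z\<in>Sigma UNIV B. \<Theta> z \<subseteq> Sigma UNIV B \<Longrightarrow> good Q F (sums Q N B)"
proof -
  note sN = good_sub[OF N]
  note prevS = filtr_prev_sub[OF F sub_zero[OF Q]]
  have "\<exists>\<rho>. bnd A \<rho> \<and> \<rho> \<subseteq> Sigma UNIV (car Q) \<and>
      (\<forall>i. \<forall>x\<in>L i. \<exists>k\<in>prev (zs Q) F L i. \<exists>y. (i, y) \<in> \<rho> \<and> x = ad Q i k y)" if L: "L \<in> F" for L
  proof -
    obtain S \<pi> where \<pi>: "S \<in> \<S>" "quo (res Q L) (prev (zs Q) F L) S \<pi>" using filtr_quo[OF F L] by blast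
    note sL = filtr_sub[OF F L]
    have oL: "ob (res Q L)" by (rule ob_res[OF Q sL])
    have oS: "ob S" "bnd A (Sigma UNIV (car S))" using S[OF \<pi>(1)] by auto
    have "\<forall>i. \<forall>s\<in>car S i. \<exists>x\<in>L i. \<pi> i x = s" using quo_lift[OF \<pi>(2)] by simp
    then obtain l where l: "\<And>i s. s \<in> car S i \<Longrightarrow> l i s \<in> L i \<and> \<pi> i (l i s) = s" by metis
    let ?\<rho> = "(\<lambda>(i, s). (i, l i s)) ` Sigma UNIV (car S)"
    have "bnd A ?\<rho>" by (rule bnd_image[OF oS(2)])
    moreover have "?\<rho> \<subseteq> Sigma UNIV (car Q)" using l sub_car[OF sL] by auto
    moreover have "\<exists>k\<in>prev (zs Q) F L i. \<exists>y. (i, y) \<in> ?\<rho> \<and> x = ad Q i k y" if x: "x \<in> L i" for i x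
    proof -
      have s: "\<pi> i x \<in> car S i" using hom_car[OF quo_hom[OF \<pi>(2)]] x by simp
      let ?y = "l i (\<pi> i x)"
      have y: "?y \<in> L i" "\<pi> i x = \<pi> i ?y" using l[OF s] by auto
      have "mi (res Q L) i x ?y \<in> prev (zs Q) F L i"
        using quo_eq[OF oL oS(1) \<pi>(2), of x i ?y] x y by simp
      then have "mi Q i x ?y \<in> prev (zs Q) F L i" using mi_res[OF Q sL x y(1)] by simp
      moreover have "x = ad Q i (mi Q i x ?y) ?y" using Q sub_car[OF sL] x y(1) by simp
      moreover have "(i, ?y) \<in> ?\<rho>" using s by force
      ultimately show ?thesis by blast
    qed
    ultimately show ?thesis by blast
  qed
  then have "\<forall>L\<in>F. \<exists>\<rho>. bnd A \<rho> \<and> \<rho> \<subseteq> Sigma UNIV (car Q) \<and>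
      (\<forall>i. \<forall>x\<in>L i. \<exists>k\<in>prev (zs Q) F L i. \<exists>y. (i, y) \<in> \<rho> \<and> x = ad Q i k y)" by blast
  then obtain \<rho> where \<rho>: "\<forall>L\<in>F. bnd A (\<rho> L) \<and> \<rho> L \<subseteq> Sigma UNIV (car Q) \<and>
      (\<forall>i. \<forall>x\<in>L i. \<exists>k\<in>prev (zs Q) F L i. \<exists>y. (i, y) \<in> \<rho> L \<and> x = ad Q i k y)"
    using bchoice[of F] by metis
  \<comment> \<open>Working modulo \<open>N\<close> is essential: a summand \<open>b\<close> of a
    new element may itself lie only in high stages.\<close>
  define least where "least z L \<longleftrightarrow> L \<in> F \<and> snd z \<in> sums Q L N (fst z) \<and>
      (\<forall>K\<in>F. snd z \<in> sums Q K N (fst z) \<longrightarrow> L \<le> K)" for z L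
  have least_unique: "L = K" if "least z L" "least z K" for z L K
    using that unfolding least_def by (meson antisym)
  have least_ex: "\<exists>K. least z K" if "L \<in> F" "snd z \<in> sums Q L N (fst z)" for z L
    using wochain_least[OF filtr_wo[OF F], of "{L \<in> F. snd z \<in> sums Q L N (fst z)}"] that
    unfolding least_def by blast
  define \<Theta> where "\<Theta> z = (if \<exists>L. least z L then \<rho> (THE L. least z L) else {})" for z
  have \<Theta>eq: "\<Theta> z = \<rho> L" if "least z L" for z L
  proof -
    have "(THE L. least z L) = L" by (rule the_equality[of "least z" L, OF that]) (rule least_unique[OF _ that])
    moreover have "\<exists>L. least z L" using that by (rule exI[of "least z" L])
    ultimately show ?thesis unfolding \<Theta>_def by (simp only: if_True)
  qed
  have \<Theta>0: "\<Theta> z = {}" if "\<not> (\<exists>L. least z L)" for z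
    unfolding \<Theta>_def using that by (rule if_not_P)
  show thesis
  proof (rule that[of \<Theta>])
    show "bnd A (\<Theta> z) \<and> \<Theta> z \<subseteq> Sigma UNIV (car Q)" for z
    proof (cases "\<exists>L. least z L")
      case True
      then obtain L where L: "least z L" by blast
      then have "L \<in> F" by (simp add: least_def)
      then show ?thesis using \<rho> \<Theta>eq[OF L] by simp
    qed (simp add: \<Theta>0)
    fix B assume B: "sub B Q" and cl': "\<forall>z\<in>Sigma UNIV B. \<Theta> z \<subseteq> Sigma UNIV B"
    note cl = bspec[OF cl']
    have N_le: "N \<le> sums Q N B" and B_le: "B \<le> sums Q N B"
      using sums_upper1[OF Q sN B] sums_upper2[OF Q sN B] by (auto simp: le_fun_def)
    show "good Q F (sums Q N B)"
      unfolding good_def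
    proof (intro conjI sub_sums[OF Q sN B] ballI)
      fix L assume L: "L \<in> F"
      note sL = filtr_sub[OF F L] and sp = prevS[OF L]
      have pL: "prev (zs Q) F L \<le> L" by (rule prev_le[OF filtr_ge[OF F L]])
      have pLx: "x \<in> L i" if "x \<in> prev (zs Q) F L i" for x i using pL that by (auto simp: le_fun_def)
      show "(\<forall>i. L i \<inter> sums Q N B i \<subseteq> prev (zs Q) F L i) \<or>
          (\<forall>i. L i \<subseteq> sums Q (prev (zs Q) F L) (sums Q N B) i)"
      proof (rule goodD[OF N L])
        assume b: "\<And>i x. x \<in> L i \<Longrightarrow> x \<in> sums Q (prev (zs Q) F L) N i"
        have "L i \<subseteq> sums Q (prev (zs Q) F L) (sums Q N B) i" for i
          using b sums_mono[OF order_refl N_le, of Q "prev (zs Q) F L" i] by blast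
        then show ?thesis by blast
      next
        assume a: "\<And>i x. x \<in> L i \<Longrightarrow> x \<in> N i \<Longrightarrow> x \<in> prev (zs Q) F L i"
        show ?thesis
        proof (cases "\<forall>i. L i \<inter> sums Q N B i \<subseteq> prev (zs Q) F L i")
          \<comment> \<open>A witness \<open>x = n + b\<close> in \<open>L\<close> outside the
            predecessor; its summand \<open>b\<close> lies in \<open>L + N\<close>.\<close>
          case False
          then obtain i x where x: "x \<in> L i" "x \<in> sums Q N B i" "x \<notin> prev (zs Q) F L i" by blast
          from x(2) obtain n b where nb: "n \<in> N i" "b \<in> B i" "x = ad Q i n b" by (rule sumsE)
          have cs: "x \<in> car Q i" "n \<in> car Q i" "b \<in> car Q i"
            using x nb sub_car[OF sL] sub_car[OF sN] sub_car[OF B] by auto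
          have b_eq: "b = ad Q i x (ng Q i n)"
            using nb(3) cs Q ad_mi_cancel'[OF Q cs(2,3)] by (simp add: mi_def)
          then have "b \<in> sums Q L N i"
            using sumsI[of x L i "ng Q i n" N Q, OF x(1) sub_ng[OF Q sN nb(1)]] by simp
          then obtain K where K: "least (i, b) K" using least_ex[OF L, of "(i, b)"] by auto
          then have KF: "K \<in> F" "b \<in> sums Q K N i" "K \<le> L"
            using L \<open>b \<in> sums Q L N i\<close> by (auto simp: least_def)
          \<comment> \<open>For a smaller \<open>K\<close>, write \<open>b = k + n'\<close>. Then
            \<open>x - k = n + n'\<close> lies in \<open>L \<inter> N\<close>, hence in the
            predecessor because \<open>N\<close> avoids the stage; so \<open>x\<close> would lie
            there as well.\<close>
          have "K = L"
          proof (rule ccontr)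
            assume "K \<noteq> L"
            then have "K < L" using KF(3) by simp
            from prev_upper2[OF KF(1) this, of "zs Q"]
            have Kp: "k \<in> prev (zs Q) F L i" if "k \<in> K i" for k using that by (auto simp: le_fun_def)
            obtain k n' where kn: "k \<in> K i" "n' \<in> N i" "b = ad Q i k n'" using KF(2) by (rule sumsE)
            have cs': "k \<in> car Q i" "n' \<in> car Q i" using kn Kp sub_car[OF sp] sub_car[OF sN] by auto
            have x_eq: "x = ad Q i k (ad Q i n n')"
              unfolding nb(3) kn(3) using cs cs' Q by (simp add: ad_lcomm)
            have nn: "ad Q i n n' \<in> N i" by (rule sub_ad[OF sN nb(1) kn(2)])
            have "ad Q i n n' = mi Q i x k" unfolding x_eq using cs cs' Q by simp
            then have "ad Q i n n' \<in> L i" using sub_mi[OF Q sL x(1) pLx[OF Kp[OF kn(1)]]] by simp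
            then have "ad Q i n n' \<in> prev (zs Q) F L i" using a nn by blast
            then have "x \<in> prev (zs Q) F L i" unfolding x_eq using sub_ad[OF sp Kp[OF kn(1)]] by blast
            then show False using x(3) by blast
          qed
          then have \<rho>B: "\<rho> L \<subseteq> Sigma UNIV B" using cl[of "(i, b)"] nb(2) \<Theta>eq[OF K] by simp
          have "L j \<subseteq> sums Q (prev (zs Q) F L) (sums Q N B) j" for j
          proof
            fix y assume "y \<in> L j"
            then obtain k w where kw: "k \<in> prev (zs Q) F L j" "(j, w) \<in> \<rho> L" "y = ad Q j k w" using \<rho> L by blast
            then have "w \<in> B j" using \<rho>B by blast
            then have "w \<in> sums Q N B j" using B_le by (auto simp: le_fun_def)
            then show "y \<in> sums Q (prev (zs Q) F L) (sums Q N B) j" unfolding kw(3) using kw(1) by (intro sumsI)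
          qed
          then show ?thesis by blast
        qed blast
      qed
    qed
  qed
qed

text \<open>The identity of the kernel extends to a retraction \<open>g\<close> of \<open>Q\<close>;
  the map taking \<open>x\<close> to \<open>x - g x\<close> kills the kernel and descends to a
  section.\<close>

lemma split_section:
  assumes Q: "smob TYPE('u) (Q :: ('i, 'r, 'u) gob)" and Z: "ob Z" and q: "quo Q (kr Q Z q) Z q" and e: "ext0 Z (res Q (kr Q Z q))"
  obtains s where "hom Z Q s" "\<And>i z. z \<in> car Z i \<Longrightarrow> q i (s i z) = z"
proof -
  have oQ: "ob Q" using Q by blast
  note qh = quo_hom[OF q]
  note sK = sub_kernel[OF oQ Z qh]
  let ?K = "res Q (kr Q Z q)"
  have oK: "ob ?K" by (rule ob_res[OF oQ sK])
  obtain g where g: "hom Q ?K g" "\<And>i x. x \<in> kr Q Z q i \<Longrightarrow> g i x = x"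
    by (rule ext0D[OF e Q sK q hom_id[OF oK]]) (rule that)
  have g': "hom Q Q g" by (rule hom_res2D[OF g(1) sK])
  have "hom (prd Q Q) Q (\<lambda>i x. ad Q i (fst x) (ng Q i (g i (snd x))))"
    by (rule hom_ad2[OF oQ hom_id[OF oQ] hom_neg[OF oQ oQ g']])
  from hom_comp[OF hom_pair[OF hom_id[OF oQ] hom_id[OF oQ]] this]
  have u: "hom Q Q (\<lambda>i x. mi Q i x (g i x))" by (simp add: mi_def)
  obtain s where s: "hom Z Q s" "\<And>i x. x \<in> car Q i \<Longrightarrow> s i (q i x) = mi Q i x (g i x)"
  proof (rule factor[OF oQ Z oQ qh quo_surj[OF q] u])
    show "mi Q i x (g i x) = ze Q i" if "x \<in> car Q i" "q i x = ze Z i" for i x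
      using g(2)[of x i] that oQ by simp
  qed (rule that)
  show thesis
  proof (rule that[OF s(1)])
    fix i z assume "z \<in> car Z i"
    then obtain x where x: "x \<in> car Q i" "q i x = z" using quo_lift[OF q] by blast
    have gx: "g i x \<in> car Q i" "q i (g i x) = ze Z i" using hom_car[OF g(1) x(1)] by auto
    have "q i (s i z) = mi Z i (q i x) (q i (g i x))"
      using s(2)[OF x(1)] x hom_mi[OF oQ Z qh x(1) gx(1)] by simp
    then show "q i (s i z) = z" using gx x Z hom_car[OF qh x(1)] by simp
  qed
qed

end

section \<open>Filtrations of retracts, after Kaplansky\<close>

lemma sup_tower:
  fixes P :: "'a::complete_lattice set"
  assumes "Well_order r" and "s0 \<in> P"
    and "\<And>i N. i \<in> Field r \<Longrightarrow> N \<in> P \<Longrightarrow> st i N \<in> P \<and> N \<le> st i N"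
    and lub: "\<And>G. G \<subseteq> P \<Longrightarrow> G \<noteq> {} \<Longrightarrow> (\<And>N N'. N \<in> G \<Longrightarrow> N' \<in> G \<Longrightarrow> N \<le> N' \<or> N' \<le> N) \<Longrightarrow> Sup G \<in> P"
  obtains T where "is_tower r P (\<le>) s0 st Sup T"
proof (rule tower_exists[of r P "(\<le>)" s0 st Sup])
  fix J :: "'b set" and T :: "'b \<Rightarrow> 'a"
  assume "insert s0 (T ` J) \<subseteq> P"
    and "\<And>a b. a \<in> insert s0 (T ` J) \<Longrightarrow> b \<in> insert s0 (T ` J) \<Longrightarrow> a \<le> b \<or> b \<le> a"
  from lub[OF this(1) _ this(2)]
  show "Sup (insert s0 (T ` J)) \<in> P \<and> (\<forall>a\<in>insert s0 (T ` J). a \<le> Sup (insert s0 (T ` J)))"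
    by (simp add: Sup_upper le_supI2)
qed (use assms that in auto)

context gcatu begin

text \<open>The bounded part of the left class of the cotorsion pair cogenerated by
  \<open>\<S>\<close>.\<close>

definition ucl :: "('i, 'r, 'u) gob set \<Rightarrow> ('i, 'r, 'u) gob set" where
  "ucl \<S> = {U. smob TYPE('u) U \<and> bnd A (Sigma UNIV (car U)) \<and>
     (\<forall>V. ob V \<and> (\<forall>S\<in>\<S>. ext0 S V) \<longrightarrow> ext0 U V)}"

text \<open>\<open>Q\<close> is exhausted by good subobjects that are also stable under the
  idempotent of the retract; their images under \<open>q\<close> exhaust \<open>M\<close>.
  Successive quotients of the images are retracts of quotients of good subobjects, which are
  filtered by \<open>\<S>\<close>, so Eklof's lemma and closure under retracts place them in the
  left class.\<close>

lemma retract_filtr: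
  fixes Q M :: "('i, 'r, 'u) gob"
  assumes Q: "smob TYPE('u) Q" and S: "\<And>S. S \<in> \<S> \<Longrightarrow> ob S \<and> bnd A (Sigma UNIV (car S))"
    and F: "filtr \<S> (zs Q) Q F" and M: "smob TYPE('u) M"
    and s: "hom M Q s" and q: "hom Q M q" and qs: "\<And>i x. x \<in> car M i \<Longrightarrow> q i (s i x) = x"
  shows "\<exists>F'. filtr (ucl \<S>) (zs M) M F'"
proof -
  have oQ: "ob Q" and oM: "ob M" using Q M by auto
  have obS: "ob S" if "S \<in> \<S>" for S using S[OF that] by simp
  have eh: "hom Q Q (\<lambda>i x. s i (q i x))" by (rule hom_comp[OF q s])
  define \<P> where "\<P> = {P. good Q F P \<and> (\<forall>i. \<forall>x\<in>P i. s i (q i x) \<in> P i)}"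
  obtain r where r: "Well_order r" "Field r = Sigma UNIV (car Q)" using Well_order_exists[of "Sigma UNIV (car Q)"] by auto
  define ok where "ok z P P' \<longleftrightarrow> P' \<in> \<P> \<and> snd z \<in> P' (fst z) \<and> (\<exists>B. sub B Q \<and> bnd A (Sigma UNIV B) \<and> P' = sums Q P B)"
    for z P P'
  have ok_ex: "\<exists>P'. ok z P P'" if z: "z \<in> Sigma UNIV (car Q)" and P: "P \<in> \<P>" for z P
  proof -
    have gP: "good Q F P" and eP: "\<And>i x. x \<in> P i \<Longrightarrow> s i (q i x) \<in> P i" using P by (auto simp: \<P>_def)
    note sP = good_sub[OF gP]
    obtain \<Theta> where \<Theta>: "\<And>z. bnd A (\<Theta> z) \<and> \<Theta> z \<subseteq> Sigma UNIV (car Q)"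
      "\<And>B. sub B Q \<Longrightarrow> \<forall>z\<in>Sigma UNIV B. \<Theta> z \<subseteq> Sigma UNIV B \<Longrightarrow> good Q F (sums Q P B)"
      by (rule good_extend[OF oQ S F gP]) (assumption | rule that)+
    \<comment> \<open>The closing-off rule of \<open>good_extend\<close> together with the value of
      the idempotent.\<close>
    let ?\<Theta> = "\<lambda>z. insert (fst z, s (fst z) (q (fst z) (snd z))) (\<Theta> z)"
    have \<Theta>': "bnd A (?\<Theta> z) \<and> ?\<Theta> z \<subseteq> Sigma UNIV (car Q)" if "z \<in> Sigma UNIV (car Q)" for z
      using \<Theta>(1)[of z] bnd_insert[OF A_inf, of "\<Theta> z"] hom_car[OF eh] that by auto
    have z': "{z} \<subseteq> Sigma UNIV (car Q)" using z by simp
    obtain B where B: "sub B Q" "bnd A (Sigma UNIV B)" "{z} \<subseteq> Sigma UNIV B"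
      "\<And>z. z \<in> Sigma UNIV B \<Longrightarrow> ?\<Theta> z \<subseteq> Sigma UNIV B"
      by (rule gensub[OF oQ z' bnd_countable[OF A_inf] \<Theta>']) (assumption | rule that | simp)+
    have eB: "s i (q i x) \<in> B i" if "x \<in> B i" for i x using B(4)[of "(i, x)"] that by simp
    have "good Q F (sums Q P B)" by (rule \<Theta>(2)[OF B(1)]) (use B(4) in blast)
    moreover have "s i (q i x) \<in> sums Q P B i" if x: "x \<in> sums Q P B i" for i x
    proof -
      from x obtain n b where nb: "n \<in> P i" "b \<in> B i" "x = ad Q i n b" by (rule sumsE)
      have "s i (q i x) = ad Q i (s i (q i n)) (s i (q i b))"
        unfolding nb(3) by (rule hom_ad[OF eh sub_car[OF sP nb(1)] sub_car[OF B(1) nb(2)]])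
      then show ?thesis using eP[OF nb(1)] eB[OF nb(2)] by (simp add: sumsI)
    qed
    moreover have "snd z \<in> sums Q P B (fst z)"
      by (rule sums_upper2[OF oQ sP B(1)]) (use B(3) in \<open>cases z, auto\<close>)
    ultimately have "ok z P (sums Q P B)" using B(1,2) unfolding ok_def \<P>_def by blast
    then show ?thesis by blast
  qed
  define st where "st z P = (SOME P'. ok z P P')" for z P
  have st: "ok z P (st z P)" if "z \<in> Field r" "P \<in> \<P>" for z P
    unfolding st_def by (rule someI_ex[OF ok_ex]) (use that r(2) in auto)
  have step: "st z P \<in> \<P> \<and> P \<le> st z P" if zP: "z \<in> Field r" "P \<in> \<P>" for z P
  proof -
    obtain B where B: "st z P \<in> \<P>" "sub B Q" "st z P = sums Q P B" using st[OF zP] unfolding ok_def by blast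
    have "sub P Q" by (rule good_sub[of Q F]) (use zP(2) in \<open>simp add: \<P>_def\<close>)
    then have "P \<le> sums Q P B" using sums_upper1[OF oQ _ B(2)] by (auto simp: le_fun_def)
    with B show ?thesis by simp
  qed
  have z0: "zs Q \<in> \<P>"
    using good_zero[OF oQ F] hom_ze[OF oQ oQ eh] by (simp add: \<P>_def)
  have lub: "Sup G \<in> \<P>"
    if "G \<subseteq> \<P>" "G \<noteq> {}" "\<And>N N'. N \<in> G \<Longrightarrow> N' \<in> G \<Longrightarrow> N \<le> N' \<or> N' \<le> N" for G
  proof -
    have "good Q F (Sup G)" by (rule good_Sup_chain[OF that(2) _ that(3)]) (use that(1) in \<open>auto simp: \<P>_def\<close>)
    moreover have "s i (q i x) \<in> Sup G i" if "x \<in> Sup G i" for i x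
      using that \<open>G \<subseteq> \<P>\<close> by (auto simp: \<P>_def Sup_apply)
    ultimately show ?thesis by (simp add: \<P>_def)
  qed
  obtain T where T: "is_tower r \<P> (\<le>) (zs Q) st Sup T"
    by (rule sup_tower[OF r(1) z0 step lub]) (assumption | rule that)+
  let ?L = "\<lambda>z. Sup (insert (zs Q) (T ` underS r z))"
  define im where "im P = (\<lambda>i. q i ` P i)" for P :: "'i \<Rightarrow> 'u set"
  have im_Sup: "im (Sup G) = Sup (im ` G)" for G
    unfolding im_def by (auto simp: fun_eq_iff Sup_apply)
  have im_zs: "im (zs Q) = zs M" using hom_ze[OF oQ oM q] by (simp add: im_def)
  have im_sub: "sub (im P) M" if "P \<in> \<P>" for P
    unfolding im_def by (rule sub_image[OF oQ oM q good_sub[of Q F]]) (use that in \<open>simp add: \<P>_def\<close>)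
  have jump: "\<exists>U\<in>ucl \<S>. \<exists>p. quo (res M (im P')) (im P) U p"
    if P: "P \<in> \<P>" and P': "P' \<in> \<P>" and B: "sub B Q" "bnd A (Sigma UNIV B)" "P' = sums Q P B" for P P' B
  proof -
    have g: "good Q F P" "good Q F P'" and e: "\<And>i x. x \<in> P i \<Longrightarrow> s i (q i x) \<in> P i" "\<And>i x. x \<in> P' i \<Longrightarrow> s i (q i x) \<in> P' i"
      using P P' by (auto simp: \<P>_def)
    note sP = good_sub[OF g(1)] and sP' = good_sub[OF g(2)]
    have PP': "P \<le> P'" using sums_upper1[OF oQ sP B(1)] B(3) by (auto simp: le_fun_def)
    have imPP': "im P \<le> im P'" using PP' unfolding im_def le_fun_def by blast
    let ?M = "res M (im P')" and ?Q = "res Q P'"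
    have M': "smob TYPE('u) ?M" and Q': "smob TYPE('u) ?Q"
      by (rule smob_res[OF M im_sub[OF P']], rule smob_res[OF Q sP'])
    have oM': "ob ?M" and oQ': "ob ?Q" using M' Q' by auto
    have sM: "sub (im P) ?M" using im_sub[OF P] imPP' sub_res[OF im_sub[OF P']] by blast
    have sQ: "sub P ?Q" using sP PP' sub_res[OF sP'] by blast
    obtain U :: "('i, 'r, 'u) gob" and \<pi> where U: "smob TYPE('u) U" and \<pi>: "quo ?M (im P) U \<pi>"
      by (rule quotient_exists[OF oM' sM conjunct2[OF M']]) (rule that)
    obtain V :: "('i, 'r, 'u) gob" and \<rho> where V: "smob TYPE('u) V" and \<rho>: "quo ?Q P V \<rho>"
      by (rule quotient_exists[OF oQ' sQ conjunct2[OF Q']]) (rule that)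
    have oU: "ob U" and oV: "ob V" using U V by auto
    have imq: "q i x \<in> im P' i" if "x \<in> P' i" for i x using that by (simp add: im_def)
    have imP: "s i y \<in> P i" if "y \<in> im P i" for i y using that e(1) by (auto simp: im_def)
    have imP': "s i y \<in> P' i" if "y \<in> im P' i" for i y using that e(2) by (auto simp: im_def)
    have sh: "hom ?M ?Q s" by (rule hom_res2[OF hom_res[OF s im_sub[OF P']]]) (simp add: imP')
    have qh: "hom ?Q ?M q" by (rule hom_res2[OF hom_res[OF q sP']]) (simp add: imq)
    \<comment> \<open>\<open>s\<close> takes the images of \<open>P\<close> and \<open>P'\<close>
      back into \<open>P\<close> and \<open>P'\<close>, because these are stable under the
      idempotent. So both maps descend and make \<open>U\<close> a retract of
      \<open>V\<close>.\<close>
    obtain s' where s': "hom U V s'" "\<And>i x. x \<in> car ?M i \<Longrightarrow> s' i (\<pi> i x) = \<rho> i (s i x)"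
    proof (rule factor[OF oM' oU oV quo_hom[OF \<pi>] quo_surj[OF \<pi>] hom_comp[OF sh quo_hom[OF \<rho>]]])
      fix i x assume x: "x \<in> car ?M i" "\<pi> i x = ze U i"
      then have "x \<in> im P i" using quo_ker[OF \<pi> x(1)] by simp
      then show "\<rho> i (s i x) = ze V i" using quo_ker[OF \<rho> hom_car[OF sh x(1)]] imP by simp
    qed (rule that)
    obtain q' where q': "hom V U q'" "\<And>i x. x \<in> car ?Q i \<Longrightarrow> q' i (\<rho> i x) = \<pi> i (q i x)"
    proof (rule factor[OF oQ' oV oU quo_hom[OF \<rho>] quo_surj[OF \<rho>] hom_comp[OF qh quo_hom[OF \<pi>]]])
      fix i x assume x: "x \<in> car ?Q i" "\<rho> i x = ze V i"
      then have "q i x \<in> im P i" using quo_ker[OF \<rho> x(1)] by (simp add: im_def)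
      then show "\<pi> i (q i x) = ze U i" using quo_ker[OF \<pi> hom_car[OF qh x(1)]] by simp
    qed (rule that)
    have ret: "q' i (s' i u) = u" if u: "u \<in> car U i" for i u
    proof -
      obtain x where x: "x \<in> car ?M i" "\<pi> i x = u" using quo_lift[OF \<pi> u] by blast
      have "x \<in> car M i" using x(1) sub_car[OF im_sub[OF P']] by simp
      then show ?thesis using s'(2)[OF x(1)] q'(2)[OF hom_car[OF sh x(1)]] qs x(2) by simp
    qed
    obtain F' where F': "filtr \<S> P ?Q F'" using good_quotient[OF oQ obS F g PP'] by blast
    have ext: "ext0 U Y" if Y: "ob Y" "\<forall>S\<in>\<S>. ext0 S Y" for Y
    proof -
      have "ext0 V Y"
        by (rule ext0_filtr[OF F' sQ oQ' \<rho> oV Y(1)]) (use Y(2) obS in blast)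
      then show ?thesis by (rule ext0_retract[OF _ U V Y(1) s'(1) q'(1) ret])
    qed
    \<comment> \<open>\<open>P' = P + B\<close> and \<open>P\<close> dies in \<open>U\<close>, so
      \<open>U\<close> is an image of the bounded \<open>B\<close>.\<close>
    have "Sigma UNIV (car U) \<subseteq> (\<lambda>(i, b). (i, \<pi> i (q i b))) ` Sigma UNIV B"
    proof
      fix z assume "z \<in> Sigma UNIV (car U)"
      then obtain i u where z: "z = (i, u)" "u \<in> car U i" by auto
      obtain x where x: "x \<in> car ?M i" "\<pi> i x = u" using quo_lift[OF \<pi> z(2)] by blast
      then obtain y where y: "y \<in> P' i" "x = q i y" by (auto simp: im_def)
      obtain n b where nb: "n \<in> P i" "b \<in> B i" "y = ad Q i n b" using y(1) unfolding B(3) by (rule sumsE)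
      have cs: "n \<in> car Q i" "b \<in> car Q i" using sub_car[OF sP nb(1)] sub_car[OF B(1) nb(2)] .
      have nb': "n \<in> P' i" "b \<in> P' i"
        using PP' nb(1) sums_upper2[OF oQ sP B(1) nb(2)] B(3) by (auto simp: le_fun_def)
      have "\<pi> i (q i n) = ze U i"
        using quo_ker[OF \<pi>, of "q i n" i] nb(1) imq[OF nb'(1)] by (simp add: im_def)
      moreover have "\<pi> i x = ad U i (\<pi> i (q i n)) (\<pi> i (q i b))"
        using hom_ad[OF hom_comp[OF qh quo_hom[OF \<pi>]], of n i b] nb' unfolding y(2) nb(3) by simp
      ultimately have "u = \<pi> i (q i b)"
        using x(2) oU hom_car[OF hom_comp[OF qh quo_hom[OF \<pi>]], of b i] nb'(2) by simp
      then show "z \<in> (\<lambda>(i, b). (i, \<pi> i (q i b))) ` Sigma UNIV B" using z(1) nb(2) by force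
    qed
    then have "bnd A (Sigma UNIV (car U))" by (rule bnd_subset[OF _ bnd_image[OF B(2)]])
    then have "U \<in> ucl \<S>" unfolding ucl_def using U ext by blast
    then show ?thesis using \<pi> by blast
  qed
  show ?thesis
  proof (rule filtr_tower[OF oM r(1), of "\<lambda>z. im (T z)" "\<lambda>z. im (?L z)"])
    fix z assume z: "z \<in> Field r"
    note Lz = is_tower_lub[OF T z] and Tz = is_tower_in[OF T z]
    show "sub (im (T z)) M" "sub (im (?L z)) M" by (rule im_sub[OF Tz], rule im_sub[OF Lz])
    show "im (?L z) = Sup (insert (zs M) ((\<lambda>z. im (T z)) ` underS r z))"
      unfolding im_Sup image_insert im_zs image_image ..
    obtain B where B: "sub B Q" "bnd A (Sigma UNIV B)" "T z = sums Q (?L z) B"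
      using st[OF z Lz] is_tower_eq[OF T z] unfolding ok_def by auto
    have "?L z \<le> T z" using step[OF z Lz] is_tower_eq[OF T z] by simp
    then have "im (?L z) \<le> im (T z)" unfolding im_def le_fun_def by blast
    then show "im (?L z) = im (T z) \<or> im (?L z) \<le> im (T z) \<and> (\<exists>S\<in>ucl \<S>. \<exists>p. quo (res M (im (T z))) (im (?L z)) S p)"
      using jump[OF Lz Tz B] by blast
  next
    have "Sup (insert (zs M) ((\<lambda>z. im (T z)) ` Field r)) = im (Sup (insert (zs Q) (T ` Field r)))"
      unfolding im_Sup image_insert im_zs image_image ..
    also have "\<dots> = car M"
    proof (rule antisym)
      show "im (Sup (insert (zs Q) (T ` Field r))) \<le> car M"
        by (rule sub_le_car[OF im_sub[OF is_tower_top[OF T]]])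
      show "car M \<le> im (Sup (insert (zs Q) (T ` Field r)))"
      proof (intro le_funI subsetI)
        fix i m assume m: "m \<in> car M i"
        have z: "(i, s i m) \<in> Field r" using hom_car[OF s m] r(2) by simp
        have "s i m \<in> T (i, s i m) i"
          using st[OF z is_tower_lub[OF T z]] is_tower_eq[OF T z] unfolding ok_def by simp
        then have "s i m \<in> Sup (insert (zs Q) (T ` Field r)) i" using z by (auto simp: Sup_apply)
        then have "q i (s i m) \<in> im (Sup (insert (zs Q) (T ` Field r))) i" unfolding im_def by (rule imageI)
        then show "m \<in> im (Sup (insert (zs Q) (T ` Field r))) i" by (simp only: qs[OF m])
      qed
    qed
    finally show "Sup (insert (zs M) ((\<lambda>z. im (T z)) ` Field r)) = car M" .
  qed
qed

text \<open>For an object of the left class the special precover by \<open>\<S>\<close>-filtered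
  objects has its kernel in the right class, hence splits, and \<open>retract_filtr\<close> applies.
  The hypothesis \<open>gen\<close> makes the precover onto.\<close>

lemma kaplansky:
  fixes M :: "('i, 'r, 'u) gob"
  assumes M: "smob TYPE('u) M" and S: "\<And>S. S \<in> \<S> \<Longrightarrow> ob S \<and> bnd A (Sigma UNIV (car S))"
    and gen: "\<And>i x. x \<in> car M i \<Longrightarrow> \<exists>S\<in>\<S>. \<exists>g. hom S M g \<and> x \<in> g i ` car S i"
    and ext: "\<And>V. smob TYPE('u) V \<Longrightarrow> (\<And>S. S \<in> \<S> \<Longrightarrow> ext0 S V) \<Longrightarrow> ext0 M V"
  shows "\<exists>F. filtr (ucl \<S>) (zs M) M F"
proof -
  have oM: "ob M" using M by blast
  obtain Q q F where Q: "smob TYPE('u) Q" and q: "quo Q (kr Q M q) M q" and F: "filtr \<S> (zs Q) Q F"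
    and e: "\<And>S. S \<in> \<S> \<Longrightarrow> ext0 S (res Q (kr Q M q))"
    by (rule special_precover[OF M S gen]) (assumption | rule that)+
  have oQ: "ob Q" using Q by blast
  have "ext0 M (res Q (kr Q M q))"
    by (rule ext[OF smob_res[OF Q sub_kernel[OF oQ oM quo_hom[OF q]]] e])
  then obtain s where s: "hom M Q s" "\<And>i z. z \<in> car M i \<Longrightarrow> q i (s i z) = z"
    by (rule split_section[OF Q oM q]) (rule that)
  show ?thesis by (rule retract_filtr[OF Q S F M s(1) quo_hom[OF q] s(2)])
qed

end

section \<open>Ext in categories equivalent to many-sorted modules\<close>

context gcat begin

text \<open>Equality up to values off the carriers. Passing through the record types of modules and
  complexes preserves objects only in this sense.\<close>

definition eqo :: "('i, 'r, 'a) gob \<Rightarrow> ('i, 'r, 'a) gob \<Rightarrow> bool" where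
  "eqo G H \<longleftrightarrow> le G H \<and> le H G"

lemma eqo_le: "eqo G H \<Longrightarrow> le G H" and eqo_ge: "eqo G H \<Longrightarrow> le H G"
  by (simp_all add: eqo_def)

lemma eqo_car: "eqo G H \<Longrightarrow> car G = car H"
  using le_fun[of G H] le_fun[of H G] by (simp add: eqo_def)

end

text \<open>A category in the sense of \<open>cat\<close> which is equivalent to the category of small objects.\<close>

locale repcat = gcatu R sh W A for R :: "('r, 'k) ring_scheme" (structure) and sh :: "'i \<Rightarrow> 'i" and W and A :: "'u set" +
  fixes \<C> :: "('o, 'm) cat" and tO :: "'o \<Rightarrow> ('i, 'r, 'u) gob" and tM :: "'m \<Rightarrow> 'i \<Rightarrow> 'u \<Rightarrow> 'u"
  assumes rob: "\<And>X. X \<in> cat_ob \<C> \<Longrightarrow> smob TYPE('u) (tO X)"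
    and rex: "\<And>G. smob TYPE('u) G \<Longrightarrow> \<exists>X\<in>cat_ob \<C>. eqo (tO X) G"
    and rhom: "\<And>X Y f. X \<in> cat_ob \<C> \<Longrightarrow> Y \<in> cat_ob \<C> \<Longrightarrow> f \<in> cat_hom \<C> X Y \<Longrightarrow> hom (tO X) (tO Y) (tM f)"
    and rhomex: "\<And>X Y g. X \<in> cat_ob \<C> \<Longrightarrow> Y \<in> cat_ob \<C> \<Longrightarrow> hom (tO X) (tO Y) g \<Longrightarrow>
      \<exists>f\<in>cat_hom \<C> X Y. \<forall>i. \<forall>x\<in>car (tO X) i. tM f i x = g i x"
    and rhom_eq: "\<And>X Y f g. X \<in> cat_ob \<C> \<Longrightarrow> Y \<in> cat_ob \<C> \<Longrightarrow> f \<in> cat_hom \<C> X Y \<Longrightarrow> g \<in> cat_hom \<C> X Y \<Longrightarrow>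
      (\<And>i x. x \<in> car (tO X) i \<Longrightarrow> tM f i x = tM g i x) \<Longrightarrow> f = g"
    and rcomp: "\<And>X Y Z f g. X \<in> cat_ob \<C> \<Longrightarrow> Y \<in> cat_ob \<C> \<Longrightarrow> Z \<in> cat_ob \<C> \<Longrightarrow>
      f \<in> cat_hom \<C> X Y \<Longrightarrow> g \<in> cat_hom \<C> Y Z \<Longrightarrow>
      cat_comp \<C> X g f \<in> cat_hom \<C> X Z \<and>
      (\<forall>i. \<forall>x\<in>car (tO X) i. tM (cat_comp \<C> X g f) i x = tM g i (tM f i x))"
    and rid: "\<And>X. X \<in> cat_ob \<C> \<Longrightarrow> cat_id \<C> X \<in> cat_hom \<C> X X \<and>
      (\<forall>i. \<forall>x\<in>car (tO X) i. tM (cat_id \<C> X) i x = x)"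
    and rses: "\<And>X E B i p. X \<in> cat_ob \<C> \<Longrightarrow> E \<in> cat_ob \<C> \<Longrightarrow> B \<in> cat_ob \<C> \<Longrightarrow>
      cat_ses \<C> X i E p B \<longleftrightarrow> i \<in> cat_hom \<C> X E \<and> p \<in> cat_hom \<C> E B \<and>
        (\<forall>n. inj_on (tM i n) (car (tO X) n)) \<and>
        (\<forall>n. tM i n ` car (tO X) n = {x \<in> car (tO E) n. tM p n x = ze (tO B) n}) \<and>
        (\<forall>n. tM p n ` car (tO E) n = car (tO B) n)"
begin

lemma obj: "X \<in> cat_ob \<C> \<Longrightarrow> ob (tO X)"
  using rob by blast

lemma comp_eq:
  assumes "X \<in> cat_ob \<C>" "Y \<in> cat_ob \<C>" "Z \<in> cat_ob \<C>" "f \<in> cat_hom \<C> X Y" "g \<in> cat_hom \<C> Y Z" "h \<in> cat_hom \<C> X Z"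
  shows "cat_comp \<C> X g f = h \<longleftrightarrow> (\<forall>i. \<forall>x\<in>car (tO X) i. tM g i (tM f i x) = tM h i x)"
proof -
  note c = rcomp[OF assms(1-5)]
  show ?thesis
    using c rhom_eq[OF assms(1,3) conjunct1[OF c] assms(6)] by auto
qed

lemma extD:
  assumes "(i, E, p) \<in> extensions \<C> B X" "B \<in> cat_ob \<C>" "X \<in> cat_ob \<C>"
  shows "E \<in> cat_ob \<C>" "i \<in> cat_hom \<C> X E" "p \<in> cat_hom \<C> E B"
    "\<And>n. inj_on (tM i n) (car (tO X) n)"
    "\<And>n. tM i n ` car (tO X) n = {x \<in> car (tO E) n. tM p n x = ze (tO B) n}"
    "\<And>n. tM p n ` car (tO E) n = car (tO B) n"
proof -
  show E: "E \<in> cat_ob \<C>" using assms(1) by (simp add: extensions_def)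
  have "cat_ses \<C> X i E p B" using assms(1) by (simp add: extensions_def)
  then show "i \<in> cat_hom \<C> X E" "p \<in> cat_hom \<C> E B"
    "\<And>n. inj_on (tM i n) (car (tO X) n)"
    "\<And>n. tM i n ` car (tO X) n = {x \<in> car (tO E) n. tM p n x = ze (tO B) n}"
    "\<And>n. tM p n ` car (tO E) n = car (tO B) n"
    using rses[OF assms(3) E assms(2)] by auto
qed

lemma ses_exists:
  assumes X: "X \<in> cat_ob \<C>" and E: "E \<in> cat_ob \<C>" and B: "B \<in> cat_ob \<C>"
    and i: "hom (tO X) (tO E) i" "\<And>n. inj_on (i n) (car (tO X) n)"
    and p: "quo (tO E) (\<lambda>n. i n ` car (tO X) n) (tO B) p"
  obtains i' p' where "cat_ses \<C> X i' E p' B" "i' \<in> cat_hom \<C> X E" "p' \<in> cat_hom \<C> E B"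
    "\<And>n x. x \<in> car (tO X) n \<Longrightarrow> tM i' n x = i n x" "\<And>n x. x \<in> car (tO E) n \<Longrightarrow> tM p' n x = p n x"
proof -
  obtain i' where i': "i' \<in> cat_hom \<C> X E" "\<And>n x. x \<in> car (tO X) n \<Longrightarrow> tM i' n x = i n x"
    using rhomex[OF X E i(1)] by blast
  obtain p' where p': "p' \<in> cat_hom \<C> E B" "\<And>n x. x \<in> car (tO E) n \<Longrightarrow> tM p' n x = p n x"
    using rhomex[OF E B quo_hom[OF p]] by blast
  have im: "tM i' n ` car (tO X) n = i n ` car (tO X) n" for n using i'(2) by simp
  have "cat_ses \<C> X i' E p' B"
    unfolding rses[OF X E B]
  proof (intro conjI allI i'(1) p'(1))
    fix n
    show "inj_on (tM i' n) (car (tO X) n)" using i(2)[of n] i'(2) by (simp cong: inj_on_cong)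
    show "tM i' n ` car (tO X) n = {x \<in> car (tO E) n. tM p' n x = ze (tO B) n}"
      unfolding im using quo_ker[OF p] p'(2) hom_car[OF i(1)] by auto
    show "tM p' n ` car (tO E) n = car (tO B) n"
      using quo_surj[OF p, of n] p'(2) by simp
  qed
  then show thesis by (rule that[OF _ i'(1) p'(1) i'(2) p'(2)])
qed

text \<open>An extension problem for \<open>f\<close> becomes an element of Yoneda Ext: push the
  short exact sequence of \<open>M\<close> out along \<open>f\<close> and realise the result in
  \<open>\<C>\<close>.\<close>

lemma ext_from_po:
  fixes M :: "('i, 'r, 'u) gob"
  assumes B: "B \<in> cat_ob \<C>" and X: "X \<in> cat_ob \<C>" and M: "smob TYPE('u) M" and N: "sub N M"
    and p0: "quo M N (tO B) p0" and f: "hom (res M N) (tO X) f"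
  obtains i E p h where "(i, E, p) \<in> extensions \<C> B X" "hom M (tO E) h"
    "\<And>n x. x \<in> N n \<Longrightarrow> h n x = tM i n (f n x)"
proof -
  have oM: "ob M" using M by blast
  note oX = obj[OF X] and oB = obj[OF B]
  obtain G h where G: "smob TYPE('u) G" and po: "po M N (tO X) f G h"
    by (rule po_exists[OF M rob[OF X] N f]) (rule that)
  have oG: "ob G" using G by blast
  obtain p where p: "quo G (car (tO X)) (tO B) p"
    by (rule po_quo[OF po oM oX oG oB N f p0]) (rule that)
  have leG: "le (tO X) G" and h: "hom M G h" and hf: "\<And>n x. x \<in> N n \<Longrightarrow> h n x = f n x"
    using po unfolding po_def by blast+
  obtain E where E: "E \<in> cat_ob \<C>" "eqo (tO E) G" using rex[OF G] by blast
  note oE = obj[OF E(1)]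
  have XE: "hom (tO X) (tO E) (\<lambda>n x. x)"
    using le_le[OF oX leG eqo_le[OF E(2)]] le_fun[OF leG] eqo_car[OF E(2)] by (simp add: le_def)
  have pE: "quo (tO E) (\<lambda>n. (\<lambda>x. x) ` car (tO X) n) (tO B) p"
    using quo_le[OF eqo_le[OF E(2)] eqo_car[OF E(2)] p] by simp
  obtain i p' where ip: "cat_ses \<C> X i E p' B" "\<And>n x. x \<in> car (tO X) n \<Longrightarrow> tM i n x = x"
    by (rule ses_exists[OF X E(1) B XE _ pE]) (auto intro: inj_onI that)
  show thesis
  proof (rule that[of i E p' h])
    show "(i, E, p') \<in> extensions \<C> B X" using ip(1) E(1) by (simp add: extensions_def)
    show "hom M (tO E) h" by (rule hom_le[OF h eqo_ge[OF E(2)]])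
    show "h n x = tM i n (f n x)" if "x \<in> N n" for n x
      using hf[OF that] ip(2)[OF hom_car[OF f, of x n]] that by simp
  qed
qed

text \<open>Extending the identity of \<open>X\<close> along \<open>i\<close> gives
  \<open>g\<close>; the difference of the identity and \<open>i \<circ> g\<close> descends along
  \<open>p\<close> to the section.\<close>

lemma retraction:
  assumes B: "B \<in> cat_ob \<C>" and X: "X \<in> cat_ob \<C>" and e: "(i, E, p) \<in> extensions \<C> B X"
    and ext: "ext0 (tO B) (tO X)"
  obtains g s where "hom (tO E) (tO X) g" "\<And>n x. x \<in> car (tO X) n \<Longrightarrow> g n (tM i n x) = x"
    "hom (tO B) (tO E) s" "\<And>n x. x \<in> car (tO B) n \<Longrightarrow> tM p n (s n x) = x"
proof -
  note E = extD[OF e B X]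
  note oX = obj[OF X] and oB = obj[OF B] and oE = obj[OF E(1)]
  note ih = rhom[OF X E(1,2)] and ph = rhom[OF E(1) B E(3)]
  define N where "N n = tM i n ` car (tO X) n" for n
  have N: "sub N (tO E)" unfolding N_def[abs_def] by (rule sub_image[OF oX oE ih sub_top[OF oX], unfolded res_simps])
  have q: "quo (tO E) N (tO B) (tM p)"
    unfolding quo_def N_def using ph E(5,6) by auto
  have iN: "hom (tO X) (res (tO E) N) (tM i)" by (rule hom_res2[OF ih]) (simp add: N_def)
  have oN: "ob (res (tO E) N)" by (rule ob_res[OF oE N])
  obtain f where f: "hom (res (tO E) N) (tO X) f" "\<And>n x. x \<in> car (tO X) n \<Longrightarrow> f n (tM i n x) = x"
  proof (rule factor[OF oX oN oX iN _ hom_id[OF oX]])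
    show "tM i n ` car (tO X) n = car (res (tO E) N) n" for n by (simp add: N_def)
    show "x = ze (tO X) n" if "x \<in> car (tO X) n" "tM i n x = ze (res (tO E) N) n" for n x
      using inj_onD[OF E(4), of n x "ze (tO X) n"] that hom_ze[OF oX oE ih, of n] oX by simp
  qed (rule that)
  obtain g where g: "hom (tO E) (tO X) g" "\<And>n x. x \<in> N n \<Longrightarrow> g n x = f n x"
    by (rule ext0D[OF ext rob[OF E(1)] N q f(1)]) (rule that)
  have gi: "g n (tM i n x) = x" if "x \<in> car (tO X) n" for n x
    using g(2)[of "tM i n x" n] f(2)[OF that] that by (simp add: N_def)
  have ig: "hom (tO E) (tO E) (\<lambda>n x. tM i n (g n x))" by (rule hom_comp[OF g(1) ih])
  have "hom (prd (tO E) (tO E)) (tO E) (\<lambda>n x. ad (tO E) n (fst x) (ng (tO E) n (tM i n (g n (snd x)))))"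
    by (rule hom_ad2[OF oE hom_id[OF oE] hom_neg[OF oE oE ig]])
  from hom_comp[OF hom_pair[OF hom_id[OF oE] hom_id[OF oE]] this]
  have u: "hom (tO E) (tO E) (\<lambda>n x. mi (tO E) n x (tM i n (g n x)))" by (simp add: mi_def)
  obtain s where s: "hom (tO B) (tO E) s" "\<And>n x. x \<in> car (tO E) n \<Longrightarrow> s n (tM p n x) = mi (tO E) n x (tM i n (g n x))"
  proof (rule factor[OF oE oB oE ph quo_surj[OF q] u])
    fix n x assume x: "x \<in> car (tO E) n" "tM p n x = ze (tO B) n"
    then have "x \<in> N n" using quo_ker[OF q x(1)] by simp
    then obtain y where "y \<in> car (tO X) n" "x = tM i n y" by (auto simp: N_def)
    then have "tM i n (g n x) = x" using gi by simp
    then show "mi (tO E) n x (tM i n (g n x)) = ze (tO E) n" using x oE by simp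
  qed (rule that)
  have ps: "tM p n (s n b) = b" if b: "b \<in> car (tO B) n" for n b
  proof -
    obtain x where x: "x \<in> car (tO E) n" "tM p n x = b" using quo_lift[OF q b] by blast
    have igx: "tM i n (g n x) \<in> N n" using hom_car[OF g(1) x(1)] by (simp add: N_def)
    have "tM p n (tM i n (g n x)) = ze (tO B) n" using quo_ker[OF q sub_car[OF N igx]] igx by simp
    then show ?thesis
      using s(2)[OF x(1)] x hom_mi[OF oE oB ph x(1) sub_car[OF N igx]] b oB by simp
  qed
  show thesis by (rule that[OF g(1) gi s(1) ps])
qed

text \<open>If all extensions split, a splitting of the pushout extends the given map. Conversely
  the extension property splits every extension and makes any two equivalent, so there is exactly
  one class and it is the class of split extensions.\<close>

lemma Ext1_vanishes_iff:
  assumes B: "B \<in> cat_ob \<C>" and X: "X \<in> cat_ob \<C>"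
  shows "Ext1_vanishes \<C> B X \<longleftrightarrow> ext0 (tO B) (tO X)"
proof
  note oX = obj[OF X] and oB = obj[OF B]
  let ?r = "extension_equiv \<C> B X"
  assume v: "Ext1_vanishes \<C> B X"
  have split: "e \<in> Ext1_zero \<C> B X" if e: "e \<in> extensions \<C> B X" for e
  proof -
    obtain i E p where ie: "e = (i, E, p)" by (cases e)
    note E = extD[OF e[unfolded ie] B X]
    have id: "cat_id \<C> E \<in> cat_hom \<C> E E" "\<And>n x. x \<in> car (tO E) n \<Longrightarrow> tM (cat_id \<C> E) n x = x"
      using rid[OF E(1)] by auto
    have "cat_comp \<C> X (cat_id \<C> E) i = i" "cat_comp \<C> E p (cat_id \<C> E) = p"
      using comp_eq[OF X E(1,1,2) id(1) E(2)] comp_eq[OF E(1,1) B id(1) E(3,3)] id(2)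
        hom_car[OF rhom[OF X E(1,2)]] by auto
    \<comment> \<open>By reflexivity each class contains its representative, so a class that equals
      \<open>Ext1_zero\<close> consists of split extensions including \<open>e\<close>.\<close>
    then have "(e, e) \<in> ?r" using e id(1) unfolding extension_equiv_def ie by auto
    moreover have "?r `` {e} \<in> Ext1 \<C> B X" unfolding Ext1_def by (rule quotientI[OF e])
    ultimately show ?thesis using v unfolding Ext1_vanishes_def by blast
  qed
  show "ext0 (tO B) (tO X)"
    unfolding ext0_def
  proof (intro allI impI, elim conjE)
    fix M N p0 f
    assume M: "ob (M :: ('i, 'r, 'u) gob)" "sml TYPE('u) M" "sub N M" "quo M N (tO B) p0" "hom (res M N) (tO X) f"
    obtain i E p h where e: "(i, E, p) \<in> extensions \<C> B X" "hom M (tO E) h"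
      "\<And>n x. x \<in> N n \<Longrightarrow> h n x = tM i n (f n x)"
      by (rule ext_from_po[OF B X conjI[OF M(1,2)] M(3-5)]) (rule that)
    note E = extD[OF e(1) B X]
    note oE = obj[OF E(1)]
    note ih = rhom[OF X E(1,2)] and ph = rhom[OF E(1) B E(3)]
    obtain s where s: "s \<in> cat_hom \<C> B E" "cat_comp \<C> B p s = cat_id \<C> B"
      using split[OF e(1)] unfolding Ext1_zero_def by auto
    note sh = rhom[OF B E(1) s(1)]
    have ps: "tM p n (tM s n b) = b" if "b \<in> car (tO B) n" for n b
      using comp_eq[OF B E(1) B s(1) E(3), of "cat_id \<C> B"] s(2) rid[OF B] that by auto
    define N' where "N' n = tM i n ` car (tO X) n" for n
    have N': "sub N' (tO E)" unfolding N'_def[abs_def] by (rule sub_image[OF oX oE ih sub_top[OF oX]])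
    have oN': "ob (res (tO E) N')" by (rule ob_res[OF oE N'])
    have iN: "hom (tO X) (res (tO E) N') (tM i)" by (rule hom_res2[OF ih]) (simp add: N'_def)
    obtain d where d: "hom (res (tO E) N') (tO X) d" "\<And>n x. x \<in> car (tO X) n \<Longrightarrow> d n (tM i n x) = x"
    proof (rule factor[OF oX oN' oX iN _ hom_id[OF oX]])
      show "tM i n ` car (tO X) n = car (res (tO E) N') n" for n by (simp add: N'_def)
      show "x = ze (tO X) n" if "x \<in> car (tO X) n" "tM i n x = ze (res (tO E) N') n" for n x
        using inj_onD[OF E(4), of n x "ze (tO X) n"] that hom_ze[OF oX oE ih, of n] oX by simp
    qed (rule that)
    have sp: "hom (tO E) (tO E) (\<lambda>n x. tM s n (tM p n x))" by (rule hom_comp[OF ph sh])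
    have "hom (prd (tO E) (tO E)) (tO E) (\<lambda>n x. ad (tO E) n (fst x) (ng (tO E) n (tM s n (tM p n (snd x)))))"
      by (rule hom_ad2[OF oE hom_id[OF oE] hom_neg[OF oE oE sp]])
    from hom_comp[OF hom_pair[OF hom_id[OF oE] hom_id[OF oE]] this]
    have u: "hom (tO E) (tO E) (\<lambda>n x. mi (tO E) n x (tM s n (tM p n x)))" by (simp add: mi_def)
    have uN: "mi (tO E) n x (tM s n (tM p n x)) \<in> N' n" if x: "x \<in> car (tO E) n" for n x
    proof -
      have c: "tM p n x \<in> car (tO B) n" "tM s n (tM p n x) \<in> car (tO E) n"
        using hom_car[OF ph x] hom_car[OF sp x] by auto
      have "tM p n (mi (tO E) n x (tM s n (tM p n x))) = ze (tO B) n"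
        using hom_mi[OF oE oB ph x c(2)] ps[OF c(1)] c(1) oB by simp
      then show ?thesis unfolding N'_def E(5) using x c oE by simp
    qed
    have u': "hom (tO E) (res (tO E) N') (\<lambda>n x. mi (tO E) n x (tM s n (tM p n x)))"
      by (rule hom_res2[OF u uN])
    \<comment> \<open>Subtracting \<open>s \<circ> p\<close> projects \<open>E\<close> onto the
      image of \<open>X\<close>, and \<open>d\<close> inverts \<open>i\<close> there; composing with
      \<open>h\<close> extends \<open>f\<close>.\<close>
    have g: "hom M (tO X) (\<lambda>n x. d n (mi (tO E) n (h n x) (tM s n (tM p n (h n x)))))"
      by (rule hom_comp[OF e(2) hom_comp[OF u' d(1)]])
    show "\<exists>g. hom M (tO X) g \<and> (\<forall>n. \<forall>x\<in>N n. g n x = f n x)"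
    proof (intro exI conjI allI ballI, rule g)
      fix n x assume x: "x \<in> N n"
      have fx: "f n x \<in> car (tO X) n" using hom_car[OF M(5), of x n] x by simp
      have ifx: "tM i n (f n x) \<in> car (tO E) n" by (rule hom_car[OF ih fx])
      have "tM p n (tM i n (f n x)) = ze (tO B) n" using E(5)[of n] fx by blast
      then have "tM s n (tM p n (h n x)) = ze (tO E) n" using e(3)[OF x] hom_ze[OF oB oE sh] by simp
      then show "d n (mi (tO E) n (h n x) (tM s n (tM p n (h n x)))) = f n x"
        using e(3)[OF x] ifx oE d(2)[OF fx] by simp
    qed
  qed
next
  note oX = obj[OF X] and oB = obj[OF B]
  let ?r = "extension_equiv \<C> B X"
  assume ext: "ext0 (tO B) (tO X)"
  have zero: "Ext1_zero \<C> B X = extensions \<C> B X"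
  proof (intro equalityI subsetI)
    show "e \<in> extensions \<C> B X" if "e \<in> Ext1_zero \<C> B X" for e using that by (auto simp: Ext1_zero_def)
    fix e assume e: "e \<in> extensions \<C> B X"
    obtain i E p where ie: "e = (i, E, p)" by (cases e)
    note E = extD[OF e[unfolded ie] B X]
    obtain g s where s: "hom (tO B) (tO E) s" "\<And>n x. x \<in> car (tO B) n \<Longrightarrow> tM p n (s n x) = x"
      by (rule retraction[OF B X e[unfolded ie] ext]) (rule that)
    obtain s' where s': "s' \<in> cat_hom \<C> B E" "\<And>n x. x \<in> car (tO B) n \<Longrightarrow> tM s' n x = s n x"
      using rhomex[OF B E(1) s(1)] by blast
    have "cat_comp \<C> B p s' = cat_id \<C> B"
      using comp_eq[OF B E(1) B s'(1) E(3), of "cat_id \<C> B"] rid[OF B] s'(2) s(2) by auto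
    then show "e \<in> Ext1_zero \<C> B X" using e s'(1) unfolding Ext1_zero_def ie by auto
  qed
  have rel: "(e, e') \<in> ?r" if e: "e \<in> extensions \<C> B X" and e': "e' \<in> extensions \<C> B X" for e e'
  proof -
    obtain i E p where ie: "e = (i, E, p)" by (cases e)
    obtain i' E' p' where ie': "e' = (i', E', p')" by (cases e')
    note E = extD[OF e[unfolded ie] B X] and E' = extD[OF e'[unfolded ie'] B X]
    note oE = obj[OF E(1)] and oE' = obj[OF E'(1)]
    note ih = rhom[OF X E(1,2)] and ph = rhom[OF E(1) B E(3)]
    note ih' = rhom[OF X E'(1,2)] and ph' = rhom[OF E'(1) B E'(3)]
    obtain g s0 where g: "hom (tO E) (tO X) g" "\<And>n x. x \<in> car (tO X) n \<Longrightarrow> g n (tM i n x) = x"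
      by (rule retraction[OF B X e[unfolded ie] ext]) (rule that)
    obtain g0 s where s: "hom (tO B) (tO E') s" "\<And>n x. x \<in> car (tO B) n \<Longrightarrow> tM p' n (s n x) = x"
      by (rule retraction[OF B X e'[unfolded ie'] ext]) (rule that)
    \<comment> \<open>The equivalence of two split extensions: the \<open>X\<close>-part is carried
      by the retraction of the first, the quotient part by the section of the second.\<close>
    have "hom (prd (tO E) (tO E)) (tO E') (\<lambda>n x. ad (tO E') n (tM i' n (g n (fst x))) (s n (tM p n (snd x))))"
      by (rule hom_ad2[OF oE' hom_comp[OF g(1) ih'] hom_comp[OF ph s(1)]])
    from hom_comp[OF hom_pair[OF hom_id[OF oE] hom_id[OF oE]] this]
    have ph0: "hom (tO E) (tO E') (\<lambda>n x. ad (tO E') n (tM i' n (g n x)) (s n (tM p n x)))" by simp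
    obtain \<phi> where \<phi>: "\<phi> \<in> cat_hom \<C> E E'"
      "\<And>n x. x \<in> car (tO E) n \<Longrightarrow> tM \<phi> n x = ad (tO E') n (tM i' n (g n x)) (s n (tM p n x))"
      using rhomex[OF E(1) E'(1) ph0] by blast
    have "tM \<phi> n (tM i n x) = tM i' n x" if x: "x \<in> car (tO X) n" for n x
    proof -
      have "tM p n (tM i n x) = ze (tO B) n" using E(5)[of n] x by blast
      then show ?thesis
        using \<phi>(2)[OF hom_car[OF ih x]] g(2)[OF x] hom_ze[OF oB oE' s(1), of n] hom_car[OF ih' x] oE' by simp
    qed
    then have 1: "cat_comp \<C> X \<phi> i = i'" using comp_eq[OF X E(1) E'(1) E(2) \<phi>(1) E'(2)] by simp
    have "tM p' n (tM \<phi> n x) = tM p n x" if x: "x \<in> car (tO E) n" for n x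
    proof -
      have c: "g n x \<in> car (tO X) n" "tM p n x \<in> car (tO B) n" using hom_car[OF g(1) x] hom_car[OF ph x] .
      have "tM p' n (tM i' n (g n x)) = ze (tO B) n" using E'(5)[of n] c(1) by blast
      then show ?thesis
        using \<phi>(2)[OF x] hom_ad[OF ph' hom_car[OF ih' c(1)] hom_car[OF s(1) c(2)]] s(2)[OF c(2)] c(2) oB by simp
    qed
    then have 2: "cat_comp \<C> E p' \<phi> = p" using comp_eq[OF E(1) E'(1) B \<phi>(1) E'(3) E(3)] by simp
    show ?thesis using e e' \<phi>(1) 1 2 unfolding extension_equiv_def ie ie' by auto
  qed
  have cls: "?r `` {e} = extensions \<C> B X" if e: "e \<in> extensions \<C> B X" for e
  proof (intro equalityI subsetI)
    show "e' \<in> extensions \<C> B X" if "e' \<in> ?r `` {e}" for e' using that by (auto simp: extension_equiv_def)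
    show "e' \<in> ?r `` {e}" if "e' \<in> extensions \<C> B X" for e' using rel[OF e that] by simp
  qed
  have o0: "ob (res (tO B) (zs (tO B)))" by (rule ob_res[OF oB sub_zero[OF oB]])
  \<comment> \<open>One class exists at all: the pushout along the zero object is a split extension.
    Without it the set of classes could be empty.\<close>
  obtain e where e: "e \<in> extensions \<C> B X"
    by (rule ext_from_po[OF B X rob[OF B] sub_zero[OF oB] quo_zero[OF oB] hom_zero[OF o0 oX]]) (rule that)
  have "Ext1 \<C> B X = {extensions \<C> B X}"
    unfolding Ext1_def quotient_def using cls e by auto
  then show "Ext1_vanishes \<C> B X" unfolding Ext1_vanishes_def zero .
qed

lemma right_perp_eq:
  "\<A> \<subseteq> cat_ob \<C> \<Longrightarrow> right_perp \<C> \<A> = {X \<in> cat_ob \<C>. \<forall>B\<in>\<A>. ext0 (tO B) (tO X)}"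
  unfolding right_perp_def using Ext1_vanishes_iff by blast

lemma left_perp_eq:
  "\<A> \<subseteq> cat_ob \<C> \<Longrightarrow> left_perp \<C> \<A> = {B \<in> cat_ob \<C>. \<forall>X\<in>\<A>. ext0 (tO B) (tO X)}"
  unfolding left_perp_def using Ext1_vanishes_iff by blast

end

section \<open>Modules and complexes as many-sorted modules\<close>

definition toU :: "('r, 'u) module \<Rightarrow> (unit, 'r, 'u) gob" where
  "toU M = \<lparr>car = \<lambda>_. carrier M, ad = \<lambda>_. add M, ze = \<lambda>_. zero M, sm = \<lambda>_. smult M, df = \<lambda>_ x. x\<rparr>"

definition toC :: "('r, 'u) chain_complex \<Rightarrow> (int, 'r, 'u) gob" where
  "toC C = \<lparr>car = \<lambda>n. carrier (ch_mod C n), ad = \<lambda>n. add (ch_mod C n), ze = \<lambda>n. zero (ch_mod C n),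
     sm = \<lambda>n. smult (ch_mod C n), df = ch_diff C\<rparr>"

definition ofG :: "('i, 'r, 'u) gob \<Rightarrow> 'i \<Rightarrow> ('r, 'u) module" where
  "ofG G i = \<lparr>carrier = car G i, mult = undefined, one = undefined, zero = ze G i, add = ad G i, smult = sm G i\<rparr>"

text \<open>The restriction is required because module homomorphisms are extensional
  functions.\<close>

definition ofC :: "(int, 'r, 'u) gob \<Rightarrow> ('r, 'u) chain_complex" where
  "ofC G = \<lparr>ch_mod = ofG G, ch_diff = \<lambda>n. restrict (df G n) (car G n)\<rparr>"

lemma toU_simps [simp]:
  "car (toU M) i = carrier M" "ad (toU M) i = add M" "ze (toU M) i = zero M" "sm (toU M) i = smult M"
  by (simp_all add: toU_def)

lemma toC_simps [simp]:
  "car (toC C) n = carrier (ch_mod C n)" "ad (toC C) n = add (ch_mod C n)" "ze (toC C) n = zero (ch_mod C n)"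
  "sm (toC C) n = smult (ch_mod C n)" "df (toC C) n = ch_diff C n"
  by (simp_all add: toC_def)

lemma ofG_simps [simp]:
  "carrier (ofG G i) = car G i" "add (ofG G i) = ad G i" "zero (ofG G i) = ze G i" "smult (ofG G i) = sm G i"
  by (simp_all add: ofG_def)

lemma ofC_simps [simp]:
  "ch_mod (ofC G) = ofG G" "ch_diff (ofC G) n = restrict (df G n) (car G n)"
  by (simp_all add: ofC_def)

lemma (in gcat) left_module_ofG: assumes G: "ob G" shows "left_module R (ofG G i)"
proof (intro left_module.intro left_module_axioms.intro)
  show "ring R" by (rule R.ring_axioms)
  show "abelian_group (ofG G i)"
  proof (rule abelian_groupI)
    show "\<exists>y\<in>carrier (ofG G i). y \<oplus>\<^bsub>ofG G i\<^esub> x = \<zero>\<^bsub>ofG G i\<^esub>" if "x \<in> carrier (ofG G i)" for x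
      using that G by (intro bexI[of _ "ng G i x"]) simp_all
    show "x \<oplus>\<^bsub>ofG G i\<^esub> y = y \<oplus>\<^bsub>ofG G i\<^esub> x" if "x \<in> carrier (ofG G i)" "y \<in> carrier (ofG G i)" for x y
      using that G by (simp add: ad_comm)
  qed (use G in \<open>simp_all add: ad_assoc\<close>)
qed (use G in \<open>simp_all add: sm_add sm_ad sm_mult\<close>)

lemma mod_hom_iff:
  "f \<in> mod_hom R M N \<longleftrightarrow> f \<in> extensional (carrier M) \<and>
     (\<forall>x\<in>carrier M. f x \<in> carrier N \<and> (\<forall>y\<in>carrier M. f (x \<oplus>\<^bsub>M\<^esub> y) = f x \<oplus>\<^bsub>N\<^esub> f y) \<and>
       (\<forall>a\<in>carrier R. f (a \<odot>\<^bsub>M\<^esub> x) = a \<odot>\<^bsub>N\<^esub> f x))"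
  unfolding mod_hom_def PiE_def by auto

locale base = R: ring R for R :: "('r, 'k) ring_scheme" (structure) +
  fixes A :: "'u set"
  assumes univ: "universe TYPE('u)" and A_inf: "infinite A" and A_small: "small TYPE('u) A"
    and R_bnd: "bnd A (carrier R)"

sublocale base \<subseteq> Mo: gcatu R "\<lambda>_ :: unit. ()" "{}" A
  by (intro gcatu.intro gcat.intro gcatu_axioms.intro R.ring_axioms univ A_inf A_small R_bnd bnd_countable[OF A_inf])
    simp_all

sublocale base \<subseteq> Ch: gcatu R "\<lambda>n :: int. n - 1" UNIV A
  by (intro gcatu.intro gcat.intro gcatu_axioms.intro R.ring_axioms univ A_inf A_small R_bnd bnd_countable[OF A_inf])
    simp_all

context base begin

lemma toU_ob: assumes "left_module R M" shows "Mo.ob (toU M)"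
proof -
  interpret M: left_module R M by fact
  show ?thesis
  proof (rule Mo.obI)
    show "\<exists>y\<in>car (toU M) i. ad (toU M) i x y = ze (toU M) i" if "x \<in> car (toU M) i" for i x
      using that by (intro bexI[of _ "\<ominus>\<^bsub>M\<^esub> x"]) (simp_all add: M.r_neg)
    show "ad (toU M) i x y = ad (toU M) i y x" if "x \<in> car (toU M) i" "y \<in> car (toU M) i" for i x y
      using that by (simp add: M.a_comm)
  qed (simp_all add: M.a_assoc M.lsmult_closed M.lsmult_l_distr M.lsmult_r_distr M.lsmult_assoc M.lsmult_one)
qed

lemma toC_ob: assumes C: "C \<in> complexes R" shows "Ch.ob (toC C)"
proof -
  have m: "left_module R (ch_mod C n)" for n using C by (simp add: complexes_def modules_def)
  have d: "ch_diff C n \<in> mod_hom R (ch_mod C n) (ch_mod C (n - 1))" for n using C by (simp add: complexes_def)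
  note d' = d[unfolded mod_hom_iff]
  have dd: "ch_diff C (n - 1) (ch_diff C n x) = \<zero>\<^bsub>ch_mod C (n - 1 - 1)\<^esub>" if "x \<in> carrier (ch_mod C n)" for n x
    using C that by (simp add: complexes_def)
  have o: "Mo.ob (toU (ch_mod C n))" for n by (rule toU_ob[OF m])
  show ?thesis
  proof (rule Ch.obI)
    show "\<exists>y\<in>car (toC C) i. ad (toC C) i x y = ze (toC C) i" if "x \<in> car (toC C) i" for i x
      using Mo.ng_ex[OF o[of i], of x] that by auto
    show "ad (toC C) i x y = ad (toC C) i y x" if "x \<in> car (toC C) i" "y \<in> car (toC C) i" for i x y
      using Mo.ad_comm[OF o[of i], of x _ y] that by simp
  qed (use d' dd Mo.ze_car[OF o] Mo.ad_car[OF o] Mo.ad_assoc[OF o] Mo.ze_ad[OF o] Mo.sm_car[OF o] Mo.sm_ad[OF o]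
      Mo.sm_add[OF o] Mo.sm_mult[OF o] Mo.sm_one[OF o] in simp_all)
qed

lemma toU_smob: "M \<in> modules R \<Longrightarrow> Mo.smob TYPE('u) (toU (M :: ('r, 'u) module))"
  by (simp add: modules_def toU_ob sml_def)

lemma toC_smob: "C \<in> complexes R \<Longrightarrow> Ch.smob TYPE('u) (toC (C :: ('r, 'u) chain_complex))"
  using toC_ob[of C] by (simp add: complexes_def modules_def sml_def)

lemma ofG_modules: "Mo.smob TYPE('u) (G :: (unit, 'r, 'u) gob) \<Longrightarrow> ofG G i \<in> modules R"
  by (simp add: modules_def Mo.left_module_ofG sml_def)

lemma ofC_complexes:
  assumes "Ch.smob TYPE('u) (G :: (int, 'r, 'u) gob)" shows "ofC G \<in> complexes R"
proof -
  have o: "Ch.ob G" and s: "\<And>n. small TYPE('u) (car G n)" using assms by (auto simp: sml_def)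
  have "restrict (df G n) (car G n) \<in> mod_hom R (ofG G n) (ofG G (n - 1))" for n
    unfolding mod_hom_iff using o by (simp add: Ch.df_car[of G n] Ch.df_ad[of G n] Ch.df_sm[of G n])
  moreover have "df G (n - 1) (df G n x) = ze G (n - 2)" if "x \<in> car G n" for n x
    using Ch.df_df[OF o _ _ that] by simp
  moreover have "df G n x \<in> car G (n - 1)" if "x \<in> car G n" for n x using Ch.df_car[OF o _ that] by simp
  ultimately show ?thesis
    unfolding complexes_def modules_def using Ch.left_module_ofG[OF o] s by simp
qed

lemma toU_hom_iff: "Mo.hom (toU M) (toU N) f \<longleftrightarrow> restrict (f ()) (carrier M) \<in> mod_hom R M N"
  if "left_module R M" for M :: "('r, 'u) module" and N :: "('r, 'u) module"
proof -
  note o = toU_ob[OF that]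
  show ?thesis
    unfolding Mo.hom_def mod_hom_iff using Mo.ad_car[OF o] Mo.sm_car[OF o] by simp
qed

lemma toC_hom_iff: "Ch.hom (toC C) (toC D) f \<longleftrightarrow> (\<lambda>n. restrict (f n) (carrier (ch_mod C n))) \<in> ch_hom R C D"
  if "C \<in> complexes R" for C :: "('r, 'u) chain_complex" and D :: "('r, 'u) chain_complex"
proof -
  note o = toC_ob[OF that]
  show ?thesis
    unfolding Ch.hom_def ch_hom_def mod_hom_iff using Ch.ad_car[OF o] Ch.sm_car[OF o] Ch.df_car[OF o]
    by simp (intro iffI; simp)
qed

lemma mod_hom_restrict: "f \<in> mod_hom R M N \<Longrightarrow> restrict f (carrier M) = f"
  by (auto simp: mod_hom_iff extensional_restrict)

lemma ch_hom_restrict: "f \<in> ch_hom R C D \<Longrightarrow> (\<lambda>n. restrict (f n) (carrier (ch_mod C n))) = f"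
proof
  fix n assume "f \<in> ch_hom R C D"
  then have "f n \<in> mod_hom R (ch_mod C n) (ch_mod D n)" by (simp add: ch_hom_def)
  then show "restrict (f n) (carrier (ch_mod C n)) = f n" by (rule mod_hom_restrict)
qed

end

sublocale base \<subseteq> Mo: repcat R "\<lambda>_ :: unit. ()" "{}" A "RMod R" toU "\<lambda>f _. f"
proof unfold_locales
  let ?C = "RMod R :: (('r, 'u) module, 'u \<Rightarrow> 'u) cat"
  have s: "cat_ob ?C = modules R" "cat_hom ?C = mod_hom R" "cat_id ?C = (\<lambda>M. \<lambda>x\<in>carrier M. x)"
    "cat_comp ?C = (\<lambda>M g f. compose (carrier M) g f)" "cat_ses ?C = mod_ses R"
    by (simp_all add: RMod_def)
  have lm: "left_module R M" if "M \<in> modules R" for M :: "('r, 'u) module" using that by (simp add: modules_def)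
  fix X Y Z assume X: "X \<in> cat_ob ?C" and Y: "Y \<in> cat_ob ?C" and Z: "Z \<in> cat_ob ?C"
  note lX = lm[OF X[unfolded s]]
  show "Mo.smob TYPE('u) (toU X)" using toU_smob X by (simp add: s)
  have h: "Mo.hom (toU X) (toU Y) (\<lambda>_. f)" if "X \<in> cat_ob ?C" "f \<in> cat_hom ?C X Y" for f X Y
    using that(2) mod_hom_restrict[of f X Y] toU_hom_iff[OF lm[OF that(1)[unfolded s]], of Y "\<lambda>_. f"] by (simp add: s)
  show "Mo.hom (toU X) (toU Y) (\<lambda>_. f)" if "f \<in> cat_hom ?C X Y" for f using h[OF X that] .
  show "\<exists>f\<in>cat_hom ?C X Y. \<forall>i. \<forall>x\<in>car (toU X) i. f x = g i x" if "Mo.hom (toU X) (toU Y) g" for g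
    using that unfolding toU_hom_iff[OF lX] s by (intro bexI[of _ "restrict (g ()) (carrier X)"]) simp_all
  show "f = g" if "f \<in> cat_hom ?C X Y" "g \<in> cat_hom ?C X Y" "\<And>i x. x \<in> car (toU X) i \<Longrightarrow> f x = g x" for f g
    using that unfolding s by (intro extensionalityI[of _ "carrier X"]) (auto simp: mod_hom_iff)
  show "cat_comp ?C X g f \<in> cat_hom ?C X Z \<and> (\<forall>i. \<forall>x\<in>car (toU X) i. cat_comp ?C X g f x = g (f x))"
    if f: "f \<in> cat_hom ?C X Y" and g: "g \<in> cat_hom ?C Y Z" for f g
  proof
    show "cat_comp ?C X g f \<in> cat_hom ?C X Z"
      using Mo.hom_comp[OF h[OF X f] h[OF Y g]] unfolding toU_hom_iff[OF lX] by (simp add: s compose_def)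
  qed (simp add: s compose_def)
  show "cat_id ?C X \<in> cat_hom ?C X X \<and> (\<forall>i. \<forall>x\<in>car (toU X) i. cat_id ?C X x = x)"
    using Mo.hom_id[OF toU_ob[OF lX]] unfolding toU_hom_iff[OF lX] by (simp add: s)
  show "cat_ses ?C X i Y p Z \<longleftrightarrow> i \<in> cat_hom ?C X Y \<and> p \<in> cat_hom ?C Y Z \<and>
        (\<forall>n. inj_on i (car (toU X) n)) \<and>
        (\<forall>n. i ` car (toU X) n = {x \<in> car (toU Y) n. p x = ze (toU Z) n}) \<and>
        (\<forall>n. p ` car (toU Y) n = car (toU Z) n)" for i p
    unfolding s mod_ses_def a_kernel_def' by simp
next
  fix G :: "(unit, 'r, 'u) gob" assume G: "Mo.smob TYPE('u) G"
  have "Mo.eqo (toU (ofG G ())) G"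
    unfolding Mo.eqo_def Mo.le_def Mo.hom_def using G by simp
  moreover have "ofG G () \<in> cat_ob (RMod R)" using ofG_modules[OF G] by (simp add: RMod_def)
  ultimately show "\<exists>X\<in>cat_ob (RMod R). Mo.eqo (toU X) G" by blast
qed

sublocale base \<subseteq> Ch: repcat R "\<lambda>n :: int. n - 1" UNIV A "ChR R" toC "\<lambda>f. f"
proof unfold_locales
  let ?C = "ChR R :: (('r, 'u) chain_complex, int \<Rightarrow> 'u \<Rightarrow> 'u) cat"
  have s: "cat_ob ?C = complexes R" "cat_hom ?C = ch_hom R" "cat_id ?C = (\<lambda>C n. \<lambda>x\<in>carrier (ch_mod C n). x)"
    "cat_comp ?C = (\<lambda>C g f n. compose (carrier (ch_mod C n)) (g n) (f n))" "cat_ses ?C = ch_ses R"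
    by (simp_all add: ChR_def)
  fix X Y Z assume X: "X \<in> cat_ob ?C" and Y: "Y \<in> cat_ob ?C" and Z: "Z \<in> cat_ob ?C"
  note lX = X[unfolded s]
  note o = toC_ob[OF lX]
  show "Ch.smob TYPE('u) (toC X)" using toC_smob X by (simp add: s)
  have h: "Ch.hom (toC X) (toC Y) f" if "X \<in> cat_ob ?C" "f \<in> cat_hom ?C X Y" for f X Y
    using that(2) ch_hom_restrict[of f X Y] toC_hom_iff[OF that(1)[unfolded s], of Y f] by (simp add: s)
  show "Ch.hom (toC X) (toC Y) f" if "f \<in> cat_hom ?C X Y" for f using h[OF X that] .
  show "\<exists>f\<in>cat_hom ?C X Y. \<forall>i. \<forall>x\<in>car (toC X) i. f i x = g i x" if "Ch.hom (toC X) (toC Y) g" for g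
    using that unfolding toC_hom_iff[OF lX] s
    by (intro bexI[of _ "\<lambda>n. restrict (g n) (carrier (ch_mod X n))"]) simp_all
  show "f = g" if f: "f \<in> cat_hom ?C X Y" and g: "g \<in> cat_hom ?C X Y"
    and e: "\<And>i x. x \<in> car (toC X) i \<Longrightarrow> f i x = g i x" for f g
  proof
    fix n
    show "f n = g n"
      by (rule extensionalityI[of _ "carrier (ch_mod X n)"]) (use f g e in \<open>simp_all add: s ch_hom_def mod_hom_iff\<close>)
  qed
  show "cat_comp ?C X g f \<in> cat_hom ?C X Z \<and> (\<forall>i. \<forall>x\<in>car (toC X) i. cat_comp ?C X g f i x = g i (f i x))"
    if f: "f \<in> cat_hom ?C X Y" and g: "g \<in> cat_hom ?C Y Z" for f g
  proof
    show "cat_comp ?C X g f \<in> cat_hom ?C X Z"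
      using Ch.hom_comp[OF h[OF X f] h[OF Y g]] unfolding toC_hom_iff[OF lX] by (simp add: s compose_def)
  qed (simp add: s compose_def)
  show "cat_id ?C X \<in> cat_hom ?C X X \<and> (\<forall>i. \<forall>x\<in>car (toC X) i. cat_id ?C X i x = x)"
    using Ch.hom_id[OF o] unfolding toC_hom_iff[OF lX] by (simp add: s)
  show "cat_ses ?C X i Y p Z \<longleftrightarrow> i \<in> cat_hom ?C X Y \<and> p \<in> cat_hom ?C Y Z \<and>
        (\<forall>n. inj_on (i n) (car (toC X) n)) \<and>
        (\<forall>n. i n ` car (toC X) n = {x \<in> car (toC Y) n. p n x = ze (toC Z) n}) \<and>
        (\<forall>n. p n ` car (toC Y) n = car (toC Z) n)" for i p
  proof -
    have "i \<in> ch_hom R X Y \<Longrightarrow> \<forall>n. i n \<in> mod_hom R (ch_mod X n) (ch_mod Y n)"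
      and "p \<in> ch_hom R Y Z \<Longrightarrow> \<forall>n. p n \<in> mod_hom R (ch_mod Y n) (ch_mod Z n)"
      by (simp_all add: ch_hom_def)
    then show ?thesis
      unfolding s ch_ses_def mod_ses_def a_kernel_def' toC_simps all_conj_distrib by argo
  qed
next
  fix G :: "(int, 'r, 'u) gob" assume G: "Ch.smob TYPE('u) G"
  have "Ch.eqo (toC (ofC G)) G"
    unfolding Ch.eqo_def Ch.le_def Ch.hom_def using G by simp
  moreover have "ofC G \<in> cat_ob (ChR R)" using ofC_complexes[OF G] by (simp add: ChR_def)
  ultimately show "\<exists>X\<in>cat_ob (ChR R). Ch.eqo (toC X) G" by blast
qed

section \<open>Cotorsion pairs of modules\<close>

context gcatu begin

lemma ext0_eqo2: assumes "ext0 G V" and "eqo V V'" shows "ext0 G V'"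
  unfolding ext0_def
proof (intro allI impI, elim conjE)
  fix M N p f
  assume M: "ob (M :: ('i, 'r, 'u) gob)" "sml TYPE('u) M" "sub N M" "quo M N G p" "hom (res M N) V' f"
  have f: "hom (res M N) V f" by (rule hom_le[OF M(5) eqo_ge[OF assms(2)]])
  obtain g where "hom M V g" "\<And>i x. x \<in> N i \<Longrightarrow> g i x = f i x"
    by (rule ext0D[OF assms(1) conjI[OF M(1,2)] M(3,4) f]) (rule that)
  then show "\<exists>g. hom M V' g \<and> (\<forall>i. \<forall>x\<in>N i. g i x = f i x)"
    using hom_le[OF _ eqo_le[OF assms(2)]] by blast
qed

lemma ext0_iso1:
  assumes "ext0 G V" "smob TYPE('u) G" "smob TYPE('u) H" "ob V" and "eqo G H" shows "ext0 H V"
  by (rule ext0_retract[OF assms(1,3,2,4)]) (use assms(5) in \<open>auto simp: eqo_def le_def\<close>)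

end

definition regR :: "('r, 'k) ring_scheme \<Rightarrow> (unit, 'r, 'r) gob" where
  "regR R = \<lparr>car = \<lambda>_. carrier R, ad = \<lambda>_. add R, ze = \<lambda>_. zero R, sm = \<lambda>_. mult R, df = \<lambda>_ x. x\<rparr>"

lemma regR_simps [simp]:
  "car (regR R) i = carrier R" "ad (regR R) i = add R" "ze (regR R) i = zero R" "sm (regR R) i = mult R"
  by (simp_all add: regR_def)

context base begin

lemma regR_ob: "Mo.ob (regR R)"
proof (rule Mo.obI)
  show "\<exists>y\<in>car (regR R) i. ad (regR R) i x y = ze (regR R) i" if "x \<in> car (regR R) i" for i x
    using that by (intro bexI[of _ "\<ominus> x"]) (simp_all add: R.r_neg)
  show "ad (regR R) i x y = ad (regR R) i y x" if "x \<in> car (regR R) i" "y \<in> car (regR R) i" for i x y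
    using that by (simp add: R.a_comm)
qed (simp_all add: R.a_assoc R.r_distr R.l_distr R.m_assoc)

lemma regR_hom: assumes M: "Mo.ob M" and m: "m \<in> car M ()" shows "Mo.hom (regR R) M (\<lambda>_ r. sm M () r m)"
  unfolding Mo.hom_def using M m by (simp add: Mo.sm_add Mo.sm_mult)

text \<open>The regular module, transported from \<open>'r\<close> to \<open>'u\<close>.\<close>

definition RG :: "(unit, 'r, 'u) gob" where
  "RG = (SOME E. Mo.smob TYPE('u) E \<and> bnd A (Sigma UNIV (car E)) \<and>
     (\<exists>e d. Mo.hom (regR R) E e \<and> Mo.hom E (regR R) d \<and>
       (\<forall>r\<in>carrier R. d () (e () r) = r) \<and> (\<forall>y\<in>car E (). e () (d () y) = y)))"

lemma RG: "Mo.smob TYPE('u) RG" "bnd A (Sigma UNIV (car RG))"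
  and RG_iso: "\<exists>e d. Mo.hom (regR R) RG e \<and> Mo.hom RG (regR R) d \<and>
       (\<forall>r\<in>carrier R. d () (e () r) = r) \<and> (\<forall>y\<in>car RG (). e () (d () y) = y)"
proof -
  have b: "bnd A (Sigma (UNIV :: unit set) (car (regR R)))"
    by (rule bnd_Sigma[OF A_inf bnd_countable[OF A_inf]]) (simp_all add: R_bnd)
  obtain E :: "(unit, 'r, 'u) gob" and e d where E: "Mo.ob E" "\<And>i. car E i \<subseteq> A" "\<And>i. car E i = e i ` car (regR R) i"
    "Mo.hom (regR R) E e" "Mo.hom E (regR R) d" "\<And>i x. x \<in> car (regR R) i \<Longrightarrow> d i (e i x) = x"
    "\<And>i y. y \<in> car E i \<Longrightarrow> e i (d i y) = y"
    by (rule Mo.copy_in_A[OF regR_ob b]) (rule that)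
  have "bnd A (Sigma UNIV (car E))"
    by (rule bnd_Sigma[OF A_inf bnd_countable[OF A_inf]]) (simp_all add: subset_imp_lepoll[OF E(2)])
  then have "\<exists>E :: (unit, 'r, 'u) gob. Mo.smob TYPE('u) E \<and> bnd A (Sigma UNIV (car E)) \<and>
     (\<exists>e d. Mo.hom (regR R) E e \<and> Mo.hom E (regR R) d \<and>
       (\<forall>r\<in>carrier R. d () (e () r) = r) \<and> (\<forall>y\<in>car E (). e () (d () y) = y))"
    using E Mo.sml_A[of E] by (intro exI[of _ E] conjI exI[of _ e] exI[of _ d]) auto
  from someI_ex[OF this]
  show "Mo.smob TYPE('u) RG" "bnd A (Sigma UNIV (car RG))"
    "\<exists>e d. Mo.hom (regR R) RG e \<and> Mo.hom RG (regR R) d \<and>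
       (\<forall>r\<in>carrier R. d () (e () r) = r) \<and> (\<forall>y\<in>car RG (). e () (d () y) = y)"
    unfolding RG_def[symmetric] by blast+
qed

lemma RG_gen: assumes M: "Mo.ob M" and m: "m \<in> car M ()"
  obtains g y where "Mo.hom RG M g" "y \<in> car RG ()" "g () y = m"
proof -
  obtain e d where e: "Mo.hom (regR R) RG e" "Mo.hom RG (regR R) d" "\<And>r. r \<in> carrier R \<Longrightarrow> d () (e () r) = r"
    using RG_iso by blast
  have h: "Mo.hom RG M (\<lambda>i y. sm M () (d i y) m)" by (rule Mo.hom_comp[OF e(2) regR_hom[OF M m]])
  show thesis
  proof (rule that[OF h, of "e () \<one>"])
    show "e () \<one> \<in> car RG ()" using Mo.hom_car[OF e(1), of \<one> "()"] by simp
    show "sm M () (d () (e () \<one>)) m = m" using e(3) M m by simp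
  qed
qed

text \<open>The regular module is free on the image of one. Lifting this generator to
  \<open>m\<close> gives a section of \<open>p\<close>, and \<open>x - (d (p x)) m\<close> projects
  \<open>M\<close> onto \<open>N\<close>.\<close>

lemma RG_projective: assumes V: "Mo.ob (V :: (unit, 'r, 'u) gob)" shows "Mo.ext0 RG V"
  unfolding Mo.ext0_def
proof (intro allI impI, elim conjE)
  fix M :: "(unit, 'r, 'u) gob" and N p f
  assume M: "Mo.ob M" "sml TYPE('u) M" "Mo.sub N M" "Mo.quo M N RG p" "Mo.hom (res M N) V f"
  have oRG: "Mo.ob RG" using RG by blast
  note ph = Mo.quo_hom[OF M(4)]
  obtain e d where e: "Mo.hom (regR R) RG e" "Mo.hom RG (regR R) d" "\<And>y. y \<in> car RG () \<Longrightarrow> e () (d () y) = y"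
    using RG_iso by blast
  have "e () \<one> \<in> car RG ()" using Mo.hom_car[OF e(1), of \<one> "()"] by simp
  then obtain m where m: "m \<in> car M ()" "p () m = e () \<one>" using Mo.quo_lift[OF M(4)] by blast
  have r: "Mo.hom M M (\<lambda>i x. sm M () (d i (p i x)) m)"
    by (rule Mo.hom_comp[OF Mo.hom_comp[OF ph e(2)] regR_hom[OF M(1) m(1)]])
  have "Mo.hom (prd M M) M (\<lambda>i x. ad M i (fst x) (ng M i (sm M () (d i (p i (snd x))) m)))"
    by (rule Mo.hom_ad2[OF M(1) Mo.hom_id[OF M(1)] Mo.hom_neg[OF M(1,1) r]])
  from Mo.hom_comp[OF Mo.hom_pair[OF Mo.hom_id[OF M(1)] Mo.hom_id[OF M(1)]] this]
  have u: "Mo.hom M M (\<lambda>i x. mi M i x (sm M () (d i (p i x)) m))" by (simp add: mi_def)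
  have uN: "mi M i x (sm M () (d i (p i x)) m) \<in> N i" if x: "x \<in> car M i" for i x
  proof -
    have i: "i = ()" by simp
    have px: "p () x \<in> car RG ()" using Mo.hom_car[OF ph x] by simp
    have dr: "d () (p () x) \<in> carrier R" using Mo.hom_car[OF e(2) px] by simp
    have "p () (sm M () (d () (p () x)) m) = sm RG () (d () (p () x)) (e () \<one>)"
      using Mo.hom_sm[OF ph m(1) dr] m(2) by simp
    also have "\<dots> = e () (d () (p () x))"
      using Mo.hom_sm[OF e(1), of \<one> "()" "d () (p () x)"] dr by simp
    also have "\<dots> = p () x" by (rule e(3)[OF px])
    finally have eq: "p () (sm M () (d () (p () x)) m) = p () x" .
    have c: "sm M () (d () (p () x)) m \<in> car M ()" using M(1) dr m(1) by simp
    have "p () (mi M () x (sm M () (d () (p () x)) m)) = ze RG ()"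
      using Mo.hom_mi[OF M(1) oRG ph, of x "()" "sm M () (d () (p () x)) m"] x c eq px oRG by simp
    then show ?thesis using Mo.quo_ker[OF M(4), of "mi M () x (sm M () (d () (p () x)) m)" "()"] x c M(1) by simp
  qed
  show "\<exists>g. Mo.hom M V g \<and> (\<forall>i. \<forall>x\<in>N i. g i x = f i x)"
  proof (intro exI conjI allI ballI)
    show "Mo.hom M V (\<lambda>i x. f i (mi M i x (sm M () (d i (p i x)) m)))"
      by (rule Mo.hom_comp[OF Mo.hom_res2[OF u uN] M(5)])
    fix i x assume x: "x \<in> N i"
    have xM: "x \<in> car M ()" using Mo.sub_car[OF M(3) x] by simp
    have "p () x = ze RG ()" using Mo.quo_ker[OF M(4) xM] x by simp
    then have "d () (p () x) = \<zero>" using Mo.hom_ze[OF oRG regR_ob e(2), of "()"] by simp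
    then show "f i (mi M i x (sm M () (d i (p i x)) m)) = f i x"
      using M(1) m(1) xM Mo.zero_sm[OF M(1) m(1)] by simp
  qed
qed

text \<open>Membership in the left class of the cotorsion pair cogenerated by \<open>S\<close>.\<close>

definition Lc :: "(unit, 'r, 'u) gob set \<Rightarrow> (unit, 'r, 'u) gob \<Rightarrow> bool" where
  "Lc S G \<longleftrightarrow> Mo.smob TYPE('u) G \<and>
     (\<forall>V. Mo.smob TYPE('u) V \<and> (\<forall>M\<in>S. Mo.ext0 M V) \<longrightarrow> Mo.ext0 G V)"

lemma Lc_smob: "Lc S G \<Longrightarrow> Mo.smob TYPE('u) G"
  by (simp add: Lc_def)

text \<open>Eklof's lemma in the form used for classes: a left class is closed under
  filtrations.\<close>

lemma Lc_filtr:
  fixes M :: "(unit, 'r, 'u) gob"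
  assumes F: "Mo.filtr \<S> X M F" and X: "Mo.sub X M" and M: "Mo.ob M" and p: "Mo.quo M X G p"
    and G: "Mo.smob TYPE('u) G" and S: "\<And>S. S \<in> \<S> \<Longrightarrow> Lc S0 S"
  shows "Lc S0 G"
  unfolding Lc_def
proof (intro conjI allI impI)
  show "Mo.ob G" "sml TYPE('u) G" using G by auto
  fix V assume V: "Mo.smob TYPE('u) V \<and> (\<forall>M\<in>S0. Mo.ext0 M V)"
  have oG: "Mo.ob G" and oV: "Mo.ob V" using G V by auto
  show "Mo.ext0 G V"
    by (rule Mo.ext0_filtr[OF F X M p oG oV]) (use S V in \<open>auto simp: Lc_def\<close>)
qed

lemma Lc_retract:
  assumes Q: "Lc S Q" and C: "Mo.smob TYPE('u) C"
    and s: "Mo.hom C Q s" and q: "Mo.hom Q C q" and qs: "\<And>i x. x \<in> car C i \<Longrightarrow> q i (s i x) = x"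
  shows "Lc S C"
  unfolding Lc_def
proof (intro conjI allI impI)
  show "Mo.ob C" "sml TYPE('u) C" using C by auto
  fix V assume V: "Mo.smob TYPE('u) V \<and> (\<forall>M\<in>S. Mo.ext0 M V)"
  have oV: "Mo.ob V" using V by auto
  have "Mo.ext0 Q V" using Q V by (auto simp: Lc_def)
  then show "Mo.ext0 C V" by (rule Mo.ext0_retract[OF _ C Lc_smob[OF Q] oV s q qs])
qed

lemma Lc_RG: "Lc S RG"
  using RG RG_projective by (simp add: Lc_def)

text \<open>The regular module is adjoined to \<open>S\<close> so that every element is hit by a
  generator. Being projective, it changes neither the right class nor the left one.\<close>

lemma Lc_kaplansky:
  assumes G: "Lc S G" and S: "\<And>M. M \<in> S \<Longrightarrow> Mo.ob M \<and> bnd A (Sigma UNIV (car M))"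
  shows "\<exists>F. Mo.filtr {U. Lc S U \<and> bnd A (Sigma UNIV (car U))} (\<lambda>i. {ze G i}) G F"
proof -
  let ?S = "insert RG S"
  have oG: "Mo.ob G" using Lc_smob[OF G] by blast
  have "\<exists>F. Mo.filtr (Mo.ucl ?S) (\<lambda>i. {ze G i}) G F"
  proof (rule Mo.kaplansky[OF Lc_smob[OF G]])
    show "Mo.ob M \<and> bnd A (Sigma UNIV (car M))" if "M \<in> ?S" for M using that S RG by auto
    show "\<exists>S\<in>?S. \<exists>g. Mo.hom S G g \<and> x \<in> g i ` car S i" if "x \<in> car G i" for i x
    proof -
      have x: "x \<in> car G ()" using that by simp
      obtain g y where "Mo.hom RG G g" "y \<in> car RG ()" "g () y = x" by (rule RG_gen[OF oG x])
      then show ?thesis by (intro bexI[of _ RG] exI[of _ g]) auto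
    qed
    show "Mo.ext0 G V" if "Mo.smob TYPE('u) V" "\<And>M. M \<in> ?S \<Longrightarrow> Mo.ext0 M V" for V
      using that G by (auto simp: Lc_def)
  qed
  then obtain F where F: "Mo.filtr (Mo.ucl ?S) (\<lambda>i. {ze G i}) G F" by blast
  have "Mo.ucl ?S \<subseteq> {U. Lc S U \<and> bnd A (Sigma UNIV (car U))}"
    using RG_projective by (auto simp: Mo.ucl_def Lc_def)
  from Mo.filtr_mono[OF F this] show ?thesis by blast
qed

text \<open>Translates membership in the left class of a cotorsion pair: test objects among small
  many-sorted modules and among modules correspond up to \<open>eqo\<close>, which extension
  properties respect.\<close>

lemma class_iff:
  assumes cp: "cotorsion_pair (RMod R) \<U> \<V>" and S: "S \<subseteq> \<U>" "right_perp (RMod R) S = \<V>"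
  shows "M \<in> \<U> \<longleftrightarrow> M \<in> modules R \<and> Lc (toU ` S) (toU M)"
proof -
  have ob: "cat_ob (RMod R) = (modules R :: ('r, 'u) module set)" by (simp add: RMod_def)
  have U: "\<U> = left_perp (RMod R) \<V>" using cp unfolding cotorsion_pair_def by (rule conjunct1)
  have Vob: "\<V> \<subseteq> cat_ob (RMod R)" using S(2) unfolding right_perp_def by blast
  have Uob: "\<U> \<subseteq> cat_ob (RMod R)" unfolding U left_perp_def by blast
  have Sob: "S \<subseteq> cat_ob (RMod R)" using S(1) Uob by blast
  have V: "V \<in> \<V> \<longleftrightarrow> V \<in> cat_ob (RMod R) \<and> (\<forall>M\<in>S. Mo.ext0 (toU M) (toU V))" for V
    using S(2) unfolding Mo.right_perp_eq[OF Sob] by auto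
  have "M \<in> \<U> \<longleftrightarrow> M \<in> modules R \<and> (\<forall>V\<in>\<V>. Mo.ext0 (toU M) (toU V))"
    unfolding U Mo.left_perp_eq[OF Vob] ob by simp
  also have "\<dots> \<longleftrightarrow> M \<in> modules R \<and> Lc (toU ` S) (toU M)"
  proof (intro conj_cong refl iffI ballI)
    assume M: "M \<in> modules R" and e: "\<forall>V\<in>\<V>. Mo.ext0 (toU M) (toU V)"
    show "Lc (toU ` S) (toU M)"
      unfolding Lc_def
    proof (intro conjI allI impI)
      show "Mo.ob (toU M)" "sml TYPE('u) (toU M)" using toU_smob[OF M] by auto
      fix V assume V': "Mo.smob TYPE('u) V \<and> (\<forall>M\<in>toU ` S. Mo.ext0 M V)"
      obtain V0 where V0: "V0 \<in> cat_ob (RMod R)" "Mo.eqo (toU V0) V" using Mo.rex[of V] V' by blast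
      have sym: "Mo.eqo V (toU V0)" using V0(2) by (simp add: Mo.eqo_def)
      have "\<forall>M\<in>S. Mo.ext0 (toU M) (toU V0)" using V' Mo.ext0_eqo2[OF _ sym] by blast
      then have "V0 \<in> \<V>" using V V0(1) by blast
      then have "Mo.ext0 (toU M) (toU V0)" using e by blast
      then show "Mo.ext0 (toU M) V" by (rule Mo.ext0_eqo2[OF _ V0(2)])
    qed
  next
    fix V assume M: "M \<in> modules R" and l: "Lc (toU ` S) (toU M)" and "V \<in> \<V>"
    then have "V \<in> modules R" "\<forall>M\<in>toU ` S. Mo.ext0 M (toU V)" using V ob by auto
    then show "Mo.ext0 (toU M) (toU V)" using l toU_smob[of V] unfolding Lc_def by blast
  qed
  finally show ?thesis .
qed

end

section \<open>Exact complexes\<close>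

definition deg :: "(int, 'r, 'a) gob \<Rightarrow> int \<Rightarrow> (unit, 'r, 'a) gob" where
  "deg G n = \<lparr>car = \<lambda>_. car G n, ad = \<lambda>_. ad G n, ze = \<lambda>_. ze G n, sm = \<lambda>_. sm G n, df = \<lambda>_ x. x\<rparr>"

lemma deg_simps [simp]:
  "car (deg G n) i = car G n" "ad (deg G n) i = ad G n" "ze (deg G n) i = ze G n" "sm (deg G n) i = sm G n"
  by (simp_all add: deg_def)

definition Zc :: "(int, 'r, 'a) gob \<Rightarrow> int \<Rightarrow> 'a set" where
  "Zc G n = {x \<in> car G n. df G n x = ze G (n - 1)}"

definition cyc :: "(int, 'r, 'a) gob \<Rightarrow> int \<Rightarrow> (unit, 'r, 'a) gob" where
  "cyc G n = res (deg G n) (\<lambda>_. Zc G n)"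

lemma cyc_simps [simp]:
  "car (cyc G n) i = Zc G n" "ad (cyc G n) i = ad G n" "ze (cyc G n) i = ze G n" "sm (cyc G n) i = sm G n"
  by (simp_all add: cyc_def)

lemma deg_res: "deg (res G N) n = res (deg G n) (\<lambda>_. N n)"
  by (simp add: deg_def res_def)

lemma Zc_res: "N n \<subseteq> car G n \<Longrightarrow> Zc (res G N) n = N n \<inter> Zc G n"
  by (auto simp: Zc_def)

lemma cyc_res: "N n \<subseteq> car G n \<Longrightarrow> cyc (res G N) n = res (deg G n) (\<lambda>_. N n \<inter> Zc G n)"
  by (simp add: cyc_def Zc_res deg_res)

text \<open>Exactness of the subfamily \<open>N\<close> in itself, with the operations of
  \<open>C\<close>; for \<open>N = car C\<close> it is exactness of \<open>C\<close>.\<close>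

definition acy :: "(int, 'r, 'a) gob \<Rightarrow> (int \<Rightarrow> 'a set) \<Rightarrow> bool" where
  "acy C N \<longleftrightarrow> (\<forall>n. \<forall>x\<in>N n. df C n x = ze C (n - 1) \<longrightarrow> (\<exists>y\<in>N (n + 1). df C (n + 1) y = x))"

lemma acyD: "acy C N \<Longrightarrow> x \<in> N n \<Longrightarrow> df C n x = ze C (n - 1) \<Longrightarrow> \<exists>y\<in>N (n + 1). df C (n + 1) y = x"
  by (simp add: acy_def)

lemma acy_prev: "acy C N \<Longrightarrow> x \<in> N (n - 1) \<Longrightarrow> df C (n - 1) x = ze C (n - 2) \<Longrightarrow> \<exists>y\<in>N n. df C n y = x"
  using acyD[of C N x "n - 1"] by simp

context base begin

lemma deg_ob: "Ch.ob G \<Longrightarrow> Mo.ob (deg G n)"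
  by (rule Mo.obI)
    (auto simp: Ch.ad_assoc Ch.sm_ad Ch.sm_add Ch.sm_mult intro: Ch.ad_comm dest: Ch.ng_ex)

lemma deg_smob: "Ch.smob TYPE('u) G \<Longrightarrow> Mo.smob TYPE('u) (deg G n)"
  using deg_ob by (auto simp: sml_def)

lemma deg_sub: "Ch.sub N G \<Longrightarrow> Mo.sub (\<lambda>_. N n) (deg G n)"
  unfolding Mo.sub_def by (simp add: Ch.sub_subset[of N G] Ch.sub_ze[of N G] Ch.sub_ad[of N G] Ch.sub_sm[of N G])

lemma deg_hom: "Ch.hom G H f \<Longrightarrow> Mo.hom (deg G n) (deg H n) (\<lambda>_. f n)"
  unfolding Mo.hom_def by (simp add: Ch.hom_car[of G H f] Ch.hom_ad[of G H f] Ch.hom_sm[of G H f])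

lemma deg_quo: "Ch.quo M N S p \<Longrightarrow> Mo.quo (deg M n) (\<lambda>_. N n) (deg S n) (\<lambda>_. p n)"
  unfolding Ch.quo_def Mo.quo_def using deg_hom by auto

lemma Zc_sub: assumes G: "Ch.ob G" shows "Mo.sub (\<lambda>_. Zc G n) (deg G n)"
proof -
  have m: "(\<lambda>x. x - (1 :: int)) n = n - 1" by simp
  show ?thesis
    unfolding Mo.sub_def Zc_def
    using G Ch.df_ze[OF G, of n] Ch.df_ad[OF G, of n] Ch.df_sm[OF G, of n] Ch.sm_ze[OF G] by auto
qed

lemma Zc_car: "x \<in> Zc G n \<Longrightarrow> x \<in> car G n" and Zc_df: "x \<in> Zc G n \<Longrightarrow> df G n x = ze G (n - 1)"
  by (simp_all add: Zc_def)

lemma cyc_ob: "Ch.ob G \<Longrightarrow> Mo.ob (cyc G n)"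
  unfolding cyc_def by (rule Mo.ob_res[OF deg_ob Zc_sub])

lemma cyc_smob: "Ch.smob TYPE('u) G \<Longrightarrow> Mo.smob TYPE('u) (cyc G n)"
  unfolding cyc_def by (rule Mo.smob_res[OF deg_smob Zc_sub]) auto

lemma Zc_hom: assumes obs: "Ch.ob G" "Ch.ob H" and f: "Ch.hom G H f" and x: "x \<in> Zc G n" shows "f n x \<in> Zc H n"
  using Ch.hom_df[OF f Zc_car[OF x]] Zc_df[OF x] Ch.hom_ze[OF obs f, of "n - 1"] Ch.hom_car[OF f Zc_car[OF x]]
  by (simp add: Zc_def)

lemma cyc_hom: assumes "Ch.ob G" "Ch.ob H" and f: "Ch.hom G H f" shows "Mo.hom (cyc G n) (cyc H n) (\<lambda>_. f n)"
  unfolding cyc_def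
  by (rule Mo.hom_res2[OF Mo.hom_res[OF deg_hom[OF f] Zc_sub[OF assms(1)]]]) (use Zc_hom[OF assms] in auto)

lemma df_Zc: assumes G: "Ch.ob G" and x: "x \<in> car G n" shows "df G n x \<in> Zc G (n - 1)"
  using Ch.df_car[OF G _ x] Ch.df_df[OF G _ _ x] by (simp add: Zc_def)

text \<open>Acyclicity of the kernel is what makes taking cycles exact here.\<close>

lemma cyc_quo:
  assumes M: "Ch.ob M" and S: "Ch.ob S" and P: "Ch.sub P M" and ex: "acy M P" and p: "Ch.quo M P S p"
  shows "Mo.quo (cyc M n) (\<lambda>_. P n \<inter> Zc M n) (cyc S n) (\<lambda>_. p n)"
  unfolding Mo.quo_def
proof (intro conjI allI ballI)
  note ph = Ch.quo_hom[OF p]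
  show h: "Mo.hom (cyc M n) (cyc S n) (\<lambda>_. p n)" by (rule cyc_hom[OF M S ph])
  fix i :: unit
  show "p n ` car (cyc M n) i = car (cyc S n) i"
  proof (intro equalityI subsetI)
    show "s \<in> car (cyc S n) i" if "s \<in> p n ` car (cyc M n) i" for s
      using that Mo.hom_car[OF h] by auto
    fix s assume "s \<in> car (cyc S n) i"
    then have s: "s \<in> Zc S n" by simp
    obtain x where x: "x \<in> car M n" "p n x = s" using Ch.quo_lift[OF p Zc_car[OF s]] by blast
    have dx: "df M n x \<in> Zc M (n - 1)" by (rule df_Zc[OF M x(1)])
    have "p (n - 1) (df M n x) = ze S (n - 1)"
      using Ch.hom_df[OF ph x(1)] x(2) Zc_df[OF s] by simp
    then have "df M n x \<in> P (n - 1)" using Ch.quo_ker[OF p Zc_car[OF dx]] by simp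
    \<comment> \<open>The boundary of the lift \<open>x\<close> is a cycle lying in
      \<open>P\<close>, hence by exactness of \<open>P\<close> the boundary of some \<open>z\<close>
      in \<open>P\<close>. Subtracting \<open>z\<close> makes the lift a cycle without changing its
      image.\<close>
    then obtain z where z: "z \<in> P n" "df M n z = df M n x"
      using acy_prev[OF ex] Zc_df[OF dx] by auto
    have zc: "z \<in> car M n" by (rule Ch.sub_car[OF P z(1)])
    have dz: "df M n z \<in> car M (n - 1)" using Ch.df_car[OF M _ zc] by simp
    have "df M n (mi M n x z) = ze M (n - 1)"
      using Ch.df_mi[OF M _ x(1) zc] z(2) dz M by simp
    then have Zx: "mi M n x z \<in> Zc M n" using x(1) zc M by (simp add: Zc_def)
    have "p n z = ze S n" using Ch.quo_ker[OF p zc] z(1) by simp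
    then have "p n (mi M n x z) = s"
      using Ch.hom_mi[OF M S ph x(1) zc] x(2) Zc_car[OF s] S by simp
    then show "s \<in> p n ` car (cyc M n) i" using Zx by auto
  qed
  show "p n x = ze (cyc S n) i \<longleftrightarrow> x \<in> P n \<inter> Zc M n" if "x \<in> car (cyc M n) i" for x
    using that Ch.quo_ker[OF p, of x n] Zc_car[of x M n] by auto
qed

definition til :: "(unit, 'r, 'u) gob set \<Rightarrow> (unit, 'r, 'u) gob set \<Rightarrow> (int, 'r, 'u) gob \<Rightarrow> bool" where
  "til SU SX G \<longleftrightarrow> Ch.smob TYPE('u) G \<and> (\<forall>n. Lc SU (deg G n)) \<and> (\<forall>n. Lc SX (cyc G n)) \<and> acy G (car G)"

text \<open>Degrees and cycle modules of a retract are retracts. For exactness, a cycle is sent to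
  \<open>Q\<close> by \<open>s\<close>, bounds there, and \<open>q\<close> brings the bounding
  element back.\<close>

lemma til_retract:
  assumes Q: "til SU SX Q" and C: "Ch.smob TYPE('u) C"
    and s: "Ch.hom C Q s" and q: "Ch.hom Q C q" and qs: "\<And>i x. x \<in> car C i \<Longrightarrow> q i (s i x) = x"
  shows "til SU SX C"
  unfolding til_def
proof (intro conjI allI)
  have oQ: "Ch.ob Q" and oC: "Ch.ob C" using Q C by (auto simp: til_def)
  show "Ch.ob C" "sml TYPE('u) C" using C by auto
  fix n
  have "Lc SU (deg Q n)" "Lc SX (cyc Q n)" using Q by (auto simp: til_def)
  note L = this
  show "Lc SU (deg C n)"
    by (rule Lc_retract[OF L(1) deg_smob[OF C] deg_hom[OF s] deg_hom[OF q]]) (simp add: qs)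
  show "Lc SX (cyc C n)"
    by (rule Lc_retract[OF L(2) cyc_smob[OF C] cyc_hom[OF oC oQ s] cyc_hom[OF oQ oC q]]) (simp add: qs Zc_car)
next
  have oQ: "Ch.ob Q" and oC: "Ch.ob C" and ex: "acy Q (car Q)" using Q C by (auto simp: til_def)
  show "acy C (car C)"
    unfolding acy_def
  proof (intro allI ballI impI)
    fix n x assume x: "x \<in> car C n" "df C n x = ze C (n - 1)"
    then have "x \<in> Zc C n" by (simp add: Zc_def)
    from Zc_hom[OF oC oQ s this]
    obtain y where y: "y \<in> car Q (n + 1)" "df Q (n + 1) y = s n x"
      using acyD[OF ex, of "s n x" n] by (auto simp: Zc_def)
    have "df C (n + 1) (q (n + 1) y) = x"
      using Ch.hom_df[OF q y(1)] y(2) qs[OF x(1)] by simp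
    then show "\<exists>y\<in>car C (n + 1). df C (n + 1) y = x" using Ch.hom_car[OF q y(1)] by blast
  qed
qed

text \<open>Exactness of all stages comes first, by induction. Only then does the filtration induce
  filtrations on cycle modules, since \<open>cyc_quo\<close> needs an exact kernel; degrees are
  unproblematic.\<close>

lemma til_filtr:
  fixes Q :: "(int, 'r, 'u) gob"
  assumes Q: "Ch.smob TYPE('u) Q" and F: "Ch.filtr \<S> (\<lambda>n. {ze Q n}) Q F" and S: "\<And>S. S \<in> \<S> \<Longrightarrow> til SU SX S"
  shows "til SU SX Q"
proof -
  have oQ: "Ch.ob Q" using Q by blast
  obtain r where r: "Well_order r" "Field r = F" "\<And>N. N \<in> F \<Longrightarrow> underS r N = {L \<in> F. L < N}"
    using wochain_Well_order[OF Ch.filtr_wo[OF F]] by blast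
  let ?z = "\<lambda>n. {ze Q n}"
  note z = Ch.sub_zero[OF oQ]
  let ?p = "prev ?z F"
  have mem_p: "x \<in> ?p N n \<longleftrightarrow> x = ze Q n \<or> (\<exists>L\<in>F. L < N \<and> x \<in> L n)" for x N n
    by (auto simp: prev_def Sup_apply)
  have acy_p: "acy Q (?p N)" if IH: "\<And>L. L \<in> F \<Longrightarrow> L < N \<Longrightarrow> acy Q L" for N
    unfolding acy_def
  proof (intro allI ballI impI)
    fix n x assume x: "x \<in> ?p N n" "df Q n x = ze Q (n - 1)"
    from x(1) consider "x = ze Q n" | L where "L \<in> F" "L < N" "x \<in> L n" unfolding mem_p by blast
    then show "\<exists>y\<in>?p N (n + 1). df Q (n + 1) y = x"
    proof cases
      case 1
      then have "df Q (n + 1) (ze Q (n + 1)) = x" using Ch.df_ze[OF oQ, of "n + 1"] by simp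
      then show ?thesis using mem_p by blast
    next
      case (2 L)
      then show ?thesis using acyD[OF IH[OF 2(1,2)] 2(3) x(2)] mem_p by blast
    qed
  qed
  \<comment> \<open>A cycle of \<open>N\<close> bounds in the exact quotient \<open>S\<close>;
    lifting the bounding element leaves an error that is a cycle in the predecessor and bounds
    there.\<close>
  have acy_step: "acy Q N" if N: "N \<in> F" and P: "acy Q (?p N)" for N
    unfolding acy_def
  proof (intro allI ballI impI)
    fix n x assume x: "x \<in> N n" "df Q n x = ze Q (n - 1)"
    obtain S p where S: "S \<in> \<S>" and p: "Ch.quo (res Q N) (?p N) S p" using Ch.filtr_quo[OF F N] by blast
    note sN = Ch.filtr_sub[OF F N] and sp = Ch.filtr_prev_sub[OF F z N]
    have pN: "y \<in> N i" if "y \<in> ?p N i" for y i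
      using prev_le[OF Ch.filtr_ge[OF F N], of F] that by (auto simp: le_fun_def)
    have oS: "Ch.ob S" and exS: "acy S (car S)" using S[THEN assms(3)] by (auto simp: til_def)
    have oN: "Ch.ob (res Q N)" by (rule Ch.ob_res[OF oQ sN])
    note ph = Ch.quo_hom[OF p]
    have xc: "x \<in> car Q n" by (rule Ch.sub_car[OF sN x(1)])
    have "x \<in> Zc (res Q N) n" using x by (simp add: Zc_def)
    from Zc_hom[OF oN oS ph this]
    obtain s where s: "s \<in> car S (n + 1)" "df S (n + 1) s = p n x"
      using acyD[OF exS, of "p n x" n] by (auto simp: Zc_def)
    obtain y where y: "y \<in> N (n + 1)" "p (n + 1) y = s" using Ch.quo_lift[OF p s(1)] by auto
    have yc: "y \<in> car Q (n + 1)" by (rule Ch.sub_car[OF sN y(1)])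
    have dyN: "df Q (n + 1) y \<in> N n" using Ch.sub_df[OF sN y(1)] by simp
    have dyZ: "df Q (n + 1) y \<in> Zc Q n" using df_Zc[OF oQ yc] by simp
    note dyc = Zc_car[OF dyZ]
    have "p n (df Q (n + 1) y) = p n x" using Ch.hom_df[OF ph, of y "n + 1"] y s by simp
    then have "mi (res Q N) n x (df Q (n + 1) y) \<in> ?p N n"
      using Ch.quo_eq[OF oN oS p, of x n "df Q (n + 1) y"] x(1) dyN by simp
    then have m: "mi Q n x (df Q (n + 1) y) \<in> ?p N n" using Ch.mi_res[OF oQ sN x(1) dyN] by simp
    have "df Q n (mi Q n x (df Q (n + 1) y)) = ze Q (n - 1)"
      using Ch.df_mi[OF oQ _ xc dyc] x(2) Zc_df[OF dyZ] oQ by simp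
    from acyD[OF P m this]
    obtain w where w: "w \<in> ?p N (n + 1)" "df Q (n + 1) w = mi Q n x (df Q (n + 1) y)" by blast
    have wc: "w \<in> car Q (n + 1)" by (rule Ch.sub_car[OF sp w(1)])
    have "df Q (n + 1) (ad Q (n + 1) w y) = x"
      using Ch.df_ad[OF oQ _ wc yc] w(2) xc dyc oQ by simp
    then show "\<exists>y\<in>N (n + 1). df Q (n + 1) y = x" using Ch.sub_ad[OF sN pN[OF w(1)] y(1)] by blast
  qed
  have acy_N: "N \<in> F \<longrightarrow> acy Q N" for N
    using wf_Well_order[OF r(1)]
  proof (induction N rule: wf_induct_rule)
    case (less N)
    show ?case
    proof
      assume N: "N \<in> F"
      have "acy Q L" if "L \<in> F" "L < N" for L
      proof -
        have "L \<in> underS r N" using r(3)[OF N] that by blast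
        then have "(L, N) \<in> r - Id" by (simp add: underS_def)
        then show ?thesis using less that(1) by blast
      qed
      from acy_step[OF N acy_p[OF this]] show "acy Q N" .
    qed
  qed
  have acyP: "acy Q (?p N)" for N by (rule acy_p) (use acy_N in blast)
  have carQ: "x \<in> car Q n \<longleftrightarrow> x = ze Q n \<or> (\<exists>L\<in>F. x \<in> L n)" for x n
    by (auto simp: Ch.filtr_Sup[OF F, symmetric] Sup_apply)
  have ex: "acy Q (car Q)"
    unfolding acy_def
  proof (intro allI ballI impI)
    fix n x assume x: "x \<in> car Q n" "df Q n x = ze Q (n - 1)"
    from x(1) consider "x = ze Q n" | L where "L \<in> F" "x \<in> L n" using carQ by blast
    then show "\<exists>y\<in>car Q (n + 1). df Q (n + 1) y = x"
    proof cases
      case 1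
      then have "df Q (n + 1) (ze Q (n + 1)) = x" using Ch.df_ze[OF oQ, of "n + 1"] by simp
      then show ?thesis using carQ by blast
    next
      case (2 L)
      have aL: "acy Q L" using acy_N 2(1) by blast
      show ?thesis using acyD[OF aL 2(2) x(2)] 2(1) carQ by blast
    qed
  qed
  have low: "N i \<inter> K \<subseteq> car Q i" if "N \<in> F" for N i K using Ch.sub_subset[OF Ch.filtr_sub[OF F that]] by blast
  have jumpN: "\<exists>S p. til SU SX S \<and> Ch.quo (res Q N) (?p N) S p" if "N \<in> F" for N
    using Ch.filtr_quo[OF F that] S by blast
  have "Lc SU (deg Q n)" for n
  proof -
    have o: "Mo.ob (deg Q n)" by (rule deg_ob[OF oQ])
    have "\<exists>F'. Mo.filtr {G. Lc SU G} (\<lambda>i. {ze (deg Q n) i}) (deg Q n) F'"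
    proof (rule Mo.filtr_tower[OF o r(1), of "\<lambda>N _. N n" "\<lambda>N _. ?p N n"])
      fix N assume "N \<in> Field r"
      then have N: "N \<in> F" using r(2) by simp
      show "Mo.sub (\<lambda>_. N n) (deg Q n)" by (rule deg_sub[OF Ch.filtr_sub[OF F N]])
      show "Mo.sub (\<lambda>_. ?p N n) (deg Q n)" by (rule deg_sub[OF Ch.filtr_prev_sub[OF F z N]])
      show "(\<lambda>_. ?p N n) = Sup (insert (\<lambda>i. {ze (deg Q n) i}) ((\<lambda>N _. N n) ` underS r N))"
        unfolding r(3)[OF N] by (rule ext) (auto simp: mem_p Sup_apply)
      obtain S p where Sp: "til SU SX S" "Ch.quo (res Q N) (?p N) S p" using jumpN[OF N] by blast
      have "Mo.quo (res (deg Q n) (\<lambda>_. N n)) (\<lambda>_. ?p N n) (deg S n) (\<lambda>_. p n)"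
        using deg_quo[OF Sp(2), of n] by (simp add: deg_res)
      moreover have "Lc SU (deg S n)" using Sp(1) by (simp add: til_def)
      moreover have "(\<lambda>_ :: unit. ?p N n) \<le> (\<lambda>_. N n)"
        using prev_le[OF Ch.filtr_ge[OF F N], of F] by (simp add: le_fun_def)
      ultimately show "(\<lambda>_ :: unit. ?p N n) = (\<lambda>_. N n) \<or> (\<lambda>_ :: unit. ?p N n) \<le> (\<lambda>_. N n) \<and>
          (\<exists>S\<in>{G. Lc SU G}. \<exists>p. Mo.quo (res (deg Q n) (\<lambda>_. N n)) (\<lambda>_. ?p N n) S p)" by blast
    next
      show "Sup (insert (\<lambda>i. {ze (deg Q n) i}) ((\<lambda>N _. N n) ` Field r)) = car (deg Q n)"
        unfolding r(2) by (rule ext) (auto simp: carQ Sup_apply)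
    qed
    then obtain F' where F': "Mo.filtr {G. Lc SU G} (\<lambda>i. {ze (deg Q n) i}) (deg Q n) F'" by blast
    show ?thesis
      by (rule Lc_filtr[OF F' Mo.sub_zero[OF o] o Mo.quo_zero[OF o] deg_smob[OF Q]]) simp
  qed
  moreover have "Lc SX (cyc Q n)" for n
  proof -
    have o: "Mo.ob (cyc Q n)" by (rule cyc_ob[OF oQ])
    have ZS: "Mo.sub (\<lambda>_. N n \<inter> Zc Q n) (cyc Q n)" if N: "Ch.sub N Q" for N
    proof -
      have "Mo.sub (\<lambda>_. N n \<inter> Zc Q n) (deg Q n)" by (rule Mo.sub_Int[OF deg_sub[OF N] Zc_sub[OF oQ]])
      then show ?thesis unfolding cyc_def using Mo.sub_res[OF Zc_sub[OF oQ]] by (simp add: le_fun_def)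
    qed
    have "\<exists>F'. Mo.filtr {G. Lc SX G} (\<lambda>i. {ze (cyc Q n) i}) (cyc Q n) F'"
    proof (rule Mo.filtr_tower[OF o r(1), of "\<lambda>N _. N n \<inter> Zc Q n" "\<lambda>N _. ?p N n \<inter> Zc Q n"])
      fix N assume "N \<in> Field r"
      then have N: "N \<in> F" using r(2) by simp
      note sN = Ch.filtr_sub[OF F N] and sp = Ch.filtr_prev_sub[OF F z N]
      have ple: "?p N \<le> N" by (rule prev_le[OF Ch.filtr_ge[OF F N]])
      show "Mo.sub (\<lambda>_. N n \<inter> Zc Q n) (cyc Q n)" by (rule ZS[OF sN])
      show "Mo.sub (\<lambda>_. ?p N n \<inter> Zc Q n) (cyc Q n)" by (rule ZS[OF sp])
      have z0: "ze Q n \<in> Zc Q n" using Mo.sub_ze[OF Zc_sub[OF oQ, of n], of "()"] by simp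
      show "(\<lambda>_. ?p N n \<inter> Zc Q n) = Sup (insert (\<lambda>i. {ze (cyc Q n) i}) ((\<lambda>N _. N n \<inter> Zc Q n) ` underS r N))"
        unfolding r(3)[OF N] by (rule ext) (use z0 in \<open>auto simp: mem_p Sup_apply\<close>)
      obtain S p where Sp: "til SU SX S" "Ch.quo (res Q N) (?p N) S p" using jumpN[OF N] by blast
      have oS: "Ch.ob S" using Sp(1) by (simp add: til_def)
      have spN: "Ch.sub (?p N) (res Q N)" using sp ple Ch.sub_res[OF sN] by blast
      have aP: "acy (res Q N) (?p N)" using acyP[of N] by (simp add: acy_def)
      have "N n \<inter> Zc Q n \<inter> (?p N n \<inter> (N n \<inter> Zc Q n)) = ?p N n \<inter> Zc Q n" using ple by (auto simp: le_fun_def)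
      moreover have "?p N n \<inter> (N n \<inter> Zc Q n) = ?p N n \<inter> Zc Q n" using ple by (auto simp: le_fun_def)
      moreover have "cyc (res Q N) n = res (cyc Q n) (\<lambda>_. N n \<inter> Zc Q n)"
        using cyc_res[of N n Q] Ch.sub_subset[OF sN] by (simp add: cyc_def)
      ultimately have "Mo.quo (res (cyc Q n) (\<lambda>_. N n \<inter> Zc Q n)) (\<lambda>_. ?p N n \<inter> Zc Q n) (cyc S n) (\<lambda>_. p n)"
        using cyc_quo[OF Ch.ob_res[OF oQ sN] oS spN aP Sp(2), of n] Zc_res[of N n Q] Ch.sub_subset[OF sN] by simp
      moreover have "Lc SX (cyc S n)" using Sp(1) by (simp add: til_def)
      moreover have "(\<lambda>_ :: unit. ?p N n \<inter> Zc Q n) \<le> (\<lambda>_. N n \<inter> Zc Q n)"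
        using ple by (auto simp: le_fun_def)
      ultimately show "(\<lambda>_ :: unit. ?p N n \<inter> Zc Q n) = (\<lambda>_. N n \<inter> Zc Q n) \<or>
          (\<lambda>_ :: unit. ?p N n \<inter> Zc Q n) \<le> (\<lambda>_. N n \<inter> Zc Q n) \<and>
          (\<exists>S\<in>{G. Lc SX G}. \<exists>p. Mo.quo (res (cyc Q n) (\<lambda>_. N n \<inter> Zc Q n)) (\<lambda>_. ?p N n \<inter> Zc Q n) S p)" by blast
    next
      have z0: "ze Q n \<in> Zc Q n" using Mo.sub_ze[OF Zc_sub[OF oQ, of n], of "()"] by simp
      show "Sup (insert (\<lambda>i. {ze (cyc Q n) i}) ((\<lambda>N _. N n \<inter> Zc Q n) ` Field r)) = car (cyc Q n)"
        unfolding r(2) by (rule ext) (use z0 Zc_car[of _ Q n] in \<open>auto simp: carQ Sup_apply\<close>)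
    qed
    then obtain F' where F': "Mo.filtr {G. Lc SX G} (\<lambda>i. {ze (cyc Q n) i}) (cyc Q n) F'" by blast
    show ?thesis
      by (rule Lc_filtr[OF F' Mo.sub_zero[OF o] o Mo.quo_zero[OF o] cyc_smob[OF Q]]) simp
  qed
  ultimately show ?thesis unfolding til_def using Q ex by blast
qed

end

section \<open>Filtering exact complexes\<close>

context base begin

text \<open>
  If \<open>N \<le> N'\<close> are two such subcomplexes, then \<open>N'\<close> modulo \<open>N\<close> is again exact, and its
  components and its cycles inherit filtrations from those of \<open>C\<close>.
\<close>

definition hill :: "(int, 'r, 'u) gob \<Rightarrow> (int \<Rightarrow> (unit \<Rightarrow> 'u set) set) \<Rightarrow> (int \<Rightarrow> (unit \<Rightarrow> 'u set) set) \<Rightarrow> (int \<Rightarrow> 'u set) \<Rightarrow> bool" where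
  "hill C FU FX N \<longleftrightarrow> Ch.sub N C \<and> (\<forall>n. Mo.good (deg C n) (FU n) (\<lambda>_. N n)) \<and>
     (\<forall>n. Mo.good (cyc C n) (FX n) (\<lambda>_. N n \<inter> Zc C n)) \<and> acy C N"

abbreviation Lb :: "(unit, 'r, 'u) gob set \<Rightarrow> (unit, 'r, 'u) gob set" where
  "Lb S \<equiv> {U. Lc S U \<and> bnd A (Sigma UNIV (car U))}"

lemma Lb_ob: "U \<in> Lb S \<Longrightarrow> Mo.ob U \<and> bnd A (Sigma UNIV (car U))"
  by (simp add: Lc_def)

text \<open>One bounded \<open>B\<close> is closed under four rules: the Hill rules
  \<open>T1\<close> for all degrees and \<open>T2\<close> for all cycle modules, and the witnesses
  \<open>W1\<close>, \<open>W2\<close>. The rules live in different degrees, but there are only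
  countably many, so a single generation step satisfies them all.\<close>

lemma hill_extend:
  assumes C: "til SU SX C"
    and FU: "\<And>n. Mo.filtr (Lb SU) (\<lambda>i. {ze (deg C n) i}) (deg C n) (FU n)"
    and FX: "\<And>n. Mo.filtr (Lb SX) (\<lambda>i. {ze (cyc C n) i}) (cyc C n) (FX n)"
    and N: "hill C FU FX N" and z: "z \<in> Sigma UNIV (car C)"
  shows "\<exists>B. Ch.sub B C \<and> bnd A (Sigma UNIV B) \<and> z \<in> Sigma UNIV B \<and> hill C FU FX (Ch.sums C N B)"
proof -
  have oC: "Ch.ob C" and exC: "acy C (car C)" using C by (auto simp: til_def)
  have sN: "Ch.sub N C" and gU: "\<And>n. Mo.good (deg C n) (FU n) (\<lambda>_. N n)"
    and gX: "\<And>n. Mo.good (cyc C n) (FX n) (\<lambda>_. N n \<inter> Zc C n)" and exN: "acy C N"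
    using N by (auto simp: hill_def)
  have od: "Mo.ob (deg C n)" and oc: "Mo.ob (cyc C n)" for n using deg_ob[OF oC] cyc_ob[OF oC] .
  have "\<forall>n. \<exists>\<Theta>. (\<forall>z. bnd A (\<Theta> z) \<and> \<Theta> z \<subseteq> Sigma UNIV (car (deg C n))) \<and>
      (\<forall>B. Mo.sub B (deg C n) \<longrightarrow> (\<forall>z\<in>Sigma UNIV B. \<Theta> z \<subseteq> Sigma UNIV B) \<longrightarrow>
        Mo.good (deg C n) (FU n) (Mo.sums (deg C n) (\<lambda>_. N n) B))"
  proof
    fix n
    show "\<exists>\<Theta>. (\<forall>z. bnd A (\<Theta> z) \<and> \<Theta> z \<subseteq> Sigma UNIV (car (deg C n))) \<and>
      (\<forall>B. Mo.sub B (deg C n) \<longrightarrow> (\<forall>z\<in>Sigma UNIV B. \<Theta> z \<subseteq> Sigma UNIV B) \<longrightarrow>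
        Mo.good (deg C n) (FU n) (Mo.sums (deg C n) (\<lambda>_. N n) B))"
      by (rule Mo.good_extend[OF od Lb_ob FU gU]) auto
  qed
  then obtain T1 where T1: "\<And>n z. bnd A (T1 n z) \<and> T1 n z \<subseteq> Sigma UNIV (car (deg C n))"
    "\<And>n B. Mo.sub B (deg C n) \<Longrightarrow> (\<forall>z\<in>Sigma UNIV B. T1 n z \<subseteq> Sigma UNIV B) \<Longrightarrow>
        Mo.good (deg C n) (FU n) (Mo.sums (deg C n) (\<lambda>_. N n) B)"
    by metis
  have "\<forall>n. \<exists>\<Theta>. (\<forall>z. bnd A (\<Theta> z) \<and> \<Theta> z \<subseteq> Sigma UNIV (car (cyc C n))) \<and>
      (\<forall>B. Mo.sub B (cyc C n) \<longrightarrow> (\<forall>z\<in>Sigma UNIV B. \<Theta> z \<subseteq> Sigma UNIV B) \<longrightarrow>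
        Mo.good (cyc C n) (FX n) (Mo.sums (cyc C n) (\<lambda>_. N n \<inter> Zc C n) B))"
  proof
    fix n
    show "\<exists>\<Theta>. (\<forall>z. bnd A (\<Theta> z) \<and> \<Theta> z \<subseteq> Sigma UNIV (car (cyc C n))) \<and>
      (\<forall>B. Mo.sub B (cyc C n) \<longrightarrow> (\<forall>z\<in>Sigma UNIV B. \<Theta> z \<subseteq> Sigma UNIV B) \<longrightarrow>
        Mo.good (cyc C n) (FX n) (Mo.sums (cyc C n) (\<lambda>_. N n \<inter> Zc C n) B))"
      by (rule Mo.good_extend[OF oc Lb_ob FX gX]) auto
  qed
  then obtain T2 where T2: "\<And>n z. bnd A (T2 n z) \<and> T2 n z \<subseteq> Sigma UNIV (car (cyc C n))"
    "\<And>n B. Mo.sub B (cyc C n) \<Longrightarrow> (\<forall>z\<in>Sigma UNIV B. T2 n z \<subseteq> Sigma UNIV B) \<Longrightarrow>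
        Mo.good (cyc C n) (FX n) (Mo.sums (cyc C n) (\<lambda>_. N n \<inter> Zc C n) B)"
    by metis
  \<comment> \<open>\<open>W1\<close> corrects the summand \<open>x\<close> of a cycle \<open>m + x\<close> to a cycle, \<open>W2\<close> chooses a preimage of a cycle.\<close>
  define W1 where "W1 n x = {(n, ad C n m x) | m. m = (SOME m. m \<in> N n \<and> ad C n m x \<in> Zc C n) \<and>
      (\<exists>m\<in>N n. ad C n m x \<in> Zc C n)}" for n x
  define W2 where "W2 n x = {(n + 1, y) | y. y = (SOME y. y \<in> car C (n + 1) \<and> df C (n + 1) y = x) \<and> x \<in> Zc C n}" for n x
  have W1: "\<exists>m0\<in>N n. ad C n m0 x \<in> Zc C n \<and> W1 n x = {(n, ad C n m0 x)}" if "m \<in> N n" "ad C n m x \<in> Zc C n" for n x m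
  proof -
    define m0 where "m0 = (SOME m. m \<in> N n \<and> ad C n m x \<in> Zc C n)"
    have m0: "m0 \<in> N n \<and> ad C n m0 x \<in> Zc C n" unfolding m0_def by (rule someI[of _ m]) (use that in simp)
    moreover have "W1 n x = {(n, ad C n m0 x)}" unfolding W1_def m0_def[symmetric] using that by auto
    ultimately show ?thesis by blast
  qed
  have W1': "W1 n x = {}" if "\<not> (\<exists>m\<in>N n. ad C n m x \<in> Zc C n)" for n x using that by (simp add: W1_def)
  have W2: "\<exists>y\<in>car C (n + 1). df C (n + 1) y = x \<and> W2 n x = {(n + 1, y)}" if x: "x \<in> Zc C n" for n x
  proof -
    define y where "y = (SOME y. y \<in> car C (n + 1) \<and> df C (n + 1) y = x)"
    have "\<exists>y. y \<in> car C (n + 1) \<and> df C (n + 1) y = x" using acyD[OF exC Zc_car[OF x] Zc_df[OF x]] by blast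
    then have "y \<in> car C (n + 1) \<and> df C (n + 1) y = x" unfolding y_def by (rule someI_ex)
    moreover have "W2 n x = {(n + 1, y)}" unfolding W2_def y_def[symmetric] using x by auto
    ultimately show ?thesis by blast
  qed
  have W2': "W2 n x = {}" if "x \<notin> Zc C n" for n x using that by (simp add: W2_def)
  \<comment> \<open>\<open>T1\<close> and \<open>T2\<close> live over the one-element sort of a
    module; their values are re-tagged with the degree of \<open>z\<close>.\<close>
  define \<Theta> where "\<Theta> z = W1 (fst z) (snd z) \<union> W2 (fst z) (snd z) \<union>
      (\<lambda>w. (fst z, snd w)) ` T1 (fst z) ((), snd z) \<union> (\<lambda>w. (fst z, snd w)) ` T2 (fst z) ((), snd z)" for z
  have \<Theta>: "bnd A (\<Theta> z) \<and> \<Theta> z \<subseteq> Sigma UNIV (car C)" if "z \<in> Sigma UNIV (car C)" for z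
  proof -
    obtain n x where zn: "z = (n, x)" by (cases z)
    have 1: "bnd A (W1 n x) \<and> W1 n x \<subseteq> Sigma UNIV (car C)"
    proof (cases "\<exists>m\<in>N n. ad C n m x \<in> Zc C n")
      case True
      then obtain m where "m \<in> N n" "ad C n m x \<in> Zc C n" by blast
      from W1[OF this] obtain m0 where "ad C n m0 x \<in> Zc C n" "W1 n x = {(n, ad C n m0 x)}" by blast
      then show ?thesis using Zc_car[of "ad C n m0 x" C n] bnd_countable[OF A_inf, of "{(n, ad C n m0 x)}"] by simp
    qed (simp add: W1')
    have 2: "bnd A (W2 n x) \<and> W2 n x \<subseteq> Sigma UNIV (car C)"
    proof (cases "x \<in> Zc C n")
      case True
      from W2[OF this] obtain y where "y \<in> car C (n + 1)" "W2 n x = {(n + 1, y)}" by blast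
      then show ?thesis using bnd_countable[OF A_inf, of "{(n + 1, y)}"] by simp
    qed (simp add: W2')
    have 3: "(\<lambda>w. (n, snd w)) ` T1 n ((), x) \<subseteq> Sigma UNIV (car C)" using T1(1)[of n "((), x)"] by fastforce
    have 4: "(\<lambda>w. (n, snd w)) ` T2 n ((), x) \<subseteq> Sigma UNIV (car C)"
      using T2(1)[of n "((), x)"] Zc_car[of _ C n] by fastforce
    show ?thesis
      unfolding \<Theta>_def zn fst_conv snd_conv using 1 2 3 4 T1(1) T2(1)
      by (intro conjI bnd_Un[OF A_inf] bnd_image Un_least) auto
  qed
  have zz: "{z} \<subseteq> Sigma UNIV (car C)" using z by simp
  obtain B where B: "Ch.sub B C" "bnd A (Sigma UNIV B)" "{z} \<subseteq> Sigma UNIV B"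
    "\<And>w. w \<in> Sigma UNIV B \<Longrightarrow> \<Theta> w \<subseteq> Sigma UNIV B"
    by (rule Ch.gensub[OF oC zz bnd_countable[OF A_inf] \<Theta>]) (assumption | rule that | simp)+
  have cl: "\<Theta> (n, b) \<subseteq> Sigma UNIV B" if "b \<in> B n" for n b using B(4)[of "(n, b)"] that by simp
  have cN: "x \<in> car C n" if "x \<in> N n" for x n using Ch.sub_car[OF sN that] .
  have cB: "x \<in> car C n" if "x \<in> B n" for x n using Ch.sub_car[OF B(1) that] .
  let ?N = "Ch.sums C N B"
  have sN': "Ch.sub ?N C" by (rule Ch.sub_sums[OF oC sN B(1)])
  have B_le: "x \<in> ?N n" if "x \<in> B n" for x n using Ch.sums_upper2[OF oC sN B(1) that] .
  have N_le: "x \<in> ?N n" if "x \<in> N n" for x n using Ch.sums_upper1[OF oC sN B(1) that] .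
  \<comment> \<open>For a cycle \<open>m + b\<close> the rule \<open>W1\<close> supplies a cycle
    \<open>m0 + b\<close> in \<open>B\<close>; the remainder \<open>m - m0\<close> lies in
    \<open>N\<close> and, as a difference of cycles, is a cycle. This identifies the cycles of
    \<open>N + B\<close> with sums of cycles.\<close>
  have split: "\<exists>m\<in>N n \<inter> Zc C n. \<exists>b\<in>B n \<inter> Zc C n. x = ad C n m b" if x: "x \<in> ?N n" "x \<in> Zc C n" for x n
  proof -
    from x(1) obtain m b where mb: "m \<in> N n" "b \<in> B n" "x = ad C n m b" by (rule Ch.sumsE)
    have "ad C n m b \<in> Zc C n" using x(2) mb(3) by simp
    from W1[OF mb(1) this] obtain m0 where m0: "m0 \<in> N n" "ad C n m0 b \<in> Zc C n" "W1 n b = {(n, ad C n m0 b)}" by blast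
    let ?b = "ad C n m0 b"
    have bB: "?b \<in> B n" using cl[OF mb(2)] m0(3) by (auto simp: \<Theta>_def)
    have "mi C n x ?b = ad C n (mi C n m m0) (mi C n b b)"
      unfolding mb(3) using mb m0(1) cN cB oC by (simp add: Ch.mi_dist)
    then have "mi C n x ?b = mi C n m m0" using cN[OF mb(1)] cN[OF m0(1)] cB[OF mb(2)] oC by simp
    then have mN: "mi C n x ?b \<in> N n" using Ch.sub_mi[OF oC sN mb(1) m0(1)] by simp
    have "mi (deg C n) () x ?b \<in> Zc C n"
      by (rule Mo.sub_mi[OF deg_ob[OF oC] Zc_sub[OF oC] x(2) m0(2)])
    moreover have "ng (deg C n) () ?b = ng C n ?b" by (simp add: ng_def)
    then have "mi (deg C n) () x ?b = mi C n x ?b" by (simp add: mi_def)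
    ultimately have "mi C n x ?b \<in> Zc C n" by simp
    moreover have "x = ad C n (mi C n x ?b) ?b" using Zc_car[OF x(2)] Zc_car[OF m0(2)] oC by simp
    ultimately show ?thesis using mN bB m0(2) by blast
  qed
  have "hill C FU FX ?N"
    unfolding hill_def
  proof (intro conjI allI sN')
    fix n
    have "(\<lambda>_ :: unit. ?N n) = Mo.sums (deg C n) (\<lambda>_. N n) (\<lambda>_. B n)"
      by (rule ext) (auto simp: Ch.sums_def Mo.sums_def)
    moreover have "Mo.good (deg C n) (FU n) (Mo.sums (deg C n) (\<lambda>_. N n) (\<lambda>_. B n))"
    proof (rule T1(2)[OF deg_sub[OF B(1)]], rule ballI)
      fix w :: "unit \<times> 'u" assume "w \<in> Sigma UNIV (\<lambda>_. B n)"
      then have w: "snd w \<in> B n" "((), snd w) = w" by (auto simp: prod_eq_iff)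
      have "(\<lambda>w. (n, snd w)) ` T1 n ((), snd w) \<subseteq> Sigma UNIV B"
        using cl[OF w(1)] by (auto simp: \<Theta>_def)
      then show "T1 n w \<subseteq> Sigma UNIV (\<lambda>_. B n)" unfolding w(2) by force
    qed
    ultimately show "Mo.good (deg C n) (FU n) (\<lambda>_. ?N n)" by simp
    have "(\<lambda>_ :: unit. ?N n \<inter> Zc C n) = Mo.sums (cyc C n) (\<lambda>_. N n \<inter> Zc C n) (\<lambda>_. B n \<inter> Zc C n)"
    proof (intro ext equalityI subsetI)
      fix i :: unit and x
      show "x \<in> Mo.sums (cyc C n) (\<lambda>_. N n \<inter> Zc C n) (\<lambda>_. B n \<inter> Zc C n) i" if "x \<in> ?N n \<inter> Zc C n"
        using split[of x n] that by (auto simp: Mo.sums_def)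
      assume "x \<in> Mo.sums (cyc C n) (\<lambda>_. N n \<inter> Zc C n) (\<lambda>_. B n \<inter> Zc C n) i"
      then obtain m b where mb: "m \<in> N n \<inter> Zc C n" "b \<in> B n \<inter> Zc C n" "x = ad C n m b"
        by (auto simp: Mo.sums_def)
      have "ad (deg C n) () m b \<in> Zc C n" by (rule Mo.sub_ad[OF Zc_sub[OF oC]]) (use mb in auto)
      moreover have "ad C n m b \<in> ?N n" by (rule Ch.sumsI) (use mb in auto)
      ultimately show "x \<in> ?N n \<inter> Zc C n" using mb(3) by simp
    qed
    moreover have "Mo.good (cyc C n) (FX n) (Mo.sums (cyc C n) (\<lambda>_. N n \<inter> Zc C n) (\<lambda>_. B n \<inter> Zc C n))"
    proof (rule T2(2))
      have "Mo.sub (\<lambda>_. B n \<inter> Zc C n) (deg C n)" by (rule Mo.sub_Int[OF deg_sub[OF B(1)] Zc_sub[OF oC]])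
      then show "Mo.sub (\<lambda>_. B n \<inter> Zc C n) (cyc C n)"
        unfolding cyc_def using Mo.sub_res[OF Zc_sub[OF oC]] by (simp add: le_fun_def)
      show "\<forall>w\<in>Sigma UNIV (\<lambda>_ :: unit. B n \<inter> Zc C n). T2 n w \<subseteq> Sigma UNIV (\<lambda>_. B n \<inter> Zc C n)"
      proof
        fix w :: "unit \<times> 'u" assume "w \<in> Sigma UNIV (\<lambda>_. B n \<inter> Zc C n)"
        then have w: "snd w \<in> B n" "((), snd w) = w" by (auto simp: prod_eq_iff)
        have Zs: "car (cyc C n) = (\<lambda>_. Zc C n)" by (rule ext) simp
        \<comment> \<open>\<open>T2\<close> produces cycles only, so closedness of \<open>B\<close>
          already gives closedness of its cycles.\<close>
        have "T2 n w \<subseteq> Sigma UNIV (\<lambda>_. Zc C n)" using T2(1)[of n w] Zs by simp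
        moreover have "(\<lambda>w. (n, snd w)) ` T2 n ((), snd w) \<subseteq> Sigma UNIV B"
          using cl[OF w(1)] by (auto simp: \<Theta>_def)
        ultimately show "T2 n w \<subseteq> Sigma UNIV (\<lambda>_. B n \<inter> Zc C n)" unfolding w(2) by force
      qed
    qed
    ultimately show "Mo.good (cyc C n) (FX n) (\<lambda>_. ?N n \<inter> Zc C n)" by simp
  next
    show "acy C ?N"
      unfolding acy_def
    proof (intro allI ballI impI)
      fix n x assume x: "x \<in> ?N n" "df C n x = ze C (n - 1)"
      have "x \<in> Zc C n" using x Ch.sub_car[OF sN' x(1)] by (simp add: Zc_def)
      from split[OF x(1) this] obtain m b where mb: "m \<in> N n" "m \<in> Zc C n" "b \<in> B n" "b \<in> Zc C n" "x = ad C n m b" by blast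
      \<comment> \<open>After splitting into cycles, the part from \<open>N\<close> bounds by
        exactness of \<open>N\<close> and the part from \<open>B\<close> by the rule
        \<open>W2\<close>.\<close>
      obtain m' where m': "m' \<in> N (n + 1)" "df C (n + 1) m' = m" using acyD[OF exN mb(1) Zc_df[OF mb(2)]] by blast
      obtain b' where b': "b' \<in> car C (n + 1)" "df C (n + 1) b' = b" "W2 n b = {(n + 1, b')}" using W2[OF mb(4)] by blast
      have bB: "b' \<in> B (n + 1)" using cl[OF mb(3)] b'(3) by (auto simp: \<Theta>_def)
      have "df C (n + 1) (ad C (n + 1) m' b') = x"
        using Ch.df_ad[OF oC _ cN[OF m'(1)] b'(1)] m'(2) b'(2) mb(5) by simp
      moreover have "ad C (n + 1) m' b' \<in> ?N (n + 1)" by (rule Ch.sumsI) (rule m'(1) bB)+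
      ultimately show "\<exists>y\<in>?N (n + 1). df C (n + 1) y = x" by blast
    qed
  qed
  then show ?thesis using B(1-3) by blast
qed

text \<open>Hill's lemma filters the degrees and the cycles of the quotient, where exactness of
  \<open>N\<close> identifies the cycles of the quotient with the quotient of the cycles.
  Boundedness holds because the quotient is an image of \<open>B\<close>.\<close>

lemma hill_quotient:
  assumes C: "til SU SX C"
    and FU: "\<And>n. Mo.filtr (Lb SU) (\<lambda>i. {ze (deg C n) i}) (deg C n) (FU n)"
    and FX: "\<And>n. Mo.filtr (Lb SX) (\<lambda>i. {ze (cyc C n) i}) (cyc C n) (FX n)"
    and N: "hill C FU FX N" and N': "hill C FU FX N'" and B: "Ch.sub B C" "bnd A (Sigma UNIV B)" "N' = Ch.sums C N B"
  shows "\<exists>S\<in>{S. til SU SX S \<and> bnd A (Sigma UNIV (car S))}. \<exists>p. Ch.quo (res C N') N S p"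
proof -
  have smC: "Ch.smob TYPE('u) C" and oC: "Ch.ob C" using C by (auto simp: til_def)
  have sN: "Ch.sub N C" and exN: "acy C N" and gU: "\<And>n. Mo.good (deg C n) (FU n) (\<lambda>_. N n)"
    and gX: "\<And>n. Mo.good (cyc C n) (FX n) (\<lambda>_. N n \<inter> Zc C n)" using N by (auto simp: hill_def)
  have sN': "Ch.sub N' C" and exN': "acy C N'" and gU': "\<And>n. Mo.good (deg C n) (FU n) (\<lambda>_. N' n)"
    and gX': "\<And>n. Mo.good (cyc C n) (FX n) (\<lambda>_. N' n \<inter> Zc C n)" using N' by (auto simp: hill_def)
  have le: "N \<le> N'" using Ch.sums_upper1[OF oC sN B(1)] B(3) by (auto simp: le_fun_def)
  have leD: "x \<in> N' n" if "x \<in> N n" for x n using le that by (auto simp: le_fun_def)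
  let ?M = "res C N'"
  have M: "Ch.smob TYPE('u) ?M" by (rule Ch.smob_res[OF smC sN'])
  have oM: "Ch.ob ?M" using M by blast
  have sNM: "Ch.sub N ?M" using sN le Ch.sub_res[OF sN'] by blast
  obtain S :: "(int, 'r, 'u) gob" and p where S: "Ch.smob TYPE('u) S" and p: "Ch.quo ?M N S p"
    by (rule Ch.quotient_exists[OF oM sNM conjunct2[OF M]]) (rule that)
  have oS: "Ch.ob S" using S by blast
  note ph = Ch.quo_hom[OF p]
  have exM: "acy ?M N" using exN by (simp add: acy_def)
  have obU: "Mo.ob U" if "U \<in> Lb SU" for U using Lb_ob[OF that] by blast
  have obX: "Mo.ob U" if "U \<in> Lb SX" for U using Lb_ob[OF that] by blast
  have "til SU SX S"
    unfolding til_def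
  proof (intro conjI allI)
    show "Ch.ob S" "sml TYPE('u) S" using S by auto
    fix n
    have od: "Mo.ob (deg C n)" and oc: "Mo.ob (cyc C n)" using deg_ob[OF oC] cyc_ob[OF oC] .
    have "(\<lambda>_ :: unit. N n) \<le> (\<lambda>_. N' n)" using le by (simp add: le_fun_def)
    from Mo.good_quotient[OF od obU FU gU gU' this]
    obtain F1 where F1: "Mo.filtr (Lb SU) (\<lambda>_. N n) (deg ?M n) F1" unfolding deg_res by blast
    show "Lc SU (deg S n)"
      by (rule Lc_filtr[OF F1 deg_sub[OF sNM] deg_ob[OF oM] deg_quo[OF p] deg_smob[OF S]]) simp
    have "(\<lambda>_ :: unit. N n \<inter> Zc C n) \<le> (\<lambda>_. N' n \<inter> Zc C n)" using le by (auto simp: le_fun_def)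
    from Mo.good_quotient[OF oc obX FX gX gX' this]
    obtain F2 where F2: "Mo.filtr (Lb SX) (\<lambda>_. N n \<inter> Zc C n) (res (cyc C n) (\<lambda>_. N' n \<inter> Zc C n)) F2" by blast
    have ceq: "res (cyc C n) (\<lambda>_. N' n \<inter> Zc C n) = cyc ?M n"
      using cyc_res[of N' n C] Ch.sub_subset[OF sN'] by (simp add: cyc_def)
    have Zeq: "N n \<inter> Zc ?M n = N n \<inter> Zc C n" using Zc_res[of N' n C] Ch.sub_subset[OF sN'] leD by auto
    have q2: "Mo.quo (cyc ?M n) (\<lambda>_. N n \<inter> Zc C n) (cyc S n) (\<lambda>_. p n)"
      using cyc_quo[OF oM oS sNM exM p, of n] Zeq by simp
    have s2: "Mo.sub (\<lambda>_. N n \<inter> Zc C n) (cyc ?M n)"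
    proof -
      have "Mo.sub (\<lambda>_. N n \<inter> Zc ?M n) (deg ?M n)" by (rule Mo.sub_Int[OF deg_sub[OF sNM] Zc_sub[OF oM]])
      then show ?thesis unfolding cyc_def Zeq[symmetric] using Mo.sub_res[OF Zc_sub[OF oM]] by (simp add: le_fun_def)
    qed
    show "Lc SX (cyc S n)"
      by (rule Lc_filtr[OF F2[unfolded ceq] s2 cyc_ob[OF oM] q2 cyc_smob[OF S]]) simp
  next
    show "acy S (car S)"
      unfolding acy_def
    proof (intro allI ballI impI)
      fix n s assume s: "s \<in> car S n" "df S n s = ze S (n - 1)"
      then have "s \<in> car (cyc S n) ()" by (simp add: Zc_def)
      from Mo.quo_lift[OF cyc_quo[OF oM oS sNM exM p, of n] this]
      \<comment> \<open>Cycles of \<open>S\<close> lift to cycles of \<open>N'\<close>, so exactness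
        of \<open>N'\<close> passes to the quotient.\<close>
      obtain x where x: "x \<in> Zc ?M n" "p n x = s" by auto
      have "x \<in> N' n" "df C n x = ze C (n - 1)" using x(1) by (auto simp: Zc_def)
      from acyD[OF exN' this] obtain y where y: "y \<in> N' (n + 1)" "df C (n + 1) y = x" by blast
      have "df S (n + 1) (p (n + 1) y) = s" using Ch.hom_df[OF ph, of y "n + 1"] y x(2) by simp
      moreover have "p (n + 1) y \<in> car S (n + 1)" using Ch.hom_car[OF ph, of y "n + 1"] y(1) by simp
      ultimately show "\<exists>y\<in>car S (n + 1). df S (n + 1) y = s" by blast
    qed
  qed
  moreover have "bnd A (Sigma UNIV (car S))"
  proof (rule bnd_subset[OF _ bnd_image[OF B(2)]])
    show "Sigma UNIV (car S) \<subseteq> (\<lambda>(n, b). (n, p n b)) ` Sigma UNIV B"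
    proof
      fix z assume "z \<in> Sigma UNIV (car S)"
      then obtain n s where z: "z = (n, s)" "s \<in> car S n" by auto
      obtain y where y: "y \<in> N' n" "p n y = s" using Ch.quo_lift[OF p z(2)] by auto
      obtain m b where mb: "m \<in> N n" "b \<in> B n" "y = ad C n m b" using y(1) unfolding B(3) by (rule Ch.sumsE)
      have bN: "b \<in> N' n" using Ch.sums_upper2[OF oC sN B(1) mb(2)] B(3) by simp
      have "p n m = ze S n" using Ch.quo_ker[OF p, of m n] mb(1) leD[OF mb(1)] by simp
      then have "s = p n b"
        using Ch.hom_ad[OF ph, of m n b] Ch.hom_car[OF ph, of b n] leD[OF mb(1)] bN mb(3) y(2) oS by simp
      then show "z \<in> (\<lambda>(n, b). (n, p n b)) ` Sigma UNIV B" using z(1) mb(2) by force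
    qed
  qed
  ultimately show ?thesis using p by blast
qed

text \<open>The tower is indexed by the elements of \<open>C\<close>: the step at an element makes
  sure that this element is included, so the union is everything. At limits the conditions collected
  in \<open>hill\<close> survive unions of chains.\<close>

lemma til_filtered:
  assumes C: "til SU SX C"
    and SU: "\<And>M. M \<in> SU \<Longrightarrow> Mo.ob M \<and> bnd A (Sigma UNIV (car M))"
    and SX: "\<And>M. M \<in> SX \<Longrightarrow> Mo.ob M \<and> bnd A (Sigma UNIV (car M))"
  shows "\<exists>F. Ch.filtr {S. til SU SX S \<and> bnd A (Sigma UNIV (car S))} (\<lambda>n. {ze C n}) C F"
proof -
  have smC: "Ch.smob TYPE('u) C" and oC: "Ch.ob C" using C by (auto simp: til_def)
  have "\<forall>n. \<exists>F. Mo.filtr (Lb SU) (\<lambda>i. {ze (deg C n) i}) (deg C n) F"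
  proof
    fix n
    have "Lc SU (deg C n)" using C by (simp add: til_def)
    then show "\<exists>F. Mo.filtr (Lb SU) (\<lambda>i. {ze (deg C n) i}) (deg C n) F" by (rule Lc_kaplansky[OF _ SU])
  qed
  from choice[OF this] obtain FU where FU': "\<forall>n. Mo.filtr (Lb SU) (\<lambda>i. {ze (deg C n) i}) (deg C n) (FU n)" by (rule exE)
  note FU = FU'[rule_format]
  have "\<forall>n. \<exists>F. Mo.filtr (Lb SX) (\<lambda>i. {ze (cyc C n) i}) (cyc C n) F"
  proof
    fix n
    have "Lc SX (cyc C n)" using C by (simp add: til_def)
    then show "\<exists>F. Mo.filtr (Lb SX) (\<lambda>i. {ze (cyc C n) i}) (cyc C n) F" by (rule Lc_kaplansky[OF _ SX])
  qed
  from choice[OF this] obtain FX where FX': "\<forall>n. Mo.filtr (Lb SX) (\<lambda>i. {ze (cyc C n) i}) (cyc C n) (FX n)" by (rule exE)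
  note FX = FX'[rule_format]
  let ?z = "\<lambda>n. {ze C n}"
  define \<P> where "\<P> = {N. hill C FU FX N}"
  obtain r where r: "Well_order r" "Field r = Sigma UNIV (car C)" using Well_order_exists[of "Sigma UNIV (car C)"] by auto
  define ok where "ok z N N' \<longleftrightarrow> N' \<in> \<P> \<and> z \<in> Sigma UNIV N' \<and>
      (\<exists>B. Ch.sub B C \<and> bnd A (Sigma UNIV B) \<and> N' = Ch.sums C N B)" for z N N'
  have ok_ex: "\<exists>N'. ok z N N'" if z: "z \<in> Sigma UNIV (car C)" and N: "N \<in> \<P>" for z N
  proof -
    have h: "hill C FU FX N" using N by (simp add: \<P>_def)
    then have sN: "Ch.sub N C" by (simp add: hill_def)
    obtain B where B: "Ch.sub B C" "bnd A (Sigma UNIV B)" "z \<in> Sigma UNIV B" "hill C FU FX (Ch.sums C N B)"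
      using hill_extend[OF C FU FX h z] by (elim exE conjE) (rule that)
    have "z \<in> Sigma UNIV (Ch.sums C N B)" using B(3) Ch.sums_upper2[OF oC sN B(1)] by auto
    then have "ok z N (Ch.sums C N B)" unfolding ok_def \<P>_def using B by blast
    then show ?thesis by blast
  qed
  define st where "st z N = (SOME N'. ok z N N')" for z N
  have st: "ok z N (st z N)" if "z \<in> Field r" "N \<in> \<P>" for z N
    unfolding st_def by (rule someI_ex[OF ok_ex]) (use that r(2) in auto)
  have step: "st z N \<in> \<P> \<and> N \<le> st z N" if zN: "z \<in> Field r" "N \<in> \<P>" for z N
  proof -
    obtain B where B: "st z N \<in> \<P>" "Ch.sub B C" "st z N = Ch.sums C N B" using st[OF zN] unfolding ok_def by blast
    have "Ch.sub N C" using zN(2) by (simp add: \<P>_def hill_def)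
    then have "N \<le> Ch.sums C N B" using Ch.sums_upper1[OF oC _ B(2)] by (auto simp: le_fun_def)
    with B show ?thesis by simp
  qed
  have z0: "?z \<in> \<P>"
    unfolding \<P>_def hill_def mem_Collect_eq
  proof (intro conjI allI)
    show "Ch.sub ?z C" by (rule Ch.sub_zero[OF oC])
    fix n
    show "Mo.good (deg C n) (FU n) (\<lambda>_. {ze C n})" using Mo.good_zero[OF deg_ob[OF oC] FU] by simp
    have "ze C n \<in> Zc C n" using Mo.sub_ze[OF Zc_sub[OF oC, of n], of "()"] by simp
    then have "{ze C n} \<inter> Zc C n = {ze C n}" by blast
    then show "Mo.good (cyc C n) (FX n) (\<lambda>_. {ze C n} \<inter> Zc C n)" using Mo.good_zero[OF cyc_ob[OF oC] FX] by simp
  next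
    show "acy C ?z" using Ch.df_ze[OF oC] by (simp add: acy_def)
  qed
  have lub: "Sup G \<in> \<P>"
    if G: "G \<subseteq> \<P>" "G \<noteq> {}" "\<And>N N'. N \<in> G \<Longrightarrow> N' \<in> G \<Longrightarrow> N \<le> N' \<or> N' \<le> N" for G
  proof -
    have h: "hill C FU FX N" if "N \<in> G" for N using G(1) that by (auto simp: \<P>_def)
    have S: "Sup G n = (\<Union>N\<in>G. N n)" for n by (simp add: Sup_apply)
    have "hill C FU FX (Sup G)"
      unfolding hill_def
    proof (intro conjI allI)
      show "Ch.sub (Sup G) C" by (rule Ch.sub_Sup_chain[OF G(2) _ G(3)]) (use h in \<open>auto simp: hill_def\<close>)
      fix n
      have chU: "a \<le> b \<or> b \<le> a" if "a \<in> (\<lambda>N _ :: unit. N n \<inter> UNIV) ` G" "b \<in> (\<lambda>N _. N n \<inter> UNIV) ` G" for a b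
        using that G(3) by (fastforce simp: le_fun_def)
      have chZ: "a \<le> b \<or> b \<le> a" if "a \<in> (\<lambda>N _ :: unit. N n \<inter> Zc C n) ` G" "b \<in> (\<lambda>N _. N n \<inter> Zc C n) ` G" for a b
        using that G(3) by (fastforce simp: le_fun_def)
      have "Mo.good (deg C n) (FU n) (Sup ((\<lambda>N _. N n \<inter> UNIV) ` G))"
        by (rule Mo.good_Sup_chain[OF _ _ chU]) (use G(2) h in \<open>auto simp: hill_def\<close>)
      moreover have "Sup ((\<lambda>N _ :: unit. N n \<inter> UNIV) ` G) = (\<lambda>_. Sup G n)" by (rule ext) (auto simp: Sup_apply)
      ultimately show "Mo.good (deg C n) (FU n) (\<lambda>_. Sup G n)" by simp
      have "Mo.good (cyc C n) (FX n) (Sup ((\<lambda>N _. N n \<inter> Zc C n) ` G))"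
        by (rule Mo.good_Sup_chain[OF _ _ chZ]) (use G(2) h in \<open>auto simp: hill_def\<close>)
      moreover have "Sup ((\<lambda>N _ :: unit. N n \<inter> Zc C n) ` G) = (\<lambda>_. Sup G n \<inter> Zc C n)"
        by (rule ext) (auto simp: Sup_apply)
      ultimately show "Mo.good (cyc C n) (FX n) (\<lambda>_. Sup G n \<inter> Zc C n)" by simp
    next
      show "acy C (Sup G)"
        unfolding acy_def
      proof (intro allI ballI impI)
        fix n x assume x: "x \<in> Sup G n" "df C n x = ze C (n - 1)"
        then obtain N where N: "N \<in> G" "x \<in> N n" unfolding S by blast
        have "acy C N" using h[OF N(1)] by (simp add: hill_def)
        from acyD[OF this N(2) x(2)] show "\<exists>y\<in>Sup G (n + 1). df C (n + 1) y = x" unfolding S using N(1) by blast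
      qed
    qed
    then show ?thesis by (simp add: \<P>_def)
  qed
  obtain T where T: "is_tower r \<P> (\<le>) ?z st Sup T"
    by (rule sup_tower[OF r(1) z0 step lub]) (assumption | rule that)+
  let ?L = "\<lambda>z. Sup (insert ?z (T ` underS r z))"
  show ?thesis
  proof (rule Ch.filtr_tower[OF oC r(1), of T ?L])
    fix z assume z: "z \<in> Field r"
    note Lz = is_tower_lub[OF T z] and Tz = is_tower_in[OF T z]
    show "Ch.sub (T z) C" "Ch.sub (?L z) C" using Lz Tz by (simp_all only: \<P>_def hill_def mem_Collect_eq)
    show "?L z = ?L z" ..
    obtain B where B: "Ch.sub B C" "bnd A (Sigma UNIV B)" "T z = Ch.sums C (?L z) B"
      using st[OF z Lz] is_tower_eq[OF T z] unfolding ok_def by auto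
    have le: "?L z \<le> T z" using step[OF z Lz] is_tower_eq[OF T z] by simp
    have hL: "hill C FU FX (?L z)" and hT: "hill C FU FX (T z)" using Lz Tz by (simp_all only: \<P>_def mem_Collect_eq)
    show "?L z = T z \<or> ?L z \<le> T z \<and>
        (\<exists>S\<in>{S. til SU SX S \<and> bnd A (Sigma UNIV (car S))}. \<exists>p. Ch.quo (res C (T z)) (?L z) S p)"
      using hill_quotient[OF C FU FX hL hT B] le by blast
  next
    show "Sup (insert ?z (T ` Field r)) = car C"
    proof (rule antisym)
      have "Ch.sub (Sup (insert ?z (T ` Field r))) C"
        using is_tower_top[OF T] by (simp only: \<P>_def hill_def mem_Collect_eq)
      then show "Sup (insert ?z (T ` Field r)) \<le> car C" by (rule Ch.sub_le_car)
      show "car C \<le> Sup (insert ?z (T ` Field r))"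
      proof (intro le_funI subsetI)
        fix n x assume x: "x \<in> car C n"
        have z: "(n, x) \<in> Field r" using x r(2) by simp
        have "(n, x) \<in> Sigma UNIV (T (n, x))"
          using st[OF z is_tower_lub[OF T z]] is_tower_eq[OF T z] unfolding ok_def by simp
        then show "x \<in> Sup (insert ?z (T ` Field r)) n" using z by (auto simp: Sup_apply)
      qed
    qed
  qed
qed

end

section \<open>The theorem\<close>

lemma deg_toC: "deg (toC C) n = toU (ch_mod C n)"
  by (simp add: deg_def toC_def toU_def)

lemma cyc_toC: "cyc (toC C) n = toU (cycles C n)"
  by (simp add: cyc_def res_def deg_def toC_def toU_def cycles_def Zc_def a_kernel_def')

lemma trivial_factor:
  assumes G: "comm_group G" and H: "subgroup H G" shows "trivial_group (G Mod H) \<longleftrightarrow> carrier G \<subseteq> H"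
proof -
  interpret comm_group G by (rule G)
  interpret H: normal H G by (rule subgroup_imp_normal[OF H])
  have c: "carrier (G Mod H) = (\<lambda>x. H #>\<^bsub>G\<^esub> x) ` carrier G" by (auto simp: FactGroup_def RCOSETS_def)
  have o: "\<one>\<^bsub>G Mod H\<^esub> = H" by (simp add: FactGroup_def)
  show ?thesis
  proof
    assume "trivial_group (G Mod H)"
    then have e: "(\<lambda>x. H #>\<^bsub>G\<^esub> x) ` carrier G = {H}" unfolding trivial_group_def c o by blast
    show "carrier G \<subseteq> H"
    proof
      fix x assume x: "x \<in> carrier G"
      then have "H #>\<^bsub>G\<^esub> x = H" using e by blast
      then show "x \<in> H" using rcos_self[OF x H] by simp
    qed
  next
    assume le: "carrier G \<subseteq> H"
    have "H #>\<^bsub>G\<^esub> x = H" if "x \<in> carrier G" for x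
      by (rule coset_join2[OF that H]) (use le that in blast)
    then have "(\<lambda>x. H #>\<^bsub>G\<^esub> x) ` carrier G = {H}" using one_closed by (auto intro: rev_image_eqI)
    then show "trivial_group (G Mod H)" unfolding trivial_group_def c o using H.factorgroup_is_group by blast
  qed
qed

context base begin

lemma left_module_toU:
  fixes M :: "('r, 'u) module"
  assumes G: "Mo.ob (toU M)" shows "left_module R M"
proof (intro left_module.intro left_module_axioms.intro)
  show "ring R" by (rule R.ring_axioms)
  show "abelian_group M"
  proof (rule abelian_groupI)
    show "\<exists>y\<in>carrier M. y \<oplus>\<^bsub>M\<^esub> x = \<zero>\<^bsub>M\<^esub>" if x: "x \<in> carrier M" for x
    proof -
      have x': "x \<in> car (toU M) ()" using x by simp
      obtain y where y: "y \<in> car (toU M) ()" "ad (toU M) () x y = ze (toU M) ()" using Mo.ng_ex[OF G x'] by blast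
      then have "ad (toU M) () y x = ze (toU M) ()" using Mo.ad_comm[OF G y(1) x'] by simp
      then show ?thesis using y(1) by auto
    qed
    show "x \<oplus>\<^bsub>M\<^esub> y = y \<oplus>\<^bsub>M\<^esub> x" if "x \<in> carrier M" "y \<in> carrier M" for x y
      using Mo.ad_comm[OF G, of x "()" y] that by simp
  qed (use Mo.ze_car[OF G] Mo.ad_car[OF G] Mo.ad_assoc[OF G] Mo.ze_ad[OF G] in simp_all)
qed (use Mo.sm_car[OF G] Mo.sm_ad[OF G] Mo.sm_add[OF G] Mo.sm_mult[OF G] Mo.sm_one[OF G] in simp_all)

lemma cycles_left_module: assumes "C \<in> complexes R" shows "left_module R (cycles (C :: ('r, 'u) chain_complex) n)"
  by (rule left_module_toU) (use cyc_ob[OF toC_ob[OF assms]] in \<open>simp add: cyc_toC\<close>)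

lemma exact_iff:
  fixes C :: "('r, 'u) chain_complex"
  assumes C: "C \<in> complexes R" shows "exact_complex C \<longleftrightarrow> acy (toC C) (car (toC C))"
proof -
  note oC = toC_ob[OF C]
  define B where "B n = ch_diff C (n + 1) ` carrier (ch_mod C (n + 1))" for n
  have car: "carrier (add_monoid (cycles C n)) = Zc (toC C) n" for n
    by (simp add: cycles_def Zc_def a_kernel_def')
  have "trivial_group (homology C n) \<longleftrightarrow> Zc (toC C) n \<subseteq> B n" for n
  proof -
    interpret M: left_module R "cycles C n" by (rule cycles_left_module[OF C])
    let ?G = "add_monoid (cycles C n)"
    have m: "x \<otimes>\<^bsub>?G\<^esub> y = ad (toC C) n x y" for x y by (simp add: cycles_def)
    have e: "\<one>\<^bsub>?G\<^esub> = ze (toC C) n" by (simp add: cycles_def)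
    have BI: "df (toC C) (n + 1) x \<in> B n" if "x \<in> car (toC C) (n + 1)" for x using that by (simp add: B_def)
    have BE: "\<exists>x\<in>car (toC C) (n + 1). df (toC C) (n + 1) x = b" if "b \<in> B n" for b using that by (auto simp: B_def)
    have BZ: "b \<in> Zc (toC C) n" if b: "b \<in> B n" for b
    proof -
      obtain x where x: "x \<in> car (toC C) (n + 1)" "df (toC C) (n + 1) x = b" using BE[OF b] by blast
      show ?thesis using df_Zc[OF oC x(1)] x(2) by simp
    qed
    have "subgroup (B n) ?G"
    proof (rule group.subgroupI[OF M.a_group])
      show "B n \<subseteq> carrier ?G" unfolding car using BZ by blast
      have "ze (toC C) (n + 1) \<in> car (toC C) (n + 1)" using oC by (rule Ch.ze_car)
      then show "B n \<noteq> {}" using BI by blast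
      fix b assume b: "b \<in> B n"
      obtain x where x: "x \<in> car (toC C) (n + 1)" "df (toC C) (n + 1) x = b" using BE[OF b] by blast
      obtain y where y: "y \<in> car (toC C) (n + 1)" "ad (toC C) (n + 1) x y = ze (toC C) (n + 1)"
        using Ch.ng_ex[OF oC x(1)] by blast
      have yB: "df (toC C) (n + 1) y \<in> B n" by (rule BI[OF y(1)])
      have "ad (toC C) n (df (toC C) (n + 1) y) b = ze (toC C) n"
        using Ch.df_ad[OF oC _ y(1) x(1)] Ch.ad_comm[OF oC y(1) x(1)] y(2) x(2) Ch.df_ze[OF oC, of "n + 1"] by simp
      then have "inv\<^bsub>?G\<^esub> b = df (toC C) (n + 1) y"
        by (intro group.inv_equality[OF M.a_group]) (use BZ[OF b] BZ[OF yB] car m e in simp_all)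
      then show "inv\<^bsub>?G\<^esub> b \<in> B n" using yB by simp
      fix c assume c: "c \<in> B n"
      obtain z where z: "z \<in> car (toC C) (n + 1)" "df (toC C) (n + 1) z = c" using BE[OF c] by blast
      have "ad (toC C) n b c = df (toC C) (n + 1) (ad (toC C) (n + 1) x z)"
        using Ch.df_ad[OF oC _ x(1) z(1)] x(2) z(2) by simp
      then show "b \<otimes>\<^bsub>?G\<^esub> c \<in> B n" unfolding m using BI[OF Ch.ad_car[OF oC x(1) z(1)]] by simp
    qed
    then have "trivial_group (?G Mod B n) \<longleftrightarrow> carrier ?G \<subseteq> B n"
      by (rule trivial_factor[OF M.a_comm_group])
    then show ?thesis unfolding car by (simp add: homology_def A_FactGroup_def B_def)
  qed
  then have "exact_complex C \<longleftrightarrow> (\<forall>n. Zc (toC C) n \<subseteq> B n)" by (simp only: exact_complex_def)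
  also have "\<dots> \<longleftrightarrow> acy (toC C) (car (toC C))"
  proof
    assume le: "\<forall>n. Zc (toC C) n \<subseteq> B n"
    show "acy (toC C) (car (toC C))"
      unfolding acy_def
    proof (intro allI ballI impI)
      fix n x assume "x \<in> car (toC C) n" "df (toC C) n x = ze (toC C) (n - 1)"
      then have "x \<in> B n" using le by (auto simp: Zc_def)
      then show "\<exists>y\<in>car (toC C) (n + 1). df (toC C) (n + 1) y = x" by (auto simp: B_def)
    qed
  next
    assume ex: "acy (toC C) (car (toC C))"
    show "\<forall>n. Zc (toC C) n \<subseteq> B n"
    proof (intro allI subsetI)
      fix n x assume x: "x \<in> Zc (toC C) n"
      from acyD[OF ex Zc_car[OF x] Zc_df[OF x]] show "x \<in> B n" by (auto simp: B_def)
    qed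
  qed
  finally show ?thesis .
qed

lemma tilde_iff:
  fixes \<U> \<V> \<X> \<Y> :: "('r, 'u) module set"
  assumes U: "cotorsion_pair (RMod R) \<U> \<V>" "SU \<subseteq> \<U>" "right_perp (RMod R) SU = \<V>"
    and X: "cotorsion_pair (RMod R) \<X> \<Y>" "SX \<subseteq> \<X>" "right_perp (RMod R) SX = \<Y>"
  shows "C \<in> tilde R \<U> \<X> \<longleftrightarrow> C \<in> complexes R \<and> til (toU ` SU) (toU ` SX) (toC C)"
proof (cases "C \<in> complexes R")
  case True
  have 1: "ch_mod C n \<in> \<U> \<longleftrightarrow> Lc (toU ` SU) (deg (toC C) n)" for n
    unfolding class_iff[OF U] deg_toC using True by (simp add: complexes_def)
  have "carrier (cycles C n) \<subseteq> carrier (ch_mod C n)" for n by (auto simp: cycles_def a_kernel_def')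
  then have "small TYPE('u) (carrier (cycles C n))" for n
    by (rule small_subset) (use True in \<open>simp add: complexes_def modules_def\<close>)
  then have "cycles C n \<in> modules R" for n by (simp add: modules_def cycles_left_module[OF True])
  then have 2: "cycles C n \<in> \<X> \<longleftrightarrow> Lc (toU ` SX) (cyc (toC C) n)" for n
    unfolding class_iff[OF X] cyc_toC by simp
  show ?thesis
    using True toC_smob[OF True] by (auto simp: tilde_def til_def exact_iff[OF True] 1 2)
qed (simp add: tilde_def)

text \<open>The zero module is a retract of the regular one, so both alternatives follow from
  closure under retracts.\<close>

lemma Lc_RG_or_zero:
  assumes G: "Mo.smob TYPE('u) G" "ad G () = ad RG ()" "ze G () = ze RG ()" "sm G () = sm RG ()"
    and c: "car G () = car RG () \<or> car G () = {ze RG ()}"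
  shows "Lc S G"
proof (rule Lc_retract[OF Lc_RG G(1)])
  have oRG: "Mo.ob RG" using RG by blast
  show "Mo.hom G RG (\<lambda>_ x. x)" unfolding Mo.hom_def using G c oRG by auto
  show "Mo.hom RG G (\<lambda>_ x. if car G () = car RG () then x else ze RG ())"
    unfolding Mo.hom_def using G c oRG Mo.sm_ze[OF oRG] by auto
  show "(if car G () = car RG () then x else ze RG ()) = x" if x: "x \<in> car G i" for i x
  proof (cases "car G () = car RG ()")
    case False
    moreover have "x \<in> car G ()" using x by simp
    ultimately have "x = ze RG ()" using c by blast
    then show ?thesis by simp
  qed simp
qed

text \<open>The contractible complex with the regular module in degrees \<open>i\<close> and \<open>i - 1\<close>.\<close>

definition dsk :: "int \<Rightarrow> (int, 'r, 'u) gob" where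
  "dsk i = \<lparr>car = \<lambda>n. if n = i \<or> n = i - 1 then car RG () else {ze RG ()}, ad = \<lambda>_. ad RG (), ze = \<lambda>_. ze RG (),
     sm = \<lambda>_. sm RG (), df = \<lambda>n x. if n = i then x else ze RG ()\<rparr>"

lemma dsk_simps [simp]:
  "car (dsk i) n = (if n = i \<or> n = i - 1 then car RG () else {ze RG ()})" "ad (dsk i) n = ad RG ()"
  "ze (dsk i) n = ze RG ()" "sm (dsk i) n = sm RG ()" "df (dsk i) n x = (if n = i then x else ze RG ())"
  by (simp_all add: dsk_def)

lemma dsk_smob: "Ch.smob TYPE('u) (dsk i)" and dsk_bnd: "bnd A (Sigma UNIV (car (dsk i)))"
proof -
  have oRG: "Mo.ob RG" using RG by blast
  have s: "car (dsk i) n \<subseteq> car RG ()" for n using oRG by simp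
  have "small TYPE('u) (car (dsk i) n)" for n
    by (rule small_subset[OF s]) (use RG in \<open>simp add: sml_def\<close>)
  moreover have "Ch.ob (dsk i)"
  proof (rule Ch.obI)
    show "\<exists>y\<in>car (dsk i) n. ad (dsk i) n x y = ze (dsk i) n" if x: "x \<in> car (dsk i) n" for n x
      using Mo.ng_ex[OF oRG, of x "()"] x oRG by (auto split: if_splits)
    show "ad (dsk i) n x y = ad (dsk i) n y x" if "x \<in> car (dsk i) n" "y \<in> car (dsk i) n" for n x y
      using Mo.ad_comm[OF oRG, of x "()" y] that s by auto
  qed (use oRG Mo.sm_ze[OF oRG] Mo.ad_assoc[OF oRG] Mo.sm_ad[OF oRG] Mo.sm_add[OF oRG] Mo.sm_mult[OF oRG] in
      \<open>auto split: if_splits\<close>)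
  ultimately show "Ch.smob TYPE('u) (dsk i)" by (simp add: sml_def)
  have b: "bnd A (car RG ())" by (rule bnd_subset[OF _ bnd_image[OF RG(2), of snd]]) force
  show "bnd A (Sigma UNIV (car (dsk i)))"
    by (rule bnd_Sigma[OF A_inf bnd_countable[OF A_inf]]) (simp, rule bnd_subset[OF s b])
qed

text \<open>The cycle module is the regular module in degree \<open>i - 1\<close> and zero
  elsewhere, so that degrees and cycles both lie in every left class.\<close>

lemma dsk_til: "til SU SX (dsk i)"
  unfolding til_def
proof (intro conjI allI)
  show "Ch.ob (dsk i)" "sml TYPE('u) (dsk i)" using dsk_smob by blast+
  show "Lc SU (deg (dsk i) n)" for n
    by (rule Lc_RG_or_zero[OF deg_smob[OF dsk_smob]]) simp_all
  show "Lc SX (cyc (dsk i) n)" for n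
    by (rule Lc_RG_or_zero[OF cyc_smob[OF dsk_smob]]) (use RG in \<open>auto simp: Zc_def\<close>)
  have oRG: "Mo.ob RG" using RG by blast
  show "acy (dsk i) (car (dsk i))"
    unfolding acy_def
  proof (intro allI ballI impI)
    fix n x assume "x \<in> car (dsk i) n" "df (dsk i) n x = ze (dsk i) (n - 1)"
    then show "\<exists>y\<in>car (dsk i) (n + 1). df (dsk i) (n + 1) y = x"
      using oRG by (intro bexI[of _ x]) (auto split: if_splits)
  qed
qed

text \<open>Chain maps out of \<open>dsk i\<close> correspond to maps from the regular module to
  degree \<open>i\<close>, since the component in degree \<open>i - 1\<close> is forced to be the
  boundary. So these complexes hit every element, and the precovers of complexes are onto.\<close>

lemma dsk_gen:
  assumes Z: "Ch.ob Z" and x: "x \<in> car Z i" shows "\<exists>g. Ch.hom (dsk i) Z g \<and> x \<in> g i ` car (dsk i) i"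
proof -
  have oRG: "Mo.ob RG" using RG by blast
  have oZ: "Mo.ob (deg Z i)" by (rule deg_ob[OF Z])
  obtain f y where f: "Mo.hom RG (deg Z i) f" and y: "y \<in> car RG ()" "f () y = x"
    by (rule RG_gen[OF oZ, of x]) (use x in simp, rule that)
  have fc: "f () r \<in> car Z i" if "r \<in> car RG ()" for r using Mo.hom_car[OF f that] by simp
  have fa: "f () (ad RG () r s) = ad Z i (f () r) (f () s)" if "r \<in> car RG ()" "s \<in> car RG ()" for r s
    using Mo.hom_ad[OF f that] by simp
  have fs: "f () (sm RG () a r) = sm Z i a (f () r)" if "a \<in> carrier R" "r \<in> car RG ()" for a r
    using Mo.hom_sm[OF f that(2,1)] by simp
  have f0: "f () (ze RG ()) = ze Z i" using Mo.hom_ze[OF oRG oZ f] by simp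
  define g where "g n r = (if n = i then f () r else if n = i - 1 then df Z i (f () r) else ze Z n)" for n r
  have "Ch.hom (dsk i) Z g"
    unfolding Ch.hom_def
  proof (intro allI ballI)
    fix n r assume r: "r \<in> car (dsk i) n"
    have rc: "r \<in> car RG ()" using r oRG by (auto split: if_splits)
    have dc: "df Z i (f () s) \<in> car Z (i - 1)" if "s \<in> car RG ()" for s using Ch.df_car[OF Z _ fc[OF that]] by simp
    have d0: "df Z n (ze Z n) = ze Z (n - 1)" for n using Ch.df_ze[OF Z, of n] by simp
    have dd: "df Z (i - 1) (df Z i (f () r)) = ze Z (i - 1 - 1)" using Ch.df_df[OF Z _ _ fc[OF rc]] by simp
    have "n = i \<or> n = i - 1 \<or> n \<noteq> i \<and> n \<noteq> i - 1" by blast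
    then show "g n r \<in> car Z n \<and> (\<forall>y\<in>car (dsk i) n. g n (ad (dsk i) n r y) = ad Z n (g n r) (g n y)) \<and>
        (\<forall>a\<in>carrier R. g n (sm (dsk i) n a r) = sm Z n a (g n r)) \<and>
        (n \<in> UNIV \<longrightarrow> g (n - 1) (df (dsk i) n r) = df Z n (g n r))"
    proof (elim disjE)
      assume n: "n = i"
      show ?thesis unfolding n using rc by (simp add: g_def fc fa fs)
    next
      assume n: "n = i - 1"
      show ?thesis
        unfolding n using rc fc dc Ch.df_ad[OF Z _ fc fc] Ch.df_sm[OF Z _ fc] dd by (simp add: g_def fa fs)
    next
      assume n: "n \<noteq> i \<and> n \<noteq> i - 1"
      then have "r = ze RG ()" using r by simp
      then show ?thesis
        using n Z d0 f0 Ch.sm_ze[OF Z] by (simp add: g_def)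
    qed
  qed
  moreover have "x \<in> g i ` car (dsk i) i" using y by (auto simp: g_def intro: rev_image_eqI)
  ultimately show ?thesis by blast
qed

end

section \<open>The cotorsion pair of complexes, its small generating set and its
  completeness\<close>

locale tilde_class = base R A for R :: "('r, 'k) ring_scheme" (structure) and A :: "'u set" +
  fixes SU SX :: "(unit, 'r, 'u) gob set" and \<T> :: "('r, 'u) chain_complex set"
  assumes SU: "\<And>M. M \<in> SU \<Longrightarrow> Mo.ob M \<and> bnd A (Sigma UNIV (car M))"
    and SX: "\<And>M. M \<in> SX \<Longrightarrow> Mo.ob M \<and> bnd A (Sigma UNIV (car M))"
    and \<T>: "\<And>C. C \<in> \<T> \<longleftrightarrow> C \<in> complexes R \<and> til SU SX (toC C)"
begin

abbreviation gens :: "(int, 'r, 'u) gob set" where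
  "gens \<equiv> {S. til SU SX S \<and> bnd A (Sigma UNIV (car S))}"

lemma gens_ob: "S \<in> gens \<Longrightarrow> Ch.ob S \<and> bnd A (Sigma UNIV (car S))"
  by (simp add: til_def)

lemma gens_gen: "Ch.ob Z \<Longrightarrow> x \<in> car Z i \<Longrightarrow> \<exists>S\<in>gens. \<exists>g. Ch.hom S Z g \<and> x \<in> g i ` car S i"
  using dsk_gen[of Z x i] dsk_til[of SU SX i] dsk_bnd[of i] by (intro bexI[of _ "dsk i"]) auto

lemma til_eqo: assumes "til SU SX G" "Ch.smob TYPE('u) H" "Ch.eqo G H" shows "til SU SX H"
  by (rule til_retract[OF assms(1,2), where s = "\<lambda>_ x. x" and q = "\<lambda>_ x. x"])
    (use assms(3) in \<open>simp_all add: Ch.eqo_def Ch.le_def\<close>)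

lemma eqo_sym: "Ch.eqo G H \<Longrightarrow> Ch.eqo H G"
  by (simp add: Ch.eqo_def)

lemma til_ext0:
  assumes C: "til SU SX C" and V: "Ch.ob (V :: (int, 'r, 'u) gob)" and e: "\<And>S. S \<in> gens \<Longrightarrow> Ch.ext0 S V"
  shows "Ch.ext0 C V"
proof -
  have oC: "Ch.ob C" using C by (simp add: til_def)
  have "\<exists>F. Ch.filtr gens (\<lambda>n. {ze C n}) C F" by (rule til_filtered[OF C]) (rule SU SX, assumption)+
  then obtain F where F: "Ch.filtr gens (\<lambda>n. {ze C n}) C F" by (rule exE)
  show ?thesis
    by (rule Ch.ext0_filtr[OF F Ch.sub_zero[OF oC] oC Ch.quo_zero[OF oC] oC V]) (rule conjI[OF conjunct1[OF gens_ob] e])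
qed

lemma ob_ChR: "cat_ob (ChR R) = (complexes R :: ('r, 'u) chain_complex set)"
  by (simp add: ChR_def)

lemma \<T>_ob: "\<T> \<subseteq> cat_ob (ChR R)"
  using \<T> by (auto simp: ob_ChR)

text \<open>Used for the whole class and for the small generating set: if a subclass tests as much
  as the bounded complexes do, its right orthogonal class is theirs, by Eklof's lemma.\<close>

lemma right_perp_subset:
  fixes X :: "('r, 'u) chain_complex"
  assumes sub: "\<S> \<subseteq> \<T>"
    and ext: "\<And>S V. S \<in> gens \<Longrightarrow> Ch.ob (V :: (int, 'r, 'u) gob) \<Longrightarrow> (\<And>C. C \<in> \<S> \<Longrightarrow> Ch.ext0 (toC C) V) \<Longrightarrow> Ch.ext0 S V"
  shows "X \<in> right_perp (ChR R) \<S> \<longleftrightarrow> X \<in> complexes R \<and> (\<forall>S\<in>gens. Ch.ext0 S (toC X))"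
proof -
  have "\<S> \<subseteq> cat_ob (ChR R)" using sub \<T>_ob by (rule subset_trans)
  then have "X \<in> right_perp (ChR R) \<S> \<longleftrightarrow> X \<in> complexes R \<and> (\<forall>C\<in>\<S>. Ch.ext0 (toC C) (toC X))"
    by (simp add: Ch.right_perp_eq ob_ChR)
  also have "\<dots> \<longleftrightarrow> X \<in> complexes R \<and> (\<forall>S\<in>gens. Ch.ext0 S (toC X))"
  proof (intro conj_cong refl iffI ballI)
    fix S assume X: "X \<in> complexes R" and a: "\<forall>C\<in>\<S>. Ch.ext0 (toC C) (toC X)" and S: "S \<in> gens"
    show "Ch.ext0 S (toC X)" by (rule ext[OF S toC_ob[OF X]]) (rule bspec[OF a])
  next
    fix C assume X: "X \<in> complexes R" and a: "\<forall>S\<in>gens. Ch.ext0 S (toC X)" and C: "C \<in> \<S>"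
    have "til SU SX (toC C)" using C sub \<T> by blast
    then show "Ch.ext0 (toC C) (toC X)" by (rule til_ext0[OF _ toC_ob[OF X]]) (rule bspec[OF a])
  qed
  finally show ?thesis .
qed

lemma right_perp_\<T>: "X \<in> right_perp (ChR R) \<T> \<longleftrightarrow> X \<in> complexes R \<and> (\<forall>S\<in>gens. Ch.ext0 S (toC X))"
proof (rule right_perp_subset[OF subset_refl])
  fix S and V :: "(int, 'r, 'u) gob"
  assume S: "S \<in> gens" and V: "Ch.ob V" and e: "\<And>C. C \<in> \<T> \<Longrightarrow> Ch.ext0 (toC C) V"
  have tS: "til SU SX S" and smS: "Ch.smob TYPE('u) S" using S by (auto simp: til_def)
  obtain C where C: "C \<in> complexes R" "Ch.eqo (toC C) S" using Ch.rex[OF smS] unfolding ob_ChR by (elim bexE) (rule that)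
  have "til SU SX (toC C)" by (rule til_eqo[OF tS toC_smob[OF C(1)] eqo_sym[OF C(2)]])
  then have "C \<in> \<T>" using \<T> C(1) by blast
  from e[OF this] show "Ch.ext0 S V" by (rule Ch.ext0_iso1[OF _ toC_smob[OF C(1)] smS V C(2)])
qed

lemma toC_ofC: "Ch.ob G \<Longrightarrow> Ch.eqo (toC (ofC G)) G"
  unfolding Ch.eqo_def Ch.le_def Ch.hom_def by simp

text \<open>Every bounded complex of the class has a copy with carriers inside \<open>A\<close>.
  Such copies are still too many as records, so one representative is kept for each
  \<open>obcode\<close>, of which there are few.\<close>

lemma small_generators: "\<exists>\<S>\<subseteq>\<T>. small TYPE('u) \<S> \<and> right_perp (ChR R) \<S> = right_perp (ChR R) \<T>"
proof -
  define G where "G = {S :: (int, 'r, 'u) gob. til SU SX S \<and> (\<forall>n. car S n \<subseteq> A)}"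
  define rep where "rep c = (SOME S. S \<in> G \<and> Ch.obcode S = c)" for c
  have rep: "rep (Ch.obcode S) \<in> G \<and> Ch.obcode (rep (Ch.obcode S)) = Ch.obcode S" if "S \<in> G" for S
    unfolding rep_def by (rule someI[of _ S]) (simp add: that)
  define \<S> where "\<S> = (\<lambda>c. ofC (rep c)) ` Ch.obcode ` G"
  have small: "small TYPE('u) \<S>"
    unfolding \<S>_def by (intro small_image Ch.small_obcodes) (simp add: G_def til_def)
  have Gs: "Ch.smob TYPE('u) S" if "S \<in> G" for S using that by (simp add: G_def til_def)
  have sub: "\<S> \<subseteq> \<T>"
  proof
    fix C assume "C \<in> \<S>"
    then obtain S where S: "S \<in> G" "C = ofC (rep (Ch.obcode S))" by (auto simp: \<S>_def)
    let ?S = "rep (Ch.obcode S)"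
    have SG: "?S \<in> G" using rep[OF S(1)] by blast
    note sm = Gs[OF SG]
    have "til SU SX ?S" using SG by (simp add: G_def)
    then have "til SU SX (toC (ofC ?S))"
      by (rule til_eqo[OF _ toC_smob[OF ofC_complexes[OF sm]] eqo_sym[OF toC_ofC[OF conjunct1[OF sm]]]])
    then show "C \<in> \<T>" unfolding \<T> S(2) using ofC_complexes[OF sm] by blast
  qed
  have p: "X \<in> right_perp (ChR R) \<S> \<longleftrightarrow> X \<in> complexes R \<and> (\<forall>S\<in>gens. Ch.ext0 S (toC X))"
    for X :: "('r, 'u) chain_complex"
  proof (rule right_perp_subset[OF sub])
    fix S and V :: "(int, 'r, 'u) gob"
    assume S: "S \<in> gens" and V: "Ch.ob V" and e: "\<And>C. C \<in> \<S> \<Longrightarrow> Ch.ext0 (toC C) V"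
    have tS: "til SU SX S" and smS: "Ch.smob TYPE('u) S" and bS: "bnd A (Sigma UNIV (car S))"
      using S by (auto simp: til_def)
    obtain E :: "(int, 'r, 'u) gob" and a d where E: "Ch.ob E" "\<And>i. car E i \<subseteq> A" "\<And>i. car E i = a i ` car S i"
      "Ch.hom S E a" "Ch.hom E S d" "\<And>i x. x \<in> car S i \<Longrightarrow> d i (a i x) = x" "\<And>i y. y \<in> car E i \<Longrightarrow> a i (d i y) = y"
      by (rule Ch.copy_in_A[OF conjunct1[OF smS] bS]) (rule that)
    have smE: "Ch.smob TYPE('u) E" using E(1) Ch.sml_A[OF E(2)] by blast
    have "til SU SX E" by (rule til_retract[OF tS smE E(5,4,7)])
    then have EG: "E \<in> G" using E(2) by (simp add: G_def)
    let ?S = "rep (Ch.obcode E)"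
    have SG: "?S \<in> G" and c: "Ch.obcode ?S = Ch.obcode E" using rep[OF EG] by blast+
    note sm = Gs[OF SG]
    have "ofC ?S \<in> \<S>" using EG by (auto simp: \<S>_def)
    from e[OF this] have "Ch.ext0 ?S V"
      by (rule Ch.ext0_iso1[OF _ toC_smob[OF ofC_complexes[OF sm]] sm V toC_ofC[OF conjunct1[OF sm]]])
    \<comment> \<open>Objects with the same code agree on carriers and operations, so the
      representative tests the same as \<open>E\<close>.\<close>
    moreover have "Ch.eqo ?S E"
      unfolding Ch.eqo_def using Ch.obcode_le[OF conjunct1[OF sm] c] Ch.obcode_le[OF E(1) c[symmetric]] ..
    ultimately have "Ch.ext0 E V" by (rule Ch.ext0_iso1[OF _ sm smE V])
    then show "Ch.ext0 S V" by (rule Ch.ext0_retract[OF _ smS smE V E(4,5,6)])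
  qed
  have "right_perp (ChR R) \<S> = right_perp (ChR R) \<T>" by (rule Set.set_eqI) (simp only: p right_perp_\<T>)
  with sub small show ?thesis by blast
qed

lemma perp_representative:
  assumes V: "Ch.smob TYPE('u) V" and e: "\<And>S. S \<in> gens \<Longrightarrow> Ch.ext0 S V"
  obtains B where "B \<in> right_perp (ChR R) \<T>" "Ch.eqo (toC B) V"
proof -
  obtain B where B: "B \<in> complexes R" "Ch.eqo (toC B) V" using Ch.rex[OF V] unfolding ob_ChR by (elim bexE) (rule that)
  have "B \<in> right_perp (ChR R) \<T>"
    unfolding right_perp_\<T> using B(1) Ch.ext0_eqo2[OF e eqo_sym[OF B(2)]] by blast
  then show thesis using B(2) by (rule that)
qed

lemma tilde_representative:
  assumes Q: "til SU SX Q"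
  obtains C where "C \<in> \<T>" "Ch.eqo (toC C) Q"
proof -
  have V: "Ch.smob TYPE('u) Q" using Q by (simp add: til_def)
  obtain C where C: "C \<in> complexes R" "Ch.eqo (toC C) Q" using Ch.rex[OF V] unfolding ob_ChR by (elim bexE) (rule that)
  have "til SU SX (toC C)" by (rule til_eqo[OF Q toC_smob[OF C(1)] eqo_sym[OF C(2)]])
  then have "C \<in> \<T>" unfolding \<T> using C(1) by blast
  then show thesis using C(2) by (rule that)
qed

lemma til_precover:
  fixes X :: "('r, 'u) chain_complex"
  assumes X: "X \<in> complexes R"
  obtains Q q B where "til SU SX Q" "Ch.quo Q (Ch.kr Q (toC X) q) (toC X) q" "Ch.smob TYPE('u) (res Q (Ch.kr Q (toC X) q))"
    "B \<in> right_perp (ChR R) \<T>" "Ch.eqo (toC B) (res Q (Ch.kr Q (toC X) q))"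
proof -
  obtain Q q F where Q: "Ch.smob TYPE('u) Q" "Ch.quo Q (Ch.kr Q (toC X) q) (toC X) q"
    "Ch.filtr gens (\<lambda>i. {ze Q i}) Q F" and e: "\<And>S. S \<in> gens \<Longrightarrow> Ch.ext0 S (res Q (Ch.kr Q (toC X) q))"
    by (rule Ch.special_precover[OF toC_smob[OF X] gens_ob gens_gen[OF toC_ob[OF X]]]) (assumption | rule that)+
  have t: "til SU SX Q" by (rule til_filtr[OF Q(1,3)]) simp
  have K: "Ch.smob TYPE('u) (res Q (Ch.kr Q (toC X) q))"
    by (rule Ch.smob_res[OF Q(1) Ch.sub_kernel[OF conjunct1[OF Q(1)] toC_ob[OF X] Ch.quo_hom[OF Q(2)]]])
  obtain B where "B \<in> right_perp (ChR R) \<T>" "Ch.eqo (toC B) (res Q (Ch.kr Q (toC X) q))"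
    by (rule perp_representative[OF K e]) (assumption | rule that)+
  then show thesis by (rule that[OF t Q(2) K])
qed

lemma perpD: "B \<in> right_perp (ChR R) \<T> \<Longrightarrow> B \<in> complexes R"
  by (simp add: right_perp_\<T>)

lemma cotorsion_\<T>: "cotorsion_pair (ChR R) \<T> (right_perp (ChR R) \<T>)"
proof -
  have ob: "right_perp (ChR R) \<T> \<subseteq> cat_ob (ChR R)" unfolding ob_ChR using perpD by blast
  have "\<T> = left_perp (ChR R) (right_perp (ChR R) \<T>)"
  proof (intro equalityI subsetI)
    fix C assume C: "C \<in> \<T>"
    have "Ch.ext0 (toC C) (toC B)" if "B \<in> right_perp (ChR R) \<T>" for B
      using that C unfolding Ch.right_perp_eq[OF \<T>_ob] mem_Collect_eq by (elim conjE) (rule bspec)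
    then show "C \<in> left_perp (ChR R) (right_perp (ChR R) \<T>)"
      unfolding Ch.left_perp_eq[OF ob] mem_Collect_eq using subsetD[OF \<T>_ob C] by (intro conjI ballI)
  next
    fix C assume "C \<in> left_perp (ChR R) (right_perp (ChR R) \<T>)"
    then have C: "C \<in> complexes R" and e: "\<And>B. B \<in> right_perp (ChR R) \<T> \<Longrightarrow> Ch.ext0 (toC C) (toC B)"
      unfolding Ch.left_perp_eq[OF ob] by (simp_all only: ob_ChR mem_Collect_eq)
    obtain Q q B where Q: "til SU SX Q" "Ch.quo Q (Ch.kr Q (toC C) q) (toC C) q"
      and B: "B \<in> right_perp (ChR R) \<T>" "Ch.eqo (toC B) (res Q (Ch.kr Q (toC C) q))"
      by (rule til_precover[OF C]) (rule that)
    have smQ: "Ch.smob TYPE('u) Q" using Q(1) by (simp add: til_def)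
    have ext: "Ch.ext0 (toC C) (res Q (Ch.kr Q (toC C) q))" by (rule Ch.ext0_eqo2[OF e[OF B(1)] B(2)])
    obtain s where s: "Ch.hom (toC C) Q s" "\<And>i z. z \<in> car (toC C) i \<Longrightarrow> q i (s i z) = z"
      by (rule Ch.split_section[OF smQ toC_ob[OF C] Q(2) ext]) (rule that)
    have "til SU SX (toC C)" by (rule til_retract[OF Q(1) toC_smob[OF C] s(1) Ch.quo_hom[OF Q(2)] s(2)])
    then show "C \<in> \<T>" using C \<T> by blast
  qed
  then show ?thesis by (simp add: cotorsion_pair_def)
qed

lemma complete_\<T>: "complete_pair (ChR R) \<T> (right_perp (ChR R) \<T>)"
  unfolding complete_pair_def
proof (intro ballI conjI)
  fix X :: "('r, 'u) chain_complex" assume "X \<in> cat_ob (ChR R)"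
  then have X: "X \<in> complexes R" by (simp add: ob_ChR)
  note oX = toC_ob[OF X] and Xob = X[folded ob_ChR]
  show "\<exists>A'\<in>\<T>. \<exists>B\<in>right_perp (ChR R) \<T>. \<exists>i p. cat_ses (ChR R) B i A' p X"
  proof -
    obtain Q q B where Q: "til SU SX Q" "Ch.quo Q (Ch.kr Q (toC X) q) (toC X) q" "Ch.smob TYPE('u) (res Q (Ch.kr Q (toC X) q))"
      and B: "B \<in> right_perp (ChR R) \<T>" "Ch.eqo (toC B) (res Q (Ch.kr Q (toC X) q))"
      by (rule til_precover[OF X]) (rule that)
    have oQ: "Ch.ob Q" using Q(1) by (simp add: til_def)
    obtain C where C: "C \<in> \<T>" "Ch.eqo (toC C) Q" by (rule tilde_representative[OF Q(1)]) (rule that)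
    have Bob: "B \<in> cat_ob (ChR R)" and Cob: "C \<in> cat_ob (ChR R)" using perpD[OF B(1)] C(1) \<T>_ob by (auto simp: ob_ChR)
    have carB: "car (toC B) n = Ch.kr Q (toC X) q n" for n using Ch.eqo_car[OF B(2)] by simp
    have "Ch.le (res Q (Ch.kr Q (toC X) q)) Q"
      unfolding Ch.le_def
      by (rule Ch.hom_res[OF Ch.hom_id[OF oQ] Ch.sub_kernel[OF oQ oX Ch.quo_hom[OF Q(2)]]])
    from Ch.hom_le[OF Ch.hom_le[OF Ch.eqo_le[OF B(2), unfolded Ch.le_def] this] Ch.eqo_ge[OF C(2)]]
    have h: "Ch.hom (toC B) (toC C) (\<lambda>_ x. x)" .
    have "Ch.quo (toC C) (Ch.kr Q (toC X) q) (toC X) q" by (rule Ch.quo_le[OF Ch.eqo_le[OF C(2)] Ch.eqo_car[OF C(2)] Q(2)])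
    then have p: "Ch.quo (toC C) (\<lambda>n. (\<lambda>x. x) ` car (toC B) n) (toC X) q" unfolding carB image_ident .
    obtain i p where "cat_ses (ChR R) B i C p X"
      by (rule Ch.ses_exists[OF Bob Cob Xob h _ p]) (rule inj_on_id2, rule that)
    then show ?thesis using B(1) C(1) by blast
  qed
  show "\<exists>A'\<in>\<T>. \<exists>B'\<in>right_perp (ChR R) \<T>. \<exists>i p. cat_ses (ChR R) X i B' p A'"
  proof -
    obtain V F where V: "Ch.smob TYPE('u) V" "Ch.le (toC X) V" "Ch.filtr gens (car (toC X)) V F"
      and e: "\<And>S. S \<in> gens \<Longrightarrow> Ch.ext0 S V"
      by (rule Ch.special_preenvelope[OF toC_smob[OF X] gens_ob]) (assumption | rule that)+
    have oV: "Ch.ob V" using V(1) by blast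
    have sX: "Ch.sub (car (toC X)) V" by (rule Ch.le_sub[OF oX oV V(2)])
    obtain L :: "(int, 'r, 'u) gob" and p where L: "Ch.smob TYPE('u) L" "Ch.quo V (car (toC X)) L p"
      by (rule Ch.quotient_exists[OF oV sX conjunct2[OF V(1)]]) (rule that)
    have oL: "Ch.ob L" using L(1) by blast
    \<comment> \<open>The filtration of \<open>V\<close> above \<open>X\<close> becomes a filtration
      of the cokernel, which puts the cokernel into the class.\<close>
    have "\<exists>F'. Ch.filtr gens (\<lambda>i. {ze L i}) L F'"
      by (rule Ch.filtr_transfer[OF oV oL oL conjunct1[OF gens_ob] V(3) sX L(2) Ch.quo_zero[OF oL] Ch.sub_zero[OF oL]])
    then obtain F' where F': "Ch.filtr gens (\<lambda>i. {ze L i}) L F'" by (rule exE)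
    have tL: "til SU SX L" by (rule til_filtr[OF L(1) F']) simp
    obtain C where C: "C \<in> \<T>" "Ch.eqo (toC C) L" by (rule tilde_representative[OF tL]) (rule that)
    obtain B where B: "B \<in> right_perp (ChR R) \<T>" "Ch.eqo (toC B) V"
      by (rule perp_representative[OF V(1) e]) (assumption | rule that)+
    have Bob: "B \<in> cat_ob (ChR R)" and Cob: "C \<in> cat_ob (ChR R)" using perpD[OF B(1)] C(1) \<T>_ob by (auto simp: ob_ChR)
    have h: "Ch.hom (toC X) (toC B) (\<lambda>_ x. x)"
      by (rule Ch.hom_le[OF V(2)[unfolded Ch.le_def] Ch.eqo_ge[OF B(2)]])
    have q1: "Ch.quo (toC B) (car (toC X)) L p" by (rule Ch.quo_le[OF Ch.eqo_le[OF B(2)] Ch.eqo_car[OF B(2)] L(2)])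
    have LC: "Ch.quo L (\<lambda>i. {ze L i}) (toC C) (\<lambda>_ x. x)"
      using Ch.eqo_ge[OF C(2)] Ch.eqo_car[OF C(2)] Ch.hom_ze[OF oL _ Ch.eqo_ge[OF C(2), unfolded Ch.le_def]] toC_ob C(1) \<T>
      unfolding Ch.quo_def Ch.le_def by auto
    have z: "ze (toC C) n = ze L n" for n
      using Ch.quo_ker[OF LC, of "ze L n" n] oL by simp
    have q2: "Ch.quo (toC B) (\<lambda>n. (\<lambda>x. x) ` car (toC X) n) (toC C) p"
      unfolding image_ident Ch.quo_def z Ch.eqo_car[OF C(2)]
      using q1 Ch.hom_le[OF Ch.quo_hom[OF q1] Ch.eqo_ge[OF C(2)]] unfolding Ch.quo_def by blast
    obtain i p where "cat_ses (ChR R) X i B p C"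
      by (rule Ch.ses_exists[OF Xob Bob Cob h _ q2]) (rule inj_on_id2, rule that)
    then show ?thesis using B(1) C(1) by blast
  qed
qed

end

text \<open>The bounding set \<open>A\<close> is the union of an embedded copy of the naturals, to
  be infinite, an embedded copy of the ring, and all the given carriers. It is small as a union of
  small sets over a small index set.\<close>

lemma base_exists:
  fixes R :: "('r, 'k) ring_scheme" and \<K> :: "'u set set"
  assumes u: "universe TYPE('u)" and R: "ring R" "small TYPE('u) (carrier R)"
    and K: "small TYPE('u) \<K>" "\<And>K. K \<in> \<K> \<Longrightarrow> small TYPE('u) K"
  obtains A :: "'u set" where "base R A" "\<And>K. K \<in> \<K> \<Longrightarrow> K \<subseteq> A"
proof -
  have "small TYPE('u) (UNIV :: nat set)" using u by (simp add: universe_def)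
  from small_embed[OF this] obtain f :: "nat \<Rightarrow> 'u" where f: "inj f" by blast
  from small_embed[OF R(2)] obtain g :: "'r \<Rightarrow> 'u" where g: "inj_on g (carrier R)" by blast
  let ?A = "range f \<union> g ` carrier R \<union> (\<Union>K\<in>\<K>. K)"
  have "base R ?A"
  proof (intro base.intro base_axioms.intro R(1) u)
    show "infinite ?A" using range_inj_infinite[OF f] by simp
    show "small TYPE('u) ?A"
      by (intro small_Un[OF u] small_image small_UN[OF u] R(2) K) (use u in \<open>simp add: universe_def\<close>)
    show "carrier R \<lesssim> ?A" unfolding lepoll_def using g by blast
  qed
  then show thesis by (rule that) blast
qed

theorem proposition3p13:
  fixes R :: "('r, 'k) ring_scheme"
    and \<U> \<V> \<X> \<Y> :: "('r, 'u) module set"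
  assumes "universe TYPE('u)"
    and "ring R" and "small TYPE('u) (carrier R)"
    and "cotorsion_pair (RMod R) \<U> \<V>"
    and "cotorsion_pair (RMod R) \<X> \<Y>"
    and "\<U> \<subseteq> \<X>"
    and "cogenerated_by_set TYPE('u) (RMod R) \<U> \<V>"
    and "cogenerated_by_set TYPE('u) (RMod R) \<X> \<Y>"
  shows "cotorsion_pair (ChR R) (tilde R \<U> \<X>) (right_perp (ChR R) (tilde R \<U> \<X>)) \<and>
         cogenerated_by_set TYPE('u) (ChR R) (tilde R \<U> \<X>) (right_perp (ChR R) (tilde R \<U> \<X>)) \<and>
         complete_pair (ChR R) (tilde R \<U> \<X>) (right_perp (ChR R) (tilde R \<U> \<X>))"
proof -
  obtain SU where SU: "SU \<subseteq> \<U>" "small TYPE('u) SU" "right_perp (RMod R) SU = \<V>"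
    using assms(7) unfolding cogenerated_by_set_def by blast
  obtain SX where SX: "SX \<subseteq> \<X>" "small TYPE('u) SX" "right_perp (RMod R) SX = \<Y>"
    using assms(8) unfolding cogenerated_by_set_def by blast
  have "\<X> = left_perp (RMod R) \<Y>" using assms(5) unfolding cotorsion_pair_def by (rule conjunct1)
  then have "\<X> \<subseteq> modules R" by (auto simp: left_perp_def RMod_def)
  then have M: "M \<in> modules R" if "M \<in> SU \<union> SX" for M using that SU(1) SX(1) assms(6) by blast
  have sm: "small TYPE('u) (carrier ` (SU \<union> SX))"
    by (rule small_image[OF small_Un[OF assms(1) SU(2) SX(2)]])
  have sm': "small TYPE('u) K" if "K \<in> carrier ` (SU \<union> SX)" for K using that M by (auto simp: modules_def)
  obtain A :: "'u set" where A: "base R A" "\<And>K. K \<in> carrier ` (SU \<union> SX) \<Longrightarrow> K \<subseteq> A"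
    by (rule base_exists[OF assms(1-3) sm sm']) (assumption | rule that)+
  interpret base R A by (rule A(1))
  have gen: "Mo.ob (toU M) \<and> bnd A (Sigma UNIV (car (toU M)))" if M': "M \<in> SU \<union> SX" for M
  proof
    show "Mo.ob (toU M)" using toU_smob[OF M[OF M']] by blast
    have "carrier M \<subseteq> A" using A(2) M' by blast
    then have "bnd A (car (toU M) i)" for i by (simp add: subset_imp_lepoll)
    then show "bnd A (Sigma UNIV (car (toU M)))" by (intro bnd_Sigma[OF A_inf bnd_countable[OF A_inf]]) simp_all
  qed
  interpret tilde_class R A "toU ` SU" "toU ` SX" "tilde R \<U> \<X>"
  proof unfold_locales
    show "C \<in> tilde R \<U> \<X> \<longleftrightarrow> C \<in> complexes R \<and> til (toU ` SU) (toU ` SX) (toC C)" for C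
      by (rule tilde_iff[OF assms(4) SU(1,3) assms(5) SX(1,3)])
  qed (use gen in auto)
  show ?thesis
    unfolding cogenerated_by_set_def using cotorsion_\<T> small_generators complete_\<T> by blast
qed

end
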